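(* For the cyclic polling system with retrials and glue periods described in the context, the scaled steady-state joint queue length vector at the start of visit periods at station $1$ satisfies, as $\rho\uparrow 1$, $$(1-\rho)\begin{pmatrix}Y_1^{(1q)}\\ Y_1^{(1o)}\\ Y_2^{(1)}\\ \vdots\\ Y_N^{(1)}\end{pmatrix}\xrightarrow{\;d\;}\frac{b^{(2)}}{2b^{(1)}}\,\frac1\delta\begin{pmatrix}(1-e^{-\nu_1G_1})\hat u_1^{(1)}\\ e^{-\nu_1G_1}\hat u_1^{(1)}\\ \hat u_2^{(1)}\\ \vdots\\ \hat u_N^{(1)}\end{pmatrix}\Gamma(\alpha,1),$$ where $\xrightarrow{\;d\;}$ denotes convergence in distribution of random vectors and $\Gamma(\alpha,1)$ is a single scalar gamma-distributed random variable multiplying the deterministic vector.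
   Context: Model. A single server serves $N$ stations $Q_1,\dots,Q_N$ cyclically (after $Q_N$ comes $Q_1$). Customers of type $i$ arrive at $Q_i$ according to a Poisson process with rate $\lambda_i>0$. Service times at $Q_i$ are i.i.d. copies of $B_i$; switch-over times from $Q_i$ to $Q_{i+1}$ are i.i.d. copies of $S_i$; interarrival, service, switch-over and retrial times are all independent. After the server switches to $Q_i$ there is first a deterministic glue period of length $G_i>0$, then a visit period at $Q_i$, then a switch-over period to $Q_{i+1}$. Type-$i$ customers who arrive at $Q_i$ (as new arrivals or as retrials) during a glue period of $Q_i$ stick, joining the queue of $Q_i$. Those arriving at any other time immediately leave to the orbit of $Q_i$ and retry after an independent exponentially distributed time with parameter $\nu_i>0$ (repeatedly, until they arrive during a glue period of $Q_i$). During the visit period at $Q_i$ the server serves exactly the customers that are in the queue of $Q_i$ at the end of the glue period (none of those in orbit and none of the new arrivals); served customers leave the system. Let $\rho_i=\lambda_i\mathbb{E}[B_i]$, $\rho=\sum_{i=1}^N\rho_i$; the system is considered in steady state for $\rho<1$. The moments $\mathbb{E}[B_i]>0$, $\mathbb{E}[B_i^2]$, $\mathbb{E}[S_i]$ are finite. Heavy-traffic scaling. Service times, switch-over times, glue periods and retrial rates are fixed, and $\lambda_i=\rho\hat\lambda_i$ with $\hat\lambda_i>0$ fixed such that $\sum_{i=1}^N\hat\lambda_i\mathbb{E}[B_i]=1$. A hat on a quantity depending on $\rho$ denotes its value at $\rho=1$; thus $\hat\rho_i=\hat\lambda_i\mathbb{E}[B_i]$. Notation. $(Y_1^{(1)},\dots,Y_N^{(1)})$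 has the limiting (steady-state) distribution of the numbers of customers of types $1,\dots,N$ in the system at the start of a visit period of station $1$; $Y_1^{(1)}=Y_1^{(1q)}+Y_1^{(1o)}$, where $Y_1^{(1q)}$ counts the type-1 customers in the queue and $Y_1^{(1o)}$ those in orbit. For $j=1,\dots,N$, $$\hat u^{(1)}_j=\hat\lambda_j\left[\frac{e^{-\nu_jG_j}}{1-e^{-\nu_jG_j}}+\sum_{k=j}^N\hat\rho_k\right],\qquad \delta=\sum_{j=1}^N\hat u^{(1)}_j\mathbb{E}[B_j],$$ $$b^{(m)}=\frac{\sum_{i=1}^N\lambda_i\mathbb{E}[B_i^m]}{\sum_{i=1}^N\lambda_i}\ (m=1,2),\qquad r=\sum_{i=1}^N(\mathbb{E}[S_i]+G_i),\qquad \alpha=2r\delta\,\frac{b^{(1)}}{b^{(2)}}.$$ ($b^{(m)}$ does not depend on $\rho$.) $\Gamma(\alpha,\mu)$ denotes a gamma random variable with density $\frac{\mu^\alpha}{\Gamma(\alpha)}x^{\alpha-1}e^{-\mu x}$, $x>0$. *)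

theory Defs
  imports "HOL-Probability.Probability"
begin

text \<open>
  Stations and customer types are numbered \<open>1, \<dots>, N\<close>. The primitive random variables of the
  model are: \<open>Interarrival i n\<close>, the time between the arrivals of the type-\<open>i\<close> customers \<open>n - 1\<close>
  and \<open>n\<close> (customer numbers start at 0, and the first interarrival time starts at time 0);
  \<open>Service i n\<close>, the service time of the \<open>n\<close>-th type-\<open>i\<close> customer; \<open>Switchover i c\<close>, the
  switch-over time following the \<open>c\<close>-th visit to station \<open>i\<close>; and \<open>Retrial i n k\<close>, the time
  between the \<open>k\<close>-th and the \<open>(k + 1)\<close>-st attempt of the \<open>n\<close>-th type-\<open>i\<close> customer to join its
  queue, attempt 0 being the arrival itself.
\<close>

datatype primitive =
    Interarrival nat nat
  | Service nat nat
  | Switchover nat nat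
  | Retrial nat nat nat

primrec primitive_type :: "primitive \<Rightarrow> nat" where
  "primitive_type (Interarrival i n) = i"
| "primitive_type (Service i n) = i"
| "primitive_type (Switchover i c) = i"
| "primitive_type (Retrial i n k) = i"

definition primitives :: "nat \<Rightarrow> primitive set" where
  "primitives N = {p. primitive_type p \<in> {1..N}}"

definition exponential_law :: "real \<Rightarrow> real measure" where
  "exponential_law l = density lborel (\<lambda>x. ennreal (exponential_density l x))"

primrec primitive_law ::
  "(nat \<Rightarrow> real) \<Rightarrow> (nat \<Rightarrow> real) \<Rightarrow> (nat \<Rightarrow> real measure) \<Rightarrow> (nat \<Rightarrow> real measure)
    \<Rightarrow> primitive \<Rightarrow> real measure"
where
  "primitive_law lam nu B S (Interarrival i n) = exponential_law (lam i)"
| "primitive_law lam nu B S (Service i n) = B i"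
| "primitive_law lam nu B S (Switchover i c) = S i"
| "primitive_law lam nu B S (Retrial i n k) = exponential_law (nu i)"

definition polling_primitives ::
  "'a measure \<Rightarrow> (primitive \<Rightarrow> 'a \<Rightarrow> real) \<Rightarrow> nat \<Rightarrow> (nat \<Rightarrow> real) \<Rightarrow> (nat \<Rightarrow> real)
    \<Rightarrow> (nat \<Rightarrow> real measure) \<Rightarrow> (nat \<Rightarrow> real measure) \<Rightarrow> bool"
where
  "polling_primitives M X N lam nu B S \<longleftrightarrow>
     prob_space M \<and>
     prob_space.indep_vars M (\<lambda>_. borel) X (primitives N) \<and>
     (\<forall>p\<in>primitives N. distr M borel (X p) = primitive_law lam nu B S p)"


text \<open>
  The evolution of the system along a realisation \<open>x\<close> of the primitives. The server passes
  through stages \<open>m = 0, 1, 2, \<dots>\<close>, each consisting of the glue period, the visit period and the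
  switch-over period of one station; stage 0 is at station 1.
\<close>

definition arrival_time :: "(primitive \<Rightarrow> real) \<Rightarrow> nat \<Rightarrow> nat \<Rightarrow> real" where
  "arrival_time x i n = (\<Sum>l\<le>n. x (Interarrival i l))"

definition attempt_time :: "(primitive \<Rightarrow> real) \<Rightarrow> nat \<Rightarrow> nat \<Rightarrow> nat \<Rightarrow> real" where
  "attempt_time x i n k = arrival_time x i n + (\<Sum>l<k. x (Retrial i n l))"

definition station :: "nat \<Rightarrow> nat \<Rightarrow> nat" where
  "station N m = m mod N + 1"

text \<open>
  \<open>glued x G i t D\<close> is the set of type-\<open>i\<close> customers in the queue of station \<open>i\<close> at the end of a
  glue period of that station starting at time \<open>t\<close>, where \<open>D i\<close> is the set of type-\<open>i\<close> customers
  served before. Since a customer who sticks is served in the visit period that follows at once,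
  a customer outside \<open>D i\<close> has made no attempt in any earlier glue period; attempt times that
  lie after the one at which the customer sticks are never looked at.
\<close>

definition glued ::
  "(primitive \<Rightarrow> real) \<Rightarrow> (nat \<Rightarrow> real) \<Rightarrow> nat \<Rightarrow> real \<Rightarrow> (nat \<Rightarrow> nat set) \<Rightarrow> nat set"
where
  "glued x G i t D = {n. n \<notin> D i \<and> (\<exists>k. attempt_time x i n k \<in> {t..<t + G i})}"

text \<open>
  \<open>stage N G x m\<close> is the pair of the starting time of stage \<open>m\<close> and the sets of customers of each
  type served before that time. The system starts empty at time 0. (The set \<open>Q\<close> below is almost
  surely finite.)
\<close>

primrec stage ::
  "nat \<Rightarrow> (nat \<Rightarrow> real) \<Rightarrow> (primitive \<Rightarrow> real) \<Rightarrow> nat \<Rightarrow> real \<times> (nat \<Rightarrow> nat set)"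
where
  "stage N G x 0 = (0, \<lambda>_. {})"
| "stage N G x (Suc m) =
     (case stage N G x m of (t, D) \<Rightarrow>
        let i = station N m; Q = glued x G i t D
        in (t + G i + (\<Sum>n\<in>Q. x (Service i n)) + x (Switchover i (m div N)),
            D(i := D i \<union> Q)))"

text \<open>
  Numbers of customers at the start of the \<open>c\<close>-th visit period of station 1: coordinate 0 counts
  the type-1 customers in the queue, coordinate 1 the type-1 customers in orbit, and coordinate
  \<open>j \<in> {2..N}\<close> all type-\<open>j\<close> customers in the system. Here and below, a vector with \<open>N + 1\<close>
  components is a function on \<open>nat\<close> that vanishes outside \<open>{0..N}\<close>.
\<close>

definition visit_counts ::
  "nat \<Rightarrow> (nat \<Rightarrow> real) \<Rightarrow> (primitive \<Rightarrow> real) \<Rightarrow> nat \<Rightarrow> nat \<Rightarrow> nat"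
where
  "visit_counts N G x c =
     (case stage N G x (c * N) of (t, D) \<Rightarrow>
        let Q = glued x G 1 t D;
            present = (\<lambda>j. {n. arrival_time x j n \<le> t + G 1} - D j)
        in (\<lambda>j. if j = 0 then card Q
                else if j = 1 then card (present 1 - Q)
                else if j \<le> N then card (present j)
                else 0))"

definition steady_state_counts ::
  "'a measure \<Rightarrow> (primitive \<Rightarrow> 'a \<Rightarrow> real) \<Rightarrow> nat \<Rightarrow> (nat \<Rightarrow> real) \<Rightarrow> (nat \<Rightarrow> nat) pmf \<Rightarrow> bool"
where
  "steady_state_counts M X N G Y \<longleftrightarrow>
     (\<forall>y. (\<lambda>c. measure M {\<omega> \<in> space M. visit_counts N G (\<lambda>p. X p \<omega>) c = y})
            \<longlonglongrightarrow> pmf Y y)"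


definition moment :: "nat \<Rightarrow> real measure \<Rightarrow> real" where
  "moment m P = (\<integral>x. x ^ m \<partial>P)"

definition u_coeff ::
  "nat \<Rightarrow> (nat \<Rightarrow> real) \<Rightarrow> (nat \<Rightarrow> real) \<Rightarrow> (nat \<Rightarrow> real) \<Rightarrow> (nat \<Rightarrow> real measure) \<Rightarrow> nat \<Rightarrow> real"
where
  "u_coeff N lamh nu G B j =
     lamh j * (exp (- nu j * G j) / (1 - exp (- nu j * G j))
               + (\<Sum>k=j..N. lamh k * moment 1 (B k)))"

definition delta_coeff ::
  "nat \<Rightarrow> (nat \<Rightarrow> real) \<Rightarrow> (nat \<Rightarrow> real) \<Rightarrow> (nat \<Rightarrow> real) \<Rightarrow> (nat \<Rightarrow> real measure) \<Rightarrow> real"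
where
  "delta_coeff N lamh nu G B = (\<Sum>j=1..N. u_coeff N lamh nu G B j * moment 1 (B j))"

text \<open>
  Moments of the service time of an arbitrary customer. They are unchanged if all arrival rates
  are multiplied by the same factor, so they may be computed from the rates at load 1.
\<close>

definition b_moment :: "nat \<Rightarrow> (nat \<Rightarrow> real) \<Rightarrow> (nat \<Rightarrow> real measure) \<Rightarrow> nat \<Rightarrow> real" where
  "b_moment N lam B m = (\<Sum>i=1..N. lam i * moment m (B i)) / (\<Sum>i=1..N. lam i)"

definition r_total :: "nat \<Rightarrow> (nat \<Rightarrow> real) \<Rightarrow> (nat \<Rightarrow> real measure) \<Rightarrow> real" where
  "r_total N G S = (\<Sum>i=1..N. moment 1 (S i) + G i)"

definition alpha_coeff ::
  "nat \<Rightarrow> (nat \<Rightarrow> real) \<Rightarrow> (nat \<Rightarrow> real) \<Rightarrow> (nat \<Rightarrow> real)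
    \<Rightarrow> (nat \<Rightarrow> real measure) \<Rightarrow> (nat \<Rightarrow> real measure) \<Rightarrow> real"
where
  "alpha_coeff N lamh nu G B S =
     2 * r_total N G S * delta_coeff N lamh nu G B
       * (b_moment N lamh B 1 / b_moment N lamh B 2)"

definition limit_direction ::
  "nat \<Rightarrow> (nat \<Rightarrow> real) \<Rightarrow> (nat \<Rightarrow> real) \<Rightarrow> (nat \<Rightarrow> real) \<Rightarrow> (nat \<Rightarrow> real measure) \<Rightarrow> nat \<Rightarrow> real"
where
  "limit_direction N lamh nu G B j =
     (if j = 0 then (1 - exp (- nu 1 * G 1)) * u_coeff N lamh nu G B 1
      else if j = 1 then exp (- nu 1 * G 1) * u_coeff N lamh nu G B 1
      else if j \<le> N then u_coeff N lamh nu G B j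
      else 0)"

definition gamma_law :: "real \<Rightarrow> real \<Rightarrow> real measure" where
  "gamma_law a \<mu> =
     density lborel
       (\<lambda>x. ennreal (if 0 < x then \<mu> powr a / Gamma a * x powr (a - 1) * exp (- \<mu> * x) else 0))"

text \<open>
  Convergence in distribution. It is used with \<open>'v = (nat \<Rightarrow> real)\<close>, which carries the product
  topology; on the vectors that vanish outside \<open>{0..N}\<close> this is the Euclidean topology, and every
  bounded continuous function of these vectors extends to the whole space.
\<close>

definition converges_in_distribution ::
  "('i \<Rightarrow> 'v::topological_space measure) \<Rightarrow> 'v measure \<Rightarrow> 'i filter \<Rightarrow> bool"
where
  "converges_in_distribution P Q F \<longleftrightarrow>
     (\<forall>f :: 'v \<Rightarrow> real. continuous_on UNIV f \<and> bounded (range f) \<longrightarrow>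
        ((\<lambda>i. \<integral>v. f v \<partial>P i) \<longlongrightarrow> (\<integral>v. f v \<partial>Q)) F)"

end

theory Submission
  imports Defs
begin

text \<open>
  Prescribe the set of customers served in every visit period. The glue periods are then windows
  determined by the service and switch-over times alone, and given these the customer types are
  independent, each with Poisson arrivals and memoryless retrials. Summing over the countably many
  prescriptions gives the effect of each glue, visit and switch-over period on the joint generating
  function and, in the limit, a stationary equation \<open>U z = g z * U (C z)\<close> up to explicit exponential factors, where \<open>C\<close> is
  the composition of the maps of the \<open>N\<close> stations.

  Put \<open>z j = exp (- (1 - \<rho>) * \<sigma> j)\<close>. Jensen's inequality bounds the scaled mean work, so that \<open>U\<close> is
  Lipschitz in \<open>\<sigma>\<close>. To first order \<open>C\<close> acts on \<open>\<sigma>\<close> linearly, and its iterates converge to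
  \<open>theta \<sigma> * b j\<close>, with \<open>b j\<close> the mean service times and \<open>theta\<close> an invariant functional with the
  coefficients \<open>u j / \<delta>\<close>; hence the transform depends asymptotically on \<open>theta \<sigma>\<close> only. The
  second-order expansion of \<open>C\<close> along \<open>\<sigma> = \<theta> b\<close> turns the stationary equation into a linear
  first-order differential equation in \<open>\<theta>\<close>, solved by the Laplace transform of a gamma law.
  Convergence of the Laplace transforms at integer vectors suffices by the Stone-Weierstrass theorem
  in the variables \<open>exp (- x j)\<close>.
\<close>

section \<open>Products of laws and renewal windows\<close>

text \<open>The dynamics are circular: the glue windows depend on who was served before, and that
  depends on where the windows lie. Prescribing the served sets cuts the circle.

  The steady state is given only as a pointwise limit of probabilities, so no moment is known in
  advance. The vector \<open>b\<close> is the right test direction: since \<open>lin b = 1\<close>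
  at load 1, every station fixes the exponents \<open>\<theta> * b j\<close> to first order, while
  for \<open>\<rho> < 1\<close> it contracts them by an amount of order \<open>1 - \<rho>\<close>.
  This yields the bound on the mean work and, one order later, the drift.

  The second-order term involves the individual counts, not only the work. They are replaced by
  \<open>cj j\<close> times the work inside expectations weighted with
  \<open>exp (- \<theta> * WW \<rho> y)\<close>; that weight takes the place of a bound on second
  moments. Applied to the second-order corrections of a cycle, the functional with the weights
  \<open>Uf 0\<close> leaves only a linear term in \<open>\<theta>\<close> and a quadratic one with
  coefficient \<open>c2 / 2\<close>, the scale of the gamma law. The exponent comes from
  \<open>rr\<close>, the mean glue and switch-over time per cycle.\<close>

definition mix :: "'i set \<Rightarrow> ('i \<Rightarrow> 'v) \<Rightarrow> ('i \<Rightarrow> 'v) \<Rightarrow> 'i \<Rightarrow> 'v" where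
  "mix A x y = (\<lambda>p. if p \<in> A then x p else y p)"

locale real_product_space = product_prob_space law UNIV for law :: "'i \<Rightarrow> real measure" +
  assumes sets_law [measurable_cong]: "\<And>p. sets (law p) = sets borel"
begin

abbreviation "Pr \<equiv> Pi\<^sub>M UNIV law"

lemma space_law [simp]: "space (law p) = UNIV"
  using sets_eq_imp_space_eq[OF sets_law] by simp

lemma space_Pr [simp]: "space Pr = UNIV"
  by (simp add: space_PiM)

lemma sets_Pr [measurable_cong]: "sets Pr = sets (Pi\<^sub>M UNIV (\<lambda>_. borel))"
  by (intro sets_PiM_cong sets_law refl)

lemma measurable_coordinate [measurable]: "(\<lambda>x. x p) \<in> borel_measurable Pr"
  using measurable_component_singleton[of p UNIV law] sets_law by (simp cong: measurable_cong_sets)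

lemma measurable_mix [measurable]: "(\<lambda>(x, y). mix A x y) \<in> Pr \<Otimes>\<^sub>M Pr \<rightarrow>\<^sub>M Pr"
proof -
  have "(\<lambda>z. (\<lambda>p\<in>UNIV. if p \<in> A then fst z p else snd z p)) \<in> Pr \<Otimes>\<^sub>M Pr \<rightarrow>\<^sub>M Pr"
  proof (rule measurable_restrict)
    fix p show "(\<lambda>z. if p \<in> A then fst z p else snd z p) \<in> Pr \<Otimes>\<^sub>M Pr \<rightarrow>\<^sub>M law p"
      by (cases "p \<in> A") (simp_all, measurable)
  qed
  then show ?thesis by (simp add: mix_def split_beta' restrict_UNIV)
qed

text \<open>On a cylinder over \<open>J\<close> the factors in \<open>J \<inter> A\<close> come from
  the first point and those in \<open>J - A\<close> from the second, and the two products recombine.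
  Independence is used below in this form: the coordinates in \<open>A\<close> are integrated out
  while all others stay frozen.\<close>

lemma distr_mix: "distr (Pr \<Otimes>\<^sub>M Pr) Pr (\<lambda>(x, y). mix A x y) = Pr"
proof (rule PiM_eq)
  fix J F assume J: "finite J" "J \<subseteq> (UNIV :: 'i set)" "\<And>j. j \<in> J \<Longrightarrow> F j \<in> sets (law j)"
  interpret PP: pair_prob_space Pr Pr ..
  let ?E = "\<lambda>K. {x \<in> space Pr. \<forall>j\<in>K. x j \<in> F j}"
  have E: "emeasure Pr (?E K) = (\<Prod>j\<in>K. emeasure (law j) (F j))" if "K \<subseteq> J" for K
    using that J by (intro emeasure_PiM_Collect) (auto intro: finite_subset)
  have m: "?E K \<in> sets Pr" if "K \<subseteq> J" for K
  proof -
    have "finite K" using that J finite_subset by blast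
    moreover have "(\<lambda>x. x j) -` F j \<inter> space Pr \<in> sets Pr" if "j \<in> K" for j
      using measurable_sets[OF measurable_component_singleton[of j UNIV law]] J(3)[of j] that \<open>K \<subseteq> J\<close>
      by blast
    ultimately show ?thesis
      by (intro sets.sets_Collect_finite_All) (auto simp: vimage_def)
  qed
  have eq: "prod_emb UNIV law J (\<Pi>\<^sub>E j\<in>J. F j) = ?E J"
    by (auto simp: prod_emb_def)
  have "emeasure (distr (Pr \<Otimes>\<^sub>M Pr) Pr (\<lambda>(x, y). mix A x y)) (?E J)
      = emeasure (Pr \<Otimes>\<^sub>M Pr) (?E (J \<inter> A) \<times> ?E (J - A))"
    using m[of J] by (subst emeasure_distr) (auto intro!: arg_cong[where f="emeasure _"]
        simp: space_pair_measure mix_def split: if_splits)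
  also have "\<dots> = emeasure Pr (?E (J \<inter> A)) * emeasure Pr (?E (J - A))"
    by (intro P.emeasure_pair_measure_Times m) auto
  also have "\<dots> = (\<Prod>j\<in>J. emeasure (law j) (F j))"
    by (subst (1 2) E) (auto simp: prod.Int_Diff[OF J(1), of _ A])
  finally show "emeasure (distr (Pr \<Otimes>\<^sub>M Pr) Pr (\<lambda>(x, y). mix A x y))
        (prod_emb UNIV law J (\<Pi>\<^sub>E j\<in>J. F j)) = (\<Prod>j\<in>J. emeasure (law j) (F j))"
    unfolding eq .
qed simp

lemma nn_integral_mix:
  assumes [measurable]: "F \<in> borel_measurable Pr"
  shows "(\<integral>\<^sup>+x. F x \<partial>Pr) = (\<integral>\<^sup>+y. \<integral>\<^sup>+x. F (mix A x y) \<partial>Pr \<partial>Pr)"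
proof -
  interpret PP: pair_prob_space Pr Pr ..
  have "(\<integral>\<^sup>+x. F x \<partial>Pr) = (\<integral>\<^sup>+x. F x \<partial>distr (Pr \<Otimes>\<^sub>M Pr) Pr (\<lambda>(x, y). mix A x y))"
    by (simp only: distr_mix)
  also have "\<dots> = (\<integral>\<^sup>+z. F (mix A (fst z) (snd z)) \<partial>(Pr \<Otimes>\<^sub>M Pr))"
    by (subst nn_integral_distr) (auto simp: split_beta')
  also have "\<dots> = (\<integral>\<^sup>+y. \<integral>\<^sup>+x. F (mix A x y) \<partial>Pr \<partial>Pr)"
    by (subst PP.nn_integral_snd[symmetric]) (auto simp: split_beta')
  finally show ?thesis .
qed

lemma nn_integral_mix_cong:
  assumes [measurable]: "F \<in> borel_measurable Pr" "F' \<in> borel_measurable Pr"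
    and "AE y in Pr. (\<integral>\<^sup>+x. F (mix A x y) \<partial>Pr) = (\<integral>\<^sup>+x. F' (mix A x y) \<partial>Pr)"
  shows "(\<integral>\<^sup>+x. F x \<partial>Pr) = (\<integral>\<^sup>+x. F' x \<partial>Pr)"
  using assms(3) by (subst (1 2) nn_integral_mix[of _ A]) (auto intro!: nn_integral_cong_AE)

lemma nn_integral_coordinate:
  assumes [measurable]: "f \<in> borel_measurable borel"
  shows "(\<integral>\<^sup>+x. f (x p) \<partial>Pr) = (\<integral>\<^sup>+e. f e \<partial>law p)"
proof -
  have "(\<integral>\<^sup>+e. f e \<partial>law p) = (\<integral>\<^sup>+e. f e \<partial>distr Pr (law p) (\<lambda>x. x p))"
    by (subst PiM_component) auto
  also have "\<dots> = (\<integral>\<^sup>+x. f (x p) \<partial>Pr)"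
    by (subst nn_integral_distr) (auto cong: measurable_cong_sets simp: sets_law)
  finally show ?thesis by simp
qed

end

section \<open>Exponential laws and sequences of renewals with marks\<close>

lemma sets_exponential_law [measurable_cong, simp]: "sets (exponential_law l) = sets borel"
  by (simp add: exponential_law_def)

lemma space_exponential_law [simp]: "space (exponential_law l) = UNIV"
  by (simp add: exponential_law_def)

lemma measurable_exponential_law1 [simp]:
  "measurable (exponential_law l) M = measurable borel M"
  by (rule measurable_cong_sets) simp_all

lemma prob_space_exponential_law: "0 < l \<Longrightarrow> prob_space (exponential_law l)"
  unfolding exponential_law_def by (rule prob_space_exponential_density)

lemma nn_integral_exponential_law:
  assumes [measurable]: "f \<in> borel_measurable borel"
  shows "(\<integral>\<^sup>+e. f e \<partial>exponential_law l) = (\<integral>\<^sup>+e. ennreal (exponential_density l e) * f e \<partial>lborel)"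
  unfolding exponential_law_def by (subst nn_integral_density) auto

lemma AE_exponential_law_neq: "AE e in exponential_law l. e \<noteq> c"
proof -
  have "AE e in lborel. e \<noteq> c" by (rule AE_lborel_singleton)
  then show ?thesis unfolding exponential_law_def by (subst AE_density) auto
qed

lemma AE_exponential_law_pos: "AE e in exponential_law l. 0 < e"
proof -
  have "AE e in exponential_law l. e \<noteq> 0" by (rule AE_exponential_law_neq)
  moreover have "AE e in exponential_law l. 0 \<le> e"
    unfolding exponential_law_def by (subst AE_density) (auto simp: exponential_density_def)
  ultimately show ?thesis by eventually_elim auto
qed

lemma exponential_law_memoryless:
  assumes [measurable]: "f \<in> borel_measurable borel" and "0 \<le> d" "0 < l"
  shows "(\<integral>\<^sup>+e. f e * indicator {d<..} e \<partial>exponential_law l)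
    = ennreal (exp (- l * d)) * (\<integral>\<^sup>+e. f (d + e) \<partial>exponential_law l)"
proof -
  have "(\<integral>\<^sup>+e. f e * indicator {d<..} e \<partial>exponential_law l)
     = (\<integral>\<^sup>+e. ennreal (exponential_density l e) * (f e * indicator {d<..} e) \<partial>lborel)"
    by (subst nn_integral_exponential_law) auto
  also have "\<dots> = (\<integral>\<^sup>+e. ennreal (exponential_density l (d + 1 * e)) * (f (d + 1 * e) * indicator {d<..} (d + 1 * e)) \<partial>lborel)"
    by (subst nn_integral_real_affine[where c=1 and t=d]) auto
  also have "\<dots> = (\<integral>\<^sup>+e. ennreal (exp (- l * d)) * (ennreal (exponential_density l e) * f (d + e)) \<partial>lborel)"
  proof (rule nn_integral_cong_AE)
    have "AE e in lborel. e \<noteq> (0::real)" by (rule AE_lborel_singleton)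
    then show "AE e in lborel. ennreal (exponential_density l (d + 1 * e)) * (f (d + 1 * e) * indicator {d<..} (d + 1 * e))
        = ennreal (exp (- l * d)) * (ennreal (exponential_density l e) * f (d + e))"
    proof eventually_elim
      case (elim e)
      show ?case
      proof (cases "0 < e")
        case True
        have "exponential_density l (d + e) = exp (- l * d) * exponential_density l e"
          using True assms by (simp add: exponential_density_def exp_add[symmetric] algebra_simps)
        then have "ennreal (exponential_density l (d + e)) = ennreal (exp (- l * d)) * ennreal (exponential_density l e)"
          by (simp only: ennreal_mult'[OF exp_ge_zero])
        then show ?thesis using True by (simp add: mult.assoc)
      next
        case False
        then show ?thesis using elim by (simp add: exponential_density_def)
      qed
    qed
  qed
  also have "\<dots> = ennreal (exp (- l * d)) * (\<integral>\<^sup>+e. f (d + e) \<partial>exponential_law l)"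
    by (subst nn_integral_cmult) (auto simp: nn_integral_exponential_law)
  finally show ?thesis .
qed

text \<open>The probability generating function of the number of renewals in a window of length \<open>d\<close>
  solves the renewal equation.\<close>

lemma exponential_law_window:
  assumes l: "0 < l" and c: "0 \<le> c" "c \<le> 1" and d: "0 \<le> d"
  shows "(\<integral>\<^sup>+e. (if e < d then ennreal c else 1) * ennreal (exp (- l * (1 - c) * max 0 (d - e))) \<partial>exponential_law l)
    = ennreal (exp (- l * (1 - c) * d))"
proof -
  let ?k = "l * (1 - c)"
  have k: "0 \<le> ?k" using l c by simp
  let ?f = "\<lambda>e::real. (if e < d then ennreal c else 1) * ennreal (exp (- ?k * max 0 (d - e)))"
  have "(\<integral>\<^sup>+e. ?f e \<partial>exponential_law l) = (\<integral>\<^sup>+e. ennreal (exponential_density l e) * ?f e \<partial>lborel)"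
    by (subst nn_integral_exponential_law) auto
  \<comment> \<open>A first renewal at \<open>e < d\<close> contributes a factor \<open>c\<close>
    and leaves a window of length \<open>d - e\<close>. Since
    \<open>l - l * (1 - c) = l * c\<close>, the integrand is a single exponential in
    \<open>e\<close>. For \<open>e > d\<close> the window is empty and the factor is 1.\<close>
  also have "\<dots> = (\<integral>\<^sup>+e. ennreal (l * c * exp (- ?k * d) * exp (- (l * c) * e)) * indicator {0..d} e
       + ennreal (exponential_density l e) * indicator {d<..} e \<partial>lborel)"
  proof (rule nn_integral_cong_AE)
    have "AE e in lborel. e \<noteq> d" by (rule AE_lborel_singleton)
    then show "AE e in lborel. ennreal (exponential_density l e) * ?f e = ennreal (l * c * exp (- ?k * d) * exp (- (l * c) * e)) * indicator {0..d} e
       + ennreal (exponential_density l e) * indicator {d<..} e"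
    proof eventually_elim
      case (elim e)
      consider "e < 0" | "0 \<le> e" "e < d" | "d < e" using elim by linarith
      then show ?case
      proof cases
        case 2
        have "exponential_density l e * (c * exp (- ?k * (d - e))) = l * c * exp (- ?k * d) * exp (- (l * c) * e)"
          using 2 by (simp add: exponential_density_def mult_exp_exp algebra_simps)
        then show ?thesis using 2 c l
          by (simp add: ennreal_mult'[symmetric] erlang_density_nonneg)
      qed (use d in \<open>auto simp: exponential_density_def\<close>)
    qed
  qed
  also have "\<dots> = (\<integral>\<^sup>+e. ennreal (l * c * exp (- ?k * d) * exp (- (l * c) * e)) * indicator {0..d} e \<partial>lborel)
       + (\<integral>\<^sup>+e. ennreal (exponential_density l e) * indicator {d<..} e \<partial>lborel)"
    by (rule nn_integral_add) auto
  also have "(\<integral>\<^sup>+e. ennreal (l * c * exp (- ?k * d) * exp (- (l * c) * e)) * indicator {0..d} e \<partial>lborel)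
      = ennreal ((- exp (- ?k * d) * exp (- (l * c) * d)) - (- exp (- ?k * d) * exp (- (l * c) * 0)))"
    by (rule nn_integral_FTC_Icc)
       (use d l c in \<open>auto intro!: derivative_eq_intros mult_nonneg_nonneg simp: algebra_simps\<close>)
  also have "(\<integral>\<^sup>+e. ennreal (exponential_density l e) * indicator {d<..} e \<partial>lborel) = ennreal (exp (- l * d))"
  proof -
    have "(\<integral>\<^sup>+e. ennreal (exponential_density l e) * indicator {d<..} e \<partial>lborel)
       = (\<integral>\<^sup>+e. 1 * indicator {d<..} e \<partial>exponential_law l)"
      by (subst nn_integral_exponential_law) auto
    also have "\<dots> = ennreal (exp (- l * d)) * (\<integral>\<^sup>+e. 1 \<partial>exponential_law l)"
      using exponential_law_memoryless[of "\<lambda>_. 1" d l] d l by simp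
    also have "(\<integral>\<^sup>+e. 1 \<partial>exponential_law l) = 1"
      using prob_space.emeasure_space_1[OF prob_space_exponential_law[OF l]] by simp
    finally show ?thesis by simp
  qed
  also have "ennreal ((- exp (- ?k * d) * exp (- (l * c) * d)) - (- exp (- ?k * d) * exp (- (l * c) * 0))) + ennreal (exp (- l * d))
     = ennreal (exp (- ?k * d))"
  proof -
    have "exp (- ?k * d) * exp (- (l * c) * d) = exp (- l * d)"
      by (simp add: mult_exp_exp algebra_simps)
    moreover have "exp (- l * d) \<le> exp (- ?k * d)"
      using l c d by (simp add: algebra_simps)
    ultimately show ?thesis by (subst ennreal_plus[symmetric]) (auto simp: algebra_simps)
  qed
  finally show ?thesis by simp
qed

text \<open>Used twice: for the arrivals of one type, where the block of a customer holds its
  retrials, and for the retrials of a single customer, where the blocks are empty.\<close>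

locale renewal_sequence = real_product_space law for law :: "'i \<Rightarrow> real measure" +
  fixes q :: "nat \<Rightarrow> 'i" and l :: real and blk :: "nat \<Rightarrow> 'i set"
  assumes inj_q: "inj q" and l_pos: "0 < l" and law_q: "\<And>n. law (q n) = exponential_law l"
    and q_notin_blk: "\<And>n m. q n \<notin> blk m"
    and blk_disjoint: "\<And>n m. n \<noteq> m \<Longrightarrow> blk n \<inter> blk m = {}"
begin

definition pos :: "nat \<Rightarrow> real \<Rightarrow> ('i \<Rightarrow> real) \<Rightarrow> real" where
  "pos k s x = s + (\<Sum>i<k. x (q i))"

text \<open>The \<open>n\<close>-th renewal, at time \<open>u\<close>, carries the factor \<open>\<Psi> n u x\<close>, which is determined by the
  coordinates in its own block, as the retrials of a customer are.\<close>

definition marks :: "(nat \<Rightarrow> real \<Rightarrow> ('i \<Rightarrow> real) \<Rightarrow> ennreal) \<Rightarrow> bool" where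
  "marks \<Psi> \<longleftrightarrow>
     (\<forall>n. (\<lambda>(u, x). \<Psi> n u x) \<in> borel_measurable (borel \<Otimes>\<^sub>M Pr)) \<and>
     (\<forall>n u x. \<Psi> n u x \<le> 1) \<and>
     (\<forall>n u x y. (\<forall>p\<in>blk n. x p = y p) \<longrightarrow> \<Psi> n u x = \<Psi> n u y)"

text \<open>The starting point \<open>s\<close> is not itself a renewal: renewal \<open>n\<close>
  lies at \<open>pos (Suc n)\<close>.\<close>

definition pprod :: "(nat \<Rightarrow> real \<Rightarrow> ('i \<Rightarrow> real) \<Rightarrow> ennreal) \<Rightarrow> nat \<Rightarrow> real \<Rightarrow> ('i \<Rightarrow> real) \<Rightarrow> ennreal" where
  "pprod \<Psi> K s x = (\<Prod>n<K. \<Psi> n (pos (Suc n) s x) x)"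

text \<open>The infinite product. For marks bounded by 1 the partial products decrease, so the
  infimum is their limit and needs no convergence argument.\<close>

definition iprod :: "(nat \<Rightarrow> real \<Rightarrow> ('i \<Rightarrow> real) \<Rightarrow> ennreal) \<Rightarrow> real \<Rightarrow> ('i \<Rightarrow> real) \<Rightarrow> ennreal" where
  "iprod \<Psi> s x = (INF K. pprod \<Psi> K s x)"

definition avg :: "(nat \<Rightarrow> real \<Rightarrow> ('i \<Rightarrow> real) \<Rightarrow> ennreal) \<Rightarrow> nat \<Rightarrow> real \<Rightarrow> ennreal" where
  "avg \<Psi> n u = (\<integral>\<^sup>+x. \<Psi> n u x \<partial>Pr)"

text \<open>Transfer operator of one renewal with averaged mark \<open>\<psi>\<close>:
  \<open>g\<close> is the value of everything that follows, as a function of the position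
  reached.\<close>

definition stp :: "(real \<Rightarrow> ennreal) \<Rightarrow> (real \<Rightarrow> ennreal) \<Rightarrow> real \<Rightarrow> ennreal" where
  "stp \<psi> g u = (\<integral>\<^sup>+e. \<psi> (u + e) * g (u + e) \<partial>exponential_law l)"

lemma measurable_pos [measurable]: "pos k s \<in> borel_measurable Pr"
  unfolding pos_def by measurable

lemma marks_measurable:
  assumes "marks \<Psi>" and [measurable]: "f \<in> borel_measurable M" "h \<in> M \<rightarrow>\<^sub>M Pr"
  shows "(\<lambda>w. \<Psi> n (f w) (h w)) \<in> borel_measurable M"
proof -
  have [measurable]: "(\<lambda>(u, x). \<Psi> n u x) \<in> borel_measurable (borel \<Otimes>\<^sub>M Pr)"
    using assms by (simp add: marks_def)
  have "(\<lambda>w. (case (f w, h w) of (u, x) \<Rightarrow> \<Psi> n u x)) \<in> borel_measurable M"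
    by measurable
  then show ?thesis by simp
qed

lemma marks_le_1: "marks \<Psi> \<Longrightarrow> \<Psi> n u x \<le> 1"
  by (simp add: marks_def)

lemma marks_cong: "marks \<Psi> \<Longrightarrow> (\<And>p. p \<in> blk n \<Longrightarrow> x p = y p) \<Longrightarrow> \<Psi> n u x = \<Psi> n u y"
  by (auto simp: marks_def)

lemma avg_measurable [measurable]: "marks \<Psi> \<Longrightarrow> avg \<Psi> n \<in> borel_measurable borel"
  unfolding avg_def[abs_def]
  by (intro P.borel_measurable_nn_integral) (simp add: marks_def split_beta')

lemma pprod_measurable [measurable]: "marks \<Psi> \<Longrightarrow> pprod \<Psi> K s \<in> borel_measurable Pr"
  unfolding pprod_def[abs_def]
  by (rule borel_measurable_prod_ennreal, erule marks_measurable) auto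

lemma iprod_measurable [measurable]: "marks \<Psi> \<Longrightarrow> iprod \<Psi> s \<in> borel_measurable Pr"
  unfolding iprod_def[abs_def] by (intro borel_measurable_INF) auto

lemma prob_exp: "prob_space (exponential_law l)"
  using prob_space_exponential_law[OF l_pos] .

lemma stp_measurable [measurable]:
  assumes [measurable]: "\<psi> \<in> borel_measurable borel" "g \<in> borel_measurable borel"
  shows "stp \<psi> g \<in> borel_measurable borel"
proof -
  interpret E: prob_space "exponential_law l" by (rule prob_exp)
  show ?thesis unfolding stp_def[abs_def] by (intro E.borel_measurable_nn_integral) measurable
qed

text \<open>The last interval and the last block occur in no earlier factor, so they can be
  integrated out first. Peeling from the end leaves the prefix of the product unchanged, and an
  induction over all terminal functions \<open>g\<close> becomes possible.\<close>

lemma pprod_peel: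
  assumes \<Psi>: "marks \<Psi>" and [measurable]: "g \<in> borel_measurable borel"
  shows "(\<integral>\<^sup>+x. pprod \<Psi> (Suc K) s x * g (pos (Suc K) s x) \<partial>Pr)
       = (\<integral>\<^sup>+x. pprod \<Psi> K s x * stp (avg \<Psi> K) g (pos K s x) \<partial>Pr)"
proof -
  let ?A = "insert (q K) (blk K)"
  have pos_eq: "pos k s (mix ?A x y) = pos k s y" if "k \<le> K" for k x y
    unfolding pos_def mix_def using that q_notin_blk inj_q
    by (intro arg_cong2[where f="(+)"] sum.cong refl) (auto simp: inj_eq)
  have pos_eq': "pos (Suc K) s (mix ?A x y) = pos K s y + x (q K)" for x y
    using pos_eq[of K x y] by (simp add: pos_def mix_def)
  have pprod_eq: "pprod \<Psi> K s (mix ?A x y) = pprod \<Psi> K s y" for x y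
    unfolding pprod_def
  proof (intro prod.cong refl)
    fix n assume "n \<in> {..<K}"
    then have n: "n < K" "Suc n \<le> K" by auto
    show "\<Psi> n (pos (Suc n) s (mix ?A x y)) (mix ?A x y) = \<Psi> n (pos (Suc n) s y) y"
      unfolding pos_eq[OF n(2)]
      using n(1) blk_disjoint[of n K] q_notin_blk by (intro marks_cong[OF \<Psi>]) (auto simp: mix_def)
  qed
  have last: "\<Psi> K u (mix ?A x y) = \<Psi> K u x" for u x y
    by (intro marks_cong[OF \<Psi>]) (auto simp: mix_def)
  have [measurable]: "avg \<Psi> K \<in> borel_measurable borel"
    using \<Psi> by (rule avg_measurable)
  have inner: "(\<integral>\<^sup>+x. \<Psi> K (u + x (q K)) x * g (u + x (q K)) \<partial>Pr) = stp (avg \<Psi> K) g u" for u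
  proof -
    have [measurable]: "(\<lambda>x. \<Psi> K (u + x (q K)) x) \<in> borel_measurable Pr"
      by (rule marks_measurable[OF \<Psi>]) auto
    have [measurable]: "(\<lambda>x. \<Psi> K v x) \<in> borel_measurable Pr" for v
      by (rule marks_measurable[OF \<Psi>]) auto
    \<comment> \<open>Resampling everything except \<open>q K\<close> separates the interval from
      the mark at its end, which lives on a block not containing \<open>q K\<close>; the mark may
      then be replaced by its average.\<close>
    have "(\<integral>\<^sup>+x. \<Psi> K (u + x (q K)) x * g (u + x (q K)) \<partial>Pr)
        = (\<integral>\<^sup>+y. \<integral>\<^sup>+x. \<Psi> K (u + mix (- {q K}) x y (q K)) (mix (- {q K}) x y) * g (u + mix (- {q K}) x y (q K)) \<partial>Pr \<partial>Pr)"
      by (rule nn_integral_mix) auto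
    also have "\<dots> = (\<integral>\<^sup>+y. \<integral>\<^sup>+x. \<Psi> K (u + y (q K)) x * g (u + y (q K)) \<partial>Pr \<partial>Pr)"
      using q_notin_blk by (intro nn_integral_cong arg_cong2[where f="(*)"] arg_cong[where f=g])
        (auto intro!: marks_cong[OF \<Psi>] simp: mix_def)
    also have "\<dots> = (\<integral>\<^sup>+y. avg \<Psi> K (u + y (q K)) * g (u + y (q K)) \<partial>Pr)"
      by (subst nn_integral_multc) (auto simp: avg_def)
    also have "\<dots> = (\<integral>\<^sup>+e. avg \<Psi> K (u + e) * g (u + e) \<partial>law (q K))"
      by (rule nn_integral_coordinate[where f="\<lambda>e. avg \<Psi> K (u + e) * g (u + e)"]) measurable
    finally show ?thesis by (simp add: stp_def law_q)
  qed
  have [measurable]: "pprod \<Psi> (Suc K) s \<in> borel_measurable Pr"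
    using \<Psi> by (rule pprod_measurable)
  have "(\<integral>\<^sup>+x. pprod \<Psi> (Suc K) s x * g (pos (Suc K) s x) \<partial>Pr)
      = (\<integral>\<^sup>+y. \<integral>\<^sup>+x. pprod \<Psi> (Suc K) s (mix ?A x y) * g (pos (Suc K) s (mix ?A x y)) \<partial>Pr \<partial>Pr)"
    by (rule nn_integral_mix) measurable
  also have "\<dots> = (\<integral>\<^sup>+y. \<integral>\<^sup>+x. pprod \<Psi> K s y * (\<Psi> K (pos K s y + x (q K)) x * g (pos K s y + x (q K))) \<partial>Pr \<partial>Pr)"
  proof (intro nn_integral_cong)
    fix x y
    have "pprod \<Psi> (Suc K) s (mix ?A x y) = pprod \<Psi> K s (mix ?A x y) * \<Psi> K (pos (Suc K) s (mix ?A x y)) (mix ?A x y)"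
      by (simp add: pprod_def)
    then show "pprod \<Psi> (Suc K) s (mix ?A x y) * g (pos (Suc K) s (mix ?A x y))
      = pprod \<Psi> K s y * (\<Psi> K (pos K s y + x (q K)) x * g (pos K s y + x (q K)))"
      by (simp only: pprod_eq pos_eq' last mult.assoc)
  qed
  also have "\<dots> = (\<integral>\<^sup>+y. pprod \<Psi> K s y * stp (avg \<Psi> K) g (pos K s y) \<partial>Pr)"
  proof (intro nn_integral_cong)
    fix y
    have [measurable]: "(\<lambda>x. \<Psi> K (pos K s y + x (q K)) x) \<in> borel_measurable Pr"
      by (rule marks_measurable[OF \<Psi>]) auto
    show "(\<integral>\<^sup>+x. pprod \<Psi> K s y * (\<Psi> K (pos K s y + x (q K)) x * g (pos K s y + x (q K))) \<partial>Pr)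
      = pprod \<Psi> K s y * stp (avg \<Psi> K) g (pos K s y)"
      by (subst nn_integral_cmult) (auto simp: inner)
  qed
  finally show ?thesis .
qed

lemma AE_coordinate_pos: "AE x in Pr. 0 < x (q i)"
proof (rule AE_component)
  show "AE e in law (q i). 0 < e"
    unfolding law_q by (rule AE_exponential_law_pos)
qed simp

lemma laplace_exponential:
  "(\<integral>\<^sup>+e. ennreal (exp (- e)) \<partial>exponential_law l) = ennreal (l / (l + 1))"
proof -
  have "(\<integral>\<^sup>+e. ennreal (exp (- e)) \<partial>exponential_law l)
      = (\<integral>\<^sup>+e. ennreal (l / (l + 1)) * ennreal (exponential_density (l + 1) e) \<partial>lborel)"
    using l_pos by (subst nn_integral_exponential_law)
      (auto intro!: nn_integral_cong simp: exponential_density_def ennreal_mult'[symmetric] mult_exp_exp field_simps)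
  also have "\<dots> = ennreal (l / (l + 1)) * (\<integral>\<^sup>+e. 1 \<partial>exponential_law (l + 1))"
    using nn_integral_exponential_law[of "\<lambda>_. 1" "l + 1"]
    by (subst nn_integral_cmult) (auto simp del: nn_integral_const)
  also have "(\<integral>\<^sup>+e. 1 \<partial>exponential_law (l + 1)) = 1"
    using prob_space.emeasure_space_1[OF prob_space_exponential_law[of "l + 1"]] l_pos by simp
  finally show ?thesis by simp
qed

text \<open>For constant marks 1 the function \<open>exp (- u)\<close> is an eigenfunction of the
  transfer operator with eigenvalue \<open>l / (l + 1)\<close>.\<close>

lemma laplace_pos:
  "(\<integral>\<^sup>+x. ennreal (exp (- pos K s x)) \<partial>Pr) = ennreal (exp (- s) * (l / (l + 1)) ^ K)"
proof -
  have m: "marks (\<lambda>n u x. 1)" by (simp add: marks_def)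
  have avg1: "avg (\<lambda>n u x. 1) n u = 1" for n u
    using P.emeasure_space_1 by (simp add: avg_def)
  have step: "stp (avg (\<lambda>n u x. 1) n) (\<lambda>u. ennreal (a * exp (- u))) = (\<lambda>u. ennreal ((a * (l / (l + 1))) * exp (- u)))"
    if "0 \<le> a" for a n
  proof
    fix u
    have "stp (avg (\<lambda>n u x. 1) n) (\<lambda>u. ennreal (a * exp (- u))) u
        = (\<integral>\<^sup>+e. ennreal (a * exp (- u)) * ennreal (exp (- e)) \<partial>exponential_law l)"
      using that unfolding stp_def avg1
      by (intro nn_integral_cong) (simp add: ennreal_mult'[symmetric] exp_add[symmetric] exp_diff exp_minus field_simps)
    also have "\<dots> = ennreal (a * exp (- u)) * ennreal (l / (l + 1))"
      by (subst nn_integral_cmult) (auto simp: laplace_exponential)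
    finally show "stp (avg (\<lambda>n u x. 1) n) (\<lambda>u. ennreal (a * exp (- u))) u = ennreal ((a * (l / (l + 1))) * exp (- u))"
      using that l_pos by (simp add: ennreal_mult'[symmetric] field_simps)
  qed
  have "(\<integral>\<^sup>+x. pprod (\<lambda>n u x. 1) K s x * ennreal (a * exp (- pos K s x)) \<partial>Pr)
      = ennreal (exp (- s) * (a * (l / (l + 1)) ^ K))" if "0 \<le> a" for a
    using that
  proof (induction K arbitrary: a)
    case 0
    then show ?case using P.emeasure_space_1 by (simp add: pprod_def pos_def mult.commute)
  next
    case (Suc K)
    have "0 \<le> a * (l / (l + 1))" using Suc.prems l_pos by simp
    from Suc.IH[OF this] show ?case
      using pprod_peel[OF m, of "\<lambda>u. ennreal (a * exp (- u))" K s] step[OF Suc.prems, of K]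
      by (simp add: mult_ac)
  qed
  from this[of 1] show ?thesis by (simp add: pprod_def)
qed

text \<open>Markov's inequality for \<open>exp (- pos K s x)\<close>: the probability of staying
  below a fixed level for \<open>K\<close> renewals decays geometrically. Positivity of the
  intervals turns unboundedness into divergence.\<close>

lemma AE_pos_at_top: "AE x in Pr. filterlim (\<lambda>K. pos K s x) at_top sequentially"
proof -
  have "AE x in Pr. \<exists>K. real T < pos K s x" for T :: nat
  proof (rule AE_I')
    let ?B = "{x \<in> space Pr. \<forall>K. pos K s x \<le> real T}"
    have B: "?B \<in> sets Pr" by measurable
    have "emeasure Pr ?B \<le> ennreal (exp (real T) * (exp (- s) * (l / (l + 1)) ^ K))" for K
    proof -
      have "emeasure Pr ?B = (\<integral>\<^sup>+x. indicator ?B x \<partial>Pr)" using B by simp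
      also have "\<dots> \<le> (\<integral>\<^sup>+x. ennreal (exp (real T)) * ennreal (exp (- pos K s x)) \<partial>Pr)"
      proof (rule nn_integral_mono)
        fix x show "indicator ?B x \<le> ennreal (exp (real T)) * ennreal (exp (- pos K s x))"
          by (auto split: split_indicator simp: ennreal_mult'[symmetric] mult_exp_exp simp flip: ennreal_1)
      qed
      also have "\<dots> = ennreal (exp (real T) * (exp (- s) * (l / (l + 1)) ^ K))"
        by (subst nn_integral_cmult) (auto simp: laplace_pos ennreal_mult')
      finally show ?thesis .
    qed
    moreover have "(\<lambda>K. ennreal (exp (real T) * (exp (- s) * (l / (l + 1)) ^ K))) \<longlonglongrightarrow> ennreal (exp (real T) * (exp (- s) * 0))"
      using l_pos by (intro tendsto_ennrealI tendsto_intros LIMSEQ_power_zero) auto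
    ultimately have "emeasure Pr ?B \<le> 0"
      by (intro LIMSEQ_le_const) auto
    then show "?B \<in> null_sets Pr" using B by (simp add: null_sets_def)
    show "{x \<in> space Pr. \<not> (\<exists>K. real T < pos K s x)} \<subseteq> ?B" by (auto simp: not_less)
  qed
  then have "AE x in Pr. \<forall>T::nat. \<exists>K. real T < pos K s x" by (simp add: AE_all_countable)
  moreover have "AE x in Pr. \<forall>i. 0 < x (q i)" by (simp add: AE_all_countable AE_coordinate_pos)
  ultimately show ?thesis
  proof eventually_elim
    case (elim x)
    have mono: "pos K s x \<le> pos K' s x" if "K \<le> K'" for K K'
      using that elim(2) by (simp add: pos_def) (intro sum_mono2; auto intro: less_imp_le)
    show ?case
      unfolding filterlim_at_top
    proof
      fix Z
      obtain T :: nat where "Z \<le> real T" using real_arch_simple by blast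
      moreover obtain K where "real T < pos K s x" using elim(1) by blast
      ultimately show "eventually (\<lambda>K. Z \<le> pos K s x) sequentially"
        using mono by (auto simp: eventually_sequentially intro!: exI[of _ K]) (meson dual_order.trans less_imp_le)
    qed
  qed
qed

text \<open>\<open>G K s\<close> and \<open>G0 K s\<close> are the exact values of all renewals from
  number \<open>K\<close> on when the position \<open>s\<close> is already past \<open>t\<close>:
  zero if a point of \<open>D\<close> is still due, otherwise the contribution of the part of the
  window that remains. Agreement with them past \<open>t\<close>, and proportionality with factor
  \<open>C\<close> before \<open>t\<close>, are preserved by the transfer operator.\<close>

lemma stp_relation:
  fixes \<psi> \<psi>0 g g0 :: "real \<Rightarrow> ennreal" and t L c :: real and D :: "nat set"
  defines "G \<equiv> \<lambda>K s. if \<exists>d\<in>D. K \<le> d then 0 else ennreal (exp (- l * (1 - c) * max 0 (t + L - s)))"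
    and "G0 \<equiv> \<lambda>K (s::real). if \<exists>d\<in>D. K \<le> d then 0 else (1 :: ennreal)"
    and "C \<equiv> ennreal (exp (- l * (1 - c) * L))"
  assumes [measurable]: "\<psi> \<in> borel_measurable borel" "\<psi>0 \<in> borel_measurable borel"
      "g \<in> borel_measurable borel" "g0 \<in> borel_measurable borel"
    and L: "0 \<le> L" and c: "0 \<le> c" "c \<le> 1"
    and before: "\<And>u. u < t \<Longrightarrow> \<psi> u = \<psi>0 u"
    and after: "\<And>u. t < u \<Longrightarrow> u \<noteq> t + L \<Longrightarrow> \<psi> u = (if K \<in> D then 0 else if u < t + L then ennreal c else 1)"
    and after0: "\<And>u. t < u \<Longrightarrow> \<psi>0 u = (if K \<in> D then 0 else 1)"
    and g: "\<And>s. s < t \<Longrightarrow> g s = C * g0 s" "\<And>s. t \<le> s \<Longrightarrow> g s = G (Suc K) s" "\<And>s. t \<le> s \<Longrightarrow> g0 s = G0 (Suc K) s"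
  shows "s < t \<Longrightarrow> stp \<psi> g s = C * stp \<psi>0 g0 s"
    and "t \<le> s \<Longrightarrow> stp \<psi> g s = G K s"
    and "t \<le> s \<Longrightarrow> stp \<psi>0 g0 s = G0 K s"
proof -
  interpret E: prob_space "exponential_law l" by (rule prob_exp)
  have "K \<le> d \<longleftrightarrow> K = d \<or> Suc K \<le> d" for d by auto
  then have D_Suc: "(\<exists>d\<in>D. K \<le> d) \<longleftrightarrow> K \<in> D \<or> (\<exists>d\<in>D. Suc K \<le> d)"
    by (metis (full_types))
  have late: "stp \<psi> g s = G K s" if s: "t \<le> s" for s
  proof (cases "\<exists>d\<in>D. K \<le> d")
    case True
    have "AE e in exponential_law l. \<psi> (s + e) * g (s + e) = 0"
      using AE_exponential_law_pos AE_exponential_law_neq[of "t + L - s"]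
    proof eventually_elim
      case (elim e)
      have e: "t < s + e" "s + e \<noteq> t + L" "t \<le> s + e" using elim s by auto
      show ?case
      proof (cases "K \<in> D")
        case False
        then have "\<exists>d\<in>D. Suc K \<le> d" using True D_Suc by blast
        then show ?thesis using g(2)[OF e(3)] by (simp add: G_def)
      qed (simp add: after[OF e(1,2)])
    qed
    then have "stp \<psi> g s = (\<integral>\<^sup>+e. 0 \<partial>exponential_law l)"
      unfolding stp_def by (rule nn_integral_cong_AE)
    then show ?thesis using True by (simp add: G_def)
  next
    case False
    let ?d = "max 0 (t + L - s)"
    have "AE e in exponential_law l. \<psi> (s + e) * g (s + e) = (if e < ?d then ennreal c else 1) * ennreal (exp (- l * (1 - c) * max 0 (?d - e)))"
      using AE_exponential_law_pos AE_exponential_law_neq[of "t + L - s"]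
    proof eventually_elim
      case (elim e)
      have "max 0 (t + L - (s + e)) = max 0 (?d - e)" "s + e < t + L \<longleftrightarrow> e < ?d" "s + e \<noteq> t + L" "t < s + e" "t \<le> s + e"
        using elim s by auto
      moreover have "K \<notin> D" "\<not> (\<exists>d\<in>D. Suc K \<le> d)" using False D_Suc by blast+
      ultimately show ?case using after[of "s + e"] g(2)[of "s + e"] by (simp add: G_def)
    qed
    then have "stp \<psi> g s = (\<integral>\<^sup>+e. (if e < ?d then ennreal c else 1) * ennreal (exp (- l * (1 - c) * max 0 (?d - e))) \<partial>exponential_law l)"
      unfolding stp_def by (rule nn_integral_cong_AE)
    also have "\<dots> = ennreal (exp (- l * (1 - c) * ?d))"
      by (rule exponential_law_window[OF l_pos c]) simp
    finally show ?thesis using False by (simp add: G_def)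
  qed
  then show "t \<le> s \<Longrightarrow> stp \<psi> g s = G K s" .
  have late0: "stp \<psi>0 g0 s = G0 K s" if s: "t \<le> s" for s
  proof -
    have "AE e in exponential_law l. \<psi>0 (s + e) * g0 (s + e) = G0 K s"
      using AE_exponential_law_pos
    proof eventually_elim
      case (elim e)
      have e: "t < s + e" "t \<le> s + e" using elim s by auto
      show ?case
        unfolding after0[OF e(1)] g(3)[OF e(2)] G0_def using D_Suc by auto
    qed
    then have "stp \<psi>0 g0 s = (\<integral>\<^sup>+e. G0 K s \<partial>exponential_law l)"
      unfolding stp_def by (rule nn_integral_cong_AE)
    then show ?thesis using E.emeasure_space_1 by simp
  qed
  then show "t \<le> s \<Longrightarrow> stp \<psi>0 g0 s = G0 K s" .
  assume s: "s < t"
  \<comment> \<open>Memorylessness at \<open>t\<close>: the part of the integral that jumps over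
    \<open>t\<close> depends on \<open>s\<close> only through \<open>exp (- l * (t - s))\<close>,
    and continues as if started at \<open>t\<close>.\<close>
  have split: "stp \<phi> h s = (\<integral>\<^sup>+e. \<phi> (s + e) * h (s + e) * indicator {..<t - s} e \<partial>exponential_law l)
       + ennreal (exp (- l * (t - s))) * stp \<phi> h t"
    if [measurable]: "\<phi> \<in> borel_measurable borel" "h \<in> borel_measurable borel" for \<phi> h
  proof -
    have "AE e in exponential_law l. \<phi> (s + e) * h (s + e) = \<phi> (s + e) * h (s + e) * indicator {..<t - s} e
       + \<phi> (s + e) * h (s + e) * indicator {t - s<..} e"
      using AE_exponential_law_neq[of "t - s"] by eventually_elim (auto split: split_indicator)
    then have "stp \<phi> h s = (\<integral>\<^sup>+e. \<phi> (s + e) * h (s + e) * indicator {..<t - s} e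
       + \<phi> (s + e) * h (s + e) * indicator {t - s<..} e \<partial>exponential_law l)"
      unfolding stp_def by (rule nn_integral_cong_AE)
    also have "\<dots> = (\<integral>\<^sup>+e. \<phi> (s + e) * h (s + e) * indicator {..<t - s} e \<partial>exponential_law l)
       + (\<integral>\<^sup>+e. \<phi> (s + e) * h (s + e) * indicator {t - s<..} e \<partial>exponential_law l)"
      by (rule nn_integral_add) auto
    also have "(\<integral>\<^sup>+e. \<phi> (s + e) * h (s + e) * indicator {t - s<..} e \<partial>exponential_law l)
        = ennreal (exp (- l * (t - s))) * (\<integral>\<^sup>+e. \<phi> (s + (t - s + e)) * h (s + (t - s + e)) \<partial>exponential_law l)"
      using s l_pos by (intro exponential_law_memoryless[where f="\<lambda>e. \<phi> (s + e) * h (s + e)"]) auto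
    also have "(\<lambda>e. \<phi> (s + (t - s + e)) * h (s + (t - s + e))) = (\<lambda>e. \<phi> (t + e) * h (t + e))"
      by simp
    finally show ?thesis by (simp add: stp_def)
  qed
  have "G K t = C * G0 K t" using L by (simp add: G_def G0_def C_def)
  moreover have "(\<integral>\<^sup>+e. \<psi> (s + e) * g (s + e) * indicator {..<t - s} e \<partial>exponential_law l)
      = C * (\<integral>\<^sup>+e. \<psi>0 (s + e) * g0 (s + e) * indicator {..<t - s} e \<partial>exponential_law l)"
    by (subst nn_integral_cmult[symmetric])
       (auto intro!: nn_integral_cong simp: before g(1) mult_ac split: split_indicator)
  ultimately show "stp \<psi> g s = C * stp \<psi>0 g0 s"
    by (simp add: split late late0 algebra_simps)
qed

text \<open>Everything after time \<open>t\<close> is replaced by a constant: at the first renewal past \<open>t\<close> the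
  sequence starts afresh, so the window \<open>[t, t + L)\<close> contributes the probability generating
  function at \<open>c\<close> of a Poisson variable with mean \<open>l * L\<close>. The points in \<open>D\<close> are required to
  lie before \<open>t\<close>.\<close>

theorem renewal_shift:
  assumes \<Psi>: "marks \<Psi>" and \<Psi>0: "marks \<Psi>0" and s: "s \<le> t" and L: "0 \<le> L" and c: "0 \<le> c" "c \<le> 1"
    and D: "finite D"
    and before: "\<And>n u. u < t \<Longrightarrow> avg \<Psi> n u = avg \<Psi>0 n u"
    and after: "\<And>n u. t < u \<Longrightarrow> u \<noteq> t + L \<Longrightarrow> avg \<Psi> n u = (if n \<in> D then 0 else if u < t + L then ennreal c else 1)"
    and after0: "\<And>n u. t < u \<Longrightarrow> avg \<Psi>0 n u = (if n \<in> D then 0 else 1)"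
  shows "(\<integral>\<^sup>+x. iprod \<Psi> s x \<partial>Pr) = ennreal (exp (- l * (1 - c) * L)) * (\<integral>\<^sup>+x. iprod \<Psi>0 s x \<partial>Pr)"
proof -
  define G where "G = (\<lambda>K s. if \<exists>d\<in>D. K \<le> d then 0 else ennreal (exp (- l * (1 - c) * max 0 (t + L - s))))"
  define G0 where "G0 = (\<lambda>K (s::real). if \<exists>d\<in>D. K \<le> d then 0 else (1 :: ennreal))"
  define C where "C = ennreal (exp (- l * (1 - c) * L))"
  define rel where "rel = (\<lambda>K g g0. g \<in> borel_measurable borel \<and> g0 \<in> borel_measurable borel \<and>
     (\<forall>s<t. g s = C * g0 s) \<and> (\<forall>s\<ge>t. g s = G K s \<and> g0 s = G0 K s))"
  have [measurable]: "avg \<Psi> n \<in> borel_measurable borel" "avg \<Psi>0 n \<in> borel_measurable borel" for n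
    using \<Psi> \<Psi>0 by auto
  have rel_step: "rel K (stp (avg \<Psi> K) g) (stp (avg \<Psi>0 K) g0)" if "rel (Suc K) g g0" for K g g0
  proof -
    have [measurable]: "g \<in> borel_measurable borel" "g0 \<in> borel_measurable borel" 
      and gs: "\<And>s. s < t \<Longrightarrow> g s = C * g0 s" "\<And>s. t \<le> s \<Longrightarrow> g s = G (Suc K) s" "\<And>s. t \<le> s \<Longrightarrow> g0 s = G0 (Suc K) s"
      using that by (auto simp: rel_def)
    have M: "avg \<Psi> K \<in> borel_measurable borel" "avg \<Psi>0 K \<in> borel_measurable borel"
        "g \<in> borel_measurable borel" "g0 \<in> borel_measurable borel"
      by measurable
    note R = stp_relation[of "avg \<Psi> K" "avg \<Psi>0 K" g g0 L c t K D,
        OF M L c before after after0 gs[unfolded G_def G0_def C_def]]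
    have "stp (avg \<Psi> K) g \<in> borel_measurable borel" "stp (avg \<Psi>0 K) g0 \<in> borel_measurable borel"
      by measurable
    then show ?thesis
      unfolding rel_def C_def G_def G0_def using R by blast
  qed
  have I: "(\<integral>\<^sup>+x. pprod \<Psi> K s x * g (pos K s x) \<partial>Pr) = C * (\<integral>\<^sup>+x. pprod \<Psi>0 K s x * g0 (pos K s x) \<partial>Pr)"
    if "rel K g g0" for K g g0
    using that
  proof (induction K arbitrary: g g0)
    case 0
    have "G 0 t = C * G0 0 t" using L by (simp add: G_def G0_def C_def)
    then have "g s = C * g0 s" using 0 s by (cases "s = t") (auto simp: rel_def)
    then show ?case using P.emeasure_space_1 by (simp add: pprod_def pos_def)
  next
    case (Suc K)
    then have [measurable]: "g \<in> borel_measurable borel" "g0 \<in> borel_measurable borel" by (auto simp: rel_def)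
    show ?case
      using Suc.IH[OF rel_step[OF Suc.prems]] by (simp add: pprod_peel[OF \<Psi>] pprod_peel[OF \<Psi>0])
  qed
  \<comment> \<open>Terminal functions that satisfy the relation at level \<open>K\<close>. Almost
    surely the positions pass \<open>t + L\<close> and \<open>K\<close> exceeds all of
    \<open>D\<close>; from then on both functions equal 1, so the limit in \<open>K\<close> is the
    full product.\<close>
  define gK where "gK = (\<lambda>K s. if s < t then C else G K s)"
  define g0K where "g0K = (\<lambda>K s. if s < t then 1 else G0 K s)"
  have [measurable]: "gK K \<in> borel_measurable borel" "g0K K \<in> borel_measurable borel" for K
    unfolding gK_def g0K_def G_def G0_def by measurable
  have rel_K: "rel K (gK K) (g0K K)" for K
    by (auto simp: rel_def) (auto simp: gK_def g0K_def)
  have le1: "C \<le> 1" "G K s \<le> 1" "G0 K s \<le> 1" for K s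
    using l_pos c L by (auto simp: C_def G_def G0_def mult_nonneg_nonneg)
  have lim: "(\<lambda>K. \<integral>\<^sup>+x. pprod \<Phi> K s x * h K (pos K s x) \<partial>Pr) \<longlonglongrightarrow> (\<integral>\<^sup>+x. iprod \<Phi> s x \<partial>Pr)"
    if \<Phi>: "marks \<Phi>" and [measurable]: "\<And>K. h K \<in> borel_measurable borel" and h1: "\<And>K s. h K s \<le> 1"
      and h: "\<And>K u. (\<forall>d\<in>D. d < K) \<Longrightarrow> t + L < u \<Longrightarrow> h K u = 1" for \<Phi> and h :: "nat \<Rightarrow> real \<Rightarrow> ennreal"
  proof (rule nn_integral_dominated_convergence[where w="\<lambda>_. 1"])
    have pp1: "pprod \<Phi> K s x \<le> 1" for K x
      unfolding pprod_def by (intro prod_le_1) (auto intro: marks_le_1[OF \<Phi>])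
    have [measurable]: "pprod \<Phi> K s \<in> borel_measurable Pr" "iprod \<Phi> s \<in> borel_measurable Pr" for K
      using \<Phi> by auto
    show "(\<lambda>x. pprod \<Phi> K s x * h K (pos K s x)) \<in> borel_measurable Pr" for K by measurable
    show "iprod \<Phi> s \<in> borel_measurable Pr" by measurable
    show "AE x in Pr. pprod \<Phi> K s x * h K (pos K s x) \<le> 1" for K
      by (intro AE_I2) (metis mult_mono[OF pp1 h1] mult_1 zero_le)
    show "AE x in Pr. (\<lambda>K. pprod \<Phi> K s x * h K (pos K s x)) \<longlonglongrightarrow> iprod \<Phi> s x"
      using AE_pos_at_top[of s]
    proof eventually_elim
      case (elim x)
      have "decseq (\<lambda>K. pprod \<Phi> K s x)"
        unfolding pprod_def by (intro decseq_SucI) (auto intro!: mult_left_le marks_le_1[OF \<Phi>])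
      then have "(\<lambda>K. pprod \<Phi> K s x) \<longlonglongrightarrow> iprod \<Phi> s x"
        unfolding iprod_def by (rule LIMSEQ_INF)
      moreover have "eventually (\<lambda>K. t + L < pos K s x) sequentially"
        using elim by (simp add: filterlim_at_top_dense)
      moreover obtain m where "\<forall>d\<in>D. d < m" using D finite_nat_set_iff_bounded by blast
      then have "eventually (\<lambda>K. \<forall>d\<in>D. d < K) sequentially"
        by (auto simp: eventually_sequentially intro!: exI[of _ m] intro: less_le_trans)
      ultimately have ev: "eventually (\<lambda>K. t + L < pos K s x) sequentially"
          "eventually (\<lambda>K. \<forall>d\<in>D. d < K) sequentially"
        and lm: "(\<lambda>K. pprod \<Phi> K s x) \<longlonglongrightarrow> iprod \<Phi> s x" by blast+
      have "eventually (\<lambda>K. pprod \<Phi> K s x = pprod \<Phi> K s x * h K (pos K s x)) sequentially"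
        using ev by eventually_elim (simp add: h)
      with lm show ?case by (rule Lim_transform_eventually)
    qed
  qed (use P.emeasure_space_1 in auto)
  have "(\<lambda>K. \<integral>\<^sup>+x. pprod \<Psi> K s x * gK K (pos K s x) \<partial>Pr) \<longlonglongrightarrow> (\<integral>\<^sup>+x. iprod \<Psi> s x \<partial>Pr)"
  proof (rule lim[OF \<Psi>])
    show "gK K \<in> borel_measurable borel" for K by measurable
  qed (use L le1 in \<open>auto simp: gK_def G_def\<close>)
  moreover have "(\<lambda>K. \<integral>\<^sup>+x. pprod \<Psi>0 K s x * g0K K (pos K s x) \<partial>Pr) \<longlonglongrightarrow> (\<integral>\<^sup>+x. iprod \<Psi>0 s x \<partial>Pr)"
  proof (rule lim[OF \<Psi>0])
    show "g0K K \<in> borel_measurable borel" for K by measurable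
  qed (use L le1 in \<open>auto simp: g0K_def G0_def\<close>)
  then have "(\<lambda>K. C * (\<integral>\<^sup>+x. pprod \<Psi>0 K s x * g0K K (pos K s x) \<partial>Pr)) \<longlonglongrightarrow> C * (\<integral>\<^sup>+x. iprod \<Psi>0 s x \<partial>Pr)"
    by (intro ennreal_tendsto_cmult) (auto simp: C_def)
  ultimately show ?thesis
    unfolding I[OF rel_K] C_def[symmetric] by (rule LIMSEQ_unique)
qed

end

section \<open>The process along a fixed history\<close>

lemma INF_prod_of_bool:
  fixes P :: "nat \<Rightarrow> bool"
  shows
  "(INF K. \<Prod>n<K. if P n then 1 else (0::ennreal)) = (if \<forall>n. P n then 1 else 0)"
proof (cases "\<forall>n. P n")
  case False
  then obtain n where "\<not> P n" by blast
  then have "(\<Prod>i<Suc n. if P i then 1 else (0::ennreal)) = 0" by simp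
  then have "(INF K. \<Prod>n<K. if P n then 1 else (0::ennreal)) \<le> 0"
    by (metis INF_lower UNIV_I)
  then show ?thesis using False by simp
qed simp

instance primitive :: countable
  by countable_datatype

definition hit :: "(primitive \<Rightarrow> real) \<Rightarrow> nat \<Rightarrow> nat \<Rightarrow> real \<Rightarrow> real \<Rightarrow> real \<Rightarrow> bool" where
  "hit x j n u a b \<longleftrightarrow> (\<exists>k. a \<le> u + (\<Sum>l<k. x (Retrial j n l)) \<and> u + (\<Sum>l<k. x (Retrial j n l)) < b)"

text \<open>Both values of \<open>cl\<close> are needed: \<open>visit_counts\<close> includes
  arrivals at the very end of the glue period, whereas an arrival at the very start of a stage
  belongs to the glue window \<open>[t, t + G i)\<close> that opens there.\<close>

definition wt :: "bool \<Rightarrow> real \<Rightarrow> real \<Rightarrow> real \<Rightarrow> ennreal" where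
  "wt cl T z u = (if u < T \<or> cl \<and> u = T then ennreal z else 1)"

locale polling_model =
  fixes N :: nat and lam nu G :: "nat \<Rightarrow> real" and B S :: "nat \<Rightarrow> real measure"
  assumes N: "N \<ge> 1"
    and lam_pos: "\<And>i. i \<in> {1..N} \<Longrightarrow> 0 < lam i"
    and nu_pos: "\<And>i. i \<in> {1..N} \<Longrightarrow> 0 < nu i"
    and G_pos: "\<And>i. i \<in> {1..N} \<Longrightarrow> 0 < G i"
    and B: "\<And>i. i \<in> {1..N} \<Longrightarrow> prob_space (B i) \<and> sets (B i) = sets borel \<and> (AE x in B i. 0 \<le> x)"
    and S: "\<And>i. i \<in> {1..N} \<Longrightarrow> prob_space (S i) \<and> sets (S i) = sets borel \<and> (AE x in S i. 0 \<le> x)"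
begin

text \<open>Nothing is assumed about primitives outside \<open>primitives N\<close>. A point mass at
  0 there lets the product run over the whole type and keeps all coordinates nonnegative.\<close>

definition law :: "primitive \<Rightarrow> real measure" where
  "law p = (if p \<in> primitives N then primitive_law lam nu B S p else return borel 0)"

lemma law_simps:
  assumes "j \<in> {1..N}"
  shows "law (Interarrival j n) = exponential_law (lam j)" "law (Retrial j n k) = exponential_law (nu j)"
    "law (Service j n) = B j" "law (Switchover j n) = S j"
  using assms by (simp_all add: law_def primitives_def)

lemma law_props: "prob_space (law p) \<and> sets (law p) = sets borel \<and> (AE e in law p. 0 \<le> e)"
proof (cases "p \<in> primitives N")
  case True
  have *: "AE e in exponential_law l. 0 \<le> e" for l
    using AE_exponential_law_pos[of l] by eventually_elim simp
  have eq: "law p = primitive_law lam nu B S p" using True by (simp add: law_def)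
  show ?thesis
  proof (cases p)
    case (Interarrival i n)
    then show ?thesis using True
      unfolding eq unfolding Interarrival primitive_law.simps by (auto simp: primitives_def prob_space_exponential_law lam_pos *)
  next
    case (Service i n)
    then show ?thesis using True B
      unfolding eq unfolding Service primitive_law.simps by (auto simp: primitives_def)
  next
    case (Switchover i n)
    then show ?thesis using True S
      unfolding eq unfolding Switchover primitive_law.simps by (auto simp: primitives_def)
  next
    case (Retrial i n k)
    then show ?thesis using True
      unfolding eq unfolding Retrial primitive_law.simps by (auto simp: primitives_def prob_space_exponential_law nu_pos *)
  qed
next
  case False
  then have eq: "law p = return borel 0" by (simp add: law_def)
  show ?thesis unfolding eq by (auto simp: prob_space_return AE_return)
qed

sublocale real_product_space law
proof -
  interpret prob_space "law p" for p using law_props by blast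
  show "real_product_space law"
    by unfold_locales (use law_props in blast)
qed

lemma AE_nonneg: "AE x in Pr. \<forall>p. 0 \<le> x (p :: primitive)"
proof -
  have "AE x in Pr. 0 \<le> x p" for p
    using law_props by (intro AE_component) auto
  then show ?thesis
    by (simp add: AE_all_countable)
qed

lemma renewal_arrivals:
  "j \<in> {1..N} \<Longrightarrow> renewal_sequence law (Interarrival j) (lam j) (\<lambda>n. range (Retrial j n))"
  by unfold_locales (auto simp: inj_def law_simps lam_pos)

lemma renewal_retrials:
  "j \<in> {1..N} \<Longrightarrow> renewal_sequence law (Retrial j n) (nu j) (\<lambda>_. {})"
  by unfold_locales (auto simp: inj_def law_simps nu_pos)

text \<open>A history \<open>h\<close> prescribes the set \<open>h l\<close> of customers served in stage \<open>l\<close>, and with it the stage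
  times \<open>\<tau>\<close>. Below, \<open>cust\<close> is the factor of a single customer, arriving at \<open>u\<close>, in the generating
  function of the customers present at time \<open>T\<close> on the event that \<open>h\<close> occurs; \<open>cl\<close> says whether
  arrivals at time \<open>T\<close> itself count. In \<open>custg\<close>, \<open>y\<close> marks those who join the queue in the glue
  period that begins at \<open>T\<close>.\<close>

definition served :: "(nat \<Rightarrow> nat set) \<Rightarrow> nat \<Rightarrow> nat \<Rightarrow> nat set" where
  "served h j m = {n. \<exists>l<m. station N l = j \<and> n \<in> h l}"

definition consistent :: "(nat \<Rightarrow> nat set) \<Rightarrow> nat \<Rightarrow> (nat \<Rightarrow> real) \<Rightarrow> nat \<Rightarrow> nat \<Rightarrow> real \<Rightarrow> (primitive \<Rightarrow> real) \<Rightarrow> bool" where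
  "consistent h m \<tau> j n u x \<longleftrightarrow>
     (\<forall>l<m. station N l = j \<longrightarrow> (n \<in> h l \<longleftrightarrow> n \<notin> served h j l \<and> hit x j n u (\<tau> l) (\<tau> l + G j)))"

definition cust :: "(nat \<Rightarrow> nat set) \<Rightarrow> nat \<Rightarrow> (nat \<Rightarrow> real) \<Rightarrow> bool \<Rightarrow> real \<Rightarrow> real \<Rightarrow> nat \<Rightarrow> nat \<Rightarrow> real \<Rightarrow> (primitive \<Rightarrow> real) \<Rightarrow> ennreal" where
  "cust h m \<tau> cl T z j n u x =
     (if consistent h m \<tau> j n u x then (if n \<in> served h j m then 1 else wt cl T z u) else 0)"

definition custg :: "(nat \<Rightarrow> nat set) \<Rightarrow> nat \<Rightarrow> (nat \<Rightarrow> real) \<Rightarrow> real \<Rightarrow> real \<Rightarrow> real \<Rightarrow> nat \<Rightarrow> nat \<Rightarrow> real \<Rightarrow> (primitive \<Rightarrow> real) \<Rightarrow> ennreal" where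
  "custg h m \<tau> T y z j n u x =
     (if consistent h m \<tau> j n u x then
        (if n \<in> served h j m then 1 else if hit x j n u T (T + G j) then ennreal y else wt True (T + G j) z u)
      else 0)"

definition cprod :: "(nat \<Rightarrow> real \<Rightarrow> (primitive \<Rightarrow> real) \<Rightarrow> ennreal) \<Rightarrow> nat \<Rightarrow> (primitive \<Rightarrow> real) \<Rightarrow> ennreal" where
  "cprod \<Phi> j x = (INF K. \<Prod>n<K. \<Phi> n (arrival_time x j n) x)"

lemma measurable_wt [measurable]:
  assumes [measurable]: "T \<in> borel_measurable M" "u \<in> borel_measurable M"
  shows "(\<lambda>w. wt cl (T w) z (u w)) \<in> borel_measurable M"
  unfolding wt_def by measurable

lemma measurable_hit [measurable]:
  assumes [measurable]: "a \<in> borel_measurable M" "b \<in> borel_measurable M" "u \<in> borel_measurable M" "f \<in> M \<rightarrow>\<^sub>M Pr"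
  shows "Measurable.pred M (\<lambda>w. hit (f w) j n (u w) (a w) (b w))"
proof -
  have [measurable]: "(\<lambda>w. f w p) \<in> borel_measurable M" for p
    using measurable_compose[OF assms(4) measurable_coordinate] .
  show ?thesis unfolding hit_def by measurable
qed

lemma measurable_consistent [measurable]:
  assumes [measurable]: "\<And>l. (\<lambda>w. \<tau> w l) \<in> borel_measurable M" "u \<in> borel_measurable M" "f \<in> M \<rightarrow>\<^sub>M Pr"
  shows "Measurable.pred M (\<lambda>w. consistent h m (\<tau> w) j n (u w) (f w))"
  unfolding consistent_def by measurable

lemma measurable_cust [measurable]:
  assumes [measurable]: "\<And>l. (\<lambda>w. \<tau> w l) \<in> borel_measurable M" "u \<in> borel_measurable M" "f \<in> M \<rightarrow>\<^sub>M Pr"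
     "T \<in> borel_measurable M"
  shows "(\<lambda>w. cust h m (\<tau> w) cl (T w) z j n (u w) (f w)) \<in> borel_measurable M"
  unfolding cust_def by measurable

lemma measurable_custg [measurable]:
  assumes [measurable]: "\<And>l. (\<lambda>w. \<tau> w l) \<in> borel_measurable M" "u \<in> borel_measurable M" "f \<in> M \<rightarrow>\<^sub>M Pr"
     "T \<in> borel_measurable M"
  shows "(\<lambda>w. custg h m (\<tau> w) (T w) y z j n (u w) (f w)) \<in> borel_measurable M"
  unfolding custg_def by measurable

lemma measurable_arrival_time [measurable]:
  assumes [measurable]: "f \<in> M \<rightarrow>\<^sub>M Pr"
  shows "(\<lambda>w. arrival_time (f w) j n) \<in> borel_measurable M"
proof -
  have [measurable]: "(\<lambda>w. f w p) \<in> borel_measurable M" for p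
    using measurable_compose[OF assms(1) measurable_coordinate] .
  show ?thesis unfolding arrival_time_def by measurable
qed

lemma wt_le_1: "z \<le> 1 \<Longrightarrow> wt cl T z u \<le> 1"
  by (simp add: wt_def flip: ennreal_1)

lemma cust_le_1: "z \<le> 1 \<Longrightarrow> cust h m \<tau> cl T z j n u x \<le> 1"
  by (simp add: cust_def wt_le_1)

lemma custg_le_1: "y \<le> 1 \<Longrightarrow> z \<le> 1 \<Longrightarrow> custg h m \<tau> T y z j n u x \<le> 1"
  by (auto simp: custg_def wt_le_1)

lemma hit_cong: "(\<And>k. x (Retrial j n k) = y (Retrial j n k)) \<Longrightarrow> hit x j n u a b = hit y j n u a b"
  by (simp add: hit_def)

lemma cust_cong:
  assumes "\<And>k. x (Retrial j n k) = y (Retrial j n k)" "\<And>l. l < m \<Longrightarrow> \<tau> l = \<tau>' l"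
  shows "cust h m \<tau> cl T z j n u x = cust h m \<tau>' cl T z j n u y"
  unfolding cust_def consistent_def using hit_cong[of x j n y] assms by (auto cong: conj_cong)

lemma custg_cong:
  assumes "\<And>k. x (Retrial j n k) = y (Retrial j n k)" "\<And>l. l < m \<Longrightarrow> \<tau> l = \<tau>' l"
  shows "custg h m \<tau> T v z j n u x = custg h m \<tau>' T v z j n u y"
  unfolding custg_def consistent_def using hit_cong[of x j n y] assms by (auto cong: conj_cong)

lemma not_hit_late:
  assumes "\<forall>p. 0 \<le> x (p :: primitive)" "b \<le> u"
  shows "\<not> hit x j n u a b"
  using assms by (auto simp: hit_def not_less intro: add_increasing2 sum_nonneg)

text \<open>All attempts of such a customer lie after the glue periods in question, so the history
  can only be contradicted by prescribing that the customer is served.\<close>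

lemma consistent_late:
  assumes x: "\<forall>p. 0 \<le> x (p :: primitive)" and le: "\<And>l. l < m \<Longrightarrow> station N l = j \<Longrightarrow> \<tau> l + G j \<le> t" and u: "t < u"
  shows "consistent h m \<tau> j n u x \<longleftrightarrow> n \<notin> served h j m"
proof -
  have "\<not> hit x j n u (\<tau> l) (\<tau> l + G j)" if "l < m" "station N l = j" for l
    using le[OF that] u by (intro not_hit_late[OF x]) auto
  then show ?thesis by (auto simp: consistent_def served_def)
qed

lemma avg_const:
  assumes "AE x in Pr. F x = c"
  shows "(\<integral>\<^sup>+x. F x \<partial>Pr) = c"
  using nn_integral_cong_AE[OF assms] P.emeasure_space_1 by simp

lemma nn_avg_cust_late:
  assumes "\<And>l. l < m \<Longrightarrow> station N l = j \<Longrightarrow> \<tau> l + G j \<le> t" "t < u"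
  shows "(\<integral>\<^sup>+x. cust h m \<tau> cl T z j n u x \<partial>Pr) = (if n \<in> served h j m then 0 else wt cl T z u)"
proof (rule avg_const)
  show "AE x in Pr. cust h m \<tau> cl T z j n u x = (if n \<in> served h j m then 0 else wt cl T z u)"
    using AE_nonneg by eventually_elim (auto simp: cust_def consistent_late[OF _ assms])
qed

lemma finite_served: "(\<And>l. l < m \<Longrightarrow> finite (h l)) \<Longrightarrow> finite (served h j m)"
proof -
  assume "\<And>l. l < m \<Longrightarrow> finite (h l)"
  then have "finite (\<Union>l<m. h l)" by auto
  then show ?thesis by (rule finite_subset[rotated]) (auto simp: served_def)
qed

lemma cprod_iprod:
  assumes "j \<in> {1..N}"
  shows "cprod \<Phi> j x = renewal_sequence.iprod (Interarrival j) \<Phi> 0 x"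
proof -
  interpret R: renewal_sequence law "Interarrival j" "lam j" "\<lambda>n. range (Retrial j n)"
    by (rule renewal_arrivals[OF assms])
  show ?thesis
    by (simp add: cprod_def R.iprod_def R.pprod_def R.pos_def arrival_time_def lessThan_Suc_atMost)
qed

lemma marks_cust:
  assumes "j \<in> {1..N}" "z \<le> 1"
  shows "renewal_sequence.marks law (\<lambda>n. range (Retrial j n)) (\<lambda>n u x. cust h m \<tau> cl T z j n u x)"
proof -
  interpret R: renewal_sequence law "Interarrival j" "lam j" "\<lambda>n. range (Retrial j n)"
    by (rule renewal_arrivals[OF assms(1)])
  show ?thesis
    unfolding R.marks_def using assms by (auto simp: cust_le_1 intro!: cust_cong)
qed

lemma marks_custg:
  assumes "j \<in> {1..N}" "y \<le> 1" "z \<le> 1"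
  shows "renewal_sequence.marks law (\<lambda>n. range (Retrial j n)) (\<lambda>n u x. custg h m \<tau> T y z j n u x)"
proof -
  interpret R: renewal_sequence law "Interarrival j" "lam j" "\<lambda>n. range (Retrial j n)"
    by (rule renewal_arrivals[OF assms(1)])
  show ?thesis
    unfolding R.marks_def using assms by (auto simp: custg_le_1 intro!: custg_cong)
qed

text \<open>\<open>renewal_shift\<close> with the window \<open>[t, t')\<close>: every prescribed
  glue period of type \<open>j\<close> is over by \<open>t\<close>, so an arrival in the window only
  adds a factor \<open>z\<close>. The served set is the set \<open>D\<close>, since a served
  customer must have arrived by then. The flags \<open>cl\<close> and \<open>cl'\<close> are
  independent because an arrival at an exact time has probability 0.\<close>

lemma nn_integral_cust_shift:
  assumes j: "j \<in> {1..N}" and fin: "\<And>l. l < m \<Longrightarrow> finite (h l)"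
    and le: "\<And>l. l < m \<Longrightarrow> station N l = j \<Longrightarrow> \<tau> l + G j \<le> t" and t: "0 \<le> t" "t \<le> t'"
    and z: "0 \<le> z" "z \<le> 1"
  shows "(\<integral>\<^sup>+x. cprod (cust h m \<tau> cl' t' z j) j x \<partial>Pr)
       = ennreal (exp (- lam j * (1 - z) * (t' - t))) * (\<integral>\<^sup>+x. cprod (cust h m \<tau> cl t z j) j x \<partial>Pr)"
proof -
  interpret R: renewal_sequence law "Interarrival j" "lam j" "\<lambda>n. range (Retrial j n)"
    by (rule renewal_arrivals[OF j])
  show ?thesis
    unfolding cprod_iprod[OF j]
  proof (rule R.renewal_shift[where D="served h j m" and L="t' - t" and t=t])
    show "R.avg (cust h m \<tau> cl' t' z j) n u = R.avg (cust h m \<tau> cl t z j) n u" if "u < t" for n u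
      using that t unfolding R.avg_def by (intro nn_integral_cong) (auto simp: cust_def wt_def)
    show "R.avg (cust h m \<tau> cl' t' z j) n u = (if n \<in> served h j m then 0 else if u < t + (t' - t) then ennreal z else 1)"
      if "t < u" "u \<noteq> t + (t' - t)" for n u
      using that nn_avg_cust_late[OF le that(1)] by (simp add: R.avg_def wt_def)
    show "R.avg (cust h m \<tau> cl t z j) n u = (if n \<in> served h j m then 0 else 1)" if "t < u" for n u
      using that nn_avg_cust_late[OF le that(1)] by (simp add: R.avg_def wt_def)
  qed (use t z j fin in \<open>auto intro: marks_cust finite_served\<close>)
qed

text \<open>The case \<open>c = 0\<close>, \<open>D = {}\<close> of \<open>renewal_shift\<close>,
  applied to the retrials of one customer. The set \<open>U\<close> lies before \<open>t\<close>,
  and the retrial clock restarts at \<open>t\<close>, so avoiding \<open>[t, t + g)\<close> costs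
  the factor \<open>exp (- nu j * g)\<close> whatever happened before.\<close>

lemma retrial_shift:
  fixes n :: nat
  assumes j: "j \<in> {1..N}" and u: "u < t" and g: "0 \<le> g"
    and [measurable]: "U \<in> sets borel" and U: "\<And>v. t \<le> v \<Longrightarrow> v \<notin> U"
  defines "p \<equiv> \<lambda>(k::nat) x. u + (\<Sum>l<k. x (Retrial j n l))"
  shows "(\<integral>\<^sup>+x. (if \<forall>k. p k x \<notin> U \<and> \<not> (t \<le> p k x \<and> p k x < t + g) then 1 else 0) \<partial>Pr)
       = ennreal (exp (- nu j * g)) * (\<integral>\<^sup>+x. (if \<forall>k. p k x \<notin> U then 1 else 0) \<partial>Pr)"
proof -
  interpret R: renewal_sequence law "Retrial j n" "nu j" "\<lambda>_. {}"
    by (rule renewal_retrials[OF j])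
  define \<Psi> where "\<Psi> = (\<lambda>(k::nat) v (x :: primitive \<Rightarrow> real). if v \<notin> U \<and> \<not> (t \<le> v \<and> v < t + g) then 1 else (0::ennreal))"
  define \<Psi>0 where "\<Psi>0 = (\<lambda>(k::nat) v (x :: primitive \<Rightarrow> real). if v \<notin> U then 1 else (0::ennreal))"
  have marks: "R.marks \<Psi>" "R.marks \<Psi>0"
    unfolding R.marks_def \<Psi>_def \<Psi>0_def by auto
  have avg: "R.avg \<Psi> k v = (if v \<notin> U \<and> \<not> (t \<le> v \<and> v < t + g) then 1 else 0)"
      "R.avg \<Psi>0 k v = (if v \<notin> U then 1 else 0)" for k v
    using P.emeasure_space_1 by (simp_all add: R.avg_def \<Psi>_def \<Psi>0_def)
  have p: "p k x = R.pos k u x" for k x by (simp add: p_def R.pos_def)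
  have iprod: "R.iprod \<Psi> u x = (if \<forall>k. p (Suc k) x \<notin> U \<and> \<not> (t \<le> p (Suc k) x \<and> p (Suc k) x < t + g) then 1 else 0)"
    "R.iprod \<Psi>0 u x = (if \<forall>k. p (Suc k) x \<notin> U then 1 else 0)" for x
    unfolding R.iprod_def R.pprod_def \<Psi>_def \<Psi>0_def p by (rule INF_prod_of_bool)+
  \<comment> \<open>Attempt 0 is the arrival at \<open>u\<close> itself and not a renewal of the
    retrial sequence, so it has to be split off.\<close>
  have all: "(\<forall>k. Q k) \<longleftrightarrow> Q 0 \<and> (\<forall>k. Q (Suc k))" for Q :: "nat \<Rightarrow> bool"
    by (metis not0_implies_Suc)
  have p0: "p 0 x = u" for x by (simp add: p_def)
  have sh: "(\<integral>\<^sup>+x. R.iprod \<Psi> u x \<partial>Pr) = ennreal (exp (- nu j * (1 - 0) * g)) * (\<integral>\<^sup>+x. R.iprod \<Psi>0 u x \<partial>Pr)"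
    by (rule R.renewal_shift[OF marks, where D="{}" and t=t])
       (use u g U in \<open>auto simp: avg\<close>)
  show ?thesis
  proof (cases "u \<in> U")
    case True
    then have n: "\<not> (\<forall>k. p k x \<notin> U)" for x using p0 by metis
    then have "\<not> (\<forall>k. p k x \<notin> U \<and> \<not> (t \<le> p k x \<and> p k x < t + g))" for x by blast
    then show ?thesis by (simp only: n if_False) simp
  next
    case False
    have "(\<forall>k. p k x \<notin> U) \<longleftrightarrow> (\<forall>k. p (Suc k) x \<notin> U)" for x
      using False all[of "\<lambda>k. p k x \<notin> U"] p0 by simp
    moreover have "(\<forall>k. p k x \<notin> U \<and> \<not> (t \<le> p k x \<and> p k x < t + g)) \<longleftrightarrow>
      (\<forall>k. p (Suc k) x \<notin> U \<and> \<not> (t \<le> p (Suc k) x \<and> p (Suc k) x < t + g))" for x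
      using False u all[of "\<lambda>k. p k x \<notin> U \<and> \<not> (t \<le> p k x \<and> p k x < t + g)"] p0 by simp
    ultimately show ?thesis using sh by (simp add: iprod)
  qed
qed

text \<open>An unserved customer who arrived before \<open>t\<close> makes an attempt in the glue
  period with probability \<open>1 - q\<close>, independently of the past, so its factor averages to
  \<open>(1 - q) * y + q * z\<close>. A customer who arrives during the glue period sticks at
  attempt 0 and contributes \<open>y\<close>.\<close>

lemma nn_integral_glue_shift:
  assumes j: "j \<in> {1..N}" and fin: "\<And>l. l < m \<Longrightarrow> finite (h l)"
    and le: "\<And>l. l < m \<Longrightarrow> station N l = j \<Longrightarrow> \<tau> l + G j \<le> t" and t: "0 \<le> t"
    and y: "0 \<le> y" "y \<le> 1" and z: "0 \<le> z" "z \<le> 1"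
  defines "q \<equiv> exp (- nu j * G j)"
  shows "(\<integral>\<^sup>+x. cprod (custg h m \<tau> t y z j) j x \<partial>Pr)
       = ennreal (exp (- lam j * (1 - y) * G j)) * (\<integral>\<^sup>+x. cprod (cust h m \<tau> False t ((1 - q) * y + q * z) j) j x \<partial>Pr)"
proof -
  interpret R: renewal_sequence law "Interarrival j" "lam j" "\<lambda>n. range (Retrial j n)"
    by (rule renewal_arrivals[OF j])
  have q: "0 \<le> q" "q \<le> 1" using nu_pos[OF j] G_pos[OF j] by (auto simp: q_def)
  let ?z = "(1 - q) * y + q * z"
  have z': "0 \<le> ?z" "?z \<le> 1"
    using q y z convex_bound_le[of y 1 z "1 - q" q] by auto
  have late: "(\<integral>\<^sup>+x. custg h m \<tau> t y z j n u x \<partial>Pr) = (if n \<in> served h j m then 0 else if u < t + G j then ennreal y else 1)"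
    if u: "t < u" "u \<noteq> t + G j" for n u
  proof (rule avg_const)
    show "AE x in Pr. custg h m \<tau> t y z j n u x = (if n \<in> served h j m then 0 else if u < t + G j then ennreal y else 1)"
      using AE_nonneg
    proof eventually_elim
      case (elim x)
      have "hit x j n u t (t + G j)" if "u < t + G j"
        unfolding hit_def using that u by (intro exI[of _ 0]) simp
      moreover have "\<not> hit x j n u t (t + G j)" if "\<not> u < t + G j"
        using that by (intro not_hit_late[OF elim]) simp
      ultimately show ?case
        using u by (simp add: custg_def consistent_late[OF elim le u(1)] wt_def)
    qed
  qed
  have early: "(\<integral>\<^sup>+x. custg h m \<tau> t y z j n u x \<partial>Pr) = (\<integral>\<^sup>+x. cust h m \<tau> False t ?z j n u x \<partial>Pr)"
    if u: "u < t" for n u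
  proof (cases "n \<in> served h j m")
    case True
    then show ?thesis by (intro nn_integral_cong) (simp add: cust_def custg_def)
  next
    case False
    \<comment> \<open>The earlier glue windows of station \<open>j\<close>: an unserved customer is
      consistent with the history exactly if it has no attempt in them.\<close>
    define U where "U = (\<Union>l\<in>{l. l < m \<and> station N l = j}. {\<tau> l..<\<tau> l + G j})"
    have Um [measurable]: "U \<in> sets borel" unfolding U_def by (intro sets.finite_UN) auto
    have Ut: "v \<notin> U" if "t \<le> v" for v
      using that le by (force simp: U_def)
    define p where "p = (\<lambda>k (x :: primitive \<Rightarrow> real). u + (\<Sum>l<k. x (Retrial j n l)))"
    have [measurable]: "p k \<in> borel_measurable Pr" for k unfolding p_def by measurable
    have cons: "consistent h m \<tau> j n u x \<longleftrightarrow> (\<forall>k. p k x \<notin> U)" for x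
      using False by (auto simp: consistent_def U_def p_def hit_def served_def)
    have hit: "hit x j n u t (t + G j) \<longleftrightarrow> \<not> (\<forall>k. \<not> (t \<le> p k x \<and> p k x < t + G j))" for x
      by (simp add: hit_def p_def)
    define W where "W = (\<integral>\<^sup>+x. (if \<forall>k. p k x \<notin> U then 1 else 0) \<partial>Pr)"
    define W1 where "W1 = (\<integral>\<^sup>+x. (if (\<forall>k. p k x \<notin> U) \<and> hit x j n u t (t + G j) then 1 else 0) \<partial>Pr)"
    define W0 where "W0 = (\<integral>\<^sup>+x. (if (\<forall>k. p k x \<notin> U) \<and> \<not> hit x j n u t (t + G j) then 1 else 0) \<partial>Pr)"
    have [measurable]: "(\<lambda>x. if (\<forall>k. p k x \<notin> U) \<and> hit x j n u t (t + G j) then 1 else (0::ennreal)) \<in> borel_measurable Pr"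
        "(\<lambda>x. if (\<forall>k. p k x \<notin> U) \<and> \<not> hit x j n u t (t + G j) then 1 else (0::ennreal)) \<in> borel_measurable Pr"
        "(\<lambda>x. if \<forall>k. p k x \<notin> U then 1 else (0::ennreal)) \<in> borel_measurable Pr"
      by measurable
    have W0: "W0 = ennreal q * W"
      using retrial_shift[OF j u _ Um Ut, of "G j" n] G_pos[OF j]
      unfolding W0_def W_def q_def hit p_def by (simp add: all_conj_distrib)
    have "W1 + W0 = W"
      unfolding W_def W1_def W0_def by (subst nn_integral_add[symmetric]) (measurable, auto intro!: nn_integral_cong)
    \<comment> \<open>Finiteness is what allows \<open>W0\<close> to be subtracted from
      \<open>W\<close> in \<open>ennreal\<close>.\<close>
    moreover have "W \<le> 1"
    proof -
      have "W \<le> (\<integral>\<^sup>+x. 1 \<partial>Pr)" unfolding W_def by (intro nn_integral_mono) auto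
      then show ?thesis using P.emeasure_space_1 by simp
    qed
    then obtain w where w: "W = ennreal w" "0 \<le> w" by (cases W) (auto simp: top_unique)
    ultimately have W1: "W1 = ennreal ((1 - q) * w)"
    proof -
      assume a: "W1 + W0 = W"
      then have "W1 \<le> ennreal w" using w by (metis add_increasing2 dual_order.refl zero_le)
      then obtain w1 where w1: "W1 = ennreal w1" "0 \<le> w1" by (cases W1) (auto simp: top_unique)
      have "w1 + q * w = w" using a w w1 q by (simp add: W0 ennreal_mult'[symmetric] ennreal_plus[symmetric] del: ennreal_plus)
      then show ?thesis using w1 by (simp add: algebra_simps)
    qed
    have "(\<integral>\<^sup>+x. custg h m \<tau> t y z j n u x \<partial>Pr)
       = (\<integral>\<^sup>+x. ennreal y * (if (\<forall>k. p k x \<notin> U) \<and> hit x j n u t (t + G j) then 1 else 0)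
            + ennreal z * (if (\<forall>k. p k x \<notin> U) \<and> \<not> hit x j n u t (t + G j) then 1 else 0) \<partial>Pr)"
      using False u G_pos[OF j] by (intro nn_integral_cong) (auto simp: custg_def cons wt_def)
    also have "\<dots> = ennreal y * W1 + ennreal z * W0"
      unfolding W1_def W0_def by (subst nn_integral_add) (auto simp: nn_integral_cmult Um)
    also have "\<dots> = ennreal ?z * W"
    proof -
      have "ennreal y * W1 + ennreal z * W0 = ennreal (y * ((1 - q) * w)) + ennreal (z * (q * w))"
        using y z q w(2) by (simp add: W0 W1 w(1) ennreal_mult')
      also have "\<dots> = ennreal (y * ((1 - q) * w) + z * (q * w))"
        using y z q w(2) by (intro ennreal_plus[symmetric]) auto
      also have "y * ((1 - q) * w) + z * (q * w) = ?z * w" by (simp add: algebra_simps)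
      finally show ?thesis using z' by (simp add: w(1) ennreal_mult')
    qed
    also have "\<dots> = (\<integral>\<^sup>+x. cust h m \<tau> False t ?z j n u x \<partial>Pr)"
      unfolding W_def by (subst nn_integral_cmult[symmetric])
        (use False u Um in \<open>auto simp: cust_def cons wt_def intro!: nn_integral_cong\<close>)
    finally show ?thesis .
  qed
  show ?thesis
    unfolding cprod_iprod[OF j]
  proof (rule R.renewal_shift[where D="served h j m" and t=t])
    show "R.avg (cust h m \<tau> False t ?z j) n u = (if n \<in> served h j m then 0 else 1)" if "t < u" for n u
      using that nn_avg_cust_late[OF le that] by (simp add: R.avg_def wt_def)
  qed (use t y z z' j fin G_pos[OF j] in \<open>auto intro: marks_cust marks_custg finite_served simp: R.avg_def late early less_imp_le\<close>)
qed

end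

section \<open>Separating the customer types from service and switch-over times\<close>

lemma (in real_product_space) nn_integral_prod_coordinates:
  assumes "finite K" and [measurable]: "\<And>p. g p \<in> borel_measurable borel"
  shows "(\<integral>\<^sup>+x. (\<Prod>p\<in>K. g p (x p)) \<partial>Pr) = (\<Prod>p\<in>K. \<integral>\<^sup>+e. g p e \<partial>law p)"
  using assms(1)
proof (induction K)
  case empty
  then show ?case using P.emeasure_space_1 by simp
next
  case (insert p K)
  have "(\<integral>\<^sup>+x. (\<Prod>p\<in>insert p K. g p (x p)) \<partial>Pr) = (\<integral>\<^sup>+y. \<integral>\<^sup>+x. (\<Prod>q\<in>insert p K. g q (mix {p} x y q)) \<partial>Pr \<partial>Pr)"
    by (rule nn_integral_mix) measurable
  also have "\<dots> = (\<integral>\<^sup>+y. \<integral>\<^sup>+x. (\<Prod>q\<in>K. g q (y q)) * g p (x p) \<partial>Pr \<partial>Pr)"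
  proof (intro nn_integral_cong)
    fix x y
    have "(\<Prod>q\<in>K. g q (mix {p} x y q)) = (\<Prod>q\<in>K. g q (y q))"
      using insert.hyps by (intro prod.cong) (auto simp: mix_def)
    then show "(\<Prod>q\<in>insert p K. g q (mix {p} x y q)) = (\<Prod>q\<in>K. g q (y q)) * g p (x p)"
      using insert.hyps by (simp add: mix_def mult.commute)
  qed
  also have "\<dots> = (\<integral>\<^sup>+y. (\<Prod>q\<in>K. g q (y q)) * (\<integral>\<^sup>+e. g p e \<partial>law p) \<partial>Pr)"
    by (intro nn_integral_cong, subst nn_integral_cmult) (simp_all add: nn_integral_coordinate)
  also have "\<dots> = (\<integral>\<^sup>+y. (\<Prod>q\<in>K. g q (y q)) \<partial>Pr) * (\<integral>\<^sup>+e. g p e \<partial>law p)"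
    by (rule nn_integral_multc) measurable
  finally show ?case using insert by (simp add: mult.commute)
qed

definition laplace :: "real measure \<Rightarrow> real \<Rightarrow> real" where
  "laplace P u = (\<integral>x. exp (- u * x) \<partial>P)"

lemma
  assumes "prob_space P" "sets P = sets borel" "AE x in P. 0 \<le> x" "0 \<le> u"
  shows integrable_laplace: "integrable P (\<lambda>x. exp (- u * x))"
    and nn_integral_laplace: "(\<integral>\<^sup>+x. ennreal (exp (- u * x)) \<partial>P) = ennreal (laplace P u)"
    and laplace_nonneg: "0 \<le> laplace P u"
    and laplace_le_1: "laplace P u \<le> 1"
proof -
  interpret prob_space P by fact
  note [measurable_cong] = assms(2)
  have meas [measurable]: "(\<lambda>x. exp (- u * x)) \<in> borel_measurable P"
    by measurable
  have bound: "AE x in P. exp (- u * x) \<le> 1"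
    using assms(3) by eventually_elim (use assms(4) in simp)
  show int: "integrable P (\<lambda>x. exp (- u * x))"
    by (rule integrable_const_bound[where B=1, OF _ meas]) (use bound in auto)
  then show "(\<integral>\<^sup>+x. ennreal (exp (- u * x)) \<partial>P) = ennreal (laplace P u)"
    unfolding laplace_def by (rule nn_integral_eq_integral) simp
  show "0 \<le> laplace P u" unfolding laplace_def by (rule Bochner_Integration.integral_nonneg) simp
  have "laplace P u \<le> (\<integral>x. 1 \<partial>P)"
    unfolding laplace_def using int bound by (intro integral_mono_AE) auto
  then show "laplace P u \<le> 1" by (simp add: prob_space)
qed

definition block :: "nat \<Rightarrow> primitive set" where
  "block j = range (Interarrival j) \<union> (\<Union>n. range (Retrial j n))"

text \<open>Service and switch-over times. For a prescribed history the stage times depend on these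
  coordinates only, and with them frozen the types are independent because their blocks are
  disjoint.\<close>

definition env :: "primitive set" where
  "env = - (\<Union>j. block j)"

lemma block_disjoint: "p \<in> block j \<Longrightarrow> p \<in> block j' \<Longrightarrow> j = j'"
  by (auto simp: block_def)

lemma env_notin_block: "p \<in> env \<Longrightarrow> p \<notin> block j"
  by (auto simp: env_def)

lemma service_env [simp]: "Service i n \<in> env" "Switchover i n \<in> env"
  by (auto simp: env_def block_def)

lemma in_block [simp]: "Interarrival j n \<in> block j" "Retrial j n k \<in> block j"
  by (auto simp: block_def)

lemma station_in: "N \<ge> 1 \<Longrightarrow> station N l \<in> {1..N}"
  by (simp add: station_def Suc_leI)

context polling_model
begin

text \<open>The types are treated one at a time. In \<open>f j x y\<close> the argument
  \<open>x\<close> supplies the customers of type \<open>j\<close> and \<open>y\<close> the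
  environment, so the factor can be integrated over \<open>block j\<close> with everything else
  frozen; \<open>R\<close> collects the factors that are already replaced.\<close>

lemma swap_types:
  fixes f f0 :: "nat \<Rightarrow> (primitive \<Rightarrow> real) \<Rightarrow> (primitive \<Rightarrow> real) \<Rightarrow> ennreal"
  assumes "finite J"
    and loc: "\<And>j x x' y y'. j \<in> J \<Longrightarrow> (\<And>p. p \<in> block j \<Longrightarrow> x p = x' p) \<Longrightarrow> (\<And>p. p \<in> env \<Longrightarrow> y p = y' p) \<Longrightarrow> f j x y = f j x' y'"
    and loc0: "\<And>j x x' y y'. j \<in> J \<Longrightarrow> (\<And>p. p \<in> block j \<Longrightarrow> x p = x' p) \<Longrightarrow> (\<And>p. p \<in> env \<Longrightarrow> y p = y' p) \<Longrightarrow> f0 j x y = f0 j x' y'"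
    and locC: "\<And>j y y'. j \<in> J \<Longrightarrow> (\<And>p. p \<in> env \<Longrightarrow> y p = y' p) \<Longrightarrow> C j y = C j y'"
    and meas: "\<And>j. j \<in> J \<Longrightarrow> (\<lambda>x. f j x x) \<in> borel_measurable Pr" "\<And>j. j \<in> J \<Longrightarrow> (\<lambda>x. f0 j x x) \<in> borel_measurable Pr"
      "\<And>j. j \<in> J \<Longrightarrow> C j \<in> borel_measurable Pr"
      "\<And>j y. j \<in> J \<Longrightarrow> (\<lambda>x. f j x y) \<in> borel_measurable Pr" "\<And>j y. j \<in> J \<Longrightarrow> (\<lambda>x. f0 j x y) \<in> borel_measurable Pr"
    and swap: "\<And>j. j \<in> J \<Longrightarrow> AE y in Pr. (\<integral>\<^sup>+x. f j x y \<partial>Pr) = C j y * (\<integral>\<^sup>+x. f0 j x y \<partial>Pr)"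
    and R: "R \<in> borel_measurable Pr" "\<And>j x x'. j \<in> J \<Longrightarrow> (\<And>p. p \<notin> block j \<Longrightarrow> x p = x' p) \<Longrightarrow> R x = R x'"
  shows "(\<integral>\<^sup>+x. R x * (\<Prod>j\<in>J. f j x x) \<partial>Pr) = (\<integral>\<^sup>+x. R x * (\<Prod>j\<in>J. C j x * f0 j x x) \<partial>Pr)"
  using assms
proof (induction J arbitrary: R)
  case empty
  then show ?case by simp
next
  case (insert j J)
  note [measurable] = insert.prems(10)
  have [measurable]: "(\<lambda>x. f j x x) \<in> borel_measurable Pr" "(\<lambda>x. f0 j x x) \<in> borel_measurable Pr"
      "C j \<in> borel_measurable Pr" "\<And>y. (\<lambda>x. f j x y) \<in> borel_measurable Pr" "\<And>y. (\<lambda>x. f0 j x y) \<in> borel_measurable Pr"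
    using insert.prems(4-8)[of j] by auto
  have [measurable]: "(\<lambda>x. \<Prod>i\<in>J. f i x x) \<in> borel_measurable Pr"
    using insert.prems(4) by (intro borel_measurable_prod_ennreal) auto
  let ?A = "block j"
  let ?R = "\<lambda>x. R x * (C j x * f0 j x x)"
  have mixes: "f j (mix ?A x y) (mix ?A x y) = f j x y" "f0 j (mix ?A x y) (mix ?A x y) = f0 j x y"
      "C j (mix ?A x y) = C j y" "R (mix ?A x y) = R y" for x y
    using env_notin_block by (auto intro!: insert.prems(1,2,3,11)[of j] simp: mix_def)
  have mixJ: "(\<Prod>i\<in>J. f i (mix ?A x y) (mix ?A x y)) = (\<Prod>i\<in>J. f i y y)" for x y
  proof (intro prod.cong refl insert.prems(1))
    fix i p assume "i \<in> J" "p \<in> block i"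
    then have "p \<notin> block j" using block_disjoint[of p i j] insert.hyps(2) by blast
    then show "mix ?A x y p = y p" by (simp add: mix_def)
  qed (auto simp: mix_def env_notin_block)
  have "(\<integral>\<^sup>+x. R x * (\<Prod>i\<in>insert j J. f i x x) \<partial>Pr) = (\<integral>\<^sup>+x. (R x * (\<Prod>i\<in>J. f i x x)) * f j x x \<partial>Pr)"
    using insert.hyps by (simp add: mult_ac)
  also have "\<dots> = (\<integral>\<^sup>+x. (R x * (\<Prod>i\<in>J. f i x x)) * (C j x * f0 j x x) \<partial>Pr)"
  proof (rule nn_integral_mix_cong[where A="?A"])
    show "AE y in Pr. (\<integral>\<^sup>+x. (R (mix ?A x y) * (\<Prod>i\<in>J. f i (mix ?A x y) (mix ?A x y))) * f j (mix ?A x y) (mix ?A x y) \<partial>Pr)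
       = (\<integral>\<^sup>+x. (R (mix ?A x y) * (\<Prod>i\<in>J. f i (mix ?A x y) (mix ?A x y))) * (C j (mix ?A x y) * f0 j (mix ?A x y) (mix ?A x y)) \<partial>Pr)"
      using insert.prems(9)[of j, OF insertI1]
      by eventually_elim (simp add: mixes mixJ nn_integral_cmult)
  qed measurable
  also have "\<dots> = (\<integral>\<^sup>+x. ?R x * (\<Prod>i\<in>J. f i x x) \<partial>Pr)"
    by (simp add: mult_ac)
  also have "\<dots> = (\<integral>\<^sup>+x. ?R x * (\<Prod>i\<in>J. C i x * f0 i x x) \<partial>Pr)"
  proof (rule insert.IH)
    fix i and x x' :: "primitive \<Rightarrow> real" assume i: "i \<in> J" and eq: "\<And>p. p \<notin> block i \<Longrightarrow> x p = x' p"
    have "R x = R x'" using i eq by (intro insert.prems(11)[of i]) auto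
    moreover have "C j x = C j x'" using eq env_notin_block by (intro insert.prems(3)) auto
    moreover have "f0 j x x = f0 j x' x'"
      using eq env_notin_block block_disjoint insert.hyps i by (intro insert.prems(2)) blast+
    ultimately show "?R x = ?R x'" by simp
  next
    fix i and x x' y y' :: "primitive \<Rightarrow> real"
    assume "i \<in> J" "\<And>p. p \<in> block i \<Longrightarrow> x p = x' p" "\<And>p. p \<in> env \<Longrightarrow> y p = y' p"
    then show "f i x y = f i x' y'" "f0 i x y = f0 i x' y'"
      by (intro insert.prems(1,2); simp)+
  next
    fix i and y y' :: "primitive \<Rightarrow> real"
    assume "i \<in> J" "\<And>p. p \<in> env \<Longrightarrow> y p = y' p"
    then show "C i y = C i y'" by (intro insert.prems(3); simp)
  next
    fix i y assume i: "i \<in> J"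
    show "(\<lambda>x. f i x x) \<in> borel_measurable Pr" "(\<lambda>x. f0 i x x) \<in> borel_measurable Pr" "C i \<in> borel_measurable Pr"
      "(\<lambda>x. f i x y) \<in> borel_measurable Pr" "(\<lambda>x. f0 i x y) \<in> borel_measurable Pr"
      "AE y in Pr. (\<integral>\<^sup>+x. f i x y \<partial>Pr) = C i y * (\<integral>\<^sup>+x. f0 i x y \<partial>Pr)"
      using i by (intro insert.prems(4-9); simp)+
  qed measurable
  finally show ?case using insert.hyps by (simp add: mult_ac)
qed

definition tau :: "(nat \<Rightarrow> nat set) \<Rightarrow> nat \<Rightarrow> (primitive \<Rightarrow> real) \<Rightarrow> real" where
  "tau h m x = (\<Sum>l<m. G (station N l) + (\<Sum>n\<in>h l. x (Service (station N l) n)) + x (Switchover (station N l) (l div N)))"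

text \<open>On almost every path, this function, \<open>visitf\<close> and \<open>gluef\<close> are
  the indicator that the run follows \<open>h\<close>, times a monomial in the counts at one epoch;
  see \<open>stagef_path\<close>, \<open>visitf_path\<close> and \<open>gluef_path\<close>. Both
  \<open>visitf\<close> and \<open>gluef\<close> refer to the start of the visit period, but
  \<open>gluef\<close> leaves the queue of stage \<open>m\<close> free and marks it by
  \<open>y\<close>, whereas \<open>visitf\<close> prescribes it.\<close>

definition stagef :: "(nat \<Rightarrow> nat set) \<Rightarrow> nat \<Rightarrow> (nat \<Rightarrow> real) \<Rightarrow> (primitive \<Rightarrow> real) \<Rightarrow> ennreal" where
  "stagef h m z x = (\<Prod>j=1..N. cprod (cust h m (\<lambda>l. tau h l x) False (tau h m x) (z j) j) j x)"

definition visitf :: "(nat \<Rightarrow> nat set) \<Rightarrow> nat \<Rightarrow> (nat \<Rightarrow> real) \<Rightarrow> (primitive \<Rightarrow> real) \<Rightarrow> ennreal" where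
  "visitf h m z x =
     (\<Prod>j=1..N. cprod (cust h (Suc m) (\<lambda>l. tau h l x) True (tau h m x + G (station N m)) (z j) j) j x)"

definition gluef :: "(nat \<Rightarrow> nat set) \<Rightarrow> nat \<Rightarrow> real \<Rightarrow> (nat \<Rightarrow> real) \<Rightarrow> (primitive \<Rightarrow> real) \<Rightarrow> ennreal" where
  "gluef h m y z x =
     (\<Prod>j=1..N. if j = station N m then cprod (custg h m (\<lambda>l. tau h l x) (tau h m x) y (z j) j) j x
        else cprod (cust h m (\<lambda>l. tau h l x) True (tau h m x + G (station N m)) (z j) j) j x)"

lemma tau_cong: "(\<And>p. p \<in> env \<Longrightarrow> x p = y p) \<Longrightarrow> tau h m x = tau h m y"
  by (simp add: tau_def)

lemma measurable_tau [measurable]: "tau h m \<in> borel_measurable Pr"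
  unfolding tau_def by measurable

lemma tau_Suc: "tau h (Suc m) x = tau h m x + G (station N m) + (\<Sum>n\<in>h m. x (Service (station N m) n)) + x (Switchover (station N m) (m div N))"
  by (simp add: tau_def)

lemma tau_step: "\<forall>p. 0 \<le> x (p :: primitive) \<Longrightarrow> tau h l x + G (station N l) \<le> tau h (Suc l) x"
  by (simp add: tau_Suc sum_nonneg)

lemma tau_mono: "\<forall>p. 0 \<le> x (p :: primitive) \<Longrightarrow> l \<le> m \<Longrightarrow> tau h l x \<le> tau h m x"
proof -
  assume x: "\<forall>p. 0 \<le> x p" and "l \<le> m"
  have "0 < G (station N l)" for l using G_pos station_in[OF N] by blast
  then have "tau h l x \<le> tau h (Suc l) x" for l
    using tau_step[OF x, of h l] by (smt (verit))
  then show ?thesis using \<open>l \<le> m\<close> by (rule lift_Suc_mono_le)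
qed

lemma tau_nonneg: "\<forall>p. 0 \<le> x (p :: primitive) \<Longrightarrow> 0 \<le> tau h m x"
  using tau_mono[of x 0 m h] by (simp add: tau_def)

lemma tau_window: "\<forall>p. 0 \<le> x (p :: primitive) \<Longrightarrow> l < m \<Longrightarrow> tau h l x + G (station N l) \<le> tau h m x"
  using tau_step[of x h l] tau_mono[of x "Suc l" m h] by simp

lemma measurable_cprod_cust [measurable]:
  assumes [measurable]: "\<And>l. (\<lambda>w. \<tau> w l) \<in> borel_measurable M" "f \<in> M \<rightarrow>\<^sub>M Pr" "T \<in> borel_measurable M"
  shows "(\<lambda>w. cprod (cust h m (\<tau> w) cl (T w) z j) j (f w)) \<in> borel_measurable M"
  unfolding cprod_def by (intro borel_measurable_INF borel_measurable_prod_ennreal) auto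

lemma measurable_cprod_custg [measurable]:
  assumes [measurable]: "\<And>l. (\<lambda>w. \<tau> w l) \<in> borel_measurable M" "f \<in> M \<rightarrow>\<^sub>M Pr" "T \<in> borel_measurable M"
  shows "(\<lambda>w. cprod (custg h m (\<tau> w) (T w) y z j) j (f w)) \<in> borel_measurable M"
  unfolding cprod_def by (intro borel_measurable_INF borel_measurable_prod_ennreal) auto

lemma arrival_time_cong: "(\<And>p. p \<in> block j \<Longrightarrow> x p = y p) \<Longrightarrow> arrival_time x j n = arrival_time y j n"
  by (simp add: arrival_time_def block_def)

lemma cprod_cust_cong:
  assumes "\<And>p. p \<in> block j \<Longrightarrow> x p = y p" "\<And>l. l < m \<Longrightarrow> \<tau> l = \<tau>' l" "T = T'"
  shows "cprod (cust h m \<tau> cl T z j) j x = cprod (cust h m \<tau>' cl T' z j) j y"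
proof -
  have "arrival_time x j n = arrival_time y j n" for n using assms(1) by (rule arrival_time_cong)
  moreover have "cust h m \<tau> cl T z j n u x = cust h m \<tau>' cl T' z j n u y" for n u
    unfolding assms(3) by (rule cust_cong) (use assms in auto)
  ultimately show ?thesis by (simp add: cprod_def)
qed

lemma cprod_custg_cong:
  assumes "\<And>p. p \<in> block j \<Longrightarrow> x p = y p" "\<And>l. l < m \<Longrightarrow> \<tau> l = \<tau>' l" "T = T'"
  shows "cprod (custg h m \<tau> T v z j) j x = cprod (custg h m \<tau>' T' v z j) j y"
proof -
  have "arrival_time x j n = arrival_time y j n" for n using assms(1) by (rule arrival_time_cong)
  moreover have "custg h m \<tau> T v z j n u x = custg h m \<tau>' T' v z j n u y" for n u
    unfolding assms(3) by (rule custg_cong) (use assms in auto)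
  ultimately show ?thesis by (simp add: cprod_def)
qed

lemma measurable_stagef [measurable]: "stagef h m z \<in> borel_measurable Pr"
  unfolding stagef_def by (intro borel_measurable_prod_ennreal) auto

lemma measurable_visitf [measurable]: "visitf h m z \<in> borel_measurable Pr"
  unfolding visitf_def by (intro borel_measurable_prod_ennreal) auto

lemma measurable_gluef [measurable]: "gluef h m y z \<in> borel_measurable Pr"
  unfolding gluef_def by (intro borel_measurable_prod_ennreal) auto

definition Lam :: "(nat \<Rightarrow> real) \<Rightarrow> real" where
  "Lam z = (\<Sum>j=1..N. lam j * (1 - z j))"

lemma Lam_nonneg: "(\<And>j. j \<in> {1..N} \<Longrightarrow> z j \<le> 1) \<Longrightarrow> 0 \<le> Lam z"
  unfolding Lam_def by (intro sum_nonneg mult_nonneg_nonneg) (use lam_pos in \<open>auto intro: less_imp_le\<close>)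

lemma stay_prob: "i \<in> {1..N} \<Longrightarrow> 0 < exp (- nu i * G i) \<and> exp (- nu i * G i) < 1"
  using nu_pos[of i] G_pos[of i] by simp

text \<open>The glue period acts on the type of its own station by
  \<open>nn_integral_glue_shift\<close>, and on every other type only through the arrivals during
  \<open>G i\<close>.\<close>

lemma nn_integral_gluef:
  assumes fin: "\<And>l. l < m \<Longrightarrow> finite (h l)" and y: "0 \<le> y" "y \<le> 1"
    and z: "\<And>j. j \<in> {1..N} \<Longrightarrow> 0 \<le> z j" "\<And>j. j \<in> {1..N} \<Longrightarrow> z j \<le> 1"
  defines "i \<equiv> station N m"
  defines "q \<equiv> exp (- nu i * G i)"
  shows "(\<integral>\<^sup>+x. gluef h m y z x \<partial>Pr)
    = ennreal (exp (- (\<Sum>j=1..N. lam j * (1 - (z(i := y)) j)) * G i)) * (\<integral>\<^sup>+x. stagef h m (z(i := (1 - q) * y + q * z i)) x \<partial>Pr)"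
proof -
  let ?z = "z(i := (1 - q) * y + q * z i)"
  define C where "C = (\<lambda>j (x :: primitive \<Rightarrow> real). ennreal (exp (- lam j * (1 - (z(i := y)) j) * G i)))"
  define f where "f = (\<lambda>j x w. if j = i then cprod (custg h m (\<lambda>l. tau h l w) (tau h m w) y (z j) j) j x
        else cprod (cust h m (\<lambda>l. tau h l w) True (tau h m w + G i) (z j) j) j x)"
  define f0 where "f0 = (\<lambda>j x w. cprod (cust h m (\<lambda>l. tau h l w) False (tau h m w) (?z j) j) j x)"
  have i: "i \<in> {1..N}" unfolding i_def by (rule station_in[OF N])
  have "(\<integral>\<^sup>+x. 1 * (\<Prod>j\<in>{1..N}. f j x x) \<partial>Pr) = (\<integral>\<^sup>+x. 1 * (\<Prod>j\<in>{1..N}. C j x * f0 j x x) \<partial>Pr)"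
  proof (rule swap_types[where f=f and ?f0.0=f0 and C=C and R="\<lambda>_. 1"])
    fix j and x x' w w' :: "primitive \<Rightarrow> real"
    assume *: "\<And>p. p \<in> block j \<Longrightarrow> x p = x' p" "\<And>p. p \<in> env \<Longrightarrow> w p = w' p"
    show "f j x w = f j x' w'" "f0 j x w = f0 j x' w'"
      unfolding f_def f0_def using * tau_cong[OF *(2)] by (auto intro!: cprod_cust_cong cprod_custg_cong)
  next
    fix j assume j: "j \<in> {1..N}"
    show "AE w in Pr. (\<integral>\<^sup>+x. f j x w \<partial>Pr) = C j w * (\<integral>\<^sup>+x. f0 j x w \<partial>Pr)"
      using AE_nonneg
    proof eventually_elim
      case (elim w)
      have le: "tau h l w + G j \<le> tau h m w" if "l < m" "station N l = j" for l
        using tau_window[OF elim that(1), of h] that(2) by simp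
      show ?case
      proof (cases "j = i")
        case True
        show ?thesis
          using nn_integral_glue_shift[OF j fin le tau_nonneg[OF elim, of h m] y z(1,2)[OF j]] True
          by (simp add: f_def f0_def C_def q_def)
      next
        case False
        show ?thesis
          using nn_integral_cust_shift[where cl'=True and cl=False and t'="tau h m w + G i", OF j fin le tau_nonneg[OF elim, of h m] _ z(1,2)[OF j]] False G_pos[OF i]
          by (simp add: f_def f0_def C_def)
      qed
    qed
  qed (auto simp: f_def f0_def C_def)
  also have "\<dots> = (\<integral>\<^sup>+x. (\<Prod>j\<in>{1..N}. ennreal (exp (- lam j * (1 - (z(i := y)) j) * G i))) * stagef h m ?z x \<partial>Pr)"
    by (simp add: prod.distrib C_def f0_def stagef_def)
  also have "\<dots> = (\<Prod>j\<in>{1..N}. ennreal (exp (- lam j * (1 - (z(i := y)) j) * G i))) * (\<integral>\<^sup>+x. stagef h m ?z x \<partial>Pr)"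
    by (rule nn_integral_cmult) measurable
  also have "(\<Prod>j\<in>{1..N}. ennreal (exp (- lam j * (1 - (z(i := y)) j) * G i))) = ennreal (exp (- (\<Sum>j=1..N. lam j * (1 - (z(i := y)) j)) * G i))"
    by (subst prod_ennreal) (simp_all add: exp_sum[symmetric] sum_distrib_right sum_negf[symmetric])
  finally show ?thesis unfolding gluef_def i_def[symmetric] f_def mult_1_left .
qed

text \<open>A history that serves a customer twice cannot occur. In all other cases the service
  times of stage \<open>m\<close> are fresh.\<close>

lemma visitf_disjoint:
  assumes "n \<in> h m" "n \<in> served h (station N m) m"
  shows "visitf h m z x = 0"
proof -
  have "\<not> consistent h (Suc m) \<tau> (station N m) n u x" for \<tau> u
    using assms by (auto simp: consistent_def)
  then have 0: "cust h (Suc m) \<tau> cl T v (station N m) n u x = 0" for \<tau> cl T v u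
    by (simp add: cust_def)
  have "cprod (cust h (Suc m) \<tau> cl T v (station N m)) (station N m) x \<le> 0" for \<tau> cl T v
    unfolding cprod_def by (rule INF_lower2[of "Suc n"]) (simp_all add: 0)
  then have c0: "cprod (cust h (Suc m) \<tau> cl T v (station N m)) (station N m) x = 0" for \<tau> cl T v
    by simp
  show ?thesis
    unfolding visitf_def using station_in[OF N, of m] by (intro prod_zero) (auto intro!: bexI[of _ "station N m"] c0)
qed

text \<open>During the visit and the switch-over all types only accumulate arrivals, which gives
  \<open>exp (- Lam z * ss x)\<close> with \<open>ss\<close> the length of that period. The times
  entering \<open>ss\<close> occur neither in the earlier stage times nor in \<open>visitf\<close>,
  so they integrate separately to Laplace transforms.\<close>

lemma nn_integral_stagef_Suc:
  assumes fin: "\<And>l. l < Suc m \<Longrightarrow> finite (h l)"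
    and z: "\<And>j. j \<in> {1..N} \<Longrightarrow> 0 \<le> z j" "\<And>j. j \<in> {1..N} \<Longrightarrow> z j \<le> 1"
  defines "i \<equiv> station N m"
  shows "(\<integral>\<^sup>+x. stagef h (Suc m) z x \<partial>Pr)
    = ennreal (laplace (S i) (Lam z)) * (ennreal (laplace (B i) (Lam z) ^ card (h m)) * (\<integral>\<^sup>+x. visitf h m z x \<partial>Pr))"
proof -
  define ss where "ss = (\<lambda>x :: primitive \<Rightarrow> real. (\<Sum>n\<in>h m. x (Service i n)) + x (Switchover i (m div N)))"
  define C where "C = (\<lambda>j (x :: primitive \<Rightarrow> real). ennreal (exp (- lam j * (1 - z j) * ss x)))"
  define f where "f = (\<lambda>j x w. cprod (cust h (Suc m) (\<lambda>l. tau h l w) False (tau h (Suc m) w) (z j) j) j x)"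
  define f0 where "f0 = (\<lambda>j x w. cprod (cust h (Suc m) (\<lambda>l. tau h l w) True (tau h m w + G i) (z j) j) j x)"
  have i: "i \<in> {1..N}" unfolding i_def by (rule station_in[OF N])
  have [measurable]: "ss \<in> borel_measurable Pr" unfolding ss_def by measurable
  have tau_ss: "tau h (Suc m) w = tau h m w + G i + ss w" for w by (simp add: tau_Suc ss_def i_def)
  have "(\<integral>\<^sup>+x. 1 * (\<Prod>j\<in>{1..N}. f j x x) \<partial>Pr) = (\<integral>\<^sup>+x. 1 * (\<Prod>j\<in>{1..N}. C j x * f0 j x x) \<partial>Pr)"
  proof (rule swap_types[where f=f and ?f0.0=f0 and C=C and R="\<lambda>_. 1"])
    fix j and x x' w w' :: "primitive \<Rightarrow> real"
    assume *: "\<And>p. p \<in> block j \<Longrightarrow> x p = x' p" "\<And>p. p \<in> env \<Longrightarrow> w p = w' p"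
    show "f j x w = f j x' w'" "f0 j x w = f0 j x' w'"
      unfolding f_def f0_def using * tau_cong[OF *(2)] by (auto intro!: cprod_cust_cong)
  next
    fix j and w w' :: "primitive \<Rightarrow> real"
    assume *: "\<And>p. p \<in> env \<Longrightarrow> w p = w' p"
    show "C j w = C j w'" unfolding C_def ss_def using * by simp
  next
    fix j assume j: "j \<in> {1..N}"
    show "AE w in Pr. (\<integral>\<^sup>+x. f j x w \<partial>Pr) = C j w * (\<integral>\<^sup>+x. f0 j x w \<partial>Pr)"
      using AE_nonneg
    proof eventually_elim
      case (elim w)
      have le: "tau h l w + G j \<le> tau h m w + G i" if "l < Suc m" "station N l = j" for l
      proof (cases "l = m")
        case False
        then show ?thesis using tau_window[OF elim, of l m h] that G_pos[OF i] by simp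
      qed (use that i_def in simp)
      have t: "0 \<le> tau h m w + G i" "tau h m w + G i \<le> tau h (Suc m) w"
        using tau_nonneg[OF elim, of h m] G_pos[OF i] tau_step[OF elim, of h m] by (auto simp: i_def)
      show ?case
        using nn_integral_cust_shift[where cl'=False and cl=True, OF j fin le t z(1,2)[OF j]]
        by (simp add: f_def f0_def C_def tau_ss)
    qed
  qed (auto simp: f_def f0_def C_def)
  also have "\<dots> = (\<integral>\<^sup>+x. ennreal (exp (- Lam z * ss x)) * visitf h m z x \<partial>Pr)"
  proof (intro nn_integral_cong)
    fix x
    have "(\<Prod>j\<in>{1..N}. C j x) = ennreal (exp (- Lam z * ss x))"
      unfolding C_def Lam_def by (subst prod_ennreal) (simp_all add: exp_sum[symmetric] sum_distrib_right sum_negf[symmetric])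
    then show "1 * (\<Prod>j\<in>{1..N}. C j x * f0 j x x) = ennreal (exp (- Lam z * ss x)) * visitf h m z x"
      by (simp add: prod.distrib visitf_def f0_def i_def)
  qed
  finally have 1: "(\<integral>\<^sup>+x. stagef h (Suc m) z x \<partial>Pr) = (\<integral>\<^sup>+x. ennreal (exp (- Lam z * ss x)) * visitf h m z x \<partial>Pr)"
    by (simp add: stagef_def f_def)
  show ?thesis
  proof (cases "h m \<inter> served h i m = {}")
    case False
    then have "visitf h m z x = 0" for x using visitf_disjoint[of _ h m z x] by (auto simp: i_def)
    then show ?thesis using 1 by simp
  next
    case disj: True
    let ?K = "insert (Switchover i (m div N)) (Service i ` h m)"
    \<comment> \<open>Switch-over times are numbered by the visit \<open>m div N\<close>. Two stages
      at the same station with equal quotient would coincide, so the switch-over time of stage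
      \<open>m\<close> is fresh.\<close>
    have div: "l div N \<noteq> m div N" if "l < m" "station N l = i" for l
    proof
      assume "l div N = m div N"
      moreover have "l mod N = m mod N" using that(2) by (simp add: i_def station_def)
      ultimately show False using that(1) by (metis div_mult_mod_eq less_irrefl)
    qed
    have tau_mix: "tau h l (mix ?K x y) = tau h l y" if "l \<le> m" for l x y
      unfolding tau_def
    proof (intro sum.cong refl arg_cong2[where f="(+)"])
      fix k assume "k \<in> {..<l}"
      then have k: "k < m" using that by auto
      show "mix ?K x y (Switchover (station N k) (k div N)) = y (Switchover (station N k) (k div N))"
        using div[OF k] by (auto simp: mix_def)
      fix n assume "n \<in> h k"
      then show "mix ?K x y (Service (station N k) n) = y (Service (station N k) n)"
        using k disj by (auto simp: mix_def served_def)
    qed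
    have mix_block: "mix ?K x y p = y p" if "p \<in> block j" for j p x y
      using that by (auto simp: mix_def block_def)
    have visit_mix: "visitf h m z (mix ?K x y) = visitf h m z y" for x y
      unfolding visitf_def
      by (intro prod.cong refl cprod_cust_cong) (auto simp: tau_mix less_Suc_eq_le mix_block)
    have ss_mix: "ss (mix ?K x y) = ss x" for x y
      by (auto simp: ss_def mix_def intro!: sum.cong)
    have fin_m: "finite (h m)" using fin by simp
    have "(\<integral>\<^sup>+x. ennreal (exp (- Lam z * ss x)) * visitf h m z x \<partial>Pr)
       = (\<integral>\<^sup>+y. \<integral>\<^sup>+x. ennreal (exp (- Lam z * ss (mix ?K x y))) * visitf h m z (mix ?K x y) \<partial>Pr \<partial>Pr)"
      by (rule nn_integral_mix) measurable
    also have "\<dots> = (\<integral>\<^sup>+y. (\<integral>\<^sup>+x. ennreal (exp (- Lam z * ss x)) \<partial>Pr) * visitf h m z y \<partial>Pr)"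
      unfolding ss_mix visit_mix by (intro nn_integral_cong nn_integral_multc) measurable
    also have "\<dots> = (\<integral>\<^sup>+x. ennreal (exp (- Lam z * ss x)) \<partial>Pr) * (\<integral>\<^sup>+y. visitf h m z y \<partial>Pr)"
      by (rule nn_integral_cmult) measurable
    also have "(\<integral>\<^sup>+x. ennreal (exp (- Lam z * ss x)) \<partial>Pr) = (\<integral>\<^sup>+x. (\<Prod>p\<in>?K. ennreal (exp (- Lam z * x p))) \<partial>Pr)"
    proof (intro nn_integral_cong)
      fix x
      have "ss x = (\<Sum>p\<in>?K. x p)"
        using fin_m by (subst sum.insert) (auto simp: ss_def sum.reindex inj_on_def)
      then show "ennreal (exp (- Lam z * ss x)) = (\<Prod>p\<in>?K. ennreal (exp (- Lam z * x p)))"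
        using fin_m by (subst prod_ennreal) (simp_all add: exp_sum[symmetric] sum_distrib_left)
    qed
    also have "\<dots> = (\<Prod>p\<in>?K. \<integral>\<^sup>+e. ennreal (exp (- Lam z * e)) \<partial>law p)"
      using fin_m by (intro nn_integral_prod_coordinates) auto
    also have "\<dots> = ennreal (laplace (S i) (Lam z)) * ennreal (laplace (B i) (Lam z) ^ card (h m))"
    proof -
      have "0 \<le> Lam z" using z(2) by (rule Lam_nonneg)
      then have "(\<integral>\<^sup>+e. ennreal (exp (- Lam z * e)) \<partial>law (Switchover i (m div N))) = ennreal (laplace (S i) (Lam z))"
        "(\<integral>\<^sup>+e. ennreal (exp (- Lam z * e)) \<partial>law (Service i n)) = ennreal (laplace (B i) (Lam z))"
        "0 \<le> laplace (B i) (Lam z)" for n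
        using S[OF i] B[OF i] nn_integral_laplace laplace_nonneg unfolding law_simps[OF i] by blast+
      then show ?thesis
        using fin_m by (subst prod.insert) (auto simp: prod.reindex inj_on_def ennreal_power)
    qed
    finally show ?thesis using 1 by (simp add: mult.assoc)
  qed
qed

end

section \<open>Generating functions of the stages\<close>

lemma INF_prod_finite:
  fixes a :: "nat \<Rightarrow> ennreal"
  assumes "finite F" "\<And>n. n \<notin> F \<Longrightarrow> a n = 1" "\<And>n. a n \<le> 1"
  shows "(INF K. \<Prod>n<K. a n) = (\<Prod>n\<in>F. a n)"
proof (rule antisym)
  obtain K where K: "F \<subseteq> {..<K}" using finite_nat_iff_bounded assms(1) by blast
  have "(\<Prod>n<K. a n) = (\<Prod>n\<in>F. a n)"
    using K assms by (intro prod.mono_neutral_right) auto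
  then show "(INF K. \<Prod>n<K. a n) \<le> (\<Prod>n\<in>F. a n)"
    by (metis INF_lower UNIV_I)
  show "(\<Prod>n\<in>F. a n) \<le> (INF K. \<Prod>n<K. a n)"
  proof (rule INF_greatest)
    fix K
    have "(\<Prod>n\<in>F. a n) = (\<Prod>n\<in>F \<inter> {..<K}. a n) * (\<Prod>n\<in>F - {..<K}. a n)"
      by (rule prod.Int_Diff[OF assms(1)])
    also have "\<dots> \<le> (\<Prod>n\<in>F \<inter> {..<K}. a n) * 1"
      using assms by (intro mult_left_mono prod_le_1) auto
    also have "(\<Prod>n\<in>F \<inter> {..<K}. a n) = (\<Prod>n<K. a n)"
      using assms by (intro prod.mono_neutral_left) auto
    finally show "(\<Prod>n\<in>F. a n) \<le> (\<Prod>n<K. a n)" by simp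
  qed
qed

lemma INF_prod_zero:
  fixes a :: "nat \<Rightarrow> ennreal"
  assumes "a n = 0" shows "(INF K. \<Prod>n<K. a n) = 0"
proof -
  have "(INF K. \<Prod>n<K. a n) \<le> (\<Prod>n<Suc n. a n)" by (rule INF_lower) simp
  then show ?thesis using assms by simp
qed

lemma nn_integral_count_space_single:
  assumes "h0 \<in> H" "\<And>h. h \<in> H \<Longrightarrow> h \<noteq> h0 \<Longrightarrow> F h = 0"
  shows "(\<integral>\<^sup>+h. F h \<partial>count_space H) = F h0"
  using nn_integral_count_space'[of "{h0}" H F] assms by auto

context polling_model
begin

definition good :: "(primitive \<Rightarrow> real) \<Rightarrow> bool" where
  "good x \<longleftrightarrow> (\<forall>p. 0 \<le> x p) \<and> (\<forall>j\<in>{1..N}. filterlim (arrival_time x j) at_top sequentially)"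

lemma AE_good: "AE x in Pr. good x"
proof -
  have "AE x in Pr. filterlim (arrival_time x j) at_top sequentially" if j: "j \<in> {1..N}" for j
  proof -
    interpret R: renewal_sequence law "Interarrival j" "lam j" "\<lambda>n. range (Retrial j n)"
      by (rule renewal_arrivals[OF j])
    have *: "R.pos (Suc n) 0 x = arrival_time x j n" for n x
      by (simp add: R.pos_def arrival_time_def lessThan_Suc_atMost)
    show ?thesis
      using R.AE_pos_at_top[of 0]
    proof eventually_elim
      case (elim x)
      then have "filterlim (\<lambda>n. R.pos (Suc n) 0 x) at_top sequentially"
        by (rule filterlim_compose) (rule filterlim_Suc)
      then show ?case unfolding * .
    qed
  qed
  then have "AE x in Pr. \<forall>j\<in>{1..N}. filterlim (arrival_time x j) at_top sequentially"
    by (simp add: AE_ball_countable)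
  then show ?thesis using AE_nonneg by eventually_elim (auto simp: good_def)
qed

lemma finite_arrivals:
  assumes "good x" "j \<in> {1..N}"
  shows "finite {n. arrival_time x j n \<le> t}"
proof -
  have "eventually (\<lambda>n. t < arrival_time x j n) sequentially"
    using assms by (auto simp: good_def filterlim_at_top_dense)
  then obtain m where "\<forall>n\<ge>m. t < arrival_time x j n" by (auto simp: eventually_sequentially)
  then have "{n. arrival_time x j n \<le> t} \<subseteq> {..<m}" by (force simp: not_less[symmetric])
  then show ?thesis using finite_subset by blast
qed

definition start_time :: "(primitive \<Rightarrow> real) \<Rightarrow> nat \<Rightarrow> real" where
  "start_time x m = fst (stage N G x m)"

definition gone :: "(primitive \<Rightarrow> real) \<Rightarrow> nat \<Rightarrow> nat \<Rightarrow> nat set" where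
  "gone x m = snd (stage N G x m)"

definition queue :: "(primitive \<Rightarrow> real) \<Rightarrow> nat \<Rightarrow> nat set" where
  "queue x l = glued x G (station N l) (start_time x l) (gone x l)"

lemma start_time_Suc: "start_time x (Suc m) = start_time x m + G (station N m) + (\<Sum>n\<in>queue x m. x (Service (station N m) n)) + x (Switchover (station N m) (m div N))"
  and gone_Suc: "gone x (Suc m) = (gone x m)(station N m := gone x m (station N m) \<union> queue x m)"
  by (simp_all add: start_time_def gone_def queue_def Let_def split_beta')

lemma start_time_0 [simp]: "start_time x 0 = 0" and gone_0 [simp]: "gone x 0 = (\<lambda>_. {})"
  by (simp_all add: start_time_def gone_def)

lemma queue_eq: "queue x l = {n. n \<notin> gone x l (station N l) \<and>
    hit x (station N l) n (arrival_time x (station N l) n) (start_time x l) (start_time x l + G (station N l))}"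
  by (simp add: queue_def glued_def hit_def attempt_time_def)

lemma queue_before: "good x \<Longrightarrow> n \<in> queue x l \<Longrightarrow> arrival_time x (station N l) n < start_time x l + G (station N l)"
  using not_hit_late[of x "start_time x l + G (station N l)" "arrival_time x (station N l) n" "station N l" n "start_time x l"]
  by (auto simp: queue_eq good_def not_le[symmetric])

lemma finite_queue: "good x \<Longrightarrow> finite (queue x l)"
  using finite_arrivals[OF _ station_in[OF N], of x l "start_time x l + G (station N l)"]
  by (rule finite_subset[rotated]) (auto dest: queue_before less_imp_le)

definition matches :: "(nat \<Rightarrow> nat set) \<Rightarrow> nat \<Rightarrow> (primitive \<Rightarrow> real) \<Rightarrow> bool" where
  "matches h m x \<longleftrightarrow> (\<forall>l<m. queue x l = h l)"

lemma matches_stage: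
  assumes "matches h m x"
  shows "start_time x m = tau h m x \<and> gone x m = (\<lambda>j. served h j m)"
  using assms
proof (induction m)
  case 0
  then show ?case by (auto simp: tau_def served_def)
next
  case (Suc m)
  then have IH: "start_time x m = tau h m x" "gone x m = (\<lambda>j. served h j m)" and q: "queue x m = h m"
    by (auto simp: matches_def)
  show ?case
    using IH q by (auto simp: start_time_Suc gone_Suc tau_Suc fun_eq_iff served_def less_Suc_eq)
qed

lemma consistent_Suc:
  "consistent h (Suc m) \<tau> j n u x \<longleftrightarrow> consistent h m \<tau> j n u x \<and>
     (station N m = j \<longrightarrow> (n \<in> h m \<longleftrightarrow> n \<notin> served h j m \<and> hit x j n u (\<tau> m) (\<tau> m + G j)))"
  unfolding consistent_def All_less_Suc by (rule conj_commute)

text \<open>The two sides use different clocks, the actual stage times and the prescribed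
  \<open>tau\<close>. They agree for as long as the run has followed \<open>h\<close>
  (\<open>matches_stage\<close>), which is all that the induction step needs.\<close>

lemma matches_iff:
  "matches h m x \<longleftrightarrow> (\<forall>j\<in>{1..N}. \<forall>n. consistent h m (\<lambda>l. tau h l x) j n (arrival_time x j n) x)"
proof (induction m)
  case 0
  then show ?case by (simp add: matches_def consistent_def)
next
  case (Suc m)
  have step: "(\<forall>j\<in>{1..N}. \<forall>n. consistent h (Suc m) (\<lambda>l. tau h l x) j n (arrival_time x j n) x) \<longleftrightarrow>
     matches h m x \<and> h m = {n. n \<notin> served h (station N m) m \<and>
       hit x (station N m) n (arrival_time x (station N m) n) (tau h m x) (tau h m x + G (station N m))}"
    (is "?L \<longleftrightarrow> _ \<and> h m = {n. ?P n}")
  proof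
    assume L: ?L
    have "matches h m x" unfolding Suc.IH
    proof (intro ballI allI)
      fix j n assume "j \<in> {1..N}"
      from L[rule_format, OF this, of n] show "consistent h m (\<lambda>l. tau h l x) j n (arrival_time x j n) x"
        by (simp only: consistent_Suc)
    qed
    moreover have "n \<in> h m \<longleftrightarrow> ?P n" for n
      using L[rule_format, OF station_in[OF N, of m], of n] by (simp only: consistent_Suc simp_thms)
    ultimately show "matches h m x \<and> h m = {n. ?P n}" by auto
  next
    assume R: "matches h m x \<and> h m = {n. ?P n}"
    then have P: "n \<in> h m \<longleftrightarrow> ?P n" for n by (simp only: mem_Collect_eq)
    have M: "\<forall>j\<in>{1..N}. \<forall>n. consistent h m (\<lambda>l. tau h l x) j n (arrival_time x j n) x"
      using conjunct1[OF R] by (simp only: Suc.IH)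
    show ?L
    proof (intro ballI allI)
      fix j n assume "j \<in> {1..N}"
      from M[rule_format, OF this, of n] show "consistent h (Suc m) (\<lambda>l. tau h l x) j n (arrival_time x j n) x"
        unfolding consistent_Suc using P[of n] by (intro conjI impI) (simp_all only:)
    qed
  qed
  have "matches h (Suc m) x \<longleftrightarrow> matches h m x \<and> queue x m = h m"
    by (auto simp: matches_def less_Suc_eq)
  also have "\<dots> \<longleftrightarrow> matches h m x \<and> h m = {n. n \<notin> served h (station N m) m \<and>
       hit x (station N m) n (arrival_time x (station N m) n) (tau h m x) (tau h m x + G (station N m))}"
  proof (rule conj_cong[OF refl])
    assume "matches h m x"
    from matches_stage[OF this] have "queue x m = {n. n \<notin> served h (station N m) m \<and>
       hit x (station N m) n (arrival_time x (station N m) n) (tau h m x) (tau h m x + G (station N m))}"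
      by (simp only: queue_eq)
    then show "queue x m = h m \<longleftrightarrow> h m = {n. n \<notin> served h (station N m) m \<and>
       hit x (station N m) n (arrival_time x (station N m) n) (tau h m x) (tau h m x + G (station N m))}"
      by (simp only: eq_commute)
  qed
  finally show ?case unfolding step .
qed

definition cntS :: "(primitive \<Rightarrow> real) \<Rightarrow> nat \<Rightarrow> nat \<Rightarrow> nat" where
  "cntS x m j = card {n. n \<notin> gone x m j \<and> arrival_time x j n < start_time x m}"

definition cntV :: "(primitive \<Rightarrow> real) \<Rightarrow> nat \<Rightarrow> nat \<Rightarrow> nat" where
  "cntV x m j = card {n. n \<notin> gone x (Suc m) j \<and> arrival_time x j n \<le> start_time x m + G (station N m)}"

lemma cprod_cust_path:
  assumes x: "good x" and j: "j \<in> {1..N}" and z: "z \<le> 1"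
    and cons: "\<And>n. consistent h m \<tau> j n (arrival_time x j n) x"
  shows "cprod (cust h m \<tau> cl T z j) j x
      = ennreal z ^ card {n. n \<notin> served h j m \<and> (arrival_time x j n < T \<or> cl \<and> arrival_time x j n = T)}"
proof -
  let ?F = "{n. n \<notin> served h j m \<and> (arrival_time x j n < T \<or> cl \<and> arrival_time x j n = T)}"
  have "finite ?F"
    using finite_arrivals[OF x j, of T] by (rule finite_subset[rotated]) auto
  then have "cprod (cust h m \<tau> cl T z j) j x = (\<Prod>n\<in>?F. cust h m \<tau> cl T z j n (arrival_time x j n) x)"
    unfolding cprod_def using z cons by (intro INF_prod_finite cust_le_1) (auto simp: cust_def wt_def)
  also have "\<dots> = (\<Prod>n\<in>?F. ennreal z)"
    using cons by (intro prod.cong) (auto simp: cust_def wt_def)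
  finally show ?thesis by simp
qed

lemma cprod_inconsistent:
  assumes "\<not> consistent h m \<tau> j n (arrival_time x j n) x"
  shows "cprod (cust h m \<tau> cl T z j) j x = 0" "cprod (custg h m \<tau> T y z j) j x = 0"
  using assms unfolding cprod_def by (auto intro!: INF_prod_zero[of _ n] simp: cust_def custg_def)

lemma stagef_path:
  assumes x: "good x" and z: "\<And>j. j \<in> {1..N} \<Longrightarrow> z j \<le> 1"
  shows "stagef h m z x = (if matches h m x then \<Prod>j=1..N. ennreal (z j) ^ cntS x m j else 0)"
proof (cases "matches h m x")
  case True
  then have "consistent h m (\<lambda>l. tau h l x) j n (arrival_time x j n) x" if "j \<in> {1..N}" for j n
    using that by (auto simp: matches_iff)
  then show ?thesis
    using True matches_stage[OF True] unfolding stagef_def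
    by (auto intro!: prod.cong simp: cprod_cust_path[OF x] z cntS_def)
next
  case False
  then obtain j n where "j \<in> {1..N}" "\<not> consistent h m (\<lambda>l. tau h l x) j n (arrival_time x j n) x"
    by (auto simp: matches_iff)
  then show ?thesis using False unfolding stagef_def
    by (auto intro!: prod_zero bexI[of _ j] cprod_inconsistent(1))
qed

lemma visitf_path:
  assumes x: "good x" and z: "\<And>j. j \<in> {1..N} \<Longrightarrow> z j \<le> 1"
  shows "visitf h m z x = (if matches h (Suc m) x then \<Prod>j=1..N. ennreal (z j) ^ cntV x m j else 0)"
proof (cases "matches h (Suc m) x")
  case True
  then have "consistent h (Suc m) (\<lambda>l. tau h l x) j n (arrival_time x j n) x" if "j \<in> {1..N}" for j n
    using that by (auto simp: matches_iff)
  moreover have "matches h m x" using True by (simp add: matches_def)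
  ultimately show ?thesis
    using True matches_stage[OF True] matches_stage[of h m x] unfolding visitf_def
    by (auto intro!: prod.cong arg_cong[where f="\<lambda>A. _ ^ card A"] simp: cprod_cust_path[OF x] z cntV_def)
next
  case False
  then obtain j n where "j \<in> {1..N}" "\<not> consistent h (Suc m) (\<lambda>l. tau h l x) j n (arrival_time x j n) x"
    by (auto simp: matches_iff)
  then show ?thesis using False unfolding visitf_def
    by (auto intro!: prod_zero bexI[of _ j] cprod_inconsistent(1))
qed

lemma gluef_path:
  assumes x: "good x" and y: "y \<le> 1" and z: "\<And>j. j \<in> {1..N} \<Longrightarrow> z j \<le> 1"
  shows "gluef h m y z x = (if matches h m x then ennreal y ^ card (queue x m) * (\<Prod>j=1..N. ennreal (z j) ^ cntV x m j) else 0)"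
proof (cases "matches h m x")
  case True
  let ?i = "station N m" and ?\<tau> = "\<lambda>l. tau h l x"
  have i: "?i \<in> {1..N}" by (rule station_in[OF N])
  have cons: "consistent h m ?\<tau> j n (arrival_time x j n) x" if "j \<in> {1..N}" for j n
    using that True by (auto simp: matches_iff)
  have st: "start_time x m = tau h m x" "gone x m j = served h j m" for j
    using matches_stage[OF True] by auto
  have other: "cprod (cust h m ?\<tau> True (tau h m x + G ?i) (z j) j) j x = ennreal (z j) ^ cntV x m j"
    if "j \<in> {1..N} - {?i}" for j
    using that cons by (subst cprod_cust_path[OF x])
      (auto intro!: arg_cong[where f="\<lambda>A. _ ^ card A"] simp: z cntV_def gone_Suc st)
  \<comment> \<open>The factors different from 1 belong to the customers who stick
    (\<open>Q\<close>, factor \<open>y\<close>) and to those left in orbit (\<open>R\<close>, factor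
    \<open>z ?i\<close>).\<close>
  define Q where "Q = queue x m"
  define R where "R = {n. n \<notin> gone x (Suc m) ?i \<and> arrival_time x ?i n \<le> start_time x m + G ?i}"
  have Q: "n \<in> Q \<longleftrightarrow> n \<notin> served h ?i m \<and> hit x ?i n (arrival_time x ?i n) (tau h m x) (tau h m x + G ?i)" for n
    by (simp add: Q_def queue_eq st)
  have R: "n \<in> R \<longleftrightarrow> n \<notin> served h ?i m \<and> n \<notin> Q \<and> arrival_time x ?i n \<le> tau h m x + G ?i" for n
    by (simp add: R_def gone_Suc st Q_def)
  have fin: "finite Q" "finite R"
    using finite_queue[OF x] finite_arrivals[OF x i, of "tau h m x + G ?i"]
    by (auto simp: Q_def R intro: finite_subset[rotated])
  have "cprod (custg h m ?\<tau> (tau h m x) y (z ?i) ?i) ?i x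
      = (\<Prod>n\<in>Q \<union> R. custg h m ?\<tau> (tau h m x) y (z ?i) ?i n (arrival_time x ?i n) x)"
    unfolding cprod_def
  proof (rule INF_prod_finite)
    show "custg h m ?\<tau> (tau h m x) y (z ?i) ?i n (arrival_time x ?i n) x = 1" if "n \<notin> Q \<union> R" for n
      using that cons[OF i] by (auto simp: custg_def wt_def Q R)
  qed (use fin y z[OF i] in \<open>auto intro: custg_le_1\<close>)
  also have "\<dots> = (\<Prod>n\<in>Q. custg h m ?\<tau> (tau h m x) y (z ?i) ?i n (arrival_time x ?i n) x)
      * (\<Prod>n\<in>R. custg h m ?\<tau> (tau h m x) y (z ?i) ?i n (arrival_time x ?i n) x)"
    using fin by (intro prod.union_disjoint) (auto simp: R)
  also have "(\<Prod>n\<in>Q. custg h m ?\<tau> (tau h m x) y (z ?i) ?i n (arrival_time x ?i n) x) = (\<Prod>n\<in>Q. ennreal y)"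
    using cons[OF i] by (intro prod.cong) (auto simp: custg_def Q)
  also have "(\<Prod>n\<in>R. custg h m ?\<tau> (tau h m x) y (z ?i) ?i n (arrival_time x ?i n) x) = (\<Prod>n\<in>R. ennreal (z ?i))"
    using cons[OF i] by (intro prod.cong) (auto simp: custg_def wt_def Q R)
  finally have main: "cprod (custg h m ?\<tau> (tau h m x) y (z ?i) ?i) ?i x = ennreal y ^ card (queue x m) * ennreal (z ?i) ^ cntV x m ?i"
    by (simp add: Q_def R_def cntV_def)
  have "gluef h m y z x = (\<Prod>j\<in>insert ?i ({1..N} - {?i}). if j = ?i then cprod (custg h m ?\<tau> (tau h m x) y (z j) j) j x
        else cprod (cust h m ?\<tau> True (tau h m x + G ?i) (z j) j) j x)"
    unfolding gluef_def using i by (intro prod.cong) auto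
  also have "\<dots> = ennreal y ^ card (queue x m) * ennreal (z ?i) ^ cntV x m ?i * (\<Prod>j\<in>{1..N} - {?i}. ennreal (z j) ^ cntV x m j)"
    using other by (subst prod.insert) (auto simp: main intro!: prod.cong)
  also have "\<dots> = ennreal y ^ card (queue x m) * (\<Prod>j=1..N. ennreal (z j) ^ cntV x m j)"
    using i by (subst (2) prod.remove[of _ ?i]) (auto simp: mult.assoc)
  finally show ?thesis using True by simp
next
  case False
  then obtain j n where j: "j \<in> {1..N}" "\<not> consistent h m (\<lambda>l. tau h l x) j n (arrival_time x j n) x"
    by (auto simp: matches_iff)
  have "(if j = station N m then cprod (custg h m (\<lambda>l. tau h l x) (tau h m x) y (z j) j) j x
        else cprod (cust h m (\<lambda>l. tau h l x) True (tau h m x + G (station N m)) (z j) j) j x) = 0"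
    by (simp only: cprod_inconsistent[OF j(2)] if_cancel)
  then have "gluef h m y z x = 0" unfolding gluef_def using j(1) by (intro prod_zero bexI[of _ j]) auto
  then show ?thesis using False by simp
qed

text \<open>Finite sets make the histories countable, so that sum and integral can be exchanged.
  Extensionality outside \<open>{..<m}\<close> ensures that a path follows exactly one of
  them.\<close>

definition histories :: "nat \<Rightarrow> (nat \<Rightarrow> nat set) set" where
  "histories m = PiE {..<m} (\<lambda>_. Collect finite)"

lemma countable_histories: "countable (histories m)"
  unfolding histories_def by (intro countable_PiE) (auto intro: countable_Collect_finite)

lemma histories_finite: "h \<in> histories m \<Longrightarrow> l < m \<Longrightarrow> finite (h l)"
  by (auto simp: histories_def)

lemma sum_histories:
  assumes x: "good x"
  shows "(\<integral>\<^sup>+h. (if matches h m x then F (\<lambda>l\<in>{..<m}. h l) else 0) \<partial>count_space (histories m)) = F (\<lambda>l\<in>{..<m}. queue x l)"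
proof -
  let ?h = "\<lambda>l\<in>{..<m}. queue x l"
  have "?h \<in> histories m" using finite_queue[OF x] by (auto simp: histories_def)
  moreover have "h = ?h" if "h \<in> histories m" "matches h m x" for h
    using that by (auto simp: histories_def matches_def PiE_iff extensional_def fun_eq_iff)
  ultimately have "(\<integral>\<^sup>+h. (if matches h m x then F (\<lambda>l\<in>{..<m}. h l) else 0) \<partial>count_space (histories m))
      = (if matches ?h m x then F (\<lambda>l\<in>{..<m}. ?h l) else 0)"
    by (intro nn_integral_count_space_single) metis+
  moreover have "matches ?h m x" by (simp add: matches_def)
  moreover have "(\<lambda>l\<in>{..<m}. ?h l) = ?h" by (rule restrict_ext) simp
  ultimately show ?thesis by (simp only: if_True)
qed

definition Sp :: "nat \<Rightarrow> (nat \<Rightarrow> real) \<Rightarrow> ennreal" where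
  "Sp m z = (\<integral>\<^sup>+x. (\<Prod>j=1..N. ennreal (z j) ^ cntS x m j) \<partial>Pr)"

definition Vp :: "nat \<Rightarrow> real \<Rightarrow> (nat \<Rightarrow> real) \<Rightarrow> ennreal" where
  "Vp m y z = (\<integral>\<^sup>+x. ennreal y ^ card (queue x m) * (\<Prod>j=1..N. ennreal (z j) ^ cntV x m j) \<partial>Pr)"

lemma Sp_histories:
  assumes z: "\<And>j. j \<in> {1..N} \<Longrightarrow> z j \<le> 1"
  shows "Sp m z = (\<integral>\<^sup>+h. \<integral>\<^sup>+x. stagef h m z x \<partial>Pr \<partial>count_space (histories m))"
proof -
  have "Sp m z = (\<integral>\<^sup>+x. \<integral>\<^sup>+h. stagef h m z x \<partial>count_space (histories m) \<partial>Pr)"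
    unfolding Sp_def
  proof (rule nn_integral_cong_AE)
    show "AE x in Pr. (\<Prod>j=1..N. ennreal (z j) ^ cntS x m j) = (\<integral>\<^sup>+h. stagef h m z x \<partial>count_space (histories m))"
      using AE_good
    proof eventually_elim
      case (elim x)
      have eq: "stagef h m z x = (if matches h m x then \<Prod>j=1..N. ennreal (z j) ^ cntS x m j else 0)" for h
        by (rule stagef_path) (use elim z in auto)
      show ?case
        unfolding eq by (rule sum_histories[OF elim, where F="\<lambda>_. _", symmetric])
    qed
  qed
  also have "\<dots> = (\<integral>\<^sup>+h. \<integral>\<^sup>+x. stagef h m z x \<partial>Pr \<partial>count_space (histories m))"
    by (rule nn_integral_count_space_nn_integral) (auto intro: countable_histories)
  finally show ?thesis .
qed

lemma Vp_glue:
  assumes y: "y \<le> 1" and z: "\<And>j. j \<in> {1..N} \<Longrightarrow> z j \<le> 1"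
  shows "Vp m y z = (\<integral>\<^sup>+h. \<integral>\<^sup>+x. gluef h m y z x \<partial>Pr \<partial>count_space (histories m))"
proof -
  have "Vp m y z = (\<integral>\<^sup>+x. \<integral>\<^sup>+h. gluef h m y z x \<partial>count_space (histories m) \<partial>Pr)"
    unfolding Vp_def
  proof (rule nn_integral_cong_AE)
    show "AE x in Pr. ennreal y ^ card (queue x m) * (\<Prod>j=1..N. ennreal (z j) ^ cntV x m j) = (\<integral>\<^sup>+h. gluef h m y z x \<partial>count_space (histories m))"
      using AE_good
    proof eventually_elim
      case (elim x)
      have eq: "gluef h m y z x = (if matches h m x then ennreal y ^ card (queue x m) * (\<Prod>j=1..N. ennreal (z j) ^ cntV x m j) else 0)" for h
        by (rule gluef_path) (use elim y z in auto)
      show ?case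
        unfolding eq by (rule sum_histories[OF elim, where F="\<lambda>_. _", symmetric])
    qed
  qed
  also have "\<dots> = (\<integral>\<^sup>+h. \<integral>\<^sup>+x. gluef h m y z x \<partial>Pr \<partial>count_space (histories m))"
    by (rule nn_integral_count_space_nn_integral) (auto intro: countable_histories)
  finally show ?thesis .
qed

text \<open>The generating function of \<open>Vp_glue\<close> again, now with the queue prescribed
  as well. This form connects to the start of the next stage, the other one to the start of the
  current stage.\<close>

lemma Vp_visit:
  assumes z: "\<And>j. j \<in> {1..N} \<Longrightarrow> z j \<le> 1"
  shows "Vp m y z = (\<integral>\<^sup>+h. \<integral>\<^sup>+x. ennreal y ^ card (h m) * visitf h m z x \<partial>Pr \<partial>count_space (histories (Suc m)))"
proof -
  have "Vp m y z = (\<integral>\<^sup>+x. \<integral>\<^sup>+h. ennreal y ^ card (h m) * visitf h m z x \<partial>count_space (histories (Suc m)) \<partial>Pr)"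
    unfolding Vp_def
  proof (rule nn_integral_cong_AE)
    show "AE x in Pr. ennreal y ^ card (queue x m) * (\<Prod>j=1..N. ennreal (z j) ^ cntV x m j)
       = (\<integral>\<^sup>+h. ennreal y ^ card (h m) * visitf h m z x \<partial>count_space (histories (Suc m)))"
      using AE_good
    proof eventually_elim
      case (elim x)
      have eq: "visitf h m z x = (if matches h (Suc m) x then \<Prod>j=1..N. ennreal (z j) ^ cntV x m j else 0)" for h
        by (rule visitf_path) (use elim z in auto)
      have "(\<integral>\<^sup>+h. ennreal y ^ card (h m) * visitf h m z x \<partial>count_space (histories (Suc m)))
        = (\<integral>\<^sup>+h. (if matches h (Suc m) x then ennreal y ^ card ((\<lambda>l\<in>{..<Suc m}. h l) m) * (\<Prod>j=1..N. ennreal (z j) ^ cntV x m j) else 0) \<partial>count_space (histories (Suc m)))"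
        unfolding eq by (intro nn_integral_cong) simp
      also have "\<dots> = ennreal y ^ card ((\<lambda>l\<in>{..<Suc m}. queue x l) m) * (\<Prod>j=1..N. ennreal (z j) ^ cntV x m j)"
        by (rule sum_histories[OF elim, where F="\<lambda>h. ennreal y ^ card (h m) * _"])
      finally show ?case by simp
    qed
  qed
  also have "\<dots> = (\<integral>\<^sup>+h. \<integral>\<^sup>+x. ennreal y ^ card (h m) * visitf h m z x \<partial>Pr \<partial>count_space (histories (Suc m)))"
    by (rule nn_integral_count_space_nn_integral) (auto intro: countable_histories)
  finally show ?thesis .
qed

lemma Vp_eq:
  fixes m :: nat
  assumes y: "0 \<le> y" "y \<le> 1"
    and z: "\<And>j. j \<in> {1..N} \<Longrightarrow> 0 \<le> z j" "\<And>j. j \<in> {1..N} \<Longrightarrow> z j \<le> 1"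
  defines "i \<equiv> station N m"
  defines "q \<equiv> exp (- nu i * G i)"
  shows "Vp m y z = ennreal (exp (- Lam (z(i := y)) * G i)) * Sp m (z(i := (1 - q) * y + q * z i))"
proof -
  have i: "i \<in> {1..N}" unfolding i_def by (rule station_in[OF N])
  have "0 < q" "q < 1" using stay_prob[OF i] by (auto simp: q_def)
  then have z': "(1 - q) * y + q * z i \<le> 1"
    using convex_bound_le[of y 1 "z i" "1 - q" q] y z i by auto
  have "Vp m y z = (\<integral>\<^sup>+h. ennreal (exp (- Lam (z(i := y)) * G i)) * (\<integral>\<^sup>+x. stagef h m (z(i := (1 - q) * y + q * z i)) x \<partial>Pr) \<partial>count_space (histories m))"
  proof (subst Vp_glue; (intro nn_integral_cong)?)
    fix h assume "h \<in> space (count_space (histories m))"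
    then show "(\<integral>\<^sup>+x. gluef h m y z x \<partial>Pr) = ennreal (exp (- Lam (z(i := y)) * G i)) * (\<integral>\<^sup>+x. stagef h m (z(i := (1 - q) * y + q * z i)) x \<partial>Pr)"
      using nn_integral_gluef[of m h y z] y z unfolding i_def q_def Lam_def
      by (simp only: histories_finite space_count_space)
  qed (use y z in auto)
  also have "\<dots> = ennreal (exp (- Lam (z(i := y)) * G i)) * Sp m (z(i := (1 - q) * y + q * z i))"
    by (subst Sp_histories) (use z z' in \<open>auto simp: nn_integral_cmult\<close>)
  finally show ?thesis .
qed

text \<open>Each queued customer is replaced by the arrivals during its own service, so its mark
  becomes \<open>laplace (B i) (Lam z)\<close>: the multitype branching structure of gated
  service.\<close>

lemma Sp_Suc:
  fixes m :: nat
  assumes z: "\<And>j. j \<in> {1..N} \<Longrightarrow> 0 \<le> z j" "\<And>j. j \<in> {1..N} \<Longrightarrow> z j \<le> 1"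
  defines "i \<equiv> station N m"
  shows "Sp (Suc m) z = ennreal (laplace (S i) (Lam z)) * Vp m (laplace (B i) (Lam z)) z"
proof -
  have i: "i \<in> {1..N}" unfolding i_def by (rule station_in[OF N])
  have b: "0 \<le> laplace (B i) (Lam z)"
    using B[OF i] Lam_nonneg[OF z(2)] by (intro laplace_nonneg) auto
  have "Sp (Suc m) z = (\<integral>\<^sup>+h. ennreal (laplace (S i) (Lam z)) * (\<integral>\<^sup>+x. ennreal (laplace (B i) (Lam z)) ^ card (h m) * visitf h m z x \<partial>Pr) \<partial>count_space (histories (Suc m)))"
  proof (subst Sp_histories; (intro nn_integral_cong)?)
    fix h assume h: "h \<in> space (count_space (histories (Suc m)))"
    show "(\<integral>\<^sup>+x. stagef h (Suc m) z x \<partial>Pr) = ennreal (laplace (S i) (Lam z)) * (\<integral>\<^sup>+x. ennreal (laplace (B i) (Lam z)) ^ card (h m) * visitf h m z x \<partial>Pr)"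
      using nn_integral_stagef_Suc[of m h z] h z histories_finite[of h "Suc m"] b
      by (simp add: nn_integral_cmult i_def ennreal_power)
  qed (use z in auto)
  also have "\<dots> = ennreal (laplace (S i) (Lam z)) * Vp m (laplace (B i) (Lam z)) z"
    by (subst Vp_visit) (use z in \<open>auto simp: nn_integral_cmult\<close>)
  finally show ?thesis .
qed

definition Tst :: "nat \<Rightarrow> (nat \<Rightarrow> real) \<Rightarrow> nat \<Rightarrow> real" where
  "Tst i z = z(i := (1 - exp (- nu i * G i)) * laplace (B i) (Lam z) + exp (- nu i * G i) * z i)"

definition gst :: "nat \<Rightarrow> (nat \<Rightarrow> real) \<Rightarrow> real" where
  "gst i z = laplace (S i) (Lam z) * exp (- Lam (z(i := laplace (B i) (Lam z))) * G i)"

text \<open>The recursion runs backwards in time: in a full cycle the map of station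
  \<open>N\<close> acts first and that of station 1 last.\<close>

primrec cyc :: "nat \<Rightarrow> (nat \<Rightarrow> real) \<Rightarrow> nat \<Rightarrow> real" where
  "cyc 0 z = z"
| "cyc (Suc k) z = cyc k (Tst (Suc k) z)"

primrec gg :: "nat \<Rightarrow> (nat \<Rightarrow> real) \<Rightarrow> real" where
  "gg 0 z = 1"
| "gg (Suc k) z = gst (Suc k) z * gg k (Tst (Suc k) z)"

definition unit_cube :: "(nat \<Rightarrow> real) set" where
  "unit_cube = {z. \<forall>j\<in>{1..N}. 0 \<le> z j \<and> z j \<le> 1}"

lemma laplace_unit:
  assumes "i \<in> {1..N}" "z \<in> unit_cube"
  shows "0 \<le> laplace (B i) (Lam z)" "laplace (B i) (Lam z) \<le> 1" "0 \<le> laplace (S i) (Lam z)" "laplace (S i) (Lam z) \<le> 1"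
proof -
  have "0 \<le> Lam z" using assms(2) by (intro Lam_nonneg) (auto simp: unit_cube_def)
  then show "0 \<le> laplace (B i) (Lam z)" "laplace (B i) (Lam z) \<le> 1" "0 \<le> laplace (S i) (Lam z)" "laplace (S i) (Lam z) \<le> 1"
    using B[OF assms(1)] S[OF assms(1)] by (auto intro: laplace_nonneg laplace_le_1)
qed

lemma Tst_unit: "i \<in> {1..N} \<Longrightarrow> z \<in> unit_cube \<Longrightarrow> Tst i z \<in> unit_cube"
  using laplace_unit[of i z] stay_prob[of i]
    convex_bound_le[of "laplace (B i) (Lam z)" 1 "z i" "1 - exp (- nu i * G i)" "exp (- nu i * G i)"]
  by (auto simp: unit_cube_def Tst_def)

lemma cyc_unit: "k \<le> N \<Longrightarrow> z \<in> unit_cube \<Longrightarrow> cyc k z \<in> unit_cube"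
  by (induction k arbitrary: z) (auto simp: Tst_unit)

lemma gst_nonneg: "i \<in> {1..N} \<Longrightarrow> z \<in> unit_cube \<Longrightarrow> 0 \<le> gst i z"
  using laplace_unit[of i z] by (simp add: gst_def)

lemma gg_nonneg: "k \<le> N \<Longrightarrow> z \<in> unit_cube \<Longrightarrow> 0 \<le> gg k z"
proof (induction k arbitrary: z)
  case (Suc k)
  then have "0 \<le> gst (Suc k) z" "Tst (Suc k) z \<in> unit_cube" by (auto intro: gst_nonneg Tst_unit)
  with Suc show ?case by simp
qed simp

lemma Sp_step:
  assumes z: "z \<in> unit_cube"
  shows "Sp (Suc m) z = ennreal (gst (station N m) z) * Sp m (Tst (station N m) z)"
proof -
  let ?i = "station N m"
  have i: "?i \<in> {1..N}" by (rule station_in[OF N])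
  note l = laplace_unit[OF i z]
  have z': "\<And>j. j \<in> {1..N} \<Longrightarrow> 0 \<le> z j" "\<And>j. j \<in> {1..N} \<Longrightarrow> z j \<le> 1"
    using z by (auto simp: unit_cube_def)
  have "Sp (Suc m) z = ennreal (laplace (S ?i) (Lam z)) * Vp m (laplace (B ?i) (Lam z)) z"
    by (rule Sp_Suc) (use z' in auto)
  also have "Vp m (laplace (B ?i) (Lam z)) z = ennreal (exp (- Lam (z(?i := laplace (B ?i) (Lam z))) * G ?i)) * Sp m (Tst ?i z)"
    unfolding Tst_def by (rule Vp_eq) (use l z' in auto)
  finally show ?thesis
    using l by (simp add: gst_def ennreal_mult' mult.assoc)
qed

lemma Sp_cycle:
  assumes "k \<le> N" "z \<in> unit_cube"
  shows "Sp (c * N + k) z = ennreal (gg k z) * Sp (c * N) (cyc k z)"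
  using assms
proof (induction k arbitrary: z)
  case (Suc k)
  have st: "station N (c * N + k) = Suc k" using Suc.prems by (simp add: station_def)
  have T: "Tst (Suc k) z \<in> unit_cube" using Suc.prems by (intro Tst_unit) auto
  have "Sp (c * N + Suc k) z = ennreal (gst (Suc k) z) * Sp (c * N + k) (Tst (Suc k) z)"
    using Sp_step[OF Suc.prems(2), of "c * N + k"] st by simp
  also have "\<dots> = ennreal (gst (Suc k) z) * (ennreal (gg k (Tst (Suc k) z)) * Sp (c * N) (cyc k (Tst (Suc k) z)))"
    using Suc T by simp
  also have "\<dots> = ennreal (gg (Suc k) z) * Sp (c * N) (cyc (Suc k) z)"
    using gst_nonneg[of "Suc k" z] gg_nonneg[of k, OF _ T] Suc.prems by (simp add: ennreal_mult' mult.assoc)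
  finally show ?case .
qed simp

end

section \<open>Measurability and passage to the steady state\<close>

lemma measurable_random_sum:
  fixes f :: "nat \<Rightarrow> 'a \<Rightarrow> real"
  assumes [measurable]: "\<And>n. Measurable.pred M (\<lambda>x. n \<in> A x)" "\<And>n. f n \<in> borel_measurable M"
  shows "(\<lambda>x. \<Sum>n\<in>A x. f n x) \<in> borel_measurable M"
proof -
  \<comment> \<open>A sum over an infinite set is 0 by convention, so the series may be used only
    where the set is bounded.\<close>
  have eq: "(\<Sum>n\<in>A x. f n x) = (if \<exists>K. \<forall>n\<ge>K. n \<notin> A x then (\<Sum>n. if n \<in> A x then f n x else 0) else 0)" for x
  proof (cases "finite (A x)")
    case True
    then have "\<exists>K. \<forall>n\<ge>K. n \<notin> A x" by (metis finite_nat_set_iff_bounded not_le)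
    moreover have "(\<Sum>n. if n \<in> A x then f n x else 0) = (\<Sum>n\<in>A x. if n \<in> A x then f n x else 0)"
      using True by (intro suminf_finite) auto
    ultimately show ?thesis by simp
  next
    case False
    then have n: "\<not> (\<exists>K. \<forall>n\<ge>K. n \<notin> A x)" by (metis finite_nat_set_iff_bounded not_le)
    show ?thesis by (simp only: sum.infinite[OF False] if_not_P[OF n])
  qed
  show ?thesis unfolding eq by measurable
qed

lemma measurable_random_card:
  assumes [measurable]: "\<And>n. Measurable.pred M (\<lambda>x. n \<in> (A x :: nat set))"
  shows "Measurable.pred M (\<lambda>x. card (A x) = k)"
proof -
  have [measurable]: "(\<lambda>x. \<Sum>n\<in>A x. 1 :: real) \<in> borel_measurable M"
    by (rule measurable_random_sum) measurable
  have "card (A x) = k \<longleftrightarrow> (\<Sum>n\<in>A x. 1 :: real) = real k" for x by simp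
  then show ?thesis by measurable
qed

lemma distr_countable_pmf:
  assumes P: "prob_space P" and V: "countable V" and f: "\<And>x. x \<in> space P \<Longrightarrow> f x \<in> V"
    and meas: "\<And>v. {x \<in> space P. f x = v} \<in> sets P"
  obtains Q where "measure_pmf Q = distr P (count_space UNIV) f"
proof -
  interpret prob_space P by fact
  have f_meas [measurable]: "f \<in> P \<rightarrow>\<^sub>M count_space UNIV"
  proof (rule measurableI)
    fix A
    have "f -` A \<inter> space P = (\<Union>v\<in>A \<inter> V. {x \<in> space P. f x = v})"
      using f by auto
    also have "\<dots> \<in> sets P"
      using V by (intro sets.countable_UN'' meas) auto
    finally show "f -` A \<inter> space P \<in> sets P" .
  qed simp
  let ?D = "distr P (count_space UNIV) f"
  interpret D: prob_space ?D by (rule prob_space_distr) measurable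
  have "AE v in ?D. measure ?D {v} \<noteq> 0"
  proof (rule AE_I')
    let ?N = "(\<Union>v\<in>{v\<in>V. measure ?D {v} = 0}. {v}) \<union> - V"
    have "(\<Union>v\<in>{v\<in>V. measure ?D {v} = 0}. {v}) \<in> null_sets ?D"
      using V by (intro null_sets_UN') (auto simp: null_sets_def D.emeasure_eq_measure)
    moreover have "f -` (- V) \<inter> space P = {}" using f by auto
    then have "- V \<in> null_sets ?D"
      by (simp add: null_sets_def emeasure_distr)
    ultimately show "?N \<in> null_sets ?D" by (rule null_sets.Un)
    show "{v \<in> space ?D. \<not> measure ?D {v} \<noteq> 0} \<subseteq> ?N" by auto
  qed
  then have "measure_pmf (Abs_pmf ?D) = ?D"
    by (intro Abs_pmf_inverse) (auto simp: D.prob_space_axioms)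
  then show ?thesis by (rule that)
qed

text \<open>Pointwise convergence of mass functions to a mass function is convergence in total
  variation (Scheffe), because no mass is lost.\<close>

lemma pmf_limit_expectation:
  fixes Q :: "nat \<Rightarrow> 'v pmf" and g :: "'v \<Rightarrow> real"
  assumes lim: "\<And>v. (\<lambda>c. pmf (Q c) v) \<longlonglongrightarrow> pmf Y v" and g: "\<And>v. \<bar>g v\<bar> \<le> 1"
  shows "(\<lambda>c. \<integral>v. g v \<partial>measure_pmf (Q c)) \<longlonglongrightarrow> (\<integral>v. g v \<partial>measure_pmf Y)"
proof -
  let ?C = "count_space UNIV :: 'v measure"
  have int: "integrable ?C (pmf R)" for R :: "'v pmf" by (rule integrable_pmf)
  have "(\<lambda>c. \<integral>\<^sup>+v. norm (pmf (Q c) v - pmf Y v) \<partial>?C) \<longlonglongrightarrow> 0"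
    by (rule Scheffe_lemma2) (auto simp: int lim nn_integral_pmf_eq_1 nn_integral_pmf)
  moreover have "(\<integral>\<^sup>+v. norm (pmf (Q c) v - pmf Y v) \<partial>?C) = ennreal (\<integral>v. \<bar>pmf (Q c) v - pmf Y v\<bar> \<partial>?C)" for c
    using int[of "Q c"] int[of Y] by (subst nn_integral_eq_integral) auto
  ultimately have L: "(\<lambda>c. \<integral>v. \<bar>pmf (Q c) v - pmf Y v\<bar> \<partial>?C) \<longlonglongrightarrow> 0"
    by (simp add: tendsto_ennreal_iff[where x=0, simplified])
  have E: "(\<integral>v. g v \<partial>measure_pmf R) = (\<integral>v. pmf R v * g v \<partial>?C)" for R
    unfolding measure_pmf_eq_density by (subst integral_density) auto
  have intg: "integrable ?C (\<lambda>v. pmf R v * g v)" for R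
  proof (rule Bochner_Integration.integrable_bound[OF int[of R]])
    show "AE v in ?C. norm (pmf R v * g v) \<le> norm (pmf R v)"
      using g by (intro AE_I2) (simp add: abs_mult mult_left_le)
  qed simp
  have "\<bar>(\<integral>v. g v \<partial>measure_pmf (Q c)) - (\<integral>v. g v \<partial>measure_pmf Y)\<bar> \<le> (\<integral>v. \<bar>pmf (Q c) v - pmf Y v\<bar> \<partial>?C)" for c
  proof -
    have "(\<integral>v. g v \<partial>measure_pmf (Q c)) - (\<integral>v. g v \<partial>measure_pmf Y) = (\<integral>v. (pmf (Q c) v - pmf Y v) * g v \<partial>?C)"
      unfolding E by (subst Bochner_Integration.integral_diff[symmetric]) (simp_all add: intg left_diff_distrib)
    also have "\<bar>\<dots>\<bar> \<le> (\<integral>v. \<bar>(pmf (Q c) v - pmf Y v) * g v\<bar> \<partial>?C)"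
      using integral_norm_bound[of ?C "\<lambda>v. (pmf (Q c) v - pmf Y v) * g v"] by simp
    also have "\<dots> \<le> (\<integral>v. \<bar>pmf (Q c) v - pmf Y v\<bar> \<partial>?C)"
    proof (intro integral_mono integrable_abs)
      show "\<bar>(pmf (Q c) v - pmf Y v) * g v\<bar> \<le> \<bar>pmf (Q c) v - pmf Y v\<bar>" for v
        using g[of v] by (simp only: abs_mult mult_left_le abs_ge_zero)
    qed (auto simp: left_diff_distrib int intg intro!: Bochner_Integration.integrable_diff)
    finally show ?thesis .
  qed
  then have "(\<lambda>c. (\<integral>v. g v \<partial>measure_pmf (Q c)) - (\<integral>v. g v \<partial>measure_pmf Y)) \<longlonglongrightarrow> 0"
    using L by (intro Lim_null_comparison[OF _ L]) auto
  then show ?thesis by (simp add: LIM_zero_iff)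
qed

lemma countable_eventually_zero: "countable {v :: nat \<Rightarrow> nat. \<forall>j>N. v j = 0}"
proof -
  have "{v. \<forall>j>N. v j = 0} \<subseteq> range (\<lambda>l j. if j < length l then l ! j else (0 :: nat))"
  proof
    fix v :: "nat \<Rightarrow> nat" assume v: "v \<in> {v. \<forall>j>N. v j = 0}"
    have "v = (\<lambda>j. if j < length (map v [0..<Suc N]) then map v [0..<Suc N] ! j else 0)"
    proof
      fix j show "v j = (if j < length (map v [0..<Suc N]) then map v [0..<Suc N] ! j else 0)"
        using v by (cases "j < Suc N") (auto simp del: upt_Suc)
    qed
    then show "v \<in> range (\<lambda>l j. if j < length l then l ! j else (0 :: nat))" by blast
  qed
  then show ?thesis by (rule countable_subset) simp
qed

text \<open>The primitives outside \<open>primitives N\<close> are arbitrary functions, possibly not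
  measurable. Since the dynamics never read them, they can be set to 0.\<close>

lemma stage_cong:
  assumes N: "N \<ge> 1" and eq: "\<And>p. p \<in> primitives N \<Longrightarrow> x p = y p"
  shows "stage N G x m = stage N G y m"
proof -
  have a: "arrival_time x j n = arrival_time y j n" "attempt_time x j n k = attempt_time y j n k" if "j \<in> {1..N}" for j n k
    using eq that by (auto simp: arrival_time_def attempt_time_def primitives_def)
  have g: "glued x G j t D = glued y G j t D" if "j \<in> {1..N}" for j t D
    using a[OF that] by (simp add: glued_def)
  show ?thesis
  proof (induction m)
    case (Suc m)
    have i: "station N m \<in> {1..N}" by (rule station_in[OF N])
    have "x (Switchover (station N m) k) = y (Switchover (station N m) k)"
      "x (Service (station N m) k) = y (Service (station N m) k)" for k
      using eq i by (simp_all add: primitives_def)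
    then show ?case using Suc g[OF i] by (simp add: Let_def split_beta')
  qed simp
qed

lemma visit_counts_cong:
  assumes N: "N \<ge> 1" and eq: "\<And>p. p \<in> primitives N \<Longrightarrow> x p = y p"
  shows "visit_counts N G x c = visit_counts N G y c"
proof -
  have a: "arrival_time x j n = arrival_time y j n" "attempt_time x j n k = attempt_time y j n k" if "j \<in> {1..N}" for j n k
    using eq that by (auto simp: arrival_time_def attempt_time_def primitives_def)
  have g: "glued x G 1 t D = glued y G 1 t D" for t D
    using a[of 1] N by (simp add: glued_def)
  have p: "{n. arrival_time x j n \<le> t} = {n. arrival_time y j n \<le> t}" if "j \<in> {1..N}" for j t
    using a[OF that] by simp
  have st: "stage N G x m = stage N G y m" for m
    by (rule stage_cong) (use N eq in auto)
  show ?thesis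
    unfolding visit_counts_def st Let_def g
    using p N by (auto simp: fun_eq_iff split: prod.split)
qed

context polling_model
begin

lemma measurable_stage:
  "(\<lambda>x. start_time x m) \<in> borel_measurable Pr \<and> (\<forall>j n. Measurable.pred Pr (\<lambda>x. n \<in> gone x m j))"
proof (induction m)
  case (Suc m)
  have [measurable]: "(\<lambda>x. start_time x m) \<in> borel_measurable Pr" "\<And>j n. Measurable.pred Pr (\<lambda>x. n \<in> gone x m j)"
    using Suc by auto
  have [measurable]: "Measurable.pred Pr (\<lambda>x. n \<in> queue x m)" for n
    unfolding queue_eq mem_Collect_eq by measurable
  have [measurable]: "(\<lambda>x. \<Sum>n\<in>queue x m. x (Service (station N m) n)) \<in> borel_measurable Pr"
    by (rule measurable_random_sum) measurable
  have "Measurable.pred Pr (\<lambda>x. n \<in> gone x (Suc m) j)" for j n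
    unfolding gone_Suc by (cases "j = station N m") simp_all
  then show ?case unfolding start_time_Suc by simp
qed simp

lemma measurable_queue [measurable]: "Measurable.pred Pr (\<lambda>x. n \<in> queue x m)"
  and measurable_gone [measurable]: "Measurable.pred Pr (\<lambda>x. n \<in> gone x m j)"
  and measurable_start [measurable]: "(\<lambda>x. start_time x m) \<in> borel_measurable Pr"
proof -
  have [measurable]: "(\<lambda>x. start_time x m) \<in> borel_measurable Pr" "\<And>j n. Measurable.pred Pr (\<lambda>x. n \<in> gone x m j)"
    using measurable_stage[of m] by auto
  show "Measurable.pred Pr (\<lambda>x. n \<in> queue x m)"
    unfolding queue_eq mem_Collect_eq by measurable
qed (use measurable_stage in auto)

lemma station_cycle [simp]: "station N (c * N) = 1"
  by (simp add: station_def)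

lemma visit_counts_eq:
  "visit_counts N G x c j =
     (if j = 0 then card (queue x (c * N)) else if j \<le> N then cntV x (c * N) j else 0)"
proof -
  have st: "stage N G x (c * N) = (start_time x (c * N), gone x (c * N))"
    by (simp add: start_time_def gone_def)
  have q: "glued x G 1 (start_time x (c * N)) (gone x (c * N)) = queue x (c * N)"
    by (simp add: queue_def)
  show ?thesis
    unfolding visit_counts_def st q[symmetric] Let_def prod.case cntV_def
    using N by (auto simp: gone_Suc q[symmetric] intro!: arg_cong[where f=card])
qed

lemma measurable_visit_counts: "{x \<in> space Pr. visit_counts N G x c = v} \<in> sets Pr"
proof -
  have [measurable]: "Measurable.pred Pr (\<lambda>x. card (queue x m) = k)" for m k
    by (rule measurable_random_card) measurable
  have [measurable]: "Measurable.pred Pr (\<lambda>x. cntV x m j = k)" for m j k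
  proof -
    have [measurable]: "(\<lambda>x. arrival_time x j n) \<in> borel_measurable Pr" for n
      by (rule measurable_arrival_time) simp
    have le: "{x \<in> space Pr. arrival_time x j n \<le> start_time x m + G (station N m)} \<in> sets Pr" for n
      by (intro borel_measurable_le borel_measurable_add measurable_start measurable_const) (simp_all add: measurable_arrival_time)
    then have [measurable]: "Measurable.pred Pr (\<lambda>x. arrival_time x j n \<le> start_time x m + G (station N m))" for n
      by (simp only: pred_def)
    have "Measurable.pred Pr (\<lambda>x. n \<in> {n. n \<notin> gone x (Suc m) j \<and> arrival_time x j n \<le> start_time x m + G (station N m)})" for n
      unfolding mem_Collect_eq by measurable
    then show ?thesis unfolding cntV_def by (rule measurable_random_card)
  qed
  have "Measurable.pred Pr (\<lambda>x. visit_counts N G x c j = v j)" for j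
    unfolding visit_counts_eq by (cases "j = 0"; cases "j \<le> N") simp_all
  then have "Measurable.pred Pr (\<lambda>x. \<forall>j. visit_counts N G x c j = v j)"
    by (rule pred_intros_countable)
  then show ?thesis by (simp add: fun_eq_iff pred_def)
qed

text \<open>Setting the foreign coordinates to 0 matches the point masses in \<open>law\<close>; on
  cylinders, those coordinates contribute 1 or 0 and the others factor by independence.\<close>

lemma distr_primitives:
  assumes "polling_primitives M X N lam nu B S"
  defines "X' \<equiv> \<lambda>\<omega> p. if p \<in> primitives N then X p \<omega> else 0"
  shows "X' \<in> M \<rightarrow>\<^sub>M Pr" "distr M Pr X' = Pr"
proof -
  interpret Mp: prob_space M using assms(1) by (simp add: polling_primitives_def)
  have indep: "Mp.indep_vars (\<lambda>_. borel) X (primitives N)"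
    and dist: "\<And>p. p \<in> primitives N \<Longrightarrow> distr M borel (X p) = law p"
    using assms(1) by (auto simp: polling_primitives_def law_def)
  have rv [measurable]: "X p \<in> borel_measurable M" if "p \<in> primitives N" for p
    using indep that by (auto simp: Mp.indep_vars_def)
  have rv' [measurable]: "(\<lambda>\<omega>. X' \<omega> p) \<in> borel_measurable M" for p
    by (cases "p \<in> primitives N") (simp_all add: X'_def)
  have "(\<lambda>\<omega>. \<lambda>p\<in>UNIV. X' \<omega> p) \<in> M \<rightarrow>\<^sub>M Pr"
    by (rule measurable_restrict) (simp cong: measurable_cong_sets add: sets_law)
  then show meas [measurable]: "X' \<in> M \<rightarrow>\<^sub>M Pr" by (simp add: restrict_UNIV)
  show "distr M Pr X' = Pr"
  proof (rule PiM_eq)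
    fix J F assume J: "finite J" "J \<subseteq> (UNIV :: primitive set)" "\<And>j. j \<in> J \<Longrightarrow> F j \<in> sets (law j)"
    let ?I = "J \<inter> primitives N"
    have F: "F j \<in> sets borel" if "j \<in> J" for j using J(3)[OF that] sets_law by simp
    have set: "prod_emb UNIV law J (\<Pi>\<^sub>E j\<in>J. F j) \<in> sets Pr"
      using J by (intro sets_PiM_I) auto
    have "emeasure (distr M Pr X') (prod_emb UNIV law J (\<Pi>\<^sub>E j\<in>J. F j)) = emeasure M (\<Inter>j\<in>J. (\<lambda>\<omega>. X' \<omega> j) -` F j \<inter> space M)"
      if "J \<noteq> {}"
      using set that by (subst emeasure_distr) (auto intro!: arg_cong[where f="emeasure M"] simp: prod_emb_def)
    also have "emeasure M (\<Inter>j\<in>J. (\<lambda>\<omega>. X' \<omega> j) -` F j \<inter> space M) = (\<Prod>j\<in>J. emeasure (law j) (F j))" if "J \<noteq> {}"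
    proof -
      have law_out: "emeasure (law j) (F j) = indicator (F j) 0" if "j \<in> J - primitives N" for j
        using that F by (simp add: law_def)
      have law_in: "emeasure (law j) (F j) = ennreal (Mp.prob (X j -` F j \<inter> space M))" if "j \<in> ?I" for j
        using that F[of j] dist[of j, symmetric] by (simp add: emeasure_distr Mp.emeasure_eq_measure)
      show ?thesis
      proof (cases "\<forall>j\<in>J - primitives N. 0 \<in> F j")
        case False
        then obtain j where j: "j \<in> J - primitives N" "0 \<notin> F j" by blast
        then have "(\<Inter>j\<in>J. (\<lambda>\<omega>. X' \<omega> j) -` F j \<inter> space M) = {}" by (auto simp: X'_def)
        moreover have "(\<Prod>j\<in>J. emeasure (law j) (F j)) = 0"
          using j J(1) by (intro prod_zero) (auto intro!: bexI[of _ j] simp: law_out)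
        ultimately show ?thesis by simp
      next
        case True
        have "(\<Prod>j\<in>J. emeasure (law j) (F j)) = (\<Prod>j\<in>?I. emeasure (law j) (F j))"
          using True J(1) by (intro prod.mono_neutral_right) (auto simp: law_out)
        also have "\<dots> = (\<Prod>j\<in>?I. ennreal (Mp.prob (X j -` F j \<inter> space M)))"
          by (intro prod.cong refl law_in)
        also have "\<dots> = ennreal (\<Prod>j\<in>?I. Mp.prob (X j -` F j \<inter> space M))"
          by (intro prod_ennreal) simp
        also have "(\<Prod>j\<in>?I. Mp.prob (X j -` F j \<inter> space M)) = Mp.prob (\<Inter>j\<in>J. (\<lambda>\<omega>. X' \<omega> j) -` F j \<inter> space M)"
        proof (cases "?I = {}")
          case True
          then have "(\<Inter>j\<in>J. (\<lambda>\<omega>. X' \<omega> j) -` F j \<inter> space M) = space M"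
            using \<open>\<forall>j\<in>J - primitives N. 0 \<in> F j\<close> \<open>J \<noteq> {}\<close> by (auto simp: X'_def)
          then show ?thesis using True by (simp add: Mp.prob_space)
        next
          case False
          have "Mp.prob (\<Inter>j\<in>?I. X j -` F j \<inter> space M) = (\<Prod>j\<in>?I. Mp.prob (X j -` F j \<inter> space M))"
            using indep False J(1) F by (intro Mp.indep_varsD) auto
          moreover have "(\<Inter>j\<in>?I. X j -` F j \<inter> space M) = (\<Inter>j\<in>J. (\<lambda>\<omega>. X' \<omega> j) -` F j \<inter> space M)"
            using False \<open>\<forall>j\<in>J - primitives N. 0 \<in> F j\<close> by (auto simp: X'_def)
          ultimately show ?thesis by simp
        qed
        finally show ?thesis by (simp add: Mp.emeasure_eq_measure)
      qed
    qed
    finally show "emeasure (distr M Pr X') (prod_emb UNIV law J (\<Pi>\<^sub>E j\<in>J. F j)) = (\<Prod>j\<in>J. emeasure (law j) (F j))"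
    proof (cases "J = {}")
      case True
      have "prod_emb UNIV law J (\<Pi>\<^sub>E j\<in>J. F j) = space Pr" using True by (auto simp: prod_emb_def)
      moreover have "X' -` space Pr \<inter> space M = space M" by auto
      ultimately show ?thesis using True meas Mp.emeasure_space_1 by (simp only: emeasure_distr sets.top prod.empty)
    qed auto
  qed simp
qed

definition genfun :: "(nat \<Rightarrow> nat) pmf \<Rightarrow> (nat \<Rightarrow> real) \<Rightarrow> real" where
  "genfun Y w = (\<integral>y. (\<Prod>j\<le>N. w j ^ y j) \<partial>measure_pmf Y)"

lemma steady_state_limit:
  assumes "polling_primitives M X N lam nu B S" "steady_state_counts M X N G Y"
  shows "v \<in> set_pmf Y \<Longrightarrow> N < j \<Longrightarrow> v j = 0"
    and "(\<And>j. j \<le> N \<Longrightarrow> 0 \<le> w j \<and> w j \<le> 1) \<Longrightarrow> (\<lambda>c. Vp (c * N) (w 0) w) \<longlonglongrightarrow> ennreal (genfun Y w)"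
proof -
  define X' where "X' = (\<lambda>\<omega> p. if p \<in> primitives N then X p \<omega> else 0)"
  interpret Mp: prob_space M using assms(1) by (simp add: polling_primitives_def)
  note X' = distr_primitives[OF assms(1), folded X'_def]
  let ?f = "\<lambda>c x. visit_counts N G x c"
  have V: "?f c x \<in> {v. \<forall>j>N. v j = 0}" for c x by (auto simp: visit_counts_eq)
  obtain Q where Q: "\<And>c. measure_pmf (Q c) = distr Pr (count_space UNIV) (?f c)"
  proof -
    have "\<exists>Q. measure_pmf Q = distr Pr (count_space UNIV) (?f c)" for c
      using distr_countable_pmf[OF P.prob_space_axioms countable_eventually_zero[of N], of "?f c"]
        V measurable_visit_counts by metis
    then show ?thesis using that by metis
  qed
  have f_meas [measurable]: "?f c \<in> Pr \<rightarrow>\<^sub>M count_space UNIV" for c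
  proof (rule measurableI)
    fix A
    have "?f c -` A \<inter> space Pr = (\<Union>v\<in>A \<inter> {v. \<forall>j>N. v j = 0}. {x \<in> space Pr. ?f c x = v})"
      using V by auto
    also have "\<dots> \<in> sets Pr"
      using countable_eventually_zero[of N] by (intro sets.countable_UN'' measurable_visit_counts) auto
    finally show "?f c -` A \<inter> space Pr \<in> sets Pr" .
  qed simp
  have lim: "(\<lambda>c. pmf (Q c) v) \<longlonglongrightarrow> pmf Y v" for v
  proof -
    have "pmf (Q c) v = measure M {\<omega> \<in> space M. visit_counts N G (\<lambda>p. X p \<omega>) c = v}" for c
    proof -
      have "pmf (Q c) v = measure Pr {x \<in> space Pr. ?f c x = v}"
        by (simp add: pmf.rep_eq Q measure_distr vimage_def)
      also have "\<dots> = measure (distr M Pr X') {x \<in> space Pr. ?f c x = v}"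
        by (simp only: X'(2))
      also have "\<dots> = measure M {\<omega> \<in> space M. ?f c (X' \<omega>) = v}"
        using X'(1) measurable_visit_counts[of c v] by (subst measure_distr) (auto intro!: arg_cong[where f="measure M"])
      also have "(\<lambda>\<omega>. ?f c (X' \<omega>)) = (\<lambda>\<omega>. ?f c (\<lambda>p. X p \<omega>))"
        by (intro ext visit_counts_cong[OF N]) (simp add: X'_def)
      then have "measure M {\<omega> \<in> space M. ?f c (X' \<omega>) = v} = measure M {\<omega> \<in> space M. visit_counts N G (\<lambda>p. X p \<omega>) c = v}"
        by (simp add: fun_eq_iff)
      finally show ?thesis .
    qed
    then show ?thesis using assms(2) by (simp add: steady_state_counts_def)
  qed
  show "v j = 0" if "v \<in> set_pmf Y" "N < j"
  proof (rule ccontr)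
    assume "v j \<noteq> 0"
    then have "{x \<in> space Pr. ?f c x = v} = {}" for c using that(2) V by fastforce
    then have "pmf (Q c) v = 0" for c
      by (simp add: pmf.rep_eq Q measure_distr vimage_def)
    then have "pmf Y v = 0" using lim[of v] LIMSEQ_unique[OF _ tendsto_const[of 0]] by simp
    then show False using that(1) by (simp add: set_pmf_iff)
  qed
  assume w: "\<And>j. j \<le> N \<Longrightarrow> 0 \<le> w j \<and> w j \<le> 1"
  let ?g = "\<lambda>v :: nat \<Rightarrow> nat. \<Prod>j\<le>N. w j ^ v j"
  have g: "0 \<le> ?g v" "?g v \<le> 1" for v
    using w by (auto intro!: prod_nonneg prod_le_1 power_le_one)
  have "Vp (c * N) (w 0) w = ennreal (\<integral>v. ?g v \<partial>measure_pmf (Q c))" for c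
  proof -
    have "Vp (c * N) (w 0) w = (\<integral>\<^sup>+x. ennreal (?g (?f c x)) \<partial>Pr)"
      unfolding Vp_def
    proof (intro nn_integral_cong)
      fix x
      have "{..N} = insert 0 {1..N}" by auto
      then have "?g (?f c x) = w 0 ^ card (queue x (c * N)) * (\<Prod>j=1..N. w j ^ cntV x (c * N) j)"
        by (simp add: visit_counts_eq)
      moreover have "(\<Prod>j=1..N. ennreal (w j) ^ cntV x (c * N) j) = ennreal (\<Prod>j=1..N. w j ^ cntV x (c * N) j)"
        using w by (subst prod_ennreal[symmetric]) (auto simp: ennreal_power intro!: prod.cong)
      ultimately show "ennreal (w 0) ^ card (queue x (c * N)) * (\<Prod>j=1..N. ennreal (w j) ^ cntV x (c * N) j) = ennreal (?g (?f c x))"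
        using w[of 0] by (simp add: ennreal_power ennreal_mult')
    qed
    also have "\<dots> = (\<integral>\<^sup>+v. ennreal (?g v) \<partial>measure_pmf (Q c))"
      unfolding Q by (subst nn_integral_distr) auto
    also have "\<dots> = ennreal (\<integral>v. ?g v \<partial>measure_pmf (Q c))"
      using g by (intro nn_integral_eq_integral measure_pmf.integrable_const_bound[where B=1]) auto
    finally show ?thesis .
  qed
  moreover have "(\<lambda>c. \<integral>v. ?g v \<partial>measure_pmf (Q c)) \<longlonglongrightarrow> genfun Y w"
    unfolding genfun_def using lim g by (intro pmf_limit_expectation) (simp_all add: abs_le_iff)
  ultimately show "(\<lambda>c. Vp (c * N) (w 0) w) \<longlonglongrightarrow> ennreal (genfun Y w)"
    by (simp add: tendsto_ennrealI)
qed

text \<open>Only the counts at visit starts are assumed to converge. When the queue of station 1 is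
  marked by \<open>z 1\<close>, its glue map leaves \<open>z\<close> unchanged, so \<open>Sp\<close>
  at the start of a cycle is \<open>Vp\<close> up to an explicit exponential and inherits the limit.
  The two equations are then the limits of \<open>Sp_cycle\<close> over a full cycle and of
  \<open>Vp_eq\<close> for separate marks of queue and orbit.\<close>

theorem genfun_equations:
  assumes "polling_primitives M X N lam nu B S" "steady_state_counts M X N G Y"
  defines "Ut \<equiv> \<lambda>z. genfun Y (z(0 := z 1))"
  shows "z \<in> unit_cube \<Longrightarrow> exp (Lam z * G 1) * Ut z = gg N z * (exp (Lam (cyc N z) * G 1) * Ut (cyc N z))"
    and "w \<in> unit_cube \<Longrightarrow> 0 \<le> w 0 \<Longrightarrow> w 0 \<le> 1 \<Longrightarrow> w' = w(1 := (1 - exp (- nu 1 * G 1)) * w 0 + exp (- nu 1 * G 1) * w 1) \<Longrightarrow>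
       exp (Lam (w(1 := w 0)) * G 1) * genfun Y w = exp (Lam w' * G 1) * Ut w'"
proof -
  have one: "1 \<in> {1..N}" using N by simp
  have Sp_lim: "(\<lambda>c. Sp (c * N) z) \<longlonglongrightarrow> ennreal (exp (Lam z * G 1) * Ut z)" if z: "z \<in> unit_cube" for z
  proof -
    have z': "\<And>j. j \<in> {1..N} \<Longrightarrow> 0 \<le> z j" "\<And>j. j \<in> {1..N} \<Longrightarrow> z j \<le> 1"
      using z by (auto simp: unit_cube_def)
    have V: "Vp m v (z(0 := b)) = Vp m v z" for m v b
      unfolding Vp_def by (intro nn_integral_cong arg_cong2[where f="(*)"] prod.cong) auto
    have "Sp (c * N) z = ennreal (exp (Lam z * G 1)) * Vp (c * N) (z 1) z" for c
    proof -
      have "Vp (c * N) (z 1) z = ennreal (exp (- Lam (z(station N (c * N) := z 1)) * G (station N (c * N)))) *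
         Sp (c * N) (z(station N (c * N) := (1 - exp (- nu (station N (c * N)) * G (station N (c * N)))) * z 1
           + exp (- nu (station N (c * N)) * G (station N (c * N))) * z (station N (c * N))))"
        by (rule Vp_eq) (use z' one in auto)
      also have "\<dots> = ennreal (exp (- Lam z * G 1)) * Sp (c * N) z"
      proof -
        have "z(1 := (1 - exp (- nu 1 * G 1)) * z 1 + exp (- nu 1 * G 1) * z 1) = z"
          by (simp add: left_diff_distrib)
        then show ?thesis unfolding station_cycle by (simp only: fun_upd_triv)
      qed
      finally show ?thesis
        by (simp add: mult.assoc[symmetric] ennreal_mult'[symmetric] mult_exp_exp)
    qed
    moreover have "(\<lambda>c. Vp (c * N) ((z(0 := z 1)) 0) (z(0 := z 1))) \<longlonglongrightarrow> ennreal (genfun Y (z(0 := z 1)))"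
      by (rule steady_state_limit(2)[OF assms(1,2)]) (use z' one in auto)
    then have "(\<lambda>c. ennreal (exp (Lam z * G 1)) * Vp (c * N) (z 1) z) \<longlonglongrightarrow> ennreal (exp (Lam z * G 1)) * ennreal (Ut z)"
      unfolding Ut_def by (intro ennreal_tendsto_cmult) (simp_all add: V)
    ultimately show ?thesis by (simp add: ennreal_mult')
  qed
  have Ut_nonneg: "0 \<le> genfun Y w" if "\<And>j. j \<le> N \<Longrightarrow> 0 \<le> w j" for w
    unfolding genfun_def using that by (intro Bochner_Integration.integral_nonneg prod_nonneg) auto
  have Ut_nonneg': "0 \<le> Ut z" if "z \<in> unit_cube" for z
    unfolding Ut_def using that one by (intro Ut_nonneg) (auto simp: unit_cube_def)
  show "exp (Lam z * G 1) * Ut z = gg N z * (exp (Lam (cyc N z) * G 1) * Ut (cyc N z))" if z: "z \<in> unit_cube"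
  proof -
    have cz: "cyc N z \<in> unit_cube" and gz: "0 \<le> gg N z" using z by (auto intro: cyc_unit gg_nonneg)
    have "Sp (Suc c * N) z = ennreal (gg N z) * Sp (c * N) (cyc N z)" for c
      using Sp_cycle[OF order_refl z, of c] by (simp add: add.commute)
    moreover have "(\<lambda>c. Sp (Suc c * N) z) \<longlonglongrightarrow> ennreal (exp (Lam z * G 1) * Ut z)"
      using LIMSEQ_Suc[OF Sp_lim[OF z]] .
    moreover have "(\<lambda>c. ennreal (gg N z) * Sp (c * N) (cyc N z)) \<longlonglongrightarrow> ennreal (gg N z) * ennreal (exp (Lam (cyc N z) * G 1) * Ut (cyc N z))"
      by (intro ennreal_tendsto_cmult Sp_lim cz) simp
    ultimately have "ennreal (exp (Lam z * G 1) * Ut z) = ennreal (gg N z) * ennreal (exp (Lam (cyc N z) * G 1) * Ut (cyc N z))"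
      using LIMSEQ_unique by fastforce
    then show ?thesis
      using gz Ut_nonneg'[OF z] Ut_nonneg'[OF cz] by (simp add: ennreal_mult'[symmetric])
  qed
  assume w: "w \<in> unit_cube" "0 \<le> w 0" "w 0 \<le> 1" and w'_def: "w' = w(1 := (1 - exp (- nu 1 * G 1)) * w 0 + exp (- nu 1 * G 1) * w 1)"
  have wj: "0 \<le> w j \<and> w j \<le> 1" if "j \<le> N" for j
    using w that by (cases "j = 0") (auto simp: unit_cube_def)
  have w': "w' \<in> unit_cube"
    using w wj[of 1] one stay_prob[OF one] convex_bound_le[of "w 0" 1 "w 1" "1 - exp (- nu 1 * G 1)" "exp (- nu 1 * G 1)"]
    by (auto simp: unit_cube_def w'_def)
  have "Vp (c * N) (w 0) w = ennreal (exp (- Lam (w(1 := w 0)) * G 1)) * Sp (c * N) w'" for c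
  proof -
    have "Vp (c * N) (w 0) w = ennreal (exp (- Lam (w(station N (c * N) := w 0)) * G (station N (c * N)))) *
         Sp (c * N) (w(station N (c * N) := (1 - exp (- nu (station N (c * N)) * G (station N (c * N)))) * w 0
           + exp (- nu (station N (c * N)) * G (station N (c * N))) * w (station N (c * N))))"
      by (rule Vp_eq) (use w wj in \<open>auto simp: unit_cube_def\<close>)
    then show ?thesis by (simp add: w'_def)
  qed
  moreover have "(\<lambda>c. Vp (c * N) (w 0) w) \<longlonglongrightarrow> ennreal (genfun Y w)"
    by (rule steady_state_limit(2)[OF assms(1,2) wj])
  moreover have "(\<lambda>c. ennreal (exp (- Lam (w(1 := w 0)) * G 1)) * Sp (c * N) w') \<longlonglongrightarrow> ennreal (exp (- Lam (w(1 := w 0)) * G 1)) * ennreal (exp (Lam w' * G 1) * Ut w')"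
    by (intro ennreal_tendsto_cmult Sp_lim w') simp
  ultimately have "ennreal (genfun Y w) = ennreal (exp (- Lam (w(1 := w 0)) * G 1)) * ennreal (exp (Lam w' * G 1) * Ut w')"
    using LIMSEQ_unique by fastforce
  then have "genfun Y w = exp (- Lam (w(1 := w 0)) * G 1) * (exp (Lam w' * G 1) * Ut w')"
    using Ut_nonneg[of w] wj Ut_nonneg'[OF w'] by (simp add: ennreal_mult'[symmetric])
  then show "exp (Lam (w(1 := w 0)) * G 1) * genfun Y w = exp (Lam w' * G 1) * Ut w'"
    by (simp add: mult.assoc[symmetric] mult_exp_exp)
qed

end

section \<open>Laplace transforms of nonnegative laws\<close>

lemma exp_minus_bounds:
  fixes t :: real assumes "0 \<le> t"
  shows "0 \<le> 1 - exp (- t)" "1 - exp (- t) \<le> t" "0 \<le> exp (- t) - 1 + t" "exp (- t) - 1 + t \<le> t\<^sup>2 / 2"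
proof -
  show "0 \<le> 1 - exp (- t)" using assms by simp
  show 1: "1 - exp (- t) \<le> t" "0 \<le> exp (- t) - 1 + t" using exp_ge_add_one_self[of "- t"] by auto
  have "(\<lambda>t. t\<^sup>2 / 2 - exp (- t) + 1 - t) 0 \<le> (\<lambda>t. t\<^sup>2 / 2 - exp (- t) + 1 - t) t"
  proof (rule DERIV_nonneg_imp_nondecreasing[OF assms])
    fix x :: real assume "0 \<le> x" "x \<le> t"
    have "((\<lambda>t. t\<^sup>2 / 2 - exp (- t) + 1 - t) has_real_derivative (x + exp (- x) - 1)) (at x)"
      by (auto intro!: derivative_eq_intros)
    moreover have "0 \<le> x + exp (- x) - 1" using exp_ge_add_one_self[of "- x"] by simp
    ultimately show "\<exists>y. ((\<lambda>t. t\<^sup>2 / 2 - exp (- t) + 1 - t) has_real_derivative y) (at x) \<and> 0 \<le> y" by blast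
  qed
  then show "exp (- t) - 1 + t \<le> t\<^sup>2 / 2" by simp
qed

lemma exp_minus_limits:
  fixes x :: real assumes "0 \<le> x"
  shows "((\<lambda>u. (1 - exp (- u * x)) / u) \<longlongrightarrow> x) (at_right 0)"
    and "((\<lambda>u. (exp (- u * x) - 1 + u * x) / u\<^sup>2) \<longlongrightarrow> x\<^sup>2 / 2) (at_right 0)"
proof -
  show "((\<lambda>u. (1 - exp (- u * x)) / u) \<longlongrightarrow> x) (at_right 0)"
  proof (cases "x = 0")
    case False
    then have "x > 0" using assms by simp
    then show ?thesis by real_asymp
  qed simp
  show "((\<lambda>u. (exp (- u * x) - 1 + u * x) / u\<^sup>2) \<longlongrightarrow> x\<^sup>2 / 2) (at_right 0)"
  proof (cases "x = 0")
    case False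
    then have "x > 0" using assms by simp
    then have "((\<lambda>u. (exp (- u * x) - 1 + u * x) / u\<^sup>2) \<longlongrightarrow> x * x / 2) (at_right 0)" by real_asymp
    then show ?thesis by (simp add: power2_eq_square)
  qed simp
qed

locale nonneg_law = prob_space P for P :: "real measure" +
  assumes sets_P [measurable_cong]: "sets P = sets borel"
    and nonneg: "AE x in P. 0 \<le> x"
    and int1: "integrable P (\<lambda>x. x)"
begin

lemma mean_eq: "moment 1 P = (\<integral>x. x \<partial>P)" "moment (Suc 0) P = (\<integral>x. x \<partial>P)"
  by (simp_all add: moment_def)

lemma mean_nonneg: "0 \<le> moment 1 P"
  unfolding mean_eq using nonneg by (rule integral_nonneg_AE)

lemma int_exp: "0 \<le> u \<Longrightarrow> integrable P (\<lambda>x. exp (- u * x))"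
  using integrable_laplace[OF prob_space_axioms sets_P nonneg] .

lemma laplace_0: "laplace P 0 = 1"
  by (simp add: laplace_def prob_space)

lemma laplace_antimono: "0 \<le> u \<Longrightarrow> u \<le> v \<Longrightarrow> laplace P v \<le> laplace P u"
  unfolding laplace_def using nonneg
  by (intro integral_mono_AE int_exp) (auto elim!: eventually_mono intro: mult_right_mono)

text \<open>Integrate the tangent line of the exponential at the mean.\<close>

lemma laplace_jensen: "0 \<le> u \<Longrightarrow> exp (- u * moment 1 P) \<le> laplace P u"
proof -
  assume u: "0 \<le> u"
  let ?m = "moment 1 P"
  have "(\<integral>x. exp (- u * ?m) * (1 - u * (x - ?m)) \<partial>P) \<le> laplace P u"
    unfolding laplace_def
  proof (intro integral_mono int_exp u)
    show "integrable P (\<lambda>x. exp (- u * ?m) * (1 - u * (x - ?m)))" using int1 by simp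
    fix x
    have "1 - u * (x - ?m) \<le> exp (- u * (x - ?m))" using exp_ge_add_one_self[of "- u * (x - ?m)"] by simp
    then have "exp (- u * ?m) * (1 - u * (x - ?m)) \<le> exp (- u * ?m) * exp (- u * (x - ?m))"
      by (intro mult_left_mono) auto
    then show "exp (- u * ?m) * (1 - u * (x - ?m)) \<le> exp (- u * x)"
      by (simp add: mult_exp_exp algebra_simps)
  qed
  moreover have "(\<integral>x. exp (- u * ?m) * (1 - u * (x - ?m)) \<partial>P) = exp (- u * ?m)"
    using int1 by (simp add: mean_eq prob_space del: One_nat_def)
  ultimately show ?thesis by simp
qed

lemma laplace_first_order: "((\<lambda>u. (1 - laplace P u) / u) \<longlongrightarrow> moment 1 P) (at_right 0)"
  unfolding tendsto_at_iff_sequentially comp_def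
proof (intro allI impI)
  fix X :: "nat \<Rightarrow> real" assume X: "\<forall>i. X i \<in> {0<..} - {0}" "X \<longlonglongrightarrow> 0"
  have pos: "0 < X i" for i using X(1) by auto
  have lim: "filterlim X (at_right 0) sequentially"
  proof -
    have "X i \<noteq> 0" for i using pos[of i] by simp
    then show ?thesis using X(2) pos by (simp add: filterlim_at)
  qed
  have "(\<lambda>i. \<integral>x. (1 - exp (- X i * x)) / X i \<partial>P) \<longlonglongrightarrow> (\<integral>x. x \<partial>P)"
  proof (rule integral_dominated_convergence[where w="\<lambda>x. x"])
    show "AE x in P. (\<lambda>i. (1 - exp (- X i * x)) / X i) \<longlonglongrightarrow> x"
      using nonneg by eventually_elim (rule filterlim_compose[OF exp_minus_limits(1) lim])
    show "AE x in P. norm ((1 - exp (- X i * x)) / X i) \<le> x" for i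
      using nonneg
    proof eventually_elim
      case (elim x)
      then show ?case using exp_minus_bounds(1,2)[of "X i * x"] pos[of i]
        by (simp add: divide_le_eq mult.commute)
    qed
    show "(\<lambda>x. (1 - exp (- X i * x)) / X i) \<in> borel_measurable P" for i by measurable
    show "(\<lambda>x. x) \<in> borel_measurable P" by measurable
  qed (rule int1)
  moreover have "(\<integral>x. (1 - exp (- X i * x)) / X i \<partial>P) = (1 - laplace P (X i)) / X i" for i
    using int_exp[of "X i"] pos[of i] by (simp add: laplace_def prob_space)
  ultimately show "(\<lambda>i. (1 - laplace P (X i)) / X i) \<longlonglongrightarrow> moment 1 P" by (simp only: mean_eq)
qed

lemma laplace_second_order:
  assumes int2: "integrable P (\<lambda>x. x\<^sup>2)"
  shows "((\<lambda>u. (laplace P u - 1 + u * moment 1 P) / u\<^sup>2) \<longlongrightarrow> moment 2 P / 2) (at_right 0)"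
  unfolding tendsto_at_iff_sequentially comp_def
proof (intro allI impI)
  fix X :: "nat \<Rightarrow> real" assume X: "\<forall>i. X i \<in> {0<..} - {0}" "X \<longlonglongrightarrow> 0"
  have pos: "0 < X i" for i using X(1) by auto
  have lim: "filterlim X (at_right 0) sequentially"
  proof -
    have "X i \<noteq> 0" for i using pos[of i] by simp
    then show ?thesis using X(2) pos by (simp add: filterlim_at)
  qed
  have "(\<lambda>i. \<integral>x. (exp (- X i * x) - 1 + X i * x) / (X i)\<^sup>2 \<partial>P) \<longlonglongrightarrow> (\<integral>x. x\<^sup>2 / 2 \<partial>P)"
  proof (rule integral_dominated_convergence[where w="\<lambda>x. x\<^sup>2 / 2"])
    show "AE x in P. (\<lambda>i. (exp (- X i * x) - 1 + X i * x) / (X i)\<^sup>2) \<longlonglongrightarrow> x\<^sup>2 / 2"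
      using nonneg by eventually_elim (rule filterlim_compose[OF exp_minus_limits(2) lim])
    show "AE x in P. norm ((exp (- X i * x) - 1 + X i * x) / (X i)\<^sup>2) \<le> x\<^sup>2 / 2" for i
      using nonneg
    proof eventually_elim
      case (elim x)
      have "0 \<le> exp (- X i * x) - 1 + X i * x" "exp (- X i * x) - 1 + X i * x \<le> (X i * x)\<^sup>2 / 2"
        using exp_minus_bounds(3,4)[of "X i * x"] elim pos[of i] by auto
      then show ?case using pos[of i]
        by (simp add: divide_le_eq power_mult_distrib mult.commute)
    qed
    show "(\<lambda>x. (exp (- X i * x) - 1 + X i * x) / (X i)\<^sup>2) \<in> borel_measurable P" for i by measurable
    show "(\<lambda>x. x\<^sup>2 / 2) \<in> borel_measurable P" by measurable
    show "integrable P (\<lambda>x. x\<^sup>2 / 2)" using int2 by simp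
  qed
  moreover have "(\<integral>x. (exp (- X i * x) - 1 + X i * x) / (X i)\<^sup>2 \<partial>P) = (laplace P (X i) - 1 + X i * moment 1 P) / (X i)\<^sup>2" for i
    using int_exp[of "X i"] pos[of i] int1 by (simp add: laplace_def prob_space mean_eq)
  ultimately show "(\<lambda>i. (laplace P (X i) - 1 + X i * moment 1 P) / (X i)\<^sup>2) \<longlonglongrightarrow> moment 2 P / 2"
    by (simp only: moment_def Bochner_Integration.integral_divide_zero)
qed

lemma laplace_first_order_compose:
  assumes u: "eventually (\<lambda>x. 0 \<le> u x) F" "((\<lambda>x. u x / e x) \<longlongrightarrow> k) F" and e: "eventually (\<lambda>x. 0 < e x) F" "(e \<longlongrightarrow> 0) F"
  shows "((\<lambda>x. (1 - laplace P (u x)) / e x) \<longlongrightarrow> moment 1 P * k) F"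
proof -
  \<comment> \<open>The argument \<open>u x\<close> may vanish; filling in the limit of the
    difference quotient makes \<open>h\<close> continuous from the right at 0.\<close>
  define h where "h = (\<lambda>u. if u \<le> 0 then moment 1 P else (1 - laplace P u) / u)"
  have "((\<lambda>x. u x / e x * e x) \<longlongrightarrow> k * 0) F" using u(2) e(2) by (rule tendsto_mult)
  moreover have "eventually (\<lambda>x. u x / e x * e x = u x) F"
    using e(1) by eventually_elim simp
  ultimately have u0: "(u \<longlongrightarrow> 0) F" using tendsto_cong by fastforce
  have "(h \<longlongrightarrow> moment 1 P) (at 0 within {0..})"
    unfolding at_within_Ici_at_right using laplace_first_order
    by (rule Lim_transform_eventually) (auto simp: h_def eventually_at intro!: exI[of _ 1])
  then have cont: "continuous (at 0 within {0..}) h"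
    by (simp add: continuous_within h_def)
  have "((\<lambda>x. h (u x)) \<longlongrightarrow> h 0) F"
    using u(1) u0 by (intro continuous_within_tendsto_compose[OF cont]) auto
  then have "((\<lambda>x. h (u x) * (u x / e x)) \<longlongrightarrow> moment 1 P * k) F"
    using u(2) by (intro tendsto_mult) (simp_all add: h_def)
  moreover have "eventually (\<lambda>x. h (u x) * (u x / e x) = (1 - laplace P (u x)) / e x) F"
    using u(1) by eventually_elim (auto simp: h_def laplace_0)
  ultimately show ?thesis by (rule Lim_transform_eventually)
qed

end

section \<open>A priori bound on the work\<close>

text \<open>Fatou's lemma along \<open>A = 1 / n\<close>: the quotients
  \<open>(1 - exp (- A * W y)) / A\<close> tend to \<open>W y\<close> and have expectations at most
  \<open>K\<close>. Existence of the mean is thus a conclusion.\<close>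

lemma pmf_mean_from_laplace:
  fixes W :: "'v \<Rightarrow> real"
  assumes W: "\<And>y. 0 \<le> W y" and K: "\<And>A. 0 < A \<Longrightarrow> 1 - (\<integral>y. exp (- A * W y) \<partial>measure_pmf Q) \<le> A * K"
  shows "integrable (measure_pmf Q) W" "(\<integral>y. W y \<partial>measure_pmf Q) \<le> K"
proof -
  let ?Q = "measure_pmf Q"
  let ?A = "\<lambda>n. 1 / real (Suc n)"
  have int: "integrable ?Q (\<lambda>y. exp (- a * W y))" if "0 \<le> a" for a
    using W that by (intro measure_pmf.integrable_const_bound[where B=1]) auto
  have K0: "0 \<le> K"
  proof -
    have "(\<integral>y. exp (- 1 * W y) \<partial>?Q) \<le> (\<integral>y. 1 \<partial>?Q)"
      using int[of 1] W by (intro integral_mono) auto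
    then show ?thesis using K[of 1] by simp
  qed
  have "(\<lambda>n. (1 - exp (- ?A n * w)) / ?A n) \<longlonglongrightarrow> w" if "0 \<le> w" for w
  proof (rule filterlim_compose[OF exp_minus_limits(1)[OF that]])
    have "?A \<longlonglongrightarrow> 0" using LIMSEQ_inverse_real_of_nat by (simp add: inverse_eq_divide)
    then show "filterlim ?A (at_right 0) sequentially" by (simp add: filterlim_at)
  qed
  then have lim: "(\<lambda>n. ennreal ((1 - exp (- ?A n * W y)) / ?A n)) \<longlonglongrightarrow> ennreal (W y)" for y
    using W by (intro tendsto_ennrealI) auto
  have "(\<integral>\<^sup>+y. ennreal (W y) \<partial>?Q) = (\<integral>\<^sup>+y. liminf (\<lambda>n. ennreal ((1 - exp (- ?A n * W y)) / ?A n)) \<partial>?Q)"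
    by (intro nn_integral_cong lim_imp_Liminf[OF _ lim, symmetric]) simp
  also have "\<dots> \<le> liminf (\<lambda>n. \<integral>\<^sup>+y. ennreal ((1 - exp (- ?A n * W y)) / ?A n) \<partial>?Q)"
    by (intro nn_integral_liminf) simp
  also have "\<dots> \<le> liminf (\<lambda>n. ennreal K)"
  proof (intro Liminf_mono always_eventually allI)
    fix n
    have i: "integrable ?Q (\<lambda>y. (1 - exp (- ?A n * W y)) / ?A n)"
      using int[of "?A n"] by (intro integrable_divide Bochner_Integration.integrable_diff) auto
    have "(\<integral>\<^sup>+y. ennreal ((1 - exp (- ?A n * W y)) / ?A n) \<partial>?Q) = ennreal (\<integral>y. (1 - exp (- ?A n * W y)) / ?A n \<partial>?Q)"
      using W by (intro nn_integral_eq_integral i) (auto intro!: divide_nonneg_nonneg simp: mult_nonneg_nonneg)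
    also have "(\<integral>y. (1 - exp (- ?A n * W y)) / ?A n \<partial>?Q) = (1 - (\<integral>y. exp (- ?A n * W y) \<partial>?Q)) / ?A n"
      using int[of "?A n"] by simp
    also have "\<dots> \<le> K"
    proof -
      have pos: "0 < ?A n" by simp
      then show ?thesis using K[OF pos] by (simp only: pos_divide_le_eq mult.commute[of K])
    qed
    finally show "(\<integral>\<^sup>+y. ennreal ((1 - exp (- ?A n * W y)) / ?A n) \<partial>?Q) \<le> ennreal K"
      by (simp add: ennreal_leI)
  qed
  also have "\<dots> = ennreal K" by (simp add: Liminf_const)
  finally have le: "(\<integral>\<^sup>+y. ennreal (W y) \<partial>?Q) \<le> ennreal K" .
  then show i: "integrable ?Q W"
    using W by (intro integrableI_bounded) (auto simp: le_less_trans)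
  have "(\<integral>\<^sup>+y. ennreal (W y) \<partial>?Q) = ennreal (\<integral>y. W y \<partial>?Q)"
    using W by (intro nn_integral_eq_integral i) auto
  then show "(\<integral>y. W y \<partial>?Q) \<le> K" using le K0 by simp
qed

lemma exp_convex2:
  fixes x y p :: real
  assumes "0 \<le> p" "p \<le> 1"
  shows "exp (p * x + (1 - p) * y) \<le> p * exp x + (1 - p) * exp y"
proof -
  let ?m = "p * x + (1 - p) * y"
  have t: "exp ?m * (1 + (v - ?m)) \<le> exp v" for v
  proof -
    have "exp ?m * (1 + (v - ?m)) \<le> exp ?m * exp (v - ?m)"
      by (intro mult_left_mono exp_ge_add_one_self) auto
    then show ?thesis by (simp add: mult_exp_exp)
  qed
  have "exp ?m = p * (exp ?m * (1 + (x - ?m))) + (1 - p) * (exp ?m * (1 + (y - ?m)))"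
    by (simp add: algebra_simps)
  also have "\<dots> \<le> p * exp x + (1 - p) * exp y"
    using assms by (intro add_mono mult_left_mono t) auto
  finally show ?thesis .
qed

section \<open>The cycle maps with the load as a parameter\<close>

locale heavy_traffic =
  fixes N :: nat and lamh nu G :: "nat \<Rightarrow> real" and B S :: "nat \<Rightarrow> real measure"
  assumes N: "N \<ge> 1"
    and lamh_pos: "\<And>i. i \<in> {1..N} \<Longrightarrow> 0 < lamh i"
    and nu_pos: "\<And>i. i \<in> {1..N} \<Longrightarrow> 0 < nu i"
    and G_pos: "\<And>i. i \<in> {1..N} \<Longrightarrow> 0 < G i"
    and B: "\<And>i. i \<in> {1..N} \<Longrightarrow> nonneg_law (B i)"
    and B2: "\<And>i. i \<in> {1..N} \<Longrightarrow> integrable (B i) (\<lambda>x. x\<^sup>2)"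
    and S: "\<And>i. i \<in> {1..N} \<Longrightarrow> nonneg_law (S i)"
    and b_pos': "\<And>i. i \<in> {1..N} \<Longrightarrow> 0 < moment 1 (B i)"
    and load': "(\<Sum>i=1..N. lamh i * moment 1 (B i)) = 1"
begin

definition p :: "nat \<Rightarrow> real" where "p i = 1 - exp (- nu i * G i)"
definition b :: "nat \<Rightarrow> real" where "b i = moment 1 (B i)"
definition s :: "nat \<Rightarrow> real" where "s i = moment 1 (S i)"

text \<open>From here on the load is an argument: \<open>LL\<close>, \<open>TT\<close>,
  \<open>gt\<close>, \<open>CC\<close> and \<open>GG\<close> are \<open>Lam\<close>,
  \<open>Tst\<close>, \<open>gst\<close>, \<open>cyc\<close> and \<open>gg\<close> for the arrival
  rates \<open>\<rho> * lamh i\<close>. The identification is made in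
  \<open>steady_equations\<close>.\<close>

definition LL :: "real \<Rightarrow> (nat \<Rightarrow> real) \<Rightarrow> real" where
  "LL \<rho> z = (\<Sum>j=1..N. \<rho> * lamh j * (1 - z j))"

definition TT :: "real \<Rightarrow> nat \<Rightarrow> (nat \<Rightarrow> real) \<Rightarrow> nat \<Rightarrow> real" where
  "TT \<rho> i z = z(i := p i * laplace (B i) (LL \<rho> z) + (1 - p i) * z i)"

definition gt :: "real \<Rightarrow> nat \<Rightarrow> (nat \<Rightarrow> real) \<Rightarrow> real" where
  "gt \<rho> i z = laplace (S i) (LL \<rho> z) * exp (- LL \<rho> (z(i := laplace (B i) (LL \<rho> z))) * G i)"

primrec CC :: "real \<Rightarrow> nat \<Rightarrow> (nat \<Rightarrow> real) \<Rightarrow> nat \<Rightarrow> real" where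
  "CC \<rho> 0 z = z"
| "CC \<rho> (Suc k) z = CC \<rho> k (TT \<rho> (Suc k) z)"

primrec GG :: "real \<Rightarrow> nat \<Rightarrow> (nat \<Rightarrow> real) \<Rightarrow> real" where
  "GG \<rho> 0 z = 1"
| "GG \<rho> (Suc k) z = gt \<rho> (Suc k) z * GG \<rho> k (TT \<rho> (Suc k) z)"

definition cube :: "(nat \<Rightarrow> real) set" where
  "cube = {z. \<forall>j\<in>{1..N}. 0 \<le> z j \<and> z j \<le> 1}"

definition tot :: "(nat \<Rightarrow> nat) \<Rightarrow> nat \<Rightarrow> nat" where
  "tot y j = (if j = 1 then y 0 + y 1 else y j)"

definition work :: "(nat \<Rightarrow> nat) \<Rightarrow> real" where
  "work y = (\<Sum>j=1..N. b j * real (tot y j))"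

lemma b_pos: "i \<in> {1..N} \<Longrightarrow> 0 < b i"
  unfolding b_def by (rule b_pos')

lemma load: "(\<Sum>i=1..N. lamh i * b i) = 1"
  using load' by (simp add: b_def)

lemma p_bounds: "i \<in> {1..N} \<Longrightarrow> 0 < p i" "i \<in> {1..N} \<Longrightarrow> p i < 1"
  using nu_pos[of i] G_pos[of i] by (auto simp: p_def)

lemma s_nonneg: "i \<in> {1..N} \<Longrightarrow> 0 \<le> s i"
  unfolding s_def by (rule nonneg_law.mean_nonneg[OF S])

lemma b_nonneg: "i \<in> {1..N} \<Longrightarrow> 0 \<le> b i"
  using b_pos less_imp_le by blast

lemma lamh_nonneg: "i \<in> {1..N} \<Longrightarrow> 0 \<le> lamh i"
  using lamh_pos less_imp_le by blast

lemma LL_nonneg: "0 \<le> \<rho> \<Longrightarrow> z \<in> cube \<Longrightarrow> 0 \<le> LL \<rho> z"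
  unfolding LL_def cube_def by (intro sum_nonneg mult_nonneg_nonneg) (auto intro: lamh_nonneg)

lemma laplace_bounds:
  assumes "nonneg_law P" "0 \<le> u" shows "0 \<le> laplace P u" "laplace P u \<le> 1"
proof -
  interpret nonneg_law P by fact
  show "0 \<le> laplace P u" "laplace P u \<le> 1"
    using laplace_nonneg[OF prob_space_axioms sets_P nonneg assms(2)] laplace_le_1[OF prob_space_axioms sets_P nonneg assms(2)] by auto
qed

lemma laplace_cube:
  assumes "i \<in> {1..N}" "0 \<le> \<rho>" "z \<in> cube"
  shows "0 \<le> laplace (B i) (LL \<rho> z)" "laplace (B i) (LL \<rho> z) \<le> 1"
    "0 \<le> laplace (S i) (LL \<rho> z)" "laplace (S i) (LL \<rho> z) \<le> 1"
  using laplace_bounds[OF B LL_nonneg] laplace_bounds[OF S LL_nonneg] assms by auto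

lemma upd_cube: "i \<in> {1..N} \<Longrightarrow> 0 \<le> \<rho> \<Longrightarrow> z \<in> cube \<Longrightarrow> z(i := laplace (B i) (LL \<rho> z)) \<in> cube"
  using laplace_cube[of i \<rho> z] by (auto simp: cube_def)

lemma TT_cube: "i \<in> {1..N} \<Longrightarrow> 0 \<le> \<rho> \<Longrightarrow> z \<in> cube \<Longrightarrow> TT \<rho> i z \<in> cube"
  using laplace_cube[of i \<rho> z] p_bounds[of i] convex_bound_le[of "laplace (B i) (LL \<rho> z)" 1 "z i" "p i" "1 - p i"]
  by (auto simp: cube_def TT_def)

lemma CC_cube: "k \<le> N \<Longrightarrow> 0 \<le> \<rho> \<Longrightarrow> z \<in> cube \<Longrightarrow> CC \<rho> k z \<in> cube"
  by (induction k arbitrary: z) (auto simp: TT_cube)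

lemma gt_bounds:
  assumes "i \<in> {1..N}" "0 \<le> \<rho>" "z \<in> cube"
  shows "0 \<le> gt \<rho> i z" "gt \<rho> i z \<le> 1"
proof -
  have "0 \<le> LL \<rho> (z(i := laplace (B i) (LL \<rho> z))) * G i"
    using LL_nonneg[OF assms(2) upd_cube[OF assms]] G_pos[OF assms(1)] by simp
  then show "0 \<le> gt \<rho> i z" "gt \<rho> i z \<le> 1"
    using laplace_cube[OF assms] by (auto simp: gt_def intro: mult_le_one)
qed

definition pm :: real where "pm = Min (p ` {1..N})"
text \<open>Contraction factor of one cycle along \<open>b\<close>. Station \<open>i\<close> turns
  the exponent \<open>A\<close> into at most \<open>(p i * \<rho> + (1 - p i)) * A\<close>, which is
  \<open>(1 - p i * (1 - \<rho>)) * A\<close>, and \<open>pm\<close> is the least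
  \<open>p i\<close>.\<close>

definition gam :: "real \<Rightarrow> real" where "gam \<rho> = 1 - pm * (1 - \<rho>)"

lemma pm: "0 < pm" "i \<in> {1..N} \<Longrightarrow> pm \<le> p i" "pm < 1"
proof -
  have ne: "p ` {1..N} \<noteq> {}" using N by auto
  show "0 < pm" unfolding pm_def using ne p_bounds by (subst Min_gr_iff) auto
  show le: "pm \<le> p i" if "i \<in> {1..N}" for i unfolding pm_def using that by simp
  show "pm < 1" using le[of 1] p_bounds(2)[of 1] N by simp
qed

lemma LL_le:
  assumes "0 \<le> A" "0 \<le> \<rho>" "\<And>j. j \<in> {1..N} \<Longrightarrow> exp (- A * b j) \<le> z j"
  shows "LL \<rho> z \<le> \<rho> * A"
proof -
  have "LL \<rho> z \<le> (\<Sum>j=1..N. \<rho> * lamh j * (A * b j))"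
    unfolding LL_def
  proof (intro sum_mono mult_left_mono)
    fix j assume j: "j \<in> {1..N}"
    have "1 - A * b j \<le> exp (- A * b j)" using exp_ge_add_one_self[of "- A * b j"] by simp
    then show "1 - z j \<le> A * b j" using assms(3)[OF j] by simp
    show "0 \<le> \<rho> * lamh j" using assms lamh_pos[OF j] by simp
  qed
  also have "\<dots> = \<rho> * A * (\<Sum>j=1..N. lamh j * b j)"
    by (simp add: sum_distrib_left mult_ac)
  finally show ?thesis unfolding load by simp
qed

text \<open>At load 1 the bounds on \<open>z\<close> give
  \<open>LL \<rho> z \<le> \<rho> * A\<close> (\<open>LL_le\<close>), and Jensen's inequality turns
  this into a bound for the transform of the service time. Convexity of the exponential handles the
  mixture of served and remaining customers.\<close>

lemma TT_lower:
  assumes A: "0 \<le> A" and \<rho>: "0 < \<rho>" "\<rho> < 1" and z: "z \<in> cube" and i: "i \<in> {1..N}"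
    and lower: "\<And>j. j \<in> {1..N} \<Longrightarrow> exp (- A * b j) \<le> z j"
  shows "exp (- (gam \<rho> * A) * b i) \<le> TT \<rho> i z i"
    and "exp (- A * b i) \<le> laplace (B i) (LL \<rho> z)"
proof -
  interpret Bi: nonneg_law "B i" by (rule B[OF i])
  note bi = b_pos[OF i] and pb = p_bounds[OF i]
  have LL: "0 \<le> LL \<rho> z" "LL \<rho> z \<le> \<rho> * A" using LL_nonneg[of \<rho> z] LL_le[OF A _ lower] \<rho> z by auto
  have "exp (- (\<rho> * A) * b i) \<le> laplace (B i) (\<rho> * A)"
    using Bi.laplace_jensen[of "\<rho> * A"] A \<rho> by (simp add: b_def)
  also have "\<dots> \<le> laplace (B i) (LL \<rho> z)" by (rule Bi.laplace_antimono[OF LL])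
  finally have L: "exp (- (\<rho> * A) * b i) \<le> laplace (B i) (LL \<rho> z)" .
  have "\<rho> * A * b i \<le> A * b i" using \<rho> A bi by (simp add: mult_left_le_one_le mult_right_mono)
  then show "exp (- A * b i) \<le> laplace (B i) (LL \<rho> z)" using L by (smt (verit) exp_le_cancel_iff mult_minus_left)
  have "gam \<rho> * A * b i \<ge> (p i * \<rho> + (1 - p i)) * (A * b i)"
  proof -
    have "pm * (1 - \<rho>) \<le> p i * (1 - \<rho>)" using pm(2)[OF i] \<rho> by (intro mult_right_mono) auto
    then have "p i * \<rho> + (1 - p i) \<le> gam \<rho>" by (simp add: gam_def algebra_simps)
    then have "(p i * \<rho> + (1 - p i)) * (A * b i) \<le> gam \<rho> * (A * b i)" using A bi by (intro mult_right_mono) auto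
    then show ?thesis by (simp add: mult_ac)
  qed
  then have "exp (- (gam \<rho> * A) * b i) \<le> exp (p i * (- (\<rho> * A) * b i) + (1 - p i) * (- A * b i))"
    by (simp add: algebra_simps)
  also have "\<dots> \<le> p i * exp (- (\<rho> * A) * b i) + (1 - p i) * exp (- A * b i)"
    using pb by (intro exp_convex2) auto
  also have "\<dots> \<le> TT \<rho> i z i"
    unfolding TT_def using pb L lower[OF i] by (auto intro!: add_mono mult_left_mono)
  finally show "exp (- (gam \<rho> * A) * b i) \<le> TT \<rho> i z i" .
qed

lemma gt_lower:
  assumes A: "0 \<le> A" and \<rho>: "0 < \<rho>" "\<rho> < 1" and z: "z \<in> cube" and i: "i \<in> {1..N}"
    and lower: "\<And>j. j \<in> {1..N} \<Longrightarrow> exp (- A * b j) \<le> z j"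
  shows "exp (- A * (s i + G i)) \<le> gt \<rho> i z"
proof -
  interpret Si: nonneg_law "S i" by (rule S[OF i])
  have \<rho>A: "\<rho> * A \<le> A" using \<rho> A by (simp add: mult_left_le_one_le)
  have LL: "0 \<le> LL \<rho> z" "LL \<rho> z \<le> A" using LL_nonneg[of \<rho> z] LL_le[OF A _ lower, of \<rho>] \<rho> z \<rho>A by auto
  have "exp (- A * s i) \<le> exp (- LL \<rho> z * s i)"
    using LL s_nonneg[OF i] by (simp add: mult_right_mono)
  also have "\<dots> \<le> laplace (S i) (LL \<rho> z)"
    using Si.laplace_jensen[OF LL(1)] by (simp add: s_def)
  finally have 1: "exp (- A * s i) \<le> laplace (S i) (LL \<rho> z)" .
  have "LL \<rho> (z(i := laplace (B i) (LL \<rho> z))) \<le> \<rho> * A"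
    using TT_lower(2)[OF A \<rho> z i lower] lower \<rho> by (intro LL_le A) auto
  then have "exp (- A * G i) \<le> exp (- LL \<rho> (z(i := laplace (B i) (LL \<rho> z))) * G i)"
    using \<rho>A G_pos[OF i] by (simp add: mult_right_mono)
  with 1 have "exp (- A * s i) * exp (- A * G i) \<le> gt \<rho> i z"
    unfolding gt_def using laplace_cube(3)[OF i _ z, of \<rho>] \<rho> by (intro mult_mono) auto
  then show ?thesis by (simp add: mult_exp_exp algebra_simps)
qed

text \<open>The stations act in the order \<open>N\<close> down to 1, with \<open>k\<close> of them
  left. Every coordinate obeys the bound for \<open>A\<close>, and those above \<open>k\<close>,
  which are already updated, the better bound for \<open>gam \<rho> * A\<close>.\<close>

lemma cycle_lower:
  assumes A: "0 \<le> A" and \<rho>: "0 < \<rho>" "\<rho> < 1" and "k \<le> N" "z \<in> cube"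
    "\<And>j. j \<in> {1..N} \<Longrightarrow> exp (- A * b j) \<le> z j" "\<And>j. j \<in> {1..N} \<Longrightarrow> k < j \<Longrightarrow> exp (- (gam \<rho> * A) * b j) \<le> z j"
  shows "(\<forall>j\<in>{1..N}. exp (- (gam \<rho> * A) * b j) \<le> CC \<rho> k z j) \<and> exp (- A * (\<Sum>i=1..k. s i + G i)) \<le> GG \<rho> k z"
  using assms(4-)
proof (induction k arbitrary: z)
  case (Suc k)
  let ?z = "TT \<rho> (Suc k) z"
  have i: "Suc k \<in> {1..N}" using Suc.prems by auto
  have T: "exp (- (gam \<rho> * A) * b (Suc k)) \<le> TT \<rho> (Suc k) z (Suc k)"
    by (rule TT_lower(1)[OF A \<rho> Suc.prems(2) i]) (rule Suc.prems(3))
  have "gam \<rho> \<le> 1" "0 \<le> gam \<rho>" using pm \<rho> mult_le_one[of pm "1 - \<rho>"] by (auto simp: gam_def)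
  then have gA: "gam \<rho> * A * b j \<le> A * b j" if "j \<in> {1..N}" for j
    using A b_pos[OF that] by (intro mult_right_mono) (auto simp: mult_left_le_one_le)
  have z: "?z \<in> cube" using TT_cube[OF i _ Suc.prems(2)] \<rho> by simp
  have IH: "(\<forall>j\<in>{1..N}. exp (- (gam \<rho> * A) * b j) \<le> CC \<rho> k ?z j) \<and> exp (- A * (\<Sum>i=1..k. s i + G i)) \<le> GG \<rho> k ?z"
  proof (rule Suc.IH)
    fix j assume j: "j \<in> {1..N}"
    show "exp (- A * b j) \<le> ?z j"
    proof (cases "j = Suc k")
      case True
      have "exp (- A * b j) \<le> exp (- (gam \<rho> * A) * b j)" using gA[OF j] by simp
      from order_trans[OF this[unfolded True] T] show ?thesis unfolding True .
    qed (use Suc.prems(3)[OF j] in \<open>simp add: TT_def\<close>)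
    show "exp (- (gam \<rho> * A) * b j) \<le> ?z j" if "k < j"
      using T Suc.prems(4)[OF j] that by (cases "j = Suc k") (auto simp: TT_def)
  qed (use z Suc.prems in auto)
  have "exp (- A * (s (Suc k) + G (Suc k))) * exp (- A * (\<Sum>i=1..k. s i + G i)) \<le> gt \<rho> (Suc k) z * GG \<rho> k ?z"
    using IH gt_lower[OF A \<rho> Suc.prems(2) i Suc.prems(3)] gt_bounds(1)[OF i _ Suc.prems(2), of \<rho>] \<rho>
    by (intro mult_mono) auto
  then have "exp (- A * (\<Sum>i=1..Suc k. s i + G i)) \<le> GG \<rho> (Suc k) z"
    by (simp add: mult_exp_exp algebra_simps)
  then show ?case using IH by simp
qed auto

end

text \<open>The steady state enters here only through the functional equation for the totals per
  type. The split of type 1 into queue and orbit is added in \<open>joint_limit\<close>.\<close>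

locale heavy_traffic_steady = heavy_traffic +
  fixes Y :: "real \<Rightarrow> (nat \<Rightarrow> nat) pmf" and Ut :: "real \<Rightarrow> (nat \<Rightarrow> real) \<Rightarrow> real"
  defines "Ut \<equiv> \<lambda>\<rho> z. \<integral>y. (\<Prod>j=1..N. z j ^ heavy_traffic.tot y j) \<partial>measure_pmf (Y \<rho>)"
  assumes stationary: "\<And>\<rho> z. 0 < \<rho> \<Longrightarrow> \<rho> < 1 \<Longrightarrow> z \<in> cube \<Longrightarrow>
     exp (LL \<rho> z * G 1) * Ut \<rho> z = GG \<rho> N z * (exp (LL \<rho> (CC \<rho> N z) * G 1) * Ut \<rho> (CC \<rho> N z))"
begin

lemma prod_bounds:
  assumes "z \<in> cube" shows "0 \<le> (\<Prod>j=1..N. z j ^ (n j :: nat))" "(\<Prod>j=1..N. z j ^ n j) \<le> 1"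
  using assms by (auto intro!: prod_nonneg prod_le_1 power_le_one simp: cube_def)

lemma integrable_prod: "z \<in> cube \<Longrightarrow> integrable (measure_pmf (Y \<rho>)) (\<lambda>y. \<Prod>j=1..N. z j ^ (n y j :: nat))"
  using prod_bounds by (intro measure_pmf.integrable_const_bound[where B=1]) (auto simp: abs_le_iff)

lemma Ut_bounds: "z \<in> cube \<Longrightarrow> 0 \<le> Ut \<rho> z" "z \<in> cube \<Longrightarrow> Ut \<rho> z \<le> 1"
proof -
  assume z: "z \<in> cube"
  show "0 \<le> Ut \<rho> z" unfolding Ut_def using prod_bounds[OF z] by (intro Bochner_Integration.integral_nonneg) auto
  have "Ut \<rho> z \<le> (\<integral>y. 1 \<partial>measure_pmf (Y \<rho>))"
    unfolding Ut_def using prod_bounds[OF z] integrable_prod[OF z] by (intro integral_mono) auto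
  then show "Ut \<rho> z \<le> 1" by simp
qed

lemma Ut_mono: "z \<in> cube \<Longrightarrow> z' \<in> cube \<Longrightarrow> (\<And>j. j \<in> {1..N} \<Longrightarrow> z j \<le> z' j) \<Longrightarrow> Ut \<rho> z \<le> Ut \<rho> z'"
  unfolding Ut_def by (intro integral_mono integrable_prod prod_mono conjI power_mono zero_le_power) (auto simp: cube_def)

lemma work_nonneg: "0 \<le> work y"
  unfolding work_def by (intro sum_nonneg mult_nonneg_nonneg) (auto intro: b_nonneg)

lemma Ut_exp: "Ut \<rho> (\<lambda>j. exp (- A * c j)) = (\<integral>y. exp (- A * (\<Sum>j=1..N. c j * real (tot y j))) \<partial>measure_pmf (Y \<rho>))"
  unfolding Ut_def
  by (intro Bochner_Integration.integral_cong refl)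
     (simp add: exp_sum[symmetric] exp_of_nat_mult[symmetric] sum_distrib_left mult_ac sum_negf)

lemma exp_cube: "0 \<le> A \<Longrightarrow> (\<And>j. j \<in> {1..N} \<Longrightarrow> 0 \<le> c j) \<Longrightarrow> (\<lambda>j. exp (- A * c j)) \<in> cube"
  by (auto simp: cube_def)

text \<open>The extra \<open>G 1\<close> pays for the exponential factors of the glue period of
  station 1 on the two sides of the stationary equation.\<close>

definition RR :: real where "RR = (\<Sum>i=1..N. s i + G i) + G 1"

lemma RR_nonneg: "0 \<le> RR"
  unfolding RR_def using s_nonneg G_pos N by (intro add_nonneg_nonneg sum_nonneg) (auto intro: less_imp_le)

lemma laplace_work_step:
  assumes A: "0 \<le> A" and \<rho>: "0 < \<rho>" "\<rho> < 1"
  shows "exp (- A * RR) * (\<integral>y. exp (- (gam \<rho> * A) * work y) \<partial>measure_pmf (Y \<rho>)) \<le> (\<integral>y. exp (- A * work y) \<partial>measure_pmf (Y \<rho>))"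
proof -
  let ?z = "\<lambda>j. exp (- A * b j)" and ?z' = "\<lambda>j. exp (- (gam \<rho> * A) * b j)"
  have g: "0 \<le> gam \<rho>" using pm \<rho> mult_le_one[of pm "1 - \<rho>"] by (auto simp: gam_def)
  have z: "?z \<in> cube" using A by (intro exp_cube) (auto intro: b_nonneg)
  have z': "?z' \<in> cube" using A g by (intro exp_cube) (auto intro: b_nonneg)
  have c: "CC \<rho> N ?z \<in> cube" using z \<rho> by (intro CC_cube) auto
  have L: "(\<forall>j\<in>{1..N}. ?z' j \<le> CC \<rho> N ?z j)" "exp (- A * (\<Sum>i=1..N. s i + G i)) \<le> GG \<rho> N ?z"
    using cycle_lower[OF A \<rho> order_refl z] by auto
  have "LL \<rho> ?z \<le> \<rho> * A" using A \<rho> by (intro LL_le) auto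
  also have "\<dots> \<le> A" using A \<rho> by (simp add: mult_left_le_one_le)
  finally have "exp (- A * G 1) \<le> exp (- LL \<rho> ?z * G 1)" using G_pos[of 1] N by (simp add: mult_right_mono)
  also have "\<dots> \<le> exp (- LL \<rho> ?z * G 1 + LL \<rho> (CC \<rho> N ?z) * G 1)"
    using LL_nonneg[OF _ c, of \<rho>] \<rho> G_pos[of 1] N by simp
  finally have e: "exp (- A * G 1) \<le> exp (- LL \<rho> ?z * G 1 + LL \<rho> (CC \<rho> N ?z) * G 1)" .
  have "exp (- A * RR) * Ut \<rho> ?z' = exp (- A * G 1) * exp (- A * (\<Sum>i=1..N. s i + G i)) * Ut \<rho> ?z'"
    by (simp add: RR_def mult_exp_exp algebra_simps)
  also have "\<dots> \<le> exp (- LL \<rho> ?z * G 1 + LL \<rho> (CC \<rho> N ?z) * G 1) * GG \<rho> N ?z * Ut \<rho> (CC \<rho> N ?z)"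
    using e L Ut_bounds[OF z'] Ut_mono[OF z' c] order_trans[OF exp_ge_zero L(2)]
    by (intro mult_mono mult_nonneg_nonneg) auto
  also have "\<dots> = exp (- LL \<rho> ?z * G 1) * (GG \<rho> N ?z * (exp (LL \<rho> (CC \<rho> N ?z) * G 1) * Ut \<rho> (CC \<rho> N ?z)))"
    by (simp only: exp_add mult_ac)
  also have "\<dots> = exp (- LL \<rho> ?z * G 1) * (exp (LL \<rho> ?z * G 1) * Ut \<rho> ?z)"
    by (simp only: stationary[OF \<rho> z])
  also have "\<dots> = Ut \<rho> ?z" by (simp add: mult.assoc[symmetric] mult_exp_exp)
  finally show ?thesis unfolding Ut_exp work_def .
qed

text \<open>Iterating \<open>laplace_work_step\<close> with the exponents
  \<open>gam \<rho> ^ n * A\<close> costs a geometric series in \<open>gam \<rho>\<close>, whose sum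
  is \<open>1 / (pm * (1 - \<rho>))\<close>, while the transform at the shrinking exponent tends to
  1. The resulting lower bound \<open>exp (- A * ?K)\<close> for all \<open>A\<close> bounds the
  mean.\<close>

lemma work_mean:
  assumes \<rho>: "0 < \<rho>" "\<rho> < 1"
  shows "integrable (measure_pmf (Y \<rho>)) work" "(1 - \<rho>) * (\<integral>y. work y \<partial>measure_pmf (Y \<rho>)) \<le> RR / pm"
proof -
  let ?Q = "measure_pmf (Y \<rho>)" and ?g = "gam \<rho>"
  let ?K = "RR / (pm * (1 - \<rho>))"
  have g: "0 \<le> ?g" "?g < 1" using pm \<rho> mult_le_one[of pm "1 - \<rho>"] by (auto simp: gam_def)
  have K0: "0 \<le> ?K" using RR_nonneg pm \<rho> by simp
  have iter: "exp (- A * RR * (\<Sum>k<n. ?g ^ k)) * (\<integral>y. exp (- (?g ^ n * A) * work y) \<partial>?Q) \<le> (\<integral>y. exp (- A * work y) \<partial>?Q)"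
    if A: "0 \<le> A" for A n
  proof (induction n)
    case (Suc n)
    have "exp (- A * RR * (\<Sum>k<Suc n. ?g ^ k)) * (\<integral>y. exp (- (?g ^ Suc n * A) * work y) \<partial>?Q)
      = exp (- A * RR * (\<Sum>k<n. ?g ^ k)) * (exp (- (?g ^ n * A) * RR) * (\<integral>y. exp (- (?g * (?g ^ n * A)) * work y) \<partial>?Q))"
      by (simp add: mult.assoc[symmetric] mult_exp_exp) (simp add: algebra_simps)
    also have "\<dots> \<le> exp (- A * RR * (\<Sum>k<n. ?g ^ k)) * (\<integral>y. exp (- (?g ^ n * A) * work y) \<partial>?Q)"
      using A g by (intro mult_left_mono laplace_work_step \<rho>) auto
    finally show ?case using Suc by simp
  qed simp
  have lower: "exp (- A * ?K) \<le> (\<integral>y. exp (- A * work y) \<partial>?Q)" if A: "0 \<le> A" for A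
  proof (rule LIMSEQ_le_const2)
    show "(\<lambda>n. exp (- A * ?K) * (\<integral>y. exp (- (?g ^ n * A) * work y) \<partial>?Q)) \<longlonglongrightarrow> exp (- A * ?K)"
    proof -
      have "(\<lambda>n. \<integral>y. exp (- (?g ^ n * A) * work y) \<partial>?Q) \<longlonglongrightarrow> (\<integral>y. 1 \<partial>?Q)"
      proof (rule integral_dominated_convergence[where w="\<lambda>_. 1"])
        have "(\<lambda>n. exp (- (?g ^ n * A) * w)) \<longlonglongrightarrow> exp (- (0 * A) * w)" for w
          using g by (intro tendsto_intros LIMSEQ_power_zero) auto
        then show "AE y in ?Q. (\<lambda>n. exp (- (?g ^ n * A) * work y)) \<longlonglongrightarrow> 1" by simp
        show "AE y in ?Q. norm (exp (- (?g ^ n * A) * work y)) \<le> 1" for n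
          using A g work_nonneg by (intro AE_I2) simp
      qed auto
      then have "(\<lambda>n. exp (- A * ?K) * (\<integral>y. exp (- (?g ^ n * A) * work y) \<partial>?Q)) \<longlonglongrightarrow> exp (- A * ?K) * 1"
        by (intro tendsto_intros) simp
      then show ?thesis by simp
    qed
    have "exp (- A * ?K) * (\<integral>y. exp (- (?g ^ n * A) * work y) \<partial>?Q) \<le> (\<integral>y. exp (- A * work y) \<partial>?Q)" for n
    proof -
      have "(\<Sum>k<n. ?g ^ k) \<le> 1 / (1 - ?g)"
      proof -
        have "(\<Sum>k<n. ?g ^ k) = (1 - ?g ^ n) / (1 - ?g)" using g by (subst sum_gp_strict) auto
        also have "\<dots> \<le> 1 / (1 - ?g)" using g by (intro divide_right_mono) auto
        finally show ?thesis .
      qed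
      then have "A * RR * (\<Sum>k<n. ?g ^ k) \<le> A * RR * (1 / (1 - ?g))"
        using A RR_nonneg by (intro mult_left_mono) auto
      also have "\<dots> = A * ?K" by (simp add: gam_def)
      finally have "exp (- A * ?K) \<le> exp (- A * RR * (\<Sum>k<n. ?g ^ k))" by simp
      then have "exp (- A * ?K) * (\<integral>y. exp (- (?g ^ n * A) * work y) \<partial>?Q)
         \<le> exp (- A * RR * (\<Sum>k<n. ?g ^ k)) * (\<integral>y. exp (- (?g ^ n * A) * work y) \<partial>?Q)"
        by (intro mult_right_mono Bochner_Integration.integral_nonneg) auto
      then show ?thesis using iter[OF A, of n] by simp
    qed
    then show "\<exists>N. \<forall>n\<ge>N. exp (- A * ?K) * (\<integral>y. exp (- (?g ^ n * A) * work y) \<partial>?Q) \<le> (\<integral>y. exp (- A * work y) \<partial>?Q)"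
      by blast
  qed
  have "1 - (\<integral>y. exp (- A * work y) \<partial>?Q) \<le> A * ?K" if "0 < A" for A
    using lower[of A] that exp_ge_add_one_self[of "- A * ?K"] by simp
  note M = pmf_mean_from_laplace[OF work_nonneg this]
  show "integrable ?Q work" by (rule M(1))
  have "(1 - \<rho>) * (\<integral>y. work y \<partial>?Q) \<le> (1 - \<rho>) * ?K" using M(2) \<rho> by (intro mult_left_mono) auto
  also have "\<dots> = RR / pm" using \<rho> by simp
  finally show "(1 - \<rho>) * (\<integral>y. work y \<partial>?Q) \<le> RR / pm" .
qed

end

section \<open>First-order expansion and state space collapse\<close>

lemma eventually_left_1: "eventually (\<lambda>\<rho>::real. 0 < \<rho> \<and> \<rho> < 1) (at_left 1)"
  using eventually_at_left_real[of 0 "1::real"] by (auto elim: eventually_mono)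

lemma eps_tendsto: "((\<lambda>\<rho>::real. 1 - \<rho>) \<longlongrightarrow> 0) (at_left 1)"
  by (rule tendsto_eq_intros refl | simp)+

lemma eps_pos: "eventually (\<lambda>\<rho>::real. 0 < 1 - \<rho>) (at_left 1)"
  using eventually_left_1 by eventually_elim simp

lemma small_of_quotient:
  fixes f e :: "'a \<Rightarrow> real"
  assumes "((\<lambda>x. f x / e x) \<longlongrightarrow> k) F" "(e \<longlongrightarrow> 0) F" "eventually (\<lambda>x. 0 < e x) F"
  shows "(f \<longlongrightarrow> 0) F"
proof -
  have "((\<lambda>x. f x / e x * e x) \<longlongrightarrow> k * 0) F" using assms(1,2) by (rule tendsto_mult)
  moreover have "eventually (\<lambda>x. f x / e x * e x = f x) F" using assms(3) by eventually_elim simp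
  ultimately show ?thesis by (simp add: tendsto_cong)
qed

lemma first_order_mult:
  fixes x y e :: "'a \<Rightarrow> real"
  assumes "((\<lambda>t. (1 - x t) / e t) \<longlongrightarrow> a) F" "((\<lambda>t. (1 - y t) / e t) \<longlongrightarrow> c) F" "(e \<longlongrightarrow> 0) F" "eventually (\<lambda>t. 0 < e t) F"
  shows "((\<lambda>t. (1 - x t * y t) / e t) \<longlongrightarrow> a + c) F"
proof -
  have "((\<lambda>t. (1 - x t) / e t + (1 - y t) / e t - e t * ((1 - x t) / e t) * ((1 - y t) / e t)) \<longlongrightarrow> a + c - 0 * a * c) F"
    using assms by (intro tendsto_intros)
  moreover have "eventually (\<lambda>t. (1 - x t) / e t + (1 - y t) / e t - e t * ((1 - x t) / e t) * ((1 - y t) / e t) = (1 - x t * y t) / e t) F"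
    using assms(4) by eventually_elim (simp add: field_simps)
  ultimately show ?thesis by (simp add: tendsto_cong)
qed

lemma first_order_exp:
  fixes u e :: "'a \<Rightarrow> real"
  assumes u: "eventually (\<lambda>t. 0 \<le> u t) F" "((\<lambda>t. u t / e t) \<longlongrightarrow> k) F" and e: "(e \<longlongrightarrow> 0) F" "eventually (\<lambda>t. 0 < e t) F"
  shows "((\<lambda>t. (1 - exp (- u t)) / e t) \<longlongrightarrow> k) F"
proof (rule tendsto_sandwich[of "\<lambda>t. u t / e t - u t / e t * u t / 2" _ F "\<lambda>t. u t / e t"])
  have "(u \<longlongrightarrow> 0) F" by (rule small_of_quotient[OF u(2) e])
  then have "((\<lambda>t. u t / e t - u t / e t * u t / 2) \<longlongrightarrow> k - k * 0 / 2) F" using u by (intro tendsto_intros) auto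
  then show "((\<lambda>t. u t / e t - u t / e t * u t / 2) \<longlongrightarrow> k) F" by simp
  show "eventually (\<lambda>t. u t / e t - u t / e t * u t / 2 \<le> (1 - exp (- u t)) / e t) F"
    using u(1) e(2)
  proof eventually_elim
    case (elim t)
    have "u t - u t * u t / 2 \<le> 1 - exp (- u t)"
      using exp_minus_bounds(4)[OF elim(1)] by (simp add: power2_eq_square)
    then have "(u t - u t * u t / 2) / e t \<le> (1 - exp (- u t)) / e t"
      using elim by (intro divide_right_mono) auto
    then show ?case by (simp add: diff_divide_distrib)
  qed
  show "eventually (\<lambda>t. (1 - exp (- u t)) / e t \<le> u t / e t) F"
    using u(1) e(2) by eventually_elim (use exp_minus_bounds(2) in \<open>auto intro!: divide_right_mono\<close>)
qed (rule u(2))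

context heavy_traffic
begin

definition lin :: "(nat \<Rightarrow> real) \<Rightarrow> real" where
  "lin \<sigma> = (\<Sum>k=1..N. lamh k * \<sigma> k)"

text \<open>\<open>Tl\<close> and \<open>gl\<close> are the linearisations of \<open>TT\<close> and
  of \<open>1 - gt\<close> at \<open>\<rho> = 1\<close>, in the variables \<open>\<sigma>\<close>
  with \<open>1 - z j\<close> asymptotic to \<open>(1 - \<rho>) * \<sigma> j\<close>. That
  asymptotic relation is \<open>first\<close> below.\<close>

definition Tl :: "nat \<Rightarrow> (nat \<Rightarrow> real) \<Rightarrow> nat \<Rightarrow> real" where
  "Tl i \<sigma> = \<sigma>(i := p i * (b i * lin \<sigma>) + (1 - p i) * \<sigma> i)"

definition gl :: "nat \<Rightarrow> (nat \<Rightarrow> real) \<Rightarrow> real" where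
  "gl i \<sigma> = s i * lin \<sigma> + lin (\<sigma>(i := b i * lin \<sigma>)) * G i"

primrec Cl :: "nat \<Rightarrow> (nat \<Rightarrow> real) \<Rightarrow> nat \<Rightarrow> real" where
  "Cl 0 \<sigma> = \<sigma>"
| "Cl (Suc k) \<sigma> = Cl k (Tl (Suc k) \<sigma>)"

primrec Gl :: "nat \<Rightarrow> (nat \<Rightarrow> real) \<Rightarrow> real" where
  "Gl 0 \<sigma> = 0"
| "Gl (Suc k) \<sigma> = gl (Suc k) \<sigma> + Gl k (Tl (Suc k) \<sigma>)"

definition first :: "(real \<Rightarrow> nat \<Rightarrow> real) \<Rightarrow> (nat \<Rightarrow> real) \<Rightarrow> bool" where
  "first z \<sigma> \<longleftrightarrow> eventually (\<lambda>\<rho>. z \<rho> \<in> cube) (at_left 1) \<and>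
     (\<forall>j\<in>{1..N}. ((\<lambda>\<rho>. (1 - z \<rho> j) / (1 - \<rho>)) \<longlongrightarrow> \<sigma> j) (at_left 1))"

lemma firstD: "first z \<sigma> \<Longrightarrow> eventually (\<lambda>\<rho>. z \<rho> \<in> cube) (at_left 1)"
  "first z \<sigma> \<Longrightarrow> j \<in> {1..N} \<Longrightarrow> ((\<lambda>\<rho>. (1 - z \<rho> j) / (1 - \<rho>)) \<longlongrightarrow> \<sigma> j) (at_left 1)"
  by (auto simp: first_def)

lemma first_LL:
  assumes "first z \<sigma>"
  shows "((\<lambda>\<rho>. LL \<rho> (z \<rho>) / (1 - \<rho>)) \<longlongrightarrow> lin \<sigma>) (at_left 1)"
proof -
  have "((\<lambda>\<rho>. \<Sum>j=1..N. \<rho> * lamh j * ((1 - z \<rho> j) / (1 - \<rho>))) \<longlongrightarrow> (\<Sum>j=1..N. 1 * lamh j * \<sigma> j)) (at_left 1)"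
    using assms by (intro tendsto_intros firstD(2)) auto
  then show ?thesis by (simp add: LL_def lin_def sum_divide_distrib)
qed

lemma first_LL_nonneg: "first z \<sigma> \<Longrightarrow> eventually (\<lambda>\<rho>. 0 \<le> LL \<rho> (z \<rho>)) (at_left 1)"
proof -
  assume f: "first z \<sigma>"
  show ?thesis
    using firstD(1)[OF f] eventually_left_1 by eventually_elim (intro LL_nonneg; simp)
qed

lemma first_laplace:
  assumes "first z \<sigma>" "nonneg_law P"
  shows "((\<lambda>\<rho>. (1 - laplace P (LL \<rho> (z \<rho>))) / (1 - \<rho>)) \<longlongrightarrow> moment 1 P * lin \<sigma>) (at_left 1)"
  by (rule nonneg_law.laplace_first_order_compose[OF assms(2) first_LL_nonneg[OF assms(1)] first_LL[OF assms(1)] eps_pos eps_tendsto])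

lemma first_upd:
  assumes f: "first z \<sigma>" and i: "i \<in> {1..N}"
  shows "first (\<lambda>\<rho>. (z \<rho>)(i := laplace (B i) (LL \<rho> (z \<rho>)))) (\<sigma>(i := b i * lin \<sigma>))"
  unfolding first_def
proof (intro conjI ballI)
  show "eventually (\<lambda>\<rho>. (z \<rho>)(i := laplace (B i) (LL \<rho> (z \<rho>))) \<in> cube) (at_left 1)"
    using firstD(1)[OF f] eventually_left_1 by eventually_elim (intro upd_cube i; simp)
  fix j assume "j \<in> {1..N}"
  then show "((\<lambda>\<rho>. (1 - ((z \<rho>)(i := laplace (B i) (LL \<rho> (z \<rho>)))) j) / (1 - \<rho>)) \<longlongrightarrow> (\<sigma>(i := b i * lin \<sigma>)) j) (at_left 1)"
    using first_laplace[OF f B[OF i]] firstD(2)[OF f] by (cases "j = i") (auto simp: b_def)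
qed

lemma first_TT:
  assumes f: "first z \<sigma>" and i: "i \<in> {1..N}"
  shows "first (\<lambda>\<rho>. TT \<rho> i (z \<rho>)) (Tl i \<sigma>)"
  unfolding first_def
proof (intro conjI ballI)
  show "eventually (\<lambda>\<rho>. TT \<rho> i (z \<rho>) \<in> cube) (at_left 1)"
    using firstD(1)[OF f] eventually_left_1 by eventually_elim (intro TT_cube i; simp)
  fix j assume j: "j \<in> {1..N}"
  show "((\<lambda>\<rho>. (1 - TT \<rho> i (z \<rho>) j) / (1 - \<rho>)) \<longlongrightarrow> Tl i \<sigma> j) (at_left 1)"
  proof (cases "j = i")
    case True
    have "((\<lambda>\<rho>. p i * ((1 - laplace (B i) (LL \<rho> (z \<rho>))) / (1 - \<rho>)) + (1 - p i) * ((1 - z \<rho> i) / (1 - \<rho>)))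
        \<longlongrightarrow> p i * (b i * lin \<sigma>) + (1 - p i) * \<sigma> i) (at_left 1)"
      unfolding b_def by (intro tendsto_intros first_laplace[OF f B[OF i]] firstD(2)[OF f i])
    moreover have "p i * ((1 - laplace (B i) (LL \<rho> (z \<rho>))) / (1 - \<rho>)) + (1 - p i) * ((1 - z \<rho> i) / (1 - \<rho>))
       = (1 - TT \<rho> i (z \<rho>) i) / (1 - \<rho>)" for \<rho>
      by (simp add: TT_def add_divide_distrib[symmetric] algebra_simps)
    ultimately show ?thesis unfolding True by (simp add: Tl_def)
  next
    case False
    then show ?thesis using firstD(2)[OF f j] by (simp add: TT_def Tl_def)
  qed
qed

lemma first_CC: "k \<le> N \<Longrightarrow> first z \<sigma> \<Longrightarrow> first (\<lambda>\<rho>. CC \<rho> k (z \<rho>)) (Cl k \<sigma>)"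
proof (induction k arbitrary: z \<sigma>)
  case (Suc k)
  have "first (\<lambda>\<rho>. TT \<rho> (Suc k) (z \<rho>)) (Tl (Suc k) \<sigma>)" by (rule first_TT) (use Suc.prems in auto)
  then show ?case using Suc by simp
qed simp

lemma first_exp_LL:
  assumes f: "first z \<sigma>" and g: "0 \<le> g"
  shows "((\<lambda>\<rho>. (1 - exp (- LL \<rho> (z \<rho>) * g)) / (1 - \<rho>)) \<longlongrightarrow> lin \<sigma> * g) (at_left 1)"
proof -
  have "((\<lambda>\<rho>. (1 - exp (- (LL \<rho> (z \<rho>) * g))) / (1 - \<rho>)) \<longlongrightarrow> lin \<sigma> * g) (at_left 1)"
  proof (rule first_order_exp[OF _ _ eps_tendsto eps_pos])
    show "eventually (\<lambda>\<rho>. 0 \<le> LL \<rho> (z \<rho>) * g) (at_left 1)"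
      using first_LL_nonneg[OF f] by eventually_elim (use g in simp)
    have "((\<lambda>\<rho>. LL \<rho> (z \<rho>) / (1 - \<rho>) * g) \<longlongrightarrow> lin \<sigma> * g) (at_left 1)"
      by (intro tendsto_intros first_LL[OF f])
    then show "((\<lambda>\<rho>. LL \<rho> (z \<rho>) * g / (1 - \<rho>)) \<longlongrightarrow> lin \<sigma> * g) (at_left 1)" by simp
  qed
  then show ?thesis by simp
qed

lemma first_gt:
  assumes f: "first z \<sigma>" and i: "i \<in> {1..N}"
  shows "((\<lambda>\<rho>. (1 - gt \<rho> i (z \<rho>)) / (1 - \<rho>)) \<longlongrightarrow> gl i \<sigma>) (at_left 1)"
  unfolding gt_def gl_def s_def
  using G_pos[OF i] by (intro first_order_mult eps_tendsto eps_pos first_laplace[OF f S[OF i]] first_exp_LL[OF first_upd[OF f i]]) simp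

lemma first_GG: "k \<le> N \<Longrightarrow> first z \<sigma> \<Longrightarrow> ((\<lambda>\<rho>. (1 - GG \<rho> k (z \<rho>)) / (1 - \<rho>)) \<longlongrightarrow> Gl k \<sigma>) (at_left 1)"
proof (induction k arbitrary: z \<sigma>)
  case (Suc k)
  have i: "Suc k \<in> {1..N}" using Suc.prems by simp
  show ?case
    unfolding GG.simps Gl.simps
    using Suc.prems by (intro first_order_mult eps_tendsto eps_pos first_gt[OF _ i] Suc.IH first_TT[OF _ i]) auto
qed simp

lemma lin_b: "lin b = 1" "lin (\<lambda>j. x * b j) = x"
proof -
  show "lin b = 1" using load by (simp add: lin_def)
  have "lin (\<lambda>j. x * b j) = x * (\<Sum>k=1..N. lamh k * b k)"
    by (simp add: lin_def sum_distrib_left mult_ac)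
  then show "lin (\<lambda>j. x * b j) = x" by (simp only: load mult_1_right)
qed

lemma Tl_b: "Tl i (\<lambda>j. x * b j) = (\<lambda>j. x * b j)"
  by (auto simp: Tl_def lin_b algebra_simps)

lemma Cl_b: "Cl k (\<lambda>j. x * b j) = (\<lambda>j. x * b j)"
  by (induction k) (auto simp: Tl_b)

lemma Gl_b: "Gl k (\<lambda>j. x * b j) = x * (\<Sum>i=1..k. s i + G i)"
proof (induction k)
  case (Suc k)
  have "(\<lambda>j. x * b j)(Suc k := b (Suc k) * x) = (\<lambda>j. x * b j)" by auto
  then have "gl (Suc k) (\<lambda>j. x * b j) = x * (s (Suc k) + G (Suc k))"
    by (simp add: gl_def lin_b algebra_simps)
  then show ?case using Suc by (simp add: Tl_b algebra_simps)
qed simp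

definition ranged :: "real \<Rightarrow> real \<Rightarrow> (nat \<Rightarrow> real) \<Rightarrow> bool" where
  "ranged m M \<sigma> \<longleftrightarrow> (\<forall>j\<in>{1..N}. m * b j \<le> \<sigma> j \<and> \<sigma> j \<le> M * b j)"

lemma ranged_lin:
  assumes w: "ranged m M \<sigma>" and i: "i \<in> {1..N}"
  shows "lin \<sigma> \<le> M - lamh i * (M * b i - \<sigma> i)" "m + lamh i * (\<sigma> i - m * b i) \<le> lin \<sigma>"
proof -
  have "lamh i * (M * b i - \<sigma> i) \<le> (\<Sum>j=1..N. lamh j * (M * b j - \<sigma> j))"
    using w i by (intro member_le_sum) (auto simp: ranged_def intro!: mult_nonneg_nonneg lamh_nonneg)
  also have "\<dots> = lin (\<lambda>j. M * b j) - lin \<sigma>"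
    by (simp add: lin_def sum_subtractf[symmetric] algebra_simps)
  finally show "lin \<sigma> \<le> M - lamh i * (M * b i - \<sigma> i)" by (simp add: lin_b)
  have "lamh i * (\<sigma> i - m * b i) \<le> (\<Sum>j=1..N. lamh j * (\<sigma> j - m * b j))"
    using w i by (intro member_le_sum) (auto simp: ranged_def intro!: mult_nonneg_nonneg lamh_nonneg)
  also have "\<dots> = lin \<sigma> - lin (\<lambda>j. m * b j)"
    by (simp add: lin_def sum_subtractf[symmetric] algebra_simps)
  finally show "m + lamh i * (\<sigma> i - m * b i) \<le> lin \<sigma>" by (simp add: lin_b)
qed

text \<open>Least pull towards the old value of coordinate 1 during a cycle: another station gives
  it weight \<open>p j * (lamh 1 * b 1)\<close> through \<open>lin\<close>, and in its own update it
  keeps weight \<open>1 - p 1\<close>.\<close>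

definition contr :: real where "contr = min (pm * (lamh 1 * b 1)) (1 - p 1)"

lemma one_in: "1 \<in> {1..N}"
  using N by simp

lemma contr: "0 < contr" "contr < 1" "contr \<le> 1 - p 1" "j \<in> {1..N} \<Longrightarrow> contr \<le> p j * (lamh 1 * b 1)"
proof -
  show "0 < contr" using pm(1) lamh_pos[OF one_in] b_pos[OF one_in] p_bounds[OF one_in] by (simp add: contr_def)
  show "contr < 1" using p_bounds[OF one_in] by (simp add: contr_def)
  show "contr \<le> 1 - p 1" by (simp add: contr_def)
  assume "j \<in> {1..N}"
  then have "pm * (lamh 1 * b 1) \<le> p j * (lamh 1 * b 1)"
    using pm(2) lamh_nonneg[OF one_in] b_nonneg[OF one_in] by (intro mult_right_mono) auto
  then show "contr \<le> p j * (lamh 1 * b 1)" by (simp add: contr_def)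
qed

text \<open>Dividing the \<open>j\<close>-th coordinate by \<open>b j\<close> turns each stage of the linearised cycle into the
  replacement of one coordinate by an average. As coordinate 1 is replaced last, all other
  coordinates are pulled towards its old value.\<close>

lemma Cl_contract:
  assumes mM: "m \<le> v" "v \<le> M" and k: "1 \<le> k" "k \<le> N" and w: "ranged m M \<sigma>" and v: "\<sigma> 1 = v * b 1"
    and later: "\<And>j. j \<in> {1..N} \<Longrightarrow> k < j \<Longrightarrow> (m + contr * (v - m)) * b j \<le> \<sigma> j \<and> \<sigma> j \<le> (M - contr * (M - v)) * b j"
  shows "ranged (m + contr * (v - m)) (M - contr * (M - v)) (Cl k \<sigma>)"
  using k w v later
proof (induction k arbitrary: \<sigma> rule: nat_induct_at_least)
  case base
  note one = one_in and pb = p_bounds[OF one_in] and b1 = b_nonneg[OF one_in]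
  have lin: "lin \<sigma> \<le> M" "m \<le> lin \<sigma>"
  proof -
    have "m * b 1 \<le> \<sigma> 1" "\<sigma> 1 \<le> M * b 1" using base(2) one unfolding ranged_def by blast+
    then have "0 \<le> lamh 1 * (M * b 1 - \<sigma> 1)" "0 \<le> lamh 1 * (\<sigma> 1 - m * b 1)"
      using lamh_nonneg[OF one] by simp_all
    then show "lin \<sigma> \<le> M" "m \<le> lin \<sigma>" using ranged_lin[OF base(2) one] by linarith+
  qed
  have "p 1 * lin \<sigma> + (1 - p 1) * v \<le> M - contr * (M - v)"
  proof -
    have "p 1 * lin \<sigma> \<le> p 1 * M" using lin pb by (intro mult_left_mono) auto
    moreover have "contr * (M - v) \<le> (1 - p 1) * (M - v)" using contr(3) mM by (intro mult_right_mono) auto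
    ultimately show ?thesis by (simp add: algebra_simps)
  qed
  then have u: "(p 1 * lin \<sigma> + (1 - p 1) * v) * b 1 \<le> (M - contr * (M - v)) * b 1"
    using b1 by (rule mult_right_mono)
  have "m + contr * (v - m) \<le> p 1 * lin \<sigma> + (1 - p 1) * v"
  proof -
    have "p 1 * m \<le> p 1 * lin \<sigma>" using lin pb by (intro mult_left_mono) auto
    moreover have "contr * (v - m) \<le> (1 - p 1) * (v - m)" using contr(3) mM by (intro mult_right_mono) auto
    ultimately show ?thesis by (simp add: algebra_simps)
  qed
  then have l: "(m + contr * (v - m)) * b 1 \<le> (p 1 * lin \<sigma> + (1 - p 1) * v) * b 1"
    using b1 by (rule mult_right_mono)
  have eq: "Tl 1 \<sigma> 1 = (p 1 * lin \<sigma> + (1 - p 1) * v) * b 1" by (simp only: Tl_def fun_upd_same base(3)) (simp add: algebra_simps)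
  show ?case unfolding ranged_def
  proof
    fix j assume j: "j \<in> {1..N}"
    show "(m + contr * (v - m)) * b j \<le> Cl 1 \<sigma> j \<and> Cl 1 \<sigma> j \<le> (M - contr * (M - v)) * b j"
    proof (cases "j = 1")
      case True then show ?thesis using u l eq by simp
    next
      case False
      then have "1 < j" using j by simp
      then show ?thesis using base(4)[OF j] by (simp add: Tl_def)
    qed
  qed
next
  case (Suc k)
  let ?i = "Suc k"
  have i: "?i \<in> {1..N}" "?i \<noteq> 1" using Suc.prems Suc.hyps by auto
  note pb = p_bounds[OF i(1)] and bi = b_nonneg[OF i(1)]
  have wi: "m * b ?i \<le> \<sigma> ?i" "\<sigma> ?i \<le> M * b ?i" using Suc.prems(2) i(1) by (auto simp: ranged_def)
  \<comment> \<open>Relative to \<open>b\<close>, coordinate 1 has weight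
    \<open>lamh 1 * b 1\<close> in the average \<open>lin\<close>, so \<open>lin\<close> keeps that
    fraction of the distance of \<open>v\<close> from either end.\<close>
  have lin: "lin \<sigma> \<le> M - lamh 1 * b 1 * (M - v)" "m + lamh 1 * b 1 * (v - m) \<le> lin \<sigma>"
    using ranged_lin[OF Suc.prems(2) one_in] by (simp_all only: Suc.prems(3)) (simp_all add: algebra_simps)
  have cM: "contr * (M - v) \<le> p ?i * (lamh 1 * b 1) * (M - v)" "contr * (v - m) \<le> p ?i * (lamh 1 * b 1) * (v - m)"
    using contr(4)[OF i(1)] mM by (auto intro: mult_right_mono)
  have "p ?i * lin \<sigma> \<le> p ?i * (M - lamh 1 * b 1 * (M - v))" "p ?i * (m + lamh 1 * b 1 * (v - m)) \<le> p ?i * lin \<sigma>"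
    using lin pb by (auto intro: mult_left_mono)
  then have "p ?i * lin \<sigma> + (1 - p ?i) * M \<le> M - contr * (M - v)" "m + contr * (v - m) \<le> p ?i * lin \<sigma> + (1 - p ?i) * m"
    using cM by (simp_all add: algebra_simps)
  then have B1: "(p ?i * lin \<sigma> + (1 - p ?i) * M) * b ?i \<le> (M - contr * (M - v)) * b ?i"
     "(m + contr * (v - m)) * b ?i \<le> (p ?i * lin \<sigma> + (1 - p ?i) * m) * b ?i"
    using bi by (auto intro: mult_right_mono)
  have B2: "(1 - p ?i) * \<sigma> ?i \<le> (1 - p ?i) * (M * b ?i)" "(1 - p ?i) * (m * b ?i) \<le> (1 - p ?i) * \<sigma> ?i"
    using wi pb by (auto intro: mult_left_mono)
  have new: "(m + contr * (v - m)) * b ?i \<le> Tl ?i \<sigma> ?i" "Tl ?i \<sigma> ?i \<le> (M - contr * (M - v)) * b ?i"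
    using B1 B2 by (simp_all add: Tl_def algebra_simps)
  have "m \<le> m + contr * (v - m)" "M - contr * (M - v) \<le> M" using contr(1) mM by auto
  then have wide: "m * b ?i \<le> (m + contr * (v - m)) * b ?i" "(M - contr * (M - v)) * b ?i \<le> M * b ?i"
    using bi by (auto intro: mult_right_mono)
  show ?case
    unfolding Cl.simps
  proof (rule Suc.IH)
    show "ranged m M (Tl ?i \<sigma>)"
      unfolding ranged_def
    proof
      fix j assume "j \<in> {1..N}"
      then show "m * b j \<le> Tl ?i \<sigma> j \<and> Tl ?i \<sigma> j \<le> M * b j"
        using Suc.prems(2) new wide by (cases "j = ?i") (auto simp: ranged_def Tl_def)
    qed
    show "Tl ?i \<sigma> 1 = v * b 1" using Suc.prems(3) i(2) by (simp add: Tl_def)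
    show "(m + contr * (v - m)) * b j \<le> Tl ?i \<sigma> j \<and> Tl ?i \<sigma> j \<le> (M - contr * (M - v)) * b j"
      if "j \<in> {1..N}" "k < j" for j
      using new Suc.prems(4)[OF that(1)] that(2) by (cases "j = ?i") (auto simp: Tl_def)
  qed (use Suc.prems in auto)
qed

lemma Cl_contract_iter:
  assumes "ranged m M \<sigma>"
  shows "\<exists>m' M'. ranged m' M' ((Cl N ^^ n) \<sigma>) \<and> M' - m' = (1 - contr) ^ n * (M - m)"
proof (induction n)
  case 0
  then show ?case using assms by auto
next
  case (Suc n)
  then obtain m' M' where w: "ranged m' M' ((Cl N ^^ n) \<sigma>)" and e: "M' - m' = (1 - contr) ^ n * (M - m)" by blast
  define v where "v = (Cl N ^^ n) \<sigma> 1 / b 1"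
  have v: "(Cl N ^^ n) \<sigma> 1 = v * b 1" using b_pos[OF one_in] by (simp add: v_def)
  have "m' \<le> v" "v \<le> M'" using w one_in b_pos[OF one_in] unfolding ranged_def v_def by (auto simp: pos_le_divide_eq pos_divide_le_eq)
  from Cl_contract[OF this N order_refl w v]
  have "ranged (m' + contr * (v - m')) (M' - contr * (M' - v)) (Cl N ((Cl N ^^ n) \<sigma>))" by simp
  \<comment> \<open>The gains at the two ends add up to \<open>contr * (M' - m')\<close> wherever
    \<open>v\<close> lies, so the width shrinks by a fixed factor.\<close>
  moreover have "(M' - contr * (M' - v)) - (m' + contr * (v - m')) = (1 - contr) ^ Suc n * (M - m)"
  proof -
    have "(M' - contr * (M' - v)) - (m' + contr * (v - m')) = (1 - contr) * (M' - m')" by (simp add: algebra_simps)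
    then show ?thesis by (simp add: e)
  qed
  ultimately show ?case by auto
qed

text \<open>Up to scale, the mean population of type \<open>j\<close> at the start of the stage of
  station \<open>k + 1\<close> at load 1. Station \<open>i\<close> takes the share
  \<open>lamh i * b i\<close> of a cycle; the sum is the share that has passed since the last visit
  to \<open>j\<close>. The term \<open>(1 - p j) / p j\<close> accounts for customers left in orbit
  by earlier glue periods. \<open>Uf 0\<close> is the coefficient \<open>u_coeff\<close>.\<close>

definition Uf :: "nat \<Rightarrow> nat \<Rightarrow> real" where
  "Uf k j = lamh j * ((1 - p j) / p j + (if j \<le> k then \<Sum>i=j..k. lamh i * b i
      else (\<Sum>i=j..N. lamh i * b i) + (\<Sum>i=1..k. lamh i * b i)))"

definition Lf :: "nat \<Rightarrow> (nat \<Rightarrow> real) \<Rightarrow> real" where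
  "Lf k \<sigma> = (\<Sum>j=1..N. Uf k j * \<sigma> j)"

lemma load_split:
  assumes "Suc k \<le> N"
  shows "(\<Sum>i=Suc k..N. lamh i * b i) + (\<Sum>i=1..k. lamh i * b i) = 1"
proof -
  have "(\<Sum>i=Suc k..N. lamh i * b i) + (\<Sum>i=1..k. lamh i * b i) = (\<Sum>i\<in>{Suc k..N} \<union> {1..k}. lamh i * b i)"
    by (rule sum.union_disjoint[symmetric]) auto
  also have "{Suc k..N} \<union> {1..k} = {1..N}" using assms by auto
  finally show ?thesis by (simp only: load)
qed

text \<open>Balance at a visit: since the loads add up to 1, the population of the visited station
  has collected arrivals over a whole cycle, and the served fraction of it equals those
  arrivals.\<close>

lemma Uf_served:
  assumes "Suc k \<le> N" shows "Uf k (Suc k) * p (Suc k) = lamh (Suc k)"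
proof -
  have "Uf k (Suc k) = lamh (Suc k) * ((1 - p (Suc k)) / p (Suc k) + 1)"
    using load_split[OF assms] by (simp add: Uf_def)
  then show ?thesis using p_bounds[of "Suc k"] assms by (simp add: field_simps)
qed

text \<open>The stage of station \<open>Suc k\<close> adds arrivals during its share
  \<open>lamh (Suc k) * b (Suc k)\<close> of the cycle and removes the customers served, which
  number \<open>lamh (Suc k)\<close> by \<open>Uf_served\<close>.\<close>

lemma Uf_Suc:
  assumes "Suc k \<le> N" "j \<in> {1..N}"
  shows "Uf (Suc k) j = Uf k j + lamh (Suc k) * b (Suc k) * lamh j - (if j = Suc k then lamh (Suc k) else 0)"
proof -
  consider "j \<le> k" | "j = Suc k" | "Suc k < j" by linarith
  then show ?thesis
  proof cases
    case 2
    have "Uf k (Suc k) = lamh (Suc k) * ((1 - p (Suc k)) / p (Suc k) + 1)"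
      using load_split[OF assms(1)] by (simp add: Uf_def)
    then show ?thesis using 2 by (simp add: Uf_def algebra_simps)
  qed (simp_all add: Uf_def algebra_simps)
qed

lemma Lf_upd: "i \<in> {1..N} \<Longrightarrow> Lf k (\<sigma>(i := x)) = Lf k \<sigma> + Uf k i * (x - \<sigma> i)"
proof -
  assume i: "i \<in> {1..N}"
  have "Lf k (\<sigma>(i := x)) = Uf k i * x + (\<Sum>j\<in>{1..N} - {i}. Uf k j * \<sigma> j)"
    unfolding Lf_def using i by (subst sum.remove[of _ i]) (auto intro!: sum.cong)
  moreover have "Lf k \<sigma> = Uf k i * \<sigma> i + (\<Sum>j\<in>{1..N} - {i}. Uf k j * \<sigma> j)"
    unfolding Lf_def using i by (subst sum.remove[of _ i]) auto
  ultimately show ?thesis by (simp add: algebra_simps)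
qed

text \<open>The transpose of \<open>Uf_Suc\<close>: exponents are carried backwards through a stage,
  populations forwards. Since \<open>Uf N\<close> and \<open>Uf 0\<close> agree on
  \<open>{1..N}\<close>, a full cycle leaves \<open>Lf 0\<close> invariant.\<close>

lemma Lf_Tl:
  assumes "Suc k \<le> N"
  shows "Lf k (Tl (Suc k) \<sigma>) = Lf (Suc k) \<sigma>"
proof -
  let ?i = "Suc k"
  have i: "?i \<in> {1..N}" using assms by simp
  have "Lf k (Tl ?i \<sigma>) = Lf k \<sigma> + Uf k ?i * p ?i * (b ?i * lin \<sigma> - \<sigma> ?i)"
    unfolding Tl_def by (subst Lf_upd[OF i]) (simp add: algebra_simps)
  also have "\<dots> = Lf k \<sigma> + lamh ?i * b ?i * lin \<sigma> - lamh ?i * \<sigma> ?i"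
    unfolding Uf_served[OF assms] by (simp add: algebra_simps)
  also have "\<dots> = (\<Sum>j=1..N. (Uf k j + lamh ?i * b ?i * lamh j - (if j = ?i then lamh ?i else 0)) * \<sigma> j)"
  proof -
    have "(\<Sum>j=1..N. (if j = ?i then lamh ?i else 0) * \<sigma> j) = lamh ?i * \<sigma> ?i"
      using i by (simp add: if_distrib[of "\<lambda>x. x * _"] cong: if_cong)
    then show ?thesis
      by (simp add: Lf_def lin_def sum_distrib_left sum.distrib sum_subtractf algebra_simps)
  qed
  also have "\<dots> = Lf ?i \<sigma>"
    unfolding Lf_def by (intro sum.cong refl) (simp only: Uf_Suc[OF assms])
  finally show ?thesis .
qed

lemma Lf_Cl: "k \<le> N \<Longrightarrow> Lf 0 (Cl k \<sigma>) = Lf k \<sigma>"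
  by (induction k arbitrary: \<sigma>) (auto simp: Lf_Tl)

lemma Lf_N: "Lf N \<sigma> = Lf 0 \<sigma>"
  unfolding Lf_def Uf_def by (intro sum.cong) auto

lemma Lf_iter: "Lf 0 ((Cl N ^^ n) \<sigma>) = Lf 0 \<sigma>"
  by (induction n) (auto simp: Lf_Cl Lf_N)

definition dl :: real where "dl = Lf 0 b"

lemma Uf_pos: "j \<in> {1..N} \<Longrightarrow> 0 < Uf 0 j"
proof -
  assume j: "j \<in> {1..N}"
  have "0 < (1 - p j) / p j" using p_bounds[OF j] by simp
  moreover have "0 \<le> (\<Sum>i=j..N. lamh i * b i)"
    using j by (intro sum_nonneg mult_nonneg_nonneg) (auto intro!: lamh_nonneg b_nonneg)
  ultimately show ?thesis using j lamh_pos[OF j] by (simp add: Uf_def add_pos_nonneg)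
qed

lemma dl_pos: "0 < dl"
  unfolding dl_def Lf_def using N by (intro sum_pos) (auto intro!: mult_pos_pos Uf_pos b_pos)

lemma ranged_Lf: "ranged m M \<sigma> \<Longrightarrow> m * dl \<le> Lf 0 \<sigma> \<and> Lf 0 \<sigma> \<le> M * dl"
proof -
  assume w: "ranged m M \<sigma>"
  have "(\<Sum>j=1..N. Uf 0 j * (m * b j)) \<le> Lf 0 \<sigma>" "Lf 0 \<sigma> \<le> (\<Sum>j=1..N. Uf 0 j * (M * b j))"
    unfolding Lf_def using w Uf_pos by (auto intro!: sum_mono mult_left_mono simp: ranged_def less_imp_le)
  then show ?thesis by (simp add: dl_def Lf_def sum_distrib_left mult_ac)
qed

definition theta :: "(nat \<Rightarrow> real) \<Rightarrow> real" where "theta \<sigma> = Lf 0 \<sigma> / dl"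

text \<open>The range of the ratios to \<open>b\<close> shrinks geometrically. Every such range
  contains \<open>theta \<sigma>\<close>, because \<open>Lf 0\<close> has positive weights and is
  invariant under the cycle; this identifies the limit.\<close>

lemma Cl_limit:
  assumes "j \<in> {1..N}"
  shows "(\<lambda>n. (Cl N ^^ n) \<sigma> j) \<longlonglongrightarrow> theta \<sigma> * b j"
proof -
  define M where "M = (\<Sum>j=1..N. \<bar>\<sigma> j\<bar> / b j)"
  have "\<bar>\<sigma> j\<bar> \<le> M * b j" if j: "j \<in> {1..N}" for j
  proof -
    have "\<bar>\<sigma> j\<bar> / b j \<le> M"
      unfolding M_def using j by (intro member_le_sum) (auto intro!: divide_nonneg_nonneg b_nonneg)
    then show ?thesis using b_pos[OF j] by (simp add: divide_le_eq)
  qed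
  then have w: "ranged (- M) M \<sigma>" by (auto simp: ranged_def abs_le_iff minus_le_iff)
  have bound: "norm ((Cl N ^^ n) \<sigma> j - theta \<sigma> * b j) \<le> (1 - contr) ^ n * (2 * M * b j)" for n
  proof -
    obtain m' M' where w': "ranged m' M' ((Cl N ^^ n) \<sigma>)" and e: "M' - m' = (1 - contr) ^ n * (M - (- M))"
      using Cl_contract_iter[OF w] by blast
    have "m' \<le> theta \<sigma>" "theta \<sigma> \<le> M'"
      using ranged_Lf[OF w'] dl_pos by (auto simp: Lf_iter theta_def field_simps)
    then have "m' * b j \<le> theta \<sigma> * b j" "theta \<sigma> * b j \<le> M' * b j"
      using b_nonneg[OF assms] by (auto intro: mult_right_mono)
    then have "norm ((Cl N ^^ n) \<sigma> j - theta \<sigma> * b j) \<le> M' * b j - m' * b j"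
    proof -
      have "m' * b j \<le> (Cl N ^^ n) \<sigma> j" "(Cl N ^^ n) \<sigma> j \<le> M' * b j"
        using w' assms unfolding ranged_def by blast+
      with \<open>m' * b j \<le> theta \<sigma> * b j\<close> \<open>theta \<sigma> * b j \<le> M' * b j\<close> show ?thesis
        unfolding real_norm_def by (intro abs_leI) linarith+
    qed
    also have "\<dots> = (M' - m') * b j" by (simp add: algebra_simps)
    finally show ?thesis by (simp add: e mult_ac)
  qed
  have "(\<lambda>n. (1 - contr) ^ n) \<longlonglongrightarrow> 0"
    using contr(1,2) by (intro LIMSEQ_power_zero) simp
  then have "(\<lambda>n. (1 - contr) ^ n * (2 * M * b j)) \<longlonglongrightarrow> 0"
    by (rule tendsto_mult_left_zero)
  then have "(\<lambda>n. (Cl N ^^ n) \<sigma> j - theta \<sigma> * b j) \<longlonglongrightarrow> 0"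
    by (rule Lim_null_comparison[rotated]) (intro always_eventually allI bound)
  then show ?thesis by (simp add: LIM_zero_iff)
qed

lemma Tl_nonneg: "i \<in> {1..N} \<Longrightarrow> (\<And>j. j \<in> {1..N} \<Longrightarrow> 0 \<le> \<sigma> j) \<Longrightarrow> j \<in> {1..N} \<Longrightarrow> 0 \<le> Tl i \<sigma> j"
proof -
  assume i: "i \<in> {1..N}" and \<sigma>: "\<And>j. j \<in> {1..N} \<Longrightarrow> 0 \<le> \<sigma> j" and j: "j \<in> {1..N}"
  have "0 \<le> lin \<sigma>" unfolding lin_def by (intro sum_nonneg mult_nonneg_nonneg \<sigma> lamh_nonneg)
  then show ?thesis
    using p_bounds[OF i] b_nonneg[OF i] \<sigma>[OF i] \<sigma>[OF j] by (auto simp: Tl_def)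
qed

lemma Cl_nonneg: "k \<le> N \<Longrightarrow> (\<And>j. j \<in> {1..N} \<Longrightarrow> 0 \<le> \<sigma> j) \<Longrightarrow> j \<in> {1..N} \<Longrightarrow> 0 \<le> Cl k \<sigma> j"
proof (induction k arbitrary: \<sigma>)
  case (Suc k)
  have "0 \<le> Cl k (Tl (Suc k) \<sigma>) j"
    by (rule Suc.IH) (use Suc.prems Tl_nonneg[of "Suc k" \<sigma>] in auto)
  then show ?case by simp
qed auto

lemma Cl_iter_nonneg: "(\<And>j. j \<in> {1..N} \<Longrightarrow> 0 \<le> \<sigma> j) \<Longrightarrow> j \<in> {1..N} \<Longrightarrow> 0 \<le> (Cl N ^^ n) \<sigma> j"
proof (induction n arbitrary: j)
  case (Suc n)
  then show ?case using Cl_nonneg[OF order_refl, of "(Cl N ^^ n) \<sigma>" j] by simp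
qed auto

lemma first_exp:
  assumes "\<And>j. j \<in> {1..N} \<Longrightarrow> 0 \<le> \<sigma> j"
  shows "first (\<lambda>\<rho> j. exp (- (1 - \<rho>) * \<sigma> j)) \<sigma>"
  unfolding first_def
proof (intro conjI ballI)
  show "eventually (\<lambda>\<rho>. (\<lambda>j. exp (- (1 - \<rho>) * \<sigma> j)) \<in> cube) (at_left 1)"
    using eps_pos by eventually_elim (use assms in \<open>auto simp: cube_def mult_le_0_iff\<close>)
  fix j assume j: "j \<in> {1..N}"
  have "((\<lambda>\<rho>. (1 - exp (- ((1 - \<rho>) * \<sigma> j))) / (1 - \<rho>)) \<longlongrightarrow> \<sigma> j) (at_left 1)"
  proof (rule first_order_exp[OF _ _ eps_tendsto eps_pos])
    show "eventually (\<lambda>\<rho>. 0 \<le> (1 - \<rho>) * \<sigma> j) (at_left 1)"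
      using eps_pos by eventually_elim (use assms[OF j] in simp)
    have "eventually (\<lambda>\<rho>. (1 - \<rho>) * \<sigma> j / (1 - \<rho>) = \<sigma> j) (at_left 1)"
      using eps_pos by eventually_elim simp
    then show "((\<lambda>\<rho>. (1 - \<rho>) * \<sigma> j / (1 - \<rho>)) \<longlongrightarrow> \<sigma> j) (at_left 1)" by (simp add: tendsto_cong)
  qed
  then show "((\<lambda>\<rho>. (1 - exp (- (1 - \<rho>) * \<sigma> j)) / (1 - \<rho>)) \<longlongrightarrow> \<sigma> j) (at_left 1)" by (simp only: mult_minus_left)
qed

end

context heavy_traffic_steady
begin

lemma tot_mean:
  assumes \<rho>: "0 < \<rho>" "\<rho> < 1" and j: "j \<in> {1..N}"
  shows "integrable (measure_pmf (Y \<rho>)) (\<lambda>y. real (tot y j))"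
    "(1 - \<rho>) * (\<integral>y. real (tot y j) \<partial>measure_pmf (Y \<rho>)) \<le> RR / (pm * b j)"
proof -
  note bj = b_pos[OF j]
  have le: "b j * real (tot y j) \<le> work y" for y
    unfolding work_def using j by (intro member_le_sum) (auto intro!: mult_nonneg_nonneg b_nonneg)
  then have le': "real (tot y j) \<le> work y / b j" for y
    using bj by (simp add: field_simps)
  show i: "integrable (measure_pmf (Y \<rho>)) (\<lambda>y. real (tot y j))"
  proof (rule Bochner_Integration.integrable_bound)
    show "integrable (measure_pmf (Y \<rho>)) (\<lambda>y. work y / b j)" using work_mean(1)[OF \<rho>] by simp
    show "AE y in measure_pmf (Y \<rho>). norm (real (tot y j)) \<le> norm (work y / b j)"
    proof (rule AE_I2)
      fix y show "norm (real (tot y j)) \<le> norm (work y / b j)"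
        using le'[of y] abs_ge_self[of "work y / b j"] by simp
    qed
  qed simp
  have "(\<integral>y. real (tot y j) \<partial>measure_pmf (Y \<rho>)) \<le> (\<integral>y. work y / b j \<partial>measure_pmf (Y \<rho>))"
    using i work_mean(1)[OF \<rho>] le' by (intro integral_mono) auto
  then have "(1 - \<rho>) * (\<integral>y. real (tot y j) \<partial>measure_pmf (Y \<rho>)) \<le> (1 - \<rho>) * ((\<integral>y. work y \<partial>measure_pmf (Y \<rho>)) / b j)"
    using \<rho> by (intro mult_left_mono) auto
  also have "\<dots> = (1 - \<rho>) * (\<integral>y. work y \<partial>measure_pmf (Y \<rho>)) / b j" by simp
  also have "\<dots> \<le> RR / pm / b j" using work_mean(2)[OF \<rho>] bj by (intro divide_right_mono) auto
  finally show "(1 - \<rho>) * (\<integral>y. real (tot y j) \<partial>measure_pmf (Y \<rho>)) \<le> RR / (pm * b j)" by simp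
qed

text \<open>On the cube a monomial changes by at most the exponent times the change of the
  coordinate. The means of the counts are of order \<open>1 / (1 - \<rho>)\<close> by
  \<open>work_mean\<close>, so after scaling the constant does not depend on
  \<open>\<rho>\<close>.\<close>

lemma Ut_lipschitz:
  assumes \<rho>: "0 < \<rho>" "\<rho> < 1" and z: "z \<in> cube" "z' \<in> cube"
  shows "\<bar>Ut \<rho> z - Ut \<rho> z'\<bar> \<le> (\<Sum>j=1..N. \<bar>z j - z' j\<bar> / (1 - \<rho>) * (RR / (pm * b j)))"
proof -
  let ?Q = "measure_pmf (Y \<rho>)"
  have pt: "\<bar>(\<Prod>j=1..N. z j ^ tot y j) - (\<Prod>j=1..N. z' j ^ tot y j)\<bar> \<le> (\<Sum>j=1..N. \<bar>z j - z' j\<bar> * real (tot y j))" for y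
  proof -
    have zb: "norm (z j) \<le> 1" "norm (z' j) \<le> 1" if "j \<in> {1..N}" for j using z that by (auto simp: cube_def)
    have "norm ((\<Prod>j=1..N. z j ^ tot y j) - (\<Prod>j=1..N. z' j ^ tot y j)) \<le> (\<Sum>j=1..N. norm (z j ^ tot y j - z' j ^ tot y j))"
    proof (intro norm_prod_diff)
      fix j assume j: "j \<in> {1..N}"
      show "norm (z j ^ tot y j) \<le> 1" "norm (z' j ^ tot y j) \<le> 1"
        unfolding norm_power using zb[OF j] by (auto intro!: power_le_one)
    qed
    also have "\<dots> \<le> (\<Sum>j=1..N. \<bar>z j - z' j\<bar> * real (tot y j))"
    proof (rule sum_mono)
      fix j assume j: "j \<in> {1..N}"
      show "norm (z j ^ tot y j - z' j ^ tot y j) \<le> \<bar>z j - z' j\<bar> * real (tot y j)"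
        using norm_power_diff[OF zb(1)[OF j] zb(2)[OF j], of "tot y j"] by (simp add: mult.commute)
    qed
    finally show ?thesis by simp
  qed
  have int: "integrable ?Q (\<lambda>y. \<bar>z j - z' j\<bar> * real (tot y j))" if "j \<in> {1..N}" for j
    using tot_mean(1)[OF \<rho> that] by simp
  have "\<bar>Ut \<rho> z - Ut \<rho> z'\<bar> = \<bar>\<integral>y. (\<Prod>j=1..N. z j ^ tot y j) - (\<Prod>j=1..N. z' j ^ tot y j) \<partial>?Q\<bar>"
    unfolding Ut_def using integrable_prod z by (subst Bochner_Integration.integral_diff) auto
  also have "\<dots> \<le> (\<integral>y. \<bar>(\<Prod>j=1..N. z j ^ tot y j) - (\<Prod>j=1..N. z' j ^ tot y j)\<bar> \<partial>?Q)"
    using integral_norm_bound[of ?Q "\<lambda>y. (\<Prod>j=1..N. z j ^ tot y j) - (\<Prod>j=1..N. z' j ^ tot y j)"] by simp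
  also have "\<dots> \<le> (\<integral>y. (\<Sum>j=1..N. \<bar>z j - z' j\<bar> * real (tot y j)) \<partial>?Q)"
    using pt int integrable_prod z by (intro integral_mono Bochner_Integration.integrable_sum integrable_abs Bochner_Integration.integrable_diff) auto
  also have "\<dots> = (\<Sum>j=1..N. \<bar>z j - z' j\<bar> * (\<integral>y. real (tot y j) \<partial>?Q))"
    using int by (subst Bochner_Integration.integral_sum) auto
  also have "\<dots> \<le> (\<Sum>j=1..N. \<bar>z j - z' j\<bar> / (1 - \<rho>) * (RR / (pm * b j)))"
  proof (rule sum_mono)
    fix j assume j: "j \<in> {1..N}"
    have "\<bar>z j - z' j\<bar> / (1 - \<rho>) * ((1 - \<rho>) * (\<integral>y. real (tot y j) \<partial>?Q)) \<le> \<bar>z j - z' j\<bar> / (1 - \<rho>) * (RR / (pm * b j))"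
      using tot_mean(2)[OF \<rho> j] \<rho> by (intro mult_left_mono) auto
    then show "\<bar>z j - z' j\<bar> * (\<integral>y. real (tot y j) \<partial>?Q) \<le> \<bar>z j - z' j\<bar> / (1 - \<rho>) * (RR / (pm * b j))"
      using \<rho> by simp
  qed
  finally show ?thesis .
qed

lemma first_close:
  assumes "first z \<sigma>" "first z' \<sigma>"
  shows "((\<lambda>\<rho>. Ut \<rho> (z \<rho>) - Ut \<rho> (z' \<rho>)) \<longlongrightarrow> 0) (at_left 1)"
proof (rule Lim_null_comparison)
  show "eventually (\<lambda>\<rho>. norm (Ut \<rho> (z \<rho>) - Ut \<rho> (z' \<rho>)) \<le>
     (\<Sum>j=1..N. \<bar>(1 - z' \<rho> j) / (1 - \<rho>) - (1 - z \<rho> j) / (1 - \<rho>)\<bar> * (RR / (pm * b j)))) (at_left 1)"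
    using firstD(1)[OF assms(1)] firstD(1)[OF assms(2)] eventually_left_1
  proof eventually_elim
    case (elim \<rho>)
    have "\<bar>(1 - z' \<rho> j) / (1 - \<rho>) - (1 - z \<rho> j) / (1 - \<rho>)\<bar> = \<bar>z \<rho> j - z' \<rho> j\<bar> / (1 - \<rho>)" for j
      using elim by (simp add: diff_divide_distrib[symmetric] abs_divide)
    then show ?case using Ut_lipschitz[of \<rho> "z \<rho>" "z' \<rho>"] elim by simp
  qed
  have "((\<lambda>\<rho>. \<Sum>j=1..N. \<bar>(1 - z' \<rho> j) / (1 - \<rho>) - (1 - z \<rho> j) / (1 - \<rho>)\<bar> * (RR / (pm * b j))) \<longlongrightarrow>
     (\<Sum>j=1..N. \<bar>\<sigma> j - \<sigma> j\<bar> * (RR / (pm * b j)))) (at_left 1)"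
    using assms by (intro tendsto_intros firstD(2)) auto
  then show "((\<lambda>\<rho>. \<Sum>j=1..N. \<bar>(1 - z' \<rho> j) / (1 - \<rho>) - (1 - z \<rho> j) / (1 - \<rho>)\<bar> * (RR / (pm * b j))) \<longlongrightarrow> 0) (at_left 1)"
    by simp
qed

text \<open>Arranged so that each bracket is of order \<open>1 - \<rho>\<close>. As it stands it
  shows that \<open>Ut\<close> hardly changes over a cycle; divided by \<open>1 - \<rho>\<close> it
  gives the drift.\<close>

lemma stationary_difference:
  assumes \<rho>: "0 < \<rho>" "\<rho> < 1" and z: "z \<in> cube"
  shows "Ut \<rho> (CC \<rho> N z) - Ut \<rho> z = Ut \<rho> (CC \<rho> N z) * (1 - GG \<rho> N z * exp (- LL \<rho> z * G 1))
      - Ut \<rho> z * (1 - exp (- LL \<rho> (CC \<rho> N z) * G 1))"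
proof -
  let ?a = "LL \<rho> z * G 1" and ?c = "LL \<rho> (CC \<rho> N z) * G 1"
  have "Ut \<rho> z * exp (- ?c) = exp (- ?a) * exp (- ?c) * (exp ?a * Ut \<rho> z)"
    by (simp add: mult_exp_exp mult.assoc[symmetric])
  also have "\<dots> = exp (- ?a) * exp (- ?c) * (GG \<rho> N z * (exp ?c * Ut \<rho> (CC \<rho> N z)))"
    by (simp only: stationary[OF \<rho> z])
  also have "\<dots> = (exp (- ?c) * exp ?c) * (GG \<rho> N z * exp (- ?a) * Ut \<rho> (CC \<rho> N z))"
    by (simp only: mult_ac)
  also have "exp (- ?c) * exp ?c = 1" by (simp add: mult_exp_exp)
  finally show ?thesis by (simp add: algebra_simps)
qed

lemma stationary_first_order:
  assumes f: "first z \<sigma>"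
  shows "((\<lambda>\<rho>. (1 - GG \<rho> N (z \<rho>) * exp (- LL \<rho> (z \<rho>) * G 1)) / (1 - \<rho>)) \<longlongrightarrow> Gl N \<sigma> + lin \<sigma> * G 1) (at_left 1)"
    and "((\<lambda>\<rho>. (1 - exp (- LL \<rho> (CC \<rho> N (z \<rho>)) * G 1)) / (1 - \<rho>)) \<longlongrightarrow> lin (Cl N \<sigma>) * G 1) (at_left 1)"
proof -
  have G1: "0 \<le> G 1" using G_pos[OF one_in] by simp
  show "((\<lambda>\<rho>. (1 - GG \<rho> N (z \<rho>) * exp (- LL \<rho> (z \<rho>) * G 1)) / (1 - \<rho>)) \<longlongrightarrow> Gl N \<sigma> + lin \<sigma> * G 1) (at_left 1)"
    by (intro first_order_mult first_GG[OF order_refl f] first_exp_LL[OF f G1] eps_tendsto eps_pos)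
  show "((\<lambda>\<rho>. (1 - exp (- LL \<rho> (CC \<rho> N (z \<rho>)) * G 1)) / (1 - \<rho>)) \<longlongrightarrow> lin (Cl N \<sigma>) * G 1) (at_left 1)"
    by (rule first_exp_LL[OF first_CC[OF order_refl f] G1])
qed

lemma bounded_mult_null:
  fixes f g :: "real \<Rightarrow> real"
  assumes "eventually (\<lambda>\<rho>. 0 \<le> f \<rho> \<and> f \<rho> \<le> 1) F" "(g \<longlongrightarrow> 0) F"
  shows "((\<lambda>\<rho>. f \<rho> * g \<rho>) \<longlongrightarrow> 0) F"
proof (rule Lim_null_comparison)
  show "eventually (\<lambda>\<rho>. norm (f \<rho> * g \<rho>) \<le> \<bar>g \<rho>\<bar>) F"
    using assms(1) by eventually_elim (auto simp: abs_mult intro!: mult_left_le_one_le)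
  show "((\<lambda>\<rho>. \<bar>g \<rho>\<bar>) \<longlongrightarrow> 0) F" using assms(2) by (rule tendsto_rabs_zero)
qed

lemma first_Ut_bounds: "first z \<sigma> \<Longrightarrow> eventually (\<lambda>\<rho>. 0 \<le> Ut \<rho> (z \<rho>) \<and> Ut \<rho> (z \<rho>) \<le> 1) (at_left 1)"
proof -
  assume f: "first z \<sigma>"
  show ?thesis using firstD(1)[OF f] by eventually_elim (simp add: Ut_bounds)
qed

lemma first_cycle:
  assumes f: "first z \<sigma>"
  shows "((\<lambda>\<rho>. Ut \<rho> (CC \<rho> N (z \<rho>)) - Ut \<rho> (z \<rho>)) \<longlongrightarrow> 0) (at_left 1)"
proof -
  have f': "first (\<lambda>\<rho>. CC \<rho> N (z \<rho>)) (Cl N \<sigma>)" by (rule first_CC[OF order_refl f])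
  have "((\<lambda>\<rho>. Ut \<rho> (CC \<rho> N (z \<rho>)) * (1 - GG \<rho> N (z \<rho>) * exp (- LL \<rho> (z \<rho>) * G 1))
      - Ut \<rho> (z \<rho>) * (1 - exp (- LL \<rho> (CC \<rho> N (z \<rho>)) * G 1))) \<longlongrightarrow> 0 - 0) (at_left 1)"
    by (intro tendsto_diff bounded_mult_null first_Ut_bounds[OF f'] first_Ut_bounds[OF f]
        small_of_quotient[OF stationary_first_order(1)[OF f] eps_tendsto eps_pos]
        small_of_quotient[OF stationary_first_order(2)[OF f] eps_tendsto eps_pos])
  moreover have "eventually (\<lambda>\<rho>. Ut \<rho> (CC \<rho> N (z \<rho>)) - Ut \<rho> (z \<rho>) = Ut \<rho> (CC \<rho> N (z \<rho>)) * (1 - GG \<rho> N (z \<rho>) * exp (- LL \<rho> (z \<rho>) * G 1))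
      - Ut \<rho> (z \<rho>) * (1 - exp (- LL \<rho> (CC \<rho> N (z \<rho>)) * G 1))) (at_left 1)"
    using firstD(1)[OF f] eventually_left_1 by eventually_elim (rule stationary_difference; simp)
  ultimately show ?thesis by (simp add: tendsto_cong)
qed

definition chi :: "real \<Rightarrow> (nat \<Rightarrow> real) \<Rightarrow> real" where
  "chi \<rho> \<sigma> = Ut \<rho> (\<lambda>j. exp (- (1 - \<rho>) * \<sigma> j))"

lemma chi_iter:
  assumes "\<And>j. j \<in> {1..N} \<Longrightarrow> 0 \<le> \<sigma> j"
  shows "((\<lambda>\<rho>. chi \<rho> ((Cl N ^^ n) \<sigma>) - chi \<rho> \<sigma>) \<longlongrightarrow> 0) (at_left 1)"
proof (induction n)
  case (Suc n)
  let ?\<sigma> = "(Cl N ^^ n) \<sigma>"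
  have pos: "0 \<le> ?\<sigma> j" "0 \<le> Cl N ?\<sigma> j" if "j \<in> {1..N}" for j
  proof -
    show "0 \<le> ?\<sigma> j" by (rule Cl_iter_nonneg) (use assms that in auto)
    have "0 \<le> (Cl N ^^ Suc n) \<sigma> j" by (rule Cl_iter_nonneg) (use assms that in auto)
    then show "0 \<le> Cl N ?\<sigma> j" by simp
  qed
  have f: "first (\<lambda>\<rho> j. exp (- (1 - \<rho>) * ?\<sigma> j)) ?\<sigma>" by (rule first_exp) (use pos in auto)
  have f': "first (\<lambda>\<rho> j. exp (- (1 - \<rho>) * Cl N ?\<sigma> j)) (Cl N ?\<sigma>)" by (rule first_exp) (use pos in auto)
  have "((\<lambda>\<rho>. (chi \<rho> (Cl N ?\<sigma>) - Ut \<rho> (CC \<rho> N (\<lambda>j. exp (- (1 - \<rho>) * ?\<sigma> j))))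
      + (Ut \<rho> (CC \<rho> N (\<lambda>j. exp (- (1 - \<rho>) * ?\<sigma> j))) - chi \<rho> ?\<sigma>) + (chi \<rho> ?\<sigma> - chi \<rho> \<sigma>)) \<longlongrightarrow> 0 + 0 + 0) (at_left 1)"
    unfolding chi_def[of _ "Cl N ?\<sigma>"] chi_def[of _ ?\<sigma>]
    by (intro tendsto_add first_close[OF f' first_CC[OF order_refl f]] first_cycle[OF f] Suc.IH[unfolded chi_def[of _ ?\<sigma>]])
  then show ?case by simp
qed simp

lemma chi_lipschitz:
  assumes \<rho>: "0 < \<rho>" "\<rho> < 1" and \<sigma>: "\<And>j. j \<in> {1..N} \<Longrightarrow> 0 \<le> \<sigma> j" "\<And>j. j \<in> {1..N} \<Longrightarrow> 0 \<le> \<sigma>' j"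
  shows "\<bar>chi \<rho> \<sigma> - chi \<rho> \<sigma>'\<bar> \<le> (\<Sum>j=1..N. \<bar>\<sigma> j - \<sigma>' j\<bar> * (RR / (pm * b j)))"
proof -
  have c: "(\<lambda>j. exp (- (1 - \<rho>) * \<sigma> j)) \<in> cube" "(\<lambda>j. exp (- (1 - \<rho>) * \<sigma>' j)) \<in> cube"
    by (rule exp_cube; use \<rho> \<sigma> in auto)+
  have lip: "\<bar>exp (- x) - exp (- y)\<bar> \<le> \<bar>x - y\<bar>" if "0 \<le> x" "0 \<le> y" for x y :: real
  proof -
    have *: "exp (- a) - exp (- c) \<le> c - a" if "0 \<le> a" "a \<le> c" for a c :: real
    proof -
      have "exp (- a) - exp (- c) = exp (- a) * (1 - exp (- (c - a)))" by (simp add: algebra_simps mult_exp_exp)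
      also have "\<dots> \<le> 1 * (c - a)" using that exp_minus_bounds[of "c - a"] by (intro mult_mono) auto
      finally show ?thesis by simp
    qed
    show ?thesis
    proof (cases "x \<le> y")
      case True
      then have "exp (- y) \<le> exp (- x)" by simp
      then show ?thesis using *[OF that(1) True] True by simp
    next
      case False
      then have "exp (- x) \<le> exp (- y)" by simp
      then show ?thesis using *[OF that(2), of x] False by simp
    qed
  qed
  have "\<bar>chi \<rho> \<sigma> - chi \<rho> \<sigma>'\<bar> \<le> (\<Sum>j=1..N. \<bar>exp (- (1 - \<rho>) * \<sigma> j) - exp (- (1 - \<rho>) * \<sigma>' j)\<bar> / (1 - \<rho>) * (RR / (pm * b j)))"
    unfolding chi_def by (rule Ut_lipschitz[OF \<rho> c])
  also have "\<dots> \<le> (\<Sum>j=1..N. \<bar>\<sigma> j - \<sigma>' j\<bar> * (RR / (pm * b j)))"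
  proof (rule sum_mono)
    fix j assume j: "j \<in> {1..N}"
    have "\<bar>exp (- ((1 - \<rho>) * \<sigma> j)) - exp (- ((1 - \<rho>) * \<sigma>' j))\<bar> \<le> \<bar>(1 - \<rho>) * \<sigma> j - (1 - \<rho>) * \<sigma>' j\<bar>"
      using \<rho> \<sigma>[OF j] by (intro lip) auto
    also have "\<dots> = (1 - \<rho>) * \<bar>\<sigma> j - \<sigma>' j\<bar>"
      using \<rho> by (simp add: right_diff_distrib[symmetric] abs_mult)
    finally have "\<bar>exp (- (1 - \<rho>) * \<sigma> j) - exp (- (1 - \<rho>) * \<sigma>' j)\<bar> \<le> \<bar>\<sigma> j - \<sigma>' j\<bar> * (1 - \<rho>)"
      by (simp only: mult_minus_left mult.commute[of "1 - \<rho>" "\<bar>_\<bar>"])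
    then have "\<bar>exp (- (1 - \<rho>) * \<sigma> j) - exp (- (1 - \<rho>) * \<sigma>' j)\<bar> / (1 - \<rho>) \<le> \<bar>\<sigma> j - \<sigma>' j\<bar>"
      using \<rho> by (subst pos_divide_le_eq) simp_all
    moreover have "0 \<le> RR / (pm * b j)" using RR_nonneg pm(1) b_pos[OF j] by simp
    ultimately show "\<bar>exp (- (1 - \<rho>) * \<sigma> j) - exp (- (1 - \<rho>) * \<sigma>' j)\<bar> / (1 - \<rho>) * (RR / (pm * b j))
        \<le> \<bar>\<sigma> j - \<sigma>' j\<bar> * (RR / (pm * b j))"
      by (rule mult_right_mono)
  qed
  finally show ?thesis .
qed

text \<open>The number \<open>n\<close> of cycles is fixed first, so large that the linear iterates
  are close to \<open>theta \<sigma> * b j\<close>; the Lipschitz bound turns this into closeness of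
  the transforms uniformly in \<open>\<rho>\<close>. Only then does \<open>\<rho>\<close> tend to 1,
  with \<open>chi_iter\<close> for this \<open>n\<close>.\<close>

theorem chi_collapse:
  assumes \<sigma>: "\<And>j. j \<in> {1..N} \<Longrightarrow> 0 \<le> \<sigma> j"
  shows "((\<lambda>\<rho>. chi \<rho> \<sigma> - chi \<rho> (\<lambda>j. theta \<sigma> * b j)) \<longlongrightarrow> 0) (at_left 1)"
proof (rule tendstoI)
  fix e :: real assume e: "0 < e"
  let ?l = "\<lambda>j. theta \<sigma> * b j"
  have th: "0 \<le> theta \<sigma>"
    unfolding theta_def Lf_def using dl_pos \<sigma> Uf_pos by (intro divide_nonneg_nonneg sum_nonneg mult_nonneg_nonneg) (auto intro: less_imp_le)
  have l: "0 \<le> ?l j" if "j \<in> {1..N}" for j using th b_nonneg[OF that] by simp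
  have "(\<lambda>n. \<Sum>j=1..N. \<bar>(Cl N ^^ n) \<sigma> j - ?l j\<bar> * (RR / (pm * b j))) \<longlonglongrightarrow> (\<Sum>j=1..N. \<bar>?l j - ?l j\<bar> * (RR / (pm * b j)))"
    by (intro tendsto_intros Cl_limit)
  then have "eventually (\<lambda>n. dist (\<Sum>j=1..N. \<bar>(Cl N ^^ n) \<sigma> j - ?l j\<bar> * (RR / (pm * b j))) 0 < e / 2) sequentially"
    using e by (intro tendstoD) auto
  then obtain n where "dist (\<Sum>j=1..N. \<bar>(Cl N ^^ n) \<sigma> j - ?l j\<bar> * (RR / (pm * b j))) 0 < e / 2"
    unfolding eventually_sequentially by blast
  then have n: "(\<Sum>j=1..N. \<bar>(Cl N ^^ n) \<sigma> j - ?l j\<bar> * (RR / (pm * b j))) < e / 2"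
    unfolding dist_real_def by linarith
  have "eventually (\<lambda>\<rho>. dist (chi \<rho> ((Cl N ^^ n) \<sigma>) - chi \<rho> \<sigma>) 0 < e / 2) (at_left 1)"
    using e by (intro tendstoD chi_iter \<sigma>) auto
  then show "eventually (\<lambda>\<rho>. dist (chi \<rho> \<sigma> - chi \<rho> ?l) 0 < e) (at_left 1)"
    using eventually_left_1
  proof eventually_elim
    case (elim \<rho>)
    have "\<bar>chi \<rho> ((Cl N ^^ n) \<sigma>) - chi \<rho> ?l\<bar> \<le> (\<Sum>j=1..N. \<bar>(Cl N ^^ n) \<sigma> j - ?l j\<bar> * (RR / (pm * b j)))"
      using elim l Cl_iter_nonneg[OF \<sigma>] by (intro chi_lipschitz) auto
    with n have "\<bar>chi \<rho> ((Cl N ^^ n) \<sigma>) - chi \<rho> ?l\<bar> < e / 2" by linarith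
    then show ?case using elim(1) unfolding dist_real_def by linarith
  qed
qed

end

section \<open>Second-order expansion\<close>

lemma eps_at_right: "filterlim (\<lambda>\<rho>::real. 1 - \<rho>) (at_right 0) (at_left 1)"
  using eps_tendsto eps_pos by (auto simp: filterlim_at elim: eventually_mono)

lemma exp_second_order:
  fixes x :: real assumes "0 \<le> x"
  shows "((\<lambda>\<rho>. (exp (- (1 - \<rho>) * x) - 1 + (1 - \<rho>) * x) / (1 - \<rho>)\<^sup>2) \<longlongrightarrow> x\<^sup>2 / 2) (at_left 1)"
  by (rule filterlim_compose[OF exp_minus_limits(2) eps_at_right]) (rule assms)

lemma abs_exp_remainder: "\<bar>exp t - 1 - t\<bar> \<le> t\<^sup>2 * exp \<bar>t\<bar>" for t :: real
proof (cases "0 \<le> t")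
  case True
  have "exp t * (1 - exp (- t)) \<le> exp t * t" using exp_minus_bounds(2)[OF True] by (intro mult_left_mono) auto
  then have 1: "exp t - 1 \<le> t * exp t" by (simp add: right_diff_distrib mult_exp_exp mult.commute)
  have "exp t - 1 - t \<le> t * (exp t - 1)" using 1 by (simp add: algebra_simps)
  also have "\<dots> \<le> t * (t * exp t)" using 1 True by (rule mult_left_mono)
  finally show ?thesis using True abs_of_nonneg[of "exp t - 1 - t"] exp_ge_add_one_self[of t]
    by (simp only: power2_eq_square mult.assoc abs_of_nonneg)
next
  case False
  then have "0 \<le> exp t - 1 - t" "exp t - 1 - t \<le> t\<^sup>2 / 2" using exp_minus_bounds(3,4)[of "- t"] by auto
  moreover have "t\<^sup>2 / 2 \<le> t\<^sup>2 * exp \<bar>t\<bar>" 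
  proof -
    have "1 / 2 \<le> exp \<bar>t\<bar>" using one_le_exp_iff[of "\<bar>t\<bar>"] by linarith
    from mult_left_mono[OF this, of "t\<^sup>2"] show ?thesis by simp
  qed
  ultimately show ?thesis by simp
qed

lemma t_exp_bound: "0 \<le> t \<Longrightarrow> t * exp (- t) \<le> 1" "0 \<le> t \<Longrightarrow> t\<^sup>2 * exp (- t) \<le> 2" for t :: real
proof -
  assume t: "0 \<le> t"
  have "t \<le> exp t" using exp_ge_add_one_self[of t] by linarith
  then show "t * exp (- t) \<le> 1" by (simp add: exp_minus field_simps)
  have "t\<^sup>2 / 2 \<le> exp t"
    using exp_lower_Taylor_quadratic[OF t] t by simp
  then show "t\<^sup>2 * exp (- t) \<le> 2" by (simp add: exp_minus field_simps)
qed

lemma w_exp_bound: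
  fixes c w :: real assumes "0 < c" "0 \<le> w"
  shows "w * exp (- c * w) \<le> 1 / c" "w\<^sup>2 * exp (- c * w) \<le> 2 / c\<^sup>2"
proof -
  have "c * (w * exp (- c * w)) \<le> 1" using t_exp_bound(1)[of "c * w"] assms by (simp add: mult.assoc)
  then show "w * exp (- c * w) \<le> 1 / c" using assms by (simp add: field_simps)
  have "c\<^sup>2 * (w\<^sup>2 * exp (- c * w)) \<le> 2" using t_exp_bound(2)[of "c * w"] assms by (simp add: power_mult_distrib mult.assoc)
  then show "w\<^sup>2 * exp (- c * w) \<le> 2 / c\<^sup>2" using assms by (simp add: field_simps)
qed

lemma ln_second_order:
  fixes w e :: "'a \<Rightarrow> real"
  assumes w: "(w \<longlongrightarrow> v) F" and e: "(e \<longlongrightarrow> 0) F" "eventually (\<lambda>t. 0 < e t) F"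
  shows "((\<lambda>t. ln (1 + e t * w t) / e t) \<longlongrightarrow> v) F"
proof -
  have ew: "((\<lambda>t. e t * w t) \<longlongrightarrow> 0 * v) F" using e(1) w by (rule tendsto_mult)
  then have "eventually (\<lambda>t. dist (e t * w t) 0 < 1 / 2) F" by (intro tendstoD) auto
  then have "eventually (\<lambda>t. norm (ln (1 + e t * w t) / e t - w t) \<le> 2 * (e t * (w t)\<^sup>2)) F"
    using e(2)
  proof eventually_elim
    case (elim t)
    have "\<bar>ln (1 + e t * w t) - e t * w t\<bar> \<le> 2 * (e t * w t)\<^sup>2"
      using elim by (intro abs_ln_one_plus_x_minus_x_bound) (simp add: dist_real_def)
    then have "\<bar>ln (1 + e t * w t) - e t * w t\<bar> / e t \<le> 2 * (e t * w t)\<^sup>2 / e t"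
      using elim by (intro divide_right_mono) auto
    moreover have "\<bar>ln (1 + e t * w t) / e t - w t\<bar> = \<bar>ln (1 + e t * w t) - e t * w t\<bar> / e t"
    proof -
      have "ln (1 + e t * w t) / e t - w t = (ln (1 + e t * w t) - e t * w t) / e t"
        using elim by (simp add: diff_divide_distrib)
      then show ?thesis using elim by (simp add: abs_divide)
    qed
    moreover have "2 * (e t * w t)\<^sup>2 / e t = 2 * (e t * (w t)\<^sup>2)"
      using elim by (simp add: power2_eq_square)
    ultimately show ?case by simp
  qed
  moreover have "((\<lambda>t. 2 * (e t * (w t)\<^sup>2)) \<longlongrightarrow> 2 * (0 * v\<^sup>2)) F"
    using e(1) w by (intro tendsto_intros)
  then have "((\<lambda>t. 2 * (e t * (w t)\<^sup>2)) \<longlongrightarrow> 0) F" by simp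
  ultimately have "((\<lambda>t. ln (1 + e t * w t) / e t - w t) \<longlongrightarrow> 0) F"
    by (rule Lim_null_comparison)
  from tendsto_add[OF this w] show ?thesis by simp
qed

lemma (in nonneg_law) laplace_second_order_compose:
  assumes int2: "integrable P (\<lambda>x. x\<^sup>2)" and u: "((\<lambda>t. u t / e t) \<longlongrightarrow> k) F" "0 < k"
    and e: "(e \<longlongrightarrow> 0) F" "eventually (\<lambda>t. 0 < e t) F"
  shows "((\<lambda>t. (laplace P (u t) - 1 + u t * moment 1 P) / (e t)\<^sup>2) \<longlongrightarrow> moment 2 P / 2 * k\<^sup>2) F"
proof -
  have pos: "eventually (\<lambda>t. 0 < u t) F"
    using order_tendstoD(1)[OF u] e(2) by eventually_elim (simp add: zero_less_divide_iff)
  moreover have "(u \<longlongrightarrow> 0) F" by (rule small_of_quotient[OF u(1) e])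
  ultimately have "filterlim u (at_right 0) F" by (auto simp: filterlim_at elim: eventually_mono)
  then have "((\<lambda>t. (laplace P (u t) - 1 + u t * moment 1 P) / (u t)\<^sup>2 * (u t / e t)\<^sup>2) \<longlongrightarrow> moment 2 P / 2 * k\<^sup>2) F"
    by (intro tendsto_mult tendsto_power u(1) filterlim_compose[OF laplace_second_order[OF int2]])
  moreover have "eventually (\<lambda>t. (laplace P (u t) - 1 + u t * moment 1 P) / (u t)\<^sup>2 * (u t / e t)\<^sup>2 = (laplace P (u t) - 1 + u t * moment 1 P) / (e t)\<^sup>2) F"
    using pos e(2) by eventually_elim (simp add: power_divide)
  ultimately show ?thesis by (simp add: tendsto_cong)
qed

lemma (in nonneg_law) moment_2_ge:
  assumes int2: "integrable P (\<lambda>x. x\<^sup>2)" shows "(moment 1 P)\<^sup>2 \<le> moment 2 P"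
proof -
  let ?m = "moment 1 P"
  have "0 \<le> (\<integral>x. (x - ?m)\<^sup>2 \<partial>P)" by (rule Bochner_Integration.integral_nonneg) simp
  also have "(\<lambda>x. (x - ?m)\<^sup>2) = (\<lambda>x. x\<^sup>2 - 2 * ?m * x + ?m\<^sup>2)"
    by (simp add: power2_diff mult_ac fun_eq_iff)
  also have "(\<integral>x. x\<^sup>2 - 2 * ?m * x + ?m\<^sup>2 \<partial>P) = moment 2 P - 2 * ?m * ?m + ?m\<^sup>2"
    using int1 int2 by (simp add: prob_space mean_eq moment_def)
  finally show ?thesis by (simp add: power2_eq_square)
qed

context heavy_traffic
begin

definition b2 :: "nat \<Rightarrow> real" where "b2 i = moment 2 (B i)"
definition cc :: real where "cc = (\<Sum>j=1..N. lamh j * (b j)\<^sup>2)"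
definition c2 :: real where "c2 = (\<Sum>j=1..N. lamh j * b2 j)"
text \<open>Second-order error of one service transform along \<open>z0\<close>: the term
  \<open>b i * \<theta>\<close> stems from the factor \<open>\<rho>\<close> in the rates, the one
  with \<open>cc\<close> from the curvature of \<open>z0\<close> inside \<open>LL\<close>, and the
  last one is the variance of the service time, which distinguishes its transform from
  \<open>exp (- u * b i)\<close>.\<close>

definition kap :: "real \<Rightarrow> nat \<Rightarrow> real" where
  "kap \<theta> i = b i * (\<theta> + \<theta>\<^sup>2 * cc / 2) + \<theta>\<^sup>2 * (b2 i - (b i)\<^sup>2) / 2"

definition z0 :: "real \<Rightarrow> real \<Rightarrow> nat \<Rightarrow> real" where "z0 \<theta> \<rho> j = exp (- (1 - \<rho>) * (\<theta> * b j))"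

definition T2 :: "real \<Rightarrow> nat \<Rightarrow> (nat \<Rightarrow> real) \<Rightarrow> nat \<Rightarrow> real" where
  "T2 \<theta> i v = (Tl i v)(i := Tl i v i + p i * kap \<theta> i)"

primrec C2 :: "real \<Rightarrow> nat \<Rightarrow> (nat \<Rightarrow> real) \<Rightarrow> nat \<Rightarrow> real" where
  "C2 \<theta> 0 v = v"
| "C2 \<theta> (Suc k) v = C2 \<theta> k (T2 \<theta> (Suc k) v)"

text \<open>Deviations are measured from the curve \<open>z0\<close> because the linearised cycle
  fixes \<open>\<theta> * b j\<close> (\<open>Cl_b\<close>); along this curve they are therefore of
  order \<open>(1 - \<rho>)\<close> squared.\<close>

definition second :: "real \<Rightarrow> (real \<Rightarrow> nat \<Rightarrow> real) \<Rightarrow> (nat \<Rightarrow> real) \<Rightarrow> bool" where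
  "second \<theta> z v \<longleftrightarrow> eventually (\<lambda>\<rho>. z \<rho> \<in> cube) (at_left 1) \<and>
     (\<forall>j\<in>{1..N}. ((\<lambda>\<rho>. (z \<rho> j - z0 \<theta> \<rho> j) / (1 - \<rho>)\<^sup>2) \<longlongrightarrow> v j) (at_left 1))"

lemma secondD: "second \<theta> z v \<Longrightarrow> eventually (\<lambda>\<rho>. z \<rho> \<in> cube) (at_left 1)"
  "second \<theta> z v \<Longrightarrow> j \<in> {1..N} \<Longrightarrow> ((\<lambda>\<rho>. (z \<rho> j - z0 \<theta> \<rho> j) / (1 - \<rho>)\<^sup>2) \<longlongrightarrow> v j) (at_left 1)"
  by (auto simp: second_def)

lemma first_z0: "0 \<le> \<theta> \<Longrightarrow> first (z0 \<theta>) (\<lambda>j. \<theta> * b j)"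
  unfolding z0_def[abs_def] by (rule first_exp) (simp add: b_nonneg)

lemma z0_second: "0 \<le> \<theta> \<Longrightarrow> j \<in> {1..N} \<Longrightarrow>
    ((\<lambda>\<rho>. (z0 \<theta> \<rho> j - 1 + (1 - \<rho>) * (\<theta> * b j)) / (1 - \<rho>)\<^sup>2) \<longlongrightarrow> (\<theta> * b j)\<^sup>2 / 2) (at_left 1)"
  unfolding z0_def by (rule exp_second_order) (simp add: b_nonneg)

lemma second_z0: "0 \<le> \<theta> \<Longrightarrow> second \<theta> (z0 \<theta>) (\<lambda>_. 0)"
  using firstD(1)[OF first_z0] by (simp add: second_def)

lemma second_first:
  assumes \<theta>: "0 \<le> \<theta>" and s: "second \<theta> z v" shows "first z (\<lambda>j. \<theta> * b j)"
  unfolding first_def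
proof (intro conjI ballI secondD(1)[OF s])
  fix j assume j: "j \<in> {1..N}"
  have "((\<lambda>\<rho>. (1 - z0 \<theta> \<rho> j) / (1 - \<rho>) - (1 - \<rho>) * ((z \<rho> j - z0 \<theta> \<rho> j) / (1 - \<rho>)\<^sup>2)) \<longlongrightarrow> \<theta> * b j - 0 * v j) (at_left 1)"
    by (intro tendsto_diff tendsto_mult firstD(2)[OF first_z0[OF \<theta>] j] eps_tendsto secondD(2)[OF s j])
  moreover have "eventually (\<lambda>\<rho>. (1 - z0 \<theta> \<rho> j) / (1 - \<rho>) - (1 - \<rho>) * ((z \<rho> j - z0 \<theta> \<rho> j) / (1 - \<rho>)\<^sup>2) = (1 - z \<rho> j) / (1 - \<rho>)) (at_left 1)"
    using eps_pos
  proof eventually_elim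
    case (elim \<rho>)
    have "(1 - \<rho>) * ((z \<rho> j - z0 \<theta> \<rho> j) / (1 - \<rho>)\<^sup>2) = (z \<rho> j - z0 \<theta> \<rho> j) / (1 - \<rho>)"
      using elim by (simp add: power2_eq_square)
    then show ?case by (simp add: diff_divide_distrib[symmetric])
  qed
  ultimately show "((\<lambda>\<rho>. (1 - z \<rho> j) / (1 - \<rho>)) \<longlongrightarrow> \<theta> * b j) (at_left 1)"
    by (simp add: tendsto_cong)
qed

lemma second_LL:
  assumes \<theta>: "0 \<le> \<theta>" and s: "second \<theta> z v"
  shows "((\<lambda>\<rho>. ((1 - \<rho>) * \<theta> - LL \<rho> (z \<rho>)) / (1 - \<rho>)\<^sup>2) \<longlongrightarrow> \<theta> + \<theta>\<^sup>2 * cc / 2 + lin v) (at_left 1)"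
proof -
  have "((\<lambda>\<rho>. (\<Sum>j=1..N. lamh j * ((z0 \<theta> \<rho> j - 1 + (1 - \<rho>) * (\<theta> * b j)) / (1 - \<rho>)\<^sup>2))
        + (\<Sum>j=1..N. lamh j * ((z \<rho> j - z0 \<theta> \<rho> j) / (1 - \<rho>)\<^sup>2)) + (\<Sum>j=1..N. lamh j * ((1 - z \<rho> j) / (1 - \<rho>))))
      \<longlongrightarrow> (\<Sum>j=1..N. lamh j * ((\<theta> * b j)\<^sup>2 / 2)) + (\<Sum>j=1..N. lamh j * v j) + (\<Sum>j=1..N. lamh j * (\<theta> * b j))) (at_left 1)"
    by (intro tendsto_add tendsto_sum tendsto_mult tendsto_const z0_second[OF \<theta>] secondD(2)[OF s] firstD(2)[OF second_first[OF \<theta> s]])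
  moreover have "(\<Sum>j=1..N. lamh j * ((\<theta> * b j)\<^sup>2 / 2)) + (\<Sum>j=1..N. lamh j * v j) + (\<Sum>j=1..N. lamh j * (\<theta> * b j)) = \<theta> + \<theta>\<^sup>2 * cc / 2 + lin v"
  proof -
    have "(\<Sum>j=1..N. lamh j * (\<theta> * b j)) = \<theta>" using lin_b(2)[of \<theta>] by (simp add: lin_def)
    moreover have "(\<Sum>j=1..N. lamh j * ((\<theta> * b j)\<^sup>2 / 2)) = \<theta>\<^sup>2 * cc / 2"
      unfolding cc_def sum_distrib_left sum_divide_distrib by (intro sum.cong refl) (simp add: power_mult_distrib)
    ultimately show ?thesis by (simp only: lin_def)
  qed
  moreover have "eventually (\<lambda>\<rho>. (\<Sum>j=1..N. lamh j * ((z0 \<theta> \<rho> j - 1 + (1 - \<rho>) * (\<theta> * b j)) / (1 - \<rho>)\<^sup>2))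
        + (\<Sum>j=1..N. lamh j * ((z \<rho> j - z0 \<theta> \<rho> j) / (1 - \<rho>)\<^sup>2)) + (\<Sum>j=1..N. lamh j * ((1 - z \<rho> j) / (1 - \<rho>)))
      = ((1 - \<rho>) * \<theta> - LL \<rho> (z \<rho>)) / (1 - \<rho>)\<^sup>2) (at_left 1)"
    using eps_pos
  proof eventually_elim
    case (elim \<rho>)
    let ?e = "1 - \<rho>"
    have q: "(1 - z \<rho> j) / ?e = ?e * (1 - z \<rho> j) / ?e\<^sup>2" for j using elim by (simp add: power2_eq_square)
    have "(\<Sum>j=1..N. lamh j * ((z0 \<theta> \<rho> j - 1 + ?e * (\<theta> * b j)) / ?e\<^sup>2))
        + (\<Sum>j=1..N. lamh j * ((z \<rho> j - z0 \<theta> \<rho> j) / ?e\<^sup>2)) + (\<Sum>j=1..N. lamh j * ((1 - z \<rho> j) / ?e))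
      = (\<Sum>j=1..N. lamh j * (?e * (\<theta> * b j)) - \<rho> * lamh j * (1 - z \<rho> j)) / ?e\<^sup>2"
      unfolding q sum.distrib[symmetric] sum_divide_distrib
      by (intro sum.cong refl) (simp add: add_divide_distrib[symmetric] algebra_simps)
    also have "(\<Sum>j=1..N. lamh j * (?e * (\<theta> * b j)) - \<rho> * lamh j * (1 - z \<rho> j)) = ?e * \<theta> - LL \<rho> (z \<rho>)"
      using lin_b(2)[of "?e * \<theta>"] by (simp add: sum_subtractf LL_def lin_def mult.assoc)
    finally show ?case .
  qed
  ultimately show ?thesis by (simp add: tendsto_cong)
qed

lemma second_laplace:
  assumes \<theta>: "0 < \<theta>" and s: "second \<theta> z v" and i: "i \<in> {1..N}"
  shows "((\<lambda>\<rho>. (laplace (B i) (LL \<rho> (z \<rho>)) - z0 \<theta> \<rho> i) / (1 - \<rho>)\<^sup>2) \<longlongrightarrow> b i * lin v + kap \<theta> i) (at_left 1)"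
proof -
  have \<theta>': "0 \<le> \<theta>" using \<theta> by simp
  have f: "((\<lambda>\<rho>. LL \<rho> (z \<rho>) / (1 - \<rho>)) \<longlongrightarrow> \<theta>) (at_left 1)"
    using first_LL[OF second_first[OF \<theta>' s]] by (simp add: lin_b)
  have "((\<lambda>\<rho>. (laplace (B i) (LL \<rho> (z \<rho>)) - 1 + LL \<rho> (z \<rho>) * moment 1 (B i)) / (1 - \<rho>)\<^sup>2
      + b i * (((1 - \<rho>) * \<theta> - LL \<rho> (z \<rho>)) / (1 - \<rho>)\<^sup>2) - (z0 \<theta> \<rho> i - 1 + (1 - \<rho>) * (\<theta> * b i)) / (1 - \<rho>)\<^sup>2)
     \<longlongrightarrow> moment 2 (B i) / 2 * \<theta>\<^sup>2 + b i * (\<theta> + \<theta>\<^sup>2 * cc / 2 + lin v) - (\<theta> * b i)\<^sup>2 / 2) (at_left 1)"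
    by (intro tendsto_add tendsto_diff tendsto_mult tendsto_const second_LL[OF \<theta>' s] z0_second[OF \<theta>' i]
        nonneg_law.laplace_second_order_compose[OF B[OF i] B2[OF i] f \<theta> eps_tendsto eps_pos])
  moreover have "moment 2 (B i) / 2 * \<theta>\<^sup>2 + b i * (\<theta> + \<theta>\<^sup>2 * cc / 2 + lin v) - (\<theta> * b i)\<^sup>2 / 2 = b i * lin v + kap \<theta> i"
    by (simp add: kap_def b2_def power_mult_distrib field_simps)
  moreover have "(laplace (B i) (LL \<rho> (z \<rho>)) - 1 + LL \<rho> (z \<rho>) * moment 1 (B i)) / (1 - \<rho>)\<^sup>2
      + b i * (((1 - \<rho>) * \<theta> - LL \<rho> (z \<rho>)) / (1 - \<rho>)\<^sup>2) - (z0 \<theta> \<rho> i - 1 + (1 - \<rho>) * (\<theta> * b i)) / (1 - \<rho>)\<^sup>2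
      = (laplace (B i) (LL \<rho> (z \<rho>)) - z0 \<theta> \<rho> i) / (1 - \<rho>)\<^sup>2" for \<rho>
    unfolding times_divide_eq_right add_divide_distrib[symmetric] diff_divide_distrib[symmetric] b_def
    by (simp add: algebra_simps)
  ultimately show ?thesis by simp
qed

lemma second_TT:
  assumes \<theta>: "0 < \<theta>" and s: "second \<theta> z v" and i: "i \<in> {1..N}"
  shows "second \<theta> (\<lambda>\<rho>. TT \<rho> i (z \<rho>)) (T2 \<theta> i v)"
  unfolding second_def
proof (intro conjI ballI)
  show "eventually (\<lambda>\<rho>. TT \<rho> i (z \<rho>) \<in> cube) (at_left 1)"
    using secondD(1)[OF s] eventually_left_1 by eventually_elim (intro TT_cube i; simp)
  fix j assume j: "j \<in> {1..N}"
  show "((\<lambda>\<rho>. (TT \<rho> i (z \<rho>) j - z0 \<theta> \<rho> j) / (1 - \<rho>)\<^sup>2) \<longlongrightarrow> T2 \<theta> i v j) (at_left 1)"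
  proof (cases "j = i")
    case True
    have "((\<lambda>\<rho>. p i * ((laplace (B i) (LL \<rho> (z \<rho>)) - z0 \<theta> \<rho> i) / (1 - \<rho>)\<^sup>2) + (1 - p i) * ((z \<rho> i - z0 \<theta> \<rho> i) / (1 - \<rho>)\<^sup>2))
       \<longlongrightarrow> p i * (b i * lin v + kap \<theta> i) + (1 - p i) * v i) (at_left 1)"
      by (intro tendsto_intros second_laplace[OF \<theta> s i] secondD(2)[OF s i])
    moreover have "p i * ((laplace (B i) (LL \<rho> (z \<rho>)) - z0 \<theta> \<rho> i) / (1 - \<rho>)\<^sup>2) + (1 - p i) * ((z \<rho> i - z0 \<theta> \<rho> i) / (1 - \<rho>)\<^sup>2)
       = (TT \<rho> i (z \<rho>) i - z0 \<theta> \<rho> i) / (1 - \<rho>)\<^sup>2" for \<rho>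
      unfolding times_divide_eq_right add_divide_distrib[symmetric] by (simp add: TT_def algebra_simps)
    ultimately show ?thesis unfolding True by (simp add: T2_def Tl_def algebra_simps)
  next
    case False
    then show ?thesis using secondD(2)[OF s j] by (simp add: TT_def T2_def Tl_def)
  qed
qed

lemma second_CC: "0 < \<theta> \<Longrightarrow> k \<le> N \<Longrightarrow> second \<theta> z v \<Longrightarrow> second \<theta> (\<lambda>\<rho>. CC \<rho> k (z \<rho>)) (C2 \<theta> k v)"
proof (induction k arbitrary: z v)
  case (Suc k)
  have "second \<theta> (\<lambda>\<rho>. TT \<rho> (Suc k) (z \<rho>)) (T2 \<theta> (Suc k) v)" by (rule second_TT) (use Suc.prems in auto)
  then show ?case using Suc by simp
qed simp

text \<open>The correction \<open>p i * kap \<theta> i\<close> enters with weight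
  \<open>Uf k i\<close>, and \<open>Uf_served\<close> makes the product
  \<open>lamh i * kap \<theta> i\<close>. The linear part is carried along by
  \<open>Lf_Tl\<close>.\<close>

lemma Lf_C2: "k \<le> N \<Longrightarrow> Lf 0 (C2 \<theta> k v) = Lf k v + (\<Sum>i=1..k. lamh i * kap \<theta> i)"
proof (induction k arbitrary: v)
  case (Suc k)
  have i: "Suc k \<in> {1..N}" using Suc.prems by simp
  have "Lf k (T2 \<theta> (Suc k) v) = Lf k (Tl (Suc k) v) + (Uf k (Suc k) * p (Suc k)) * kap \<theta> (Suc k)"
    unfolding T2_def by (subst Lf_upd[OF i]) simp
  also have "\<dots> = Lf (Suc k) v + lamh (Suc k) * kap \<theta> (Suc k)"
    using Suc.prems by (simp only: Uf_served Lf_Tl)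
  finally show ?case using Suc by simp
qed simp

definition vf :: "real \<Rightarrow> nat \<Rightarrow> real" where "vf \<theta> = C2 \<theta> N (\<lambda>_. 0)"

text \<open>At load 1 the curvature term weighted by \<open>lamh i * b i\<close> cancels the squared
  means in the variances; only the second moments in \<open>c2\<close> remain.\<close>

lemma Lf_vf: "Lf 0 (vf \<theta>) = \<theta> + \<theta>\<^sup>2 * c2 / 2"
proof -
  have "Lf 0 (vf \<theta>) = (\<Sum>i=1..N. lamh i * kap \<theta> i)"
    unfolding vf_def by (subst Lf_C2[OF order_refl]) (simp add: Lf_def)
  also have "\<dots> = (\<Sum>i=1..N. (\<theta> + \<theta>\<^sup>2 * cc / 2) * (lamh i * b i) + \<theta>\<^sup>2 / 2 * (lamh i * b2 i) - \<theta>\<^sup>2 / 2 * (lamh i * (b i)\<^sup>2))"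
    by (intro sum.cong refl) (simp add: kap_def field_simps)
  also have "\<dots> = (\<theta> + \<theta>\<^sup>2 * cc / 2) * (\<Sum>i=1..N. lamh i * b i) + \<theta>\<^sup>2 / 2 * c2 - \<theta>\<^sup>2 / 2 * cc"
    by (simp only: sum.distrib sum_subtractf sum_distrib_left[symmetric] c2_def cc_def)
  finally show ?thesis by (simp only: load) (simp add: algebra_simps)
qed

lemma c2_pos: "0 < c2"
  unfolding c2_def
proof (intro sum_pos mult_pos_pos)
  fix i assume i: "i \<in> {1..N}"
  have "0 < (b i)\<^sup>2" using b_pos[OF i] by simp
  also have "\<dots> \<le> b2 i" unfolding b_def b2_def by (rule nonneg_law.moment_2_ge[OF B[OF i] B2[OF i]])
  finally show "0 < b2 i" .
qed (use lamh_pos N in auto)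

text \<open>Number of type-\<open>j\<close> customers per unit of work in the limit. As
  \<open>dl\<close> is \<open>Lf 0 b\<close>, the sum of \<open>b j * cj j\<close> over all types is
  1.\<close>

definition cj :: "nat \<Rightarrow> real" where "cj j = Uf 0 j / dl"

lemma theta_point: "j \<in> {1..N} \<Longrightarrow> theta (\<lambda>i. a * b i + (if i = j then x else 0)) = a + x * cj j"
proof -
  assume j: "j \<in> {1..N}"
  have "Uf 0 i * (a * b i + (if i = j then x else 0)) = a * (Uf 0 i * b i) + (if i = j then Uf 0 j * x else 0)" for i
    by (simp add: algebra_simps)
  then have "Lf 0 (\<lambda>i. a * b i + (if i = j then x else 0)) = a * dl + Uf 0 j * x"
    using j by (simp add: Lf_def dl_def sum.distrib sum_distrib_left[symmetric])
  then show ?thesis using dl_pos by (simp add: theta_def cj_def field_simps)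
qed

end

section \<open>The drift and the asymptotic differential equation\<close>

context heavy_traffic_steady
begin

abbreviation expect :: "real \<Rightarrow> ((nat \<Rightarrow> nat) \<Rightarrow> real) \<Rightarrow> real" where
  "expect \<rho> f \<equiv> (\<integral>y. f y \<partial>measure_pmf (Y \<rho>))"

definition WW :: "real \<Rightarrow> (nat \<Rightarrow> nat) \<Rightarrow> real" where "WW \<rho> y = (1 - \<rho>) * work y"
definition ZZ :: "real \<Rightarrow> nat \<Rightarrow> (nat \<Rightarrow> nat) \<Rightarrow> real" where "ZZ \<rho> j y = (1 - \<rho>) * real (tot y j)"

lemma WW_nonneg: "\<rho> \<le> 1 \<Longrightarrow> 0 \<le> WW \<rho> y"
  by (simp add: WW_def work_nonneg)

lemma ZZ_bounds:
  assumes "\<rho> \<le> 1" "j \<in> {1..N}" shows "0 \<le> ZZ \<rho> j y" "ZZ \<rho> j y \<le> WW \<rho> y / b j"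
proof -
  show "0 \<le> ZZ \<rho> j y" using assms by (simp add: ZZ_def)
  have "b j * real (tot y j) \<le> work y"
    unfolding work_def using assms by (intro member_le_sum) (auto intro!: mult_nonneg_nonneg b_nonneg)
  then have "(1 - \<rho>) * (b j * real (tot y j)) \<le> (1 - \<rho>) * work y" using assms by (intro mult_left_mono) auto
  then show "ZZ \<rho> j y \<le> WW \<rho> y / b j" using b_pos[OF assms(2)] by (simp add: ZZ_def WW_def field_simps)
qed

lemma WW_sum: "WW \<rho> y = (\<Sum>j=1..N. b j * ZZ \<rho> j y)"
  unfolding WW_def ZZ_def work_def sum_distrib_left
  by (intro sum.cong refl) (simp only: mult.left_commute)

lemma chi_expect: "chi \<rho> \<sigma> = expect \<rho> (\<lambda>y. exp (- (\<Sum>j=1..N. \<sigma> j * ZZ \<rho> j y)))"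
proof -
  have "(\<Sum>j=1..N. \<sigma> j * ZZ \<rho> j y) = (1 - \<rho>) * (\<Sum>j=1..N. \<sigma> j * real (tot y j))" for y
    unfolding ZZ_def sum_distrib_left by (intro sum.cong refl) (simp only: mult.left_commute)
  then show ?thesis unfolding chi_def Ut_exp by (simp only: minus_mult_left[symmetric] mult_minus_left)
qed

lemma integrable_bounded: "(\<And>y. \<bar>f y :: real\<bar> \<le> C) \<Longrightarrow> integrable (measure_pmf (Y \<rho>)) f"
  by (rule measure_pmf.integrable_const_bound[where B=C]) auto

lemma expect_abs_le:
  assumes "\<And>y. \<bar>f y :: real\<bar> \<le> C" shows "\<bar>expect \<rho> f\<bar> \<le> C"
proof -
  have "\<bar>expect \<rho> f\<bar> \<le> expect \<rho> (\<lambda>y. \<bar>f y\<bar>)" using integral_norm_bound[of "measure_pmf (Y \<rho>)" f] by simp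
  also have "\<dots> \<le> expect \<rho> (\<lambda>_. C)" using assms integrable_bounded[of "\<lambda>y. \<bar>f y\<bar>" C] by (intro integral_mono) auto
  finally show ?thesis by simp
qed

lemma prod_as_exp:
  assumes "\<And>j. j \<in> {1..N} \<Longrightarrow> z j = exp (- (1 - \<rho>) * \<sigma> j)"
  shows "(\<Prod>j=1..N. z j ^ tot y j) = exp (- (\<Sum>j=1..N. \<sigma> j * ZZ \<rho> j y))"
proof -
  have "(\<Prod>j=1..N. z j ^ tot y j) = (\<Prod>j=1..N. exp (- (\<sigma> j * ZZ \<rho> j y)))"
    using assms by (intro prod.cong refl) (simp only: exp_of_nat_mult[symmetric] ZZ_def, simp add: algebra_simps)
  then show ?thesis by (simp only: exp_sum[OF finite_atLeastAtMost] sum_negf[symmetric])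
qed

text \<open>To first order in \<open>1 - \<rho>\<close>, a perturbation of \<open>z0\<close> of
  second order inserts the linear form in the counts under the expectation. The error is quadratic
  in the work, and the weight \<open>exp (- \<theta> * WW \<rho> y)\<close> bounds it because
  \<open>\<theta> > 0\<close>.\<close>

lemma second_order_difference:
  assumes \<theta>: "0 < \<theta>" and s: "second \<theta> z v"
  shows "((\<lambda>\<rho>. (Ut \<rho> (z \<rho>) - Ut \<rho> (z0 \<theta> \<rho>)) / (1 - \<rho>)
     - expect \<rho> (\<lambda>y. (\<Sum>j=1..N. v j * ZZ \<rho> j y) * exp (- \<theta> * WW \<rho> y))) \<longlongrightarrow> 0) (at_left 1)"
proof -
  define w where "w = (\<lambda>j \<rho>. (z \<rho> j - z0 \<theta> \<rho> j) / (1 - \<rho>)\<^sup>2 / z0 \<theta> \<rho> j)"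
  \<comment> \<open>Chosen so that \<open>z \<rho> j\<close> is \<open>z0 \<theta> \<rho> j\<close>
    times the exponential of \<open>d j \<rho>\<close> scaled by \<open>(1 - \<rho>)\<close>
    squared; the monomial in \<open>z\<close> is then \<open>exp (- \<theta> * WW \<rho> y)\<close>
    times a correction linear in the counts in the exponent.\<close>
  define d where "d = (\<lambda>j \<rho>. ln (1 + (1 - \<rho>)\<^sup>2 * w j \<rho>) / (1 - \<rho>)\<^sup>2)"
  define K where "K = (\<Sum>j=1..N. (\<bar>v j\<bar> + 1) / b j)"
  have K0: "0 \<le> K" unfolding K_def by (intro sum_nonneg divide_nonneg_nonneg) (auto intro: b_nonneg)
  have e2: "((\<lambda>\<rho>::real. (1 - \<rho>)\<^sup>2) \<longlongrightarrow> 0) (at_left 1)" using tendsto_power[OF eps_tendsto, of 2] by simp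
  have e2pos: "eventually (\<lambda>\<rho>::real. 0 < (1 - \<rho>)\<^sup>2) (at_left 1)" using eps_pos by eventually_elim simp
  have z01: "((\<lambda>\<rho>. z0 \<theta> \<rho> j) \<longlongrightarrow> 1) (at_left 1)" for j
  proof -
    have "((\<lambda>\<rho>. exp (- (1 - \<rho>) * (\<theta> * b j))) \<longlongrightarrow> exp (- 0 * (\<theta> * b j))) (at_left 1)"
      by (intro tendsto_intros eps_tendsto)
    then show ?thesis by (simp add: z0_def)
  qed
  have wlim: "(w j \<longlongrightarrow> v j) (at_left 1)" if "j \<in> {1..N}" for j
    using tendsto_divide[OF secondD(2)[OF s that] z01] by (simp add: w_def)
  have dlim: "(d j \<longlongrightarrow> v j) (at_left 1)" if "j \<in> {1..N}" for j
    unfolding d_def by (rule ln_second_order[OF wlim[OF that] e2 e2pos])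
  have ev_pos: "eventually (\<lambda>\<rho>. \<forall>j\<in>{1..N}. 0 < 1 + (1 - \<rho>)\<^sup>2 * w j \<rho>) (at_left 1)"
  proof (intro eventually_ball_finite ballI)
    fix j assume j: "j \<in> {1..N}"
    have "((\<lambda>\<rho>. 1 + (1 - \<rho>)\<^sup>2 * w j \<rho>) \<longlongrightarrow> 1 + 0 * v j) (at_left 1)" by (intro tendsto_intros e2 wlim[OF j])
    then show "eventually (\<lambda>\<rho>. 0 < 1 + (1 - \<rho>)\<^sup>2 * w j \<rho>) (at_left 1)" by (intro order_tendstoD(1)) auto
  qed simp
  have ev_d: "eventually (\<lambda>\<rho>. \<forall>j\<in>{1..N}. \<bar>d j \<rho>\<bar> < \<bar>v j\<bar> + 1) (at_left 1)"
  proof (intro eventually_ball_finite ballI)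
    fix j assume j: "j \<in> {1..N}"
    have "((\<lambda>\<rho>. \<bar>d j \<rho>\<bar>) \<longlongrightarrow> \<bar>v j\<bar>) (at_left 1)" by (intro tendsto_intros dlim[OF j])
    then show "eventually (\<lambda>\<rho>. \<bar>d j \<rho>\<bar> < \<bar>v j\<bar> + 1) (at_left 1)" by (intro order_tendstoD(2)) auto
  qed simp
  \<comment> \<open>The correction in the exponent is at most
    \<open>(1 - \<rho>) * K * WW \<rho> y\<close>. Half of the weight absorbs it, and the other half
    remains to bound the square of the work.\<close>
  have ev_K: "eventually (\<lambda>\<rho>. (1 - \<rho>) * K < \<theta> / 2) (at_left 1)"
  proof -
    have "((\<lambda>\<rho>. (1 - \<rho>) * K) \<longlongrightarrow> 0 * K) (at_left 1)" by (intro tendsto_intros eps_tendsto)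
    then show ?thesis using \<theta> by (intro order_tendstoD(2)) auto
  qed
  let ?bd = "\<lambda>\<rho>. (1 - \<rho>) * K\<^sup>2 * (8 / \<theta>\<^sup>2) + (\<Sum>j=1..N. \<bar>d j \<rho> - v j\<bar> / b j) * (1 / \<theta>)"
  have "eventually (\<lambda>\<rho>. norm ((Ut \<rho> (z \<rho>) - Ut \<rho> (z0 \<theta> \<rho>)) / (1 - \<rho>)
     - expect \<rho> (\<lambda>y. (\<Sum>j=1..N. v j * ZZ \<rho> j y) * exp (- \<theta> * WW \<rho> y))) \<le> ?bd \<rho>) (at_left 1)"
    using eventually_left_1 secondD(1)[OF s] secondD(1)[OF second_z0[OF less_imp_le[OF \<theta>]]] ev_pos ev_d ev_K
  proof eventually_elim
    case (elim \<rho>)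
    let ?e = "1 - \<rho>"
    define x where "x = (\<lambda>y. \<Sum>j=1..N. d j \<rho> * ZZ \<rho> j y)"
    define l where "l = (\<lambda>y. \<Sum>j=1..N. v j * ZZ \<rho> j y)"
    have e: "0 < ?e" "\<rho> \<le> 1" using elim(1) by auto
    have W: "0 \<le> WW \<rho> y" for y using e by (intro WW_nonneg) simp
    have z0p: "(\<Prod>j=1..N. z0 \<theta> \<rho> j ^ tot y j) = exp (- \<theta> * WW \<rho> y)" for y
    proof -
      have "(\<Prod>j=1..N. z0 \<theta> \<rho> j ^ tot y j) = exp (- (\<Sum>j=1..N. (\<theta> * b j) * ZZ \<rho> j y))"
        by (rule prod_as_exp) (simp add: z0_def)
      moreover have "\<theta> * WW \<rho> y = (\<Sum>j=1..N. (\<theta> * b j) * ZZ \<rho> j y)" by (simp only: WW_sum sum_distrib_left mult.assoc)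
      ultimately show ?thesis by simp
    qed
    have zp: "(\<Prod>j=1..N. z \<rho> j ^ tot y j) = exp (- \<theta> * WW \<rho> y) * exp (?e * x y)" for y
    proof -
      have "(\<Prod>j=1..N. z \<rho> j ^ tot y j) = exp (- (\<Sum>j=1..N. (\<theta> * b j - ?e * d j \<rho>) * ZZ \<rho> j y))"
      proof (rule prod_as_exp)
        fix j assume j: "j \<in> {1..N}"
        have zpos: "0 < z0 \<theta> \<rho> j" by (simp add: z0_def)
        have "1 + ?e\<^sup>2 * w j \<rho> = z \<rho> j / z0 \<theta> \<rho> j"
          using e zpos by (simp add: w_def field_simps)
        moreover have "exp (?e\<^sup>2 * d j \<rho>) = 1 + ?e\<^sup>2 * w j \<rho>"
          using elim(4) j e by (simp add: d_def)
        ultimately have "z \<rho> j = z0 \<theta> \<rho> j * exp (?e\<^sup>2 * d j \<rho>)" using zpos by simp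
        then show "z \<rho> j = exp (- ?e * (\<theta> * b j - ?e * d j \<rho>))"
          by (simp add: z0_def mult_exp_exp power2_eq_square algebra_simps)
      qed
      also have "\<dots> = exp (- \<theta> * WW \<rho> y) * exp (?e * x y)"
      proof -
        have "\<theta> * WW \<rho> y - ?e * x y = (\<Sum>j=1..N. (\<theta> * b j - ?e * d j \<rho>) * ZZ \<rho> j y)"
          by (simp only: x_def WW_sum left_diff_distrib sum_subtractf sum_distrib_left mult.assoc)
        from this[symmetric] show ?thesis by (simp add: mult_exp_exp)
      qed
      finally show ?thesis .
    qed
    have xK: "\<bar>x y\<bar> \<le> K * WW \<rho> y" for y
    proof -
      have "\<bar>x y\<bar> \<le> (\<Sum>j=1..N. \<bar>d j \<rho> * ZZ \<rho> j y\<bar>)" unfolding x_def by (rule sum_abs)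
      also have "\<dots> \<le> (\<Sum>j=1..N. (\<bar>v j\<bar> + 1) * (WW \<rho> y / b j))"
      proof (rule sum_mono)
        fix j assume j: "j \<in> {1..N}"
        have "\<bar>d j \<rho>\<bar> \<le> \<bar>v j\<bar> + 1" using elim(5) j by (simp add: less_imp_le)
        then show "\<bar>d j \<rho> * ZZ \<rho> j y\<bar> \<le> (\<bar>v j\<bar> + 1) * (WW \<rho> y / b j)"
          unfolding abs_mult using ZZ_bounds[OF e(2) j, of y] by (intro mult_mono) auto
      qed
      finally show ?thesis by (simp add: K_def sum_distrib_right)
    qed
    have xl: "\<bar>x y - l y\<bar> \<le> (\<Sum>j=1..N. \<bar>d j \<rho> - v j\<bar> / b j) * WW \<rho> y" for y
    proof -
      have "\<bar>x y - l y\<bar> \<le> (\<Sum>j=1..N. \<bar>(d j \<rho> - v j) * ZZ \<rho> j y\<bar>)"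
        unfolding x_def l_def sum_subtractf[symmetric] left_diff_distrib[symmetric] by (rule sum_abs)
      also have "\<dots> \<le> (\<Sum>j=1..N. \<bar>d j \<rho> - v j\<bar> * (WW \<rho> y / b j))"
        unfolding abs_mult using ZZ_bounds[OF e(2)] by (intro sum_mono mult_left_mono) auto
      finally show ?thesis by (simp add: sum_distrib_right)
    qed
    have pt: "\<bar>(exp (- \<theta> * WW \<rho> y) * exp (?e * x y) - exp (- \<theta> * WW \<rho> y)) / ?e - l y * exp (- \<theta> * WW \<rho> y)\<bar> \<le> ?bd \<rho>" for y
    proof -
      let ?W = "WW \<rho> y" and ?x = "x y"
      have eq: "(exp (- \<theta> * ?W) * exp (?e * ?x) - exp (- \<theta> * ?W)) / ?e - l y * exp (- \<theta> * ?W)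
         = exp (- \<theta> * ?W) * ((exp (?e * ?x) - 1 - ?e * ?x) / ?e) + exp (- \<theta> * ?W) * (?x - l y)"
        using e by (simp add: field_simps)
      have tri: "\<bar>(exp (- \<theta> * ?W) * exp (?e * ?x) - exp (- \<theta> * ?W)) / ?e - l y * exp (- \<theta> * ?W)\<bar> \<le> exp (- \<theta> * ?W) * (\<bar>exp (?e * ?x) - 1 - ?e * ?x\<bar> / ?e) + exp (- \<theta> * ?W) * \<bar>?x - l y\<bar>"
        unfolding eq using e abs_triangle_ineq[of "exp (- \<theta> * ?W) * ((exp (?e * ?x) - 1 - ?e * ?x) / ?e)" "exp (- \<theta> * ?W) * (?x - l y)"]
        by (simp add: abs_mult abs_divide)
      have m1: "exp (- \<theta> * ?W) * (\<bar>exp (?e * ?x) - 1 - ?e * ?x\<bar> / ?e) \<le> ?e * K\<^sup>2 * (8 / \<theta>\<^sup>2)"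
      proof -
        have "\<bar>exp (?e * ?x) - 1 - ?e * ?x\<bar> / ?e \<le> (?e * ?x)\<^sup>2 * exp \<bar>?e * ?x\<bar> / ?e"
          using e by (intro divide_right_mono abs_exp_remainder) auto
        also have "\<dots> = ?e * (\<bar>?x\<bar>\<^sup>2 * exp (?e * \<bar>?x\<bar>))"
          using e by (simp add: power2_eq_square abs_mult)
        also have "\<dots> \<le> ?e * ((K * ?W)\<^sup>2 * exp (\<theta> / 2 * ?W))"
        proof (intro mult_left_mono mult_mono power_mono)
          have "?e * \<bar>?x\<bar> \<le> ?e * (K * ?W)" using e xK by (intro mult_left_mono) auto
          also have "\<dots> \<le> \<theta> / 2 * ?W" using mult_right_mono[OF less_imp_le[OF elim(6)] W[of y]] by (simp add: mult.assoc)
          finally show "exp (?e * \<bar>?x\<bar>) \<le> exp (\<theta> / 2 * ?W)" by simp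
        qed (use e xK in auto)
        finally have "exp (- \<theta> * ?W) * (\<bar>exp (?e * ?x) - 1 - ?e * ?x\<bar> / ?e) \<le> exp (- \<theta> * ?W) * (?e * ((K * ?W)\<^sup>2 * exp (\<theta> / 2 * ?W)))"
          by (intro mult_left_mono) auto
        also have "\<dots> = ?e * K\<^sup>2 * (?W\<^sup>2 * exp (- (\<theta> / 2) * ?W))"
        proof -
          have "exp (- \<theta> * ?W) * exp (\<theta> / 2 * ?W) = exp (- (\<theta> / 2) * ?W)" by (simp add: mult_exp_exp algebra_simps)
          then show ?thesis by (simp add: power_mult_distrib mult_ac)
        qed
        also have "\<dots> \<le> ?e * K\<^sup>2 * (2 / (\<theta> / 2)\<^sup>2)"
          using e \<theta> W by (intro mult_left_mono w_exp_bound) auto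
        finally show ?thesis by (simp add: power_divide)
      qed
      have m2: "exp (- \<theta> * ?W) * \<bar>?x - l y\<bar> \<le> (\<Sum>j=1..N. \<bar>d j \<rho> - v j\<bar> / b j) * (1 / \<theta>)"
      proof -
        have "exp (- \<theta> * ?W) * \<bar>?x - l y\<bar> \<le> exp (- \<theta> * ?W) * ((\<Sum>j=1..N. \<bar>d j \<rho> - v j\<bar> / b j) * ?W)"
          by (intro mult_left_mono xl) auto
        also have "\<dots> = (\<Sum>j=1..N. \<bar>d j \<rho> - v j\<bar> / b j) * (?W * exp (- \<theta> * ?W))" by simp
        also have "\<dots> \<le> (\<Sum>j=1..N. \<bar>d j \<rho> - v j\<bar> / b j) * (1 / \<theta>)"
          using \<theta> W b_nonneg by (intro mult_left_mono w_exp_bound sum_nonneg divide_nonneg_nonneg) auto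
        finally show ?thesis .
      qed
      show ?thesis by (rule order_trans[OF tri add_mono[OF m1 m2]])
    qed
    have li: "integrable (measure_pmf (Y \<rho>)) (\<lambda>y. l y * exp (- \<theta> * WW \<rho> y))"
    proof (rule integrable_bounded)
      fix y
      have "\<bar>l y\<bar> \<le> (\<Sum>j=1..N. \<bar>v j\<bar> / b j) * WW \<rho> y"
      proof -
        have "\<bar>l y\<bar> \<le> (\<Sum>j=1..N. \<bar>v j * ZZ \<rho> j y\<bar>)" unfolding l_def by (rule sum_abs)
        also have "\<dots> \<le> (\<Sum>j=1..N. \<bar>v j\<bar> * (WW \<rho> y / b j))"
          unfolding abs_mult using ZZ_bounds[OF e(2)] by (intro sum_mono mult_left_mono) auto
        finally show ?thesis by (simp add: sum_distrib_right)
      qed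
      then have "\<bar>l y\<bar> * exp (- \<theta> * WW \<rho> y) \<le> (\<Sum>j=1..N. \<bar>v j\<bar> / b j) * WW \<rho> y * exp (- \<theta> * WW \<rho> y)"
        by (intro mult_right_mono) auto
      also have "\<dots> = (\<Sum>j=1..N. \<bar>v j\<bar> / b j) * (WW \<rho> y * exp (- \<theta> * WW \<rho> y))" by simp
      also have "\<dots> \<le> (\<Sum>j=1..N. \<bar>v j\<bar> / b j) * (1 / \<theta>)"
        using \<theta> W b_nonneg by (intro mult_left_mono w_exp_bound sum_nonneg divide_nonneg_nonneg) auto
      finally show "\<bar>l y * exp (- \<theta> * WW \<rho> y)\<bar> \<le> (\<Sum>j=1..N. \<bar>v j\<bar> / b j) * (1 / \<theta>)"
        by (simp add: abs_mult)
    qed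
    have "(Ut \<rho> (z \<rho>) - Ut \<rho> (z0 \<theta> \<rho>)) / ?e - expect \<rho> (\<lambda>y. l y * exp (- \<theta> * WW \<rho> y))
       = expect \<rho> (\<lambda>y. (exp (- \<theta> * WW \<rho> y) * exp (?e * x y) - exp (- \<theta> * WW \<rho> y)) / ?e - l y * exp (- \<theta> * WW \<rho> y))"
      using li integrable_prod[OF elim(2), of \<rho> tot] integrable_prod[OF elim(3), of \<rho> tot]
      unfolding Ut_def z0p zp by simp
    then show ?case using expect_abs_le[OF pt, of \<rho>] by (simp add: l_def)
  qed
  moreover have "(?bd \<longlongrightarrow> 0 * K\<^sup>2 * (8 / \<theta>\<^sup>2) + (\<Sum>j=1..N. \<bar>v j - v j\<bar> / b j) * (1 / \<theta>)) (at_left 1)"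
    using b_pos by (intro tendsto_intros eps_tendsto dlim) (auto simp: less_imp_neq[THEN not_sym])
  moreover have "0 * K\<^sup>2 * (8 / \<theta>\<^sup>2) + (\<Sum>j=1..N. \<bar>v j - v j\<bar> / b j) * (1 / \<theta>) = 0" by simp
  ultimately show ?thesis by (simp only: Lim_null_comparison)
qed

definition rr :: real where "rr = (\<Sum>i=1..N. s i + G i)"

text \<open>Divide \<open>stationary_difference\<close> along \<open>z0\<close> by
  \<open>1 - \<rho>\<close>. The glue period of station 1 contributes \<open>\<theta> * G 1\<close>
  at both ends and cancels, leaving \<open>\<theta> * rr\<close>. The other side is evaluated by
  \<open>second_order_difference\<close> with the displacement \<open>vf \<theta>\<close> of a full
  cycle.\<close>

lemma drift_limit:
  assumes \<theta>: "0 < \<theta>"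
  shows "((\<lambda>\<rho>. expect \<rho> (\<lambda>y. (\<Sum>j=1..N. vf \<theta> j * ZZ \<rho> j y) * exp (- \<theta> * WW \<rho> y)) - \<theta> * rr * chi \<rho> (\<lambda>j. \<theta> * b j)) \<longlongrightarrow> 0) (at_left 1)"
proof -
  have \<theta>': "0 \<le> \<theta>" using \<theta> by simp
  note f = first_z0[OF \<theta>']
  have s: "second \<theta> (\<lambda>\<rho>. CC \<rho> N (z0 \<theta> \<rho>)) (vf \<theta>)"
    unfolding vf_def by (rule second_CC[OF \<theta> order_refl second_z0[OF \<theta>']])
  let ?U0 = "\<lambda>\<rho>. Ut \<rho> (z0 \<theta> \<rho>)" and ?U1 = "\<lambda>\<rho>. Ut \<rho> (CC \<rho> N (z0 \<theta> \<rho>))"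
  let ?A = "\<lambda>\<rho>. (1 - GG \<rho> N (z0 \<theta> \<rho>) * exp (- LL \<rho> (z0 \<theta> \<rho>) * G 1)) / (1 - \<rho>)"
  let ?A' = "\<lambda>\<rho>. (1 - exp (- LL \<rho> (CC \<rho> N (z0 \<theta> \<rho>)) * G 1)) / (1 - \<rho>)"
  have A: "(?A \<longlongrightarrow> \<theta> * rr + \<theta> * G 1) (at_left 1)" "(?A' \<longlongrightarrow> \<theta> * G 1) (at_left 1)"
    using stationary_first_order[OF f] by (simp_all only: Gl_b lin_b Cl_b rr_def)
  have "((\<lambda>\<rho>. (?U1 \<rho> - ?U0 \<rho>) * ?A \<rho> + ?U0 \<rho> * (?A \<rho> - ?A' \<rho> - \<theta> * rr)) \<longlongrightarrow> 0 * (\<theta> * rr + \<theta> * G 1) + 0) (at_left 1)"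
  proof (intro tendsto_add tendsto_mult first_cycle[OF f] A bounded_mult_null first_Ut_bounds[OF f])
    have "((\<lambda>\<rho>. ?A \<rho> - ?A' \<rho> - \<theta> * rr) \<longlongrightarrow> \<theta> * rr + \<theta> * G 1 - \<theta> * G 1 - \<theta> * rr) (at_left 1)"
      by (intro tendsto_diff A tendsto_const)
    then show "((\<lambda>\<rho>. ?A \<rho> - ?A' \<rho> - \<theta> * rr) \<longlongrightarrow> 0) (at_left 1)" by simp
  qed
  moreover have "eventually (\<lambda>\<rho>. (?U1 \<rho> - ?U0 \<rho>) * ?A \<rho> + ?U0 \<rho> * (?A \<rho> - ?A' \<rho> - \<theta> * rr)
     = (?U1 \<rho> - ?U0 \<rho>) / (1 - \<rho>) - \<theta> * rr * ?U0 \<rho>) (at_left 1)"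
    using firstD(1)[OF f] eventually_left_1
  proof eventually_elim
    case (elim \<rho>)
    have gen: "D = u1 * a - u0 * a' \<Longrightarrow> (u1 - u0) * a + u0 * (a - a' - r) = D - r * u0" for D u1 u0 a a' r :: real
      by (simp add: algebra_simps)
    have "(?U1 \<rho> - ?U0 \<rho>) / (1 - \<rho>) = ?U1 \<rho> * ?A \<rho> - ?U0 \<rho> * ?A' \<rho>"
      using elim by (subst stationary_difference) (auto simp: diff_divide_distrib right_diff_distrib)
    then show ?case by (rule gen)
  qed
  ultimately have 1: "((\<lambda>\<rho>. (?U1 \<rho> - ?U0 \<rho>) / (1 - \<rho>) - \<theta> * rr * ?U0 \<rho>) \<longlongrightarrow> 0) (at_left 1)"
    by (simp add: tendsto_cong)
  have "((\<lambda>\<rho>. ((?U1 \<rho> - ?U0 \<rho>) / (1 - \<rho>) - \<theta> * rr * ?U0 \<rho>) - ((?U1 \<rho> - ?U0 \<rho>) / (1 - \<rho>)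
     - expect \<rho> (\<lambda>y. (\<Sum>j=1..N. vf \<theta> j * ZZ \<rho> j y) * exp (- \<theta> * WW \<rho> y)))) \<longlongrightarrow> 0 - 0) (at_left 1)"
    by (intro tendsto_diff[OF 1] second_order_difference[OF \<theta> s])
  moreover have "z0 \<theta> \<rho> = (\<lambda>j. exp (- (1 - \<rho>) * (\<theta> * b j)))" for \<rho> by (simp add: z0_def fun_eq_iff)
  ultimately show ?thesis by (simp add: chi_def)
qed

text \<open>The weighted mean square of \<open>exp (- \<eta> * ZZ \<rho> j y) - exp (- \<eta> * (cj
  j * WW \<rho> y))\<close> is a combination of three transforms whose arguments have the same
  \<open>theta\<close>, with coefficients 1, -2, 1; by \<open>chi_collapse\<close> it tends to 0.
  For small \<open>\<eta>\<close> the quotient \<open>(1 - exp (- \<eta> * x)) / \<eta>\<close>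
  recovers \<open>x\<close> up to a quadratic error, which the weight bounds.\<close>

lemma coordinate_collapse:
  assumes \<theta>: "0 < \<theta>" and j: "j \<in> {1..N}"
  shows "((\<lambda>\<rho>. expect \<rho> (\<lambda>y. (ZZ \<rho> j y - cj j * WW \<rho> y) * exp (- \<theta> * WW \<rho> y))) \<longlongrightarrow> 0) (at_left 1)"
proof (rule tendstoI)
  fix e :: real assume e: "0 < e"
  have c: "0 \<le> cj j" using Uf_pos[OF j] dl_pos by (simp add: cj_def)
  \<comment> \<open>\<open>\<eta> * D\<close> bounds the error of the linearisation, and
    \<open>\<eta>\<close> makes it \<open>e / 4\<close>. With the choice of \<open>\<kappa>\<close>
    below, \<open>\<kappa> / \<eta>\<close> and the mean-square term are a further
    \<open>e / 4\<close> each.\<close>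
  define D where "D = (1 / (b j)\<^sup>2 + (cj j)\<^sup>2) / \<theta>\<^sup>2"
  have D: "0 < D" using b_pos[OF j] \<theta> by (simp add: D_def add_pos_nonneg)
  define \<eta> where "\<eta> = e / (4 * D)"
  have \<eta>: "0 < \<eta>" using e D by (simp add: \<eta>_def)
  define \<kappa> where "\<kappa> = \<eta> * e / 4"
  have \<kappa>: "0 < \<kappa>" using e \<eta> by (simp add: \<kappa>_def)
  define sq where "sq = (\<lambda>\<rho> y. exp (- \<theta> * WW \<rho> y) * (exp (- \<eta> * ZZ \<rho> j y) - exp (- \<eta> * (cj j * WW \<rho> y)))\<^sup>2)"
  let ?s1 = "\<lambda>i. \<theta> * b i + (if i = j then 2 * \<eta> else 0)"
  let ?s2 = "\<lambda>i. (\<theta> + \<eta> * cj j) * b i + (if i = j then \<eta> else 0)"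
  let ?s3 = "\<lambda>i. (\<theta> + 2 * \<eta> * cj j) * b i"
  have exps: "(\<Sum>i=1..N. (a * b i + (if i = j then x else 0)) * ZZ \<rho> i y) = a * WW \<rho> y + x * ZZ \<rho> j y" for a x \<rho> y
  proof -
    have "(a * b i + (if i = j then x else 0)) * ZZ \<rho> i y = a * (b i * ZZ \<rho> i y) + (if i = j then x * ZZ \<rho> j y else 0)" for i
      by (simp add: algebra_simps)
    then show ?thesis using j by (simp add: WW_sum sum.distrib sum_distrib_left[symmetric])
  qed
  have int: "integrable (measure_pmf (Y \<rho>)) (\<lambda>y. exp (- (a * WW \<rho> y + x * ZZ \<rho> j y)))" if "0 \<le> a" "0 \<le> x" "\<rho> \<le> 1" for a x \<rho>
    using that WW_nonneg[OF that(3)] ZZ_bounds(1)[OF that(3) j]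
    by (intro integrable_bounded[of _ 1]) (simp del: minus_add_distrib add: add_nonneg_nonneg)
  have sq_eq: "expect \<rho> (sq \<rho>) = chi \<rho> ?s1 - 2 * chi \<rho> ?s2 + chi \<rho> ?s3" if "\<rho> \<le> 1" for \<rho>
  proof -
    have "sq \<rho> y = exp (- (\<theta> * WW \<rho> y + 2 * \<eta> * ZZ \<rho> j y)) - 2 * exp (- ((\<theta> + \<eta> * cj j) * WW \<rho> y + \<eta> * ZZ \<rho> j y))
        + exp (- ((\<theta> + 2 * \<eta> * cj j) * WW \<rho> y + 0 * ZZ \<rho> j y))" for y
      by (simp add: sq_def power2_eq_square algebra_simps mult_exp_exp)
    moreover have "chi \<rho> ?s3 = expect \<rho> (\<lambda>y. exp (- ((\<theta> + 2 * \<eta> * cj j) * WW \<rho> y + 0 * ZZ \<rho> j y)))"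
      using exps[of "\<theta> + 2 * \<eta> * cj j" 0] by (simp add: chi_expect)
    ultimately show ?thesis
      using int[of \<theta> "2 * \<eta>" \<rho>] int[of "\<theta> + \<eta> * cj j" \<eta> \<rho>] int[of "\<theta> + 2 * \<eta> * cj j" 0 \<rho>] that \<theta> \<eta> c
      by (simp add: chi_expect exps[unfolded One_nat_def])
  qed
  have nonneg: "0 \<le> ?s1 i" "0 \<le> ?s2 i" if "i \<in> {1..N}" for i
    using that \<theta> \<eta> c b_nonneg by (auto intro!: add_nonneg_nonneg mult_nonneg_nonneg)
  have th: "theta ?s1 = \<theta> + 2 * \<eta> * cj j" "theta ?s2 = \<theta> + 2 * \<eta> * cj j"
    by (simp_all add: theta_point[OF j])
  have "((\<lambda>\<rho>. (chi \<rho> ?s1 - chi \<rho> ?s3) - 2 * (chi \<rho> ?s2 - chi \<rho> ?s3)) \<longlongrightarrow> 0 - 2 * 0) (at_left 1)"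
    using chi_collapse[of ?s1] chi_collapse[of ?s2] nonneg unfolding th by (intro tendsto_intros) auto
  then have "((\<lambda>\<rho>. chi \<rho> ?s1 - 2 * chi \<rho> ?s2 + chi \<rho> ?s3) \<longlongrightarrow> 0) (at_left 1)"
    by (simp add: algebra_simps)
  then have "eventually (\<lambda>\<rho>. chi \<rho> ?s1 - 2 * chi \<rho> ?s2 + chi \<rho> ?s3 < \<kappa> * (\<eta> * e / 4)) (at_left 1)"
    using \<kappa> \<eta> e by (intro order_tendstoD(2)) auto
  then show "eventually (\<lambda>\<rho>. dist (expect \<rho> (\<lambda>y. (ZZ \<rho> j y - cj j * WW \<rho> y) * exp (- \<theta> * WW \<rho> y))) 0 < e) (at_left 1)"
    using eventually_left_1
  proof eventually_elim
    case (elim \<rho>)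
    then have \<rho>: "\<rho> \<le> 1" by simp
    have pt: "\<bar>(ZZ \<rho> j y - cj j * WW \<rho> y) * exp (- \<theta> * WW \<rho> y)\<bar> \<le> \<eta> * D + (\<kappa> + sq \<rho> y / \<kappa>) / \<eta>" for y
    proof -
      let ?Z = "ZZ \<rho> j y" and ?W = "WW \<rho> y"
      let ?E = "exp (- \<theta> * ?W)" and ?d = "exp (- \<eta> * ?Z) - exp (- \<eta> * (cj j * ?W))"
      have W: "0 \<le> ?W" and Z: "0 \<le> ?Z" "?Z \<le> ?W / b j" using WW_nonneg[OF \<rho>] ZZ_bounds[OF \<rho> j] by auto
      have lin: "\<bar>x - (1 - exp (- \<eta> * x)) / \<eta>\<bar> \<le> \<eta> * x\<^sup>2 / 2" if "0 \<le> x" for x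
      proof -
        have "x - (1 - exp (- \<eta> * x)) / \<eta> = (exp (- (\<eta> * x)) - 1 + \<eta> * x) / \<eta>" using \<eta> by (simp add: field_simps)
        moreover have "0 \<le> (exp (- (\<eta> * x)) - 1 + \<eta> * x) / \<eta>" "(exp (- (\<eta> * x)) - 1 + \<eta> * x) / \<eta> \<le> (\<eta> * x)\<^sup>2 / 2 / \<eta>"
          using exp_minus_bounds(3,4)[of "\<eta> * x"] \<eta> that by (intro divide_right_mono divide_nonneg_nonneg; simp)+
        moreover have "(\<eta> * x)\<^sup>2 / 2 / \<eta> = \<eta> * x\<^sup>2 / 2" using \<eta> by (simp add: power2_eq_square)
        ultimately show ?thesis by (simp only: abs_of_nonneg)
      qed
      have "?Z - cj j * ?W = (?Z - (1 - exp (- \<eta> * ?Z)) / \<eta>) - (cj j * ?W - (1 - exp (- \<eta> * (cj j * ?W))) / \<eta>) - ?d / \<eta>"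
        using \<eta> by (simp add: field_simps)
      then have "\<bar>?Z - cj j * ?W\<bar> \<le> \<eta> * ?Z\<^sup>2 / 2 + \<eta> * (cj j * ?W)\<^sup>2 / 2 + \<bar>?d / \<eta>\<bar>"
      proof -
        have gen: "a - a' = d - d' - r \<Longrightarrow> \<bar>d\<bar> \<le> m \<Longrightarrow> \<bar>d'\<bar> \<le> m' \<Longrightarrow> \<bar>a - a'\<bar> \<le> m + m' + \<bar>r\<bar>" for a a' d d' r m m' :: real
          by linarith
        assume "?Z - cj j * ?W = (?Z - (1 - exp (- \<eta> * ?Z)) / \<eta>) - (cj j * ?W - (1 - exp (- \<eta> * (cj j * ?W))) / \<eta>) - ?d / \<eta>"
        from gen[OF this lin[OF Z(1)] lin[OF mult_nonneg_nonneg[OF c W]]] show ?thesis .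
      qed
      then have "\<bar>?Z - cj j * ?W\<bar> \<le> \<eta> * ?Z\<^sup>2 / 2 + \<eta> * (cj j * ?W)\<^sup>2 / 2 + \<bar>?d\<bar> / \<eta>"
        using \<eta> by (simp only: abs_divide abs_of_pos)
      moreover have "?Z\<^sup>2 \<le> ?W\<^sup>2 / (b j)\<^sup>2" using power_mono[OF Z(2,1), of 2] by (simp add: power_divide)
      ultimately have "\<bar>?Z - cj j * ?W\<bar> \<le> \<eta> / 2 * (1 / (b j)\<^sup>2 + (cj j)\<^sup>2) * ?W\<^sup>2 + \<bar>?d\<bar> / \<eta>"
        using mult_left_mono[of "?Z\<^sup>2" "?W\<^sup>2 / (b j)\<^sup>2" "\<eta> / 2"] \<eta> by (simp add: power_mult_distrib algebra_simps)
      then have "\<bar>?Z - cj j * ?W\<bar> * ?E \<le> (\<eta> / 2 * (1 / (b j)\<^sup>2 + (cj j)\<^sup>2) * ?W\<^sup>2 + \<bar>?d\<bar> / \<eta>) * ?E"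
        by (intro mult_right_mono) auto
      also have "\<dots> = \<eta> / 2 * (1 / (b j)\<^sup>2 + (cj j)\<^sup>2) * (?W\<^sup>2 * ?E) + (\<bar>?d\<bar> * ?E) / \<eta>" by (simp add: algebra_simps)
      also have "\<dots> \<le> \<eta> / 2 * (1 / (b j)\<^sup>2 + (cj j)\<^sup>2) * (2 / \<theta>\<^sup>2) + (\<kappa> + sq \<rho> y / \<kappa>) / \<eta>"
      proof (intro add_mono mult_left_mono divide_right_mono w_exp_bound(2) \<theta> W)
        \<comment> \<open>Only the mean square of the difference is known to be small; this is the
          passage from the square to the absolute value at the price of
          \<open>\<kappa>\<close>.\<close>
        have "\<bar>?d\<bar> * \<kappa> \<le> \<kappa>\<^sup>2 + ?d\<^sup>2"
        proof -
          have gen: "x * k \<le> k\<^sup>2 + x\<^sup>2" if "0 \<le> x" "0 < k" for x k :: real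
            using sum_squares_bound[of x k] mult_nonneg_nonneg[of x k] that by linarith
          show ?thesis using gen[of "\<bar>?d\<bar>" \<kappa>] \<kappa> by (simp only: power2_abs abs_ge_zero)
        qed
        then have "\<bar>?d\<bar> \<le> \<kappa> + ?d\<^sup>2 / \<kappa>"
        proof -
          have gen: "x \<le> k + q / k" if "x * k \<le> k\<^sup>2 + q" "0 < k" for x k q :: real
            using that by (simp add: field_simps power2_eq_square)
          assume "\<bar>?d\<bar> * \<kappa> \<le> \<kappa>\<^sup>2 + ?d\<^sup>2"
          from gen[OF this \<kappa>] show ?thesis .
        qed
        then have "\<bar>?d\<bar> * ?E \<le> (\<kappa> + ?d\<^sup>2 / \<kappa>) * ?E" by (intro mult_right_mono) auto
        also have "\<dots> = \<kappa> * ?E + sq \<rho> y / \<kappa>" by (simp add: sq_def algebra_simps)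
        also have "\<kappa> * ?E \<le> \<kappa> * 1" using \<kappa> \<theta> W by (intro mult_left_mono) auto
        finally show "\<bar>?d\<bar> * ?E \<le> \<kappa> + sq \<rho> y / \<kappa>" by simp
      qed (use \<eta> in auto)
      also have "\<eta> / 2 * (1 / (b j)\<^sup>2 + (cj j)\<^sup>2) * (2 / \<theta>\<^sup>2) = \<eta> * D" by (simp add: D_def)
      finally show ?thesis by (simp add: abs_mult)
    qed
    have sqb: "\<bar>sq \<rho> y\<bar> \<le> 1" for y
    proof -
      have "\<bar>exp (- \<eta> * ZZ \<rho> j y) - exp (- \<eta> * (cj j * WW \<rho> y))\<bar> \<le> 1"
        using \<eta> c WW_nonneg[OF \<rho>, of y] ZZ_bounds(1)[OF \<rho> j, of y]
        by (smt (verit) exp_gt_zero exp_le_one_iff mult_nonneg_nonneg mult_minus_left)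
      then have "(exp (- \<eta> * ZZ \<rho> j y) - exp (- \<eta> * (cj j * WW \<rho> y)))\<^sup>2 \<le> 1" by (simp add: abs_square_le_1)
      then show ?thesis unfolding sq_def abs_mult using \<theta> WW_nonneg[OF \<rho>, of y] by (intro mult_le_one) auto
    qed
    have sqi: "integrable (measure_pmf (Y \<rho>)) (sq \<rho>)" using sqb by (rule integrable_bounded)
    have fi: "integrable (measure_pmf (Y \<rho>)) (\<lambda>y. \<bar>(ZZ \<rho> j y - cj j * WW \<rho> y) * exp (- \<theta> * WW \<rho> y)\<bar>)"
    proof (rule integrable_bounded)
      fix y
      have "\<eta> * D + (\<kappa> + sq \<rho> y / \<kappa>) / \<eta> \<le> \<eta> * D + (\<kappa> + 1 / \<kappa>) / \<eta>"
        using sqb[of y] \<kappa> \<eta> by (intro add_left_mono divide_right_mono) auto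
      then show "\<bar>\<bar>(ZZ \<rho> j y - cj j * WW \<rho> y) * exp (- \<theta> * WW \<rho> y)\<bar>\<bar> \<le> \<eta> * D + (\<kappa> + 1 / \<kappa>) / \<eta>"
        using pt[of y] by simp
    qed
    have "\<bar>expect \<rho> (\<lambda>y. (ZZ \<rho> j y - cj j * WW \<rho> y) * exp (- \<theta> * WW \<rho> y))\<bar> \<le> expect \<rho> (\<lambda>y. \<bar>(ZZ \<rho> j y - cj j * WW \<rho> y) * exp (- \<theta> * WW \<rho> y)\<bar>)"
      using integral_norm_bound[of "measure_pmf (Y \<rho>)" "\<lambda>y. (ZZ \<rho> j y - cj j * WW \<rho> y) * exp (- \<theta> * WW \<rho> y)"] by simp
    also have "\<dots> \<le> expect \<rho> (\<lambda>y. \<eta> * D + (\<kappa> + sq \<rho> y / \<kappa>) / \<eta>)"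
      using fi sqi pt by (intro integral_mono) auto
    also have "\<dots> = \<eta> * D + (\<kappa> + expect \<rho> (sq \<rho>) / \<kappa>) / \<eta>"
      using sqi by simp
    also have "\<dots> < \<eta> * D + (\<kappa> + \<eta> * e / 4) / \<eta>"
    proof -
      have "expect \<rho> (sq \<rho>) / \<kappa> < \<eta> * e / 4"
        unfolding sq_eq[OF \<rho>] using elim(1) \<kappa> by (simp add: pos_divide_less_eq mult.commute)
      then show ?thesis using \<eta> by (simp add: divide_strict_right_mono)
    qed
    also have "\<dots> = 3 * e / 4" using \<eta> D by (simp add: \<kappa>_def \<eta>_def field_simps)
    also have "\<dots> < e" using e by simp
    finally show ?case by (simp add: dist_real_def)
  qed
qed

definition mm :: "real \<Rightarrow> real \<Rightarrow> real" where
  "mm \<rho> \<theta> = expect \<rho> (\<lambda>y. WW \<rho> y * exp (- \<theta> * WW \<rho> y))"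

text \<open>In \<open>drift_limit\<close> every \<open>ZZ \<rho> j y\<close> is replaced by
  \<open>cj j * WW \<rho> y\<close>. The coefficient of the work is then
  \<open>Lf 0 (vf \<theta>) / dl\<close>, known from \<open>Lf_vf\<close>; multiplying by
  \<open>dl / \<theta>\<close> gives the stated form.\<close>

lemma ode_limit:
  assumes \<theta>: "0 < \<theta>"
  shows "((\<lambda>\<rho>. mm \<rho> \<theta> * (1 + \<theta> * c2 / 2) - rr * dl * chi \<rho> (\<lambda>j. \<theta> * b j)) \<longlongrightarrow> 0) (at_left 1)"
proof -
  let ?E = "\<lambda>\<rho> y. exp (- \<theta> * WW \<rho> y)"
  have "((\<lambda>\<rho>. (expect \<rho> (\<lambda>y. (\<Sum>j=1..N. vf \<theta> j * ZZ \<rho> j y) * ?E \<rho> y) - \<theta> * rr * chi \<rho> (\<lambda>j. \<theta> * b j))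
     - (\<Sum>j=1..N. vf \<theta> j * expect \<rho> (\<lambda>y. (ZZ \<rho> j y - cj j * WW \<rho> y) * ?E \<rho> y))) \<longlongrightarrow> 0 - (\<Sum>j=1..N. vf \<theta> j * 0)) (at_left 1)"
    by (intro tendsto_diff tendsto_sum tendsto_mult tendsto_const drift_limit[OF \<theta>] coordinate_collapse[OF \<theta>])
  moreover have "eventually (\<lambda>\<rho>. (expect \<rho> (\<lambda>y. (\<Sum>j=1..N. vf \<theta> j * ZZ \<rho> j y) * ?E \<rho> y) - \<theta> * rr * chi \<rho> (\<lambda>j. \<theta> * b j))
     - (\<Sum>j=1..N. vf \<theta> j * expect \<rho> (\<lambda>y. (ZZ \<rho> j y - cj j * WW \<rho> y) * ?E \<rho> y))
     = (\<theta> + \<theta>\<^sup>2 * c2 / 2) / dl * mm \<rho> \<theta> - \<theta> * rr * chi \<rho> (\<lambda>j. \<theta> * b j)) (at_left 1)"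
    using eventually_left_1
  proof eventually_elim
    case (elim \<rho>)
    then have \<rho>: "\<rho> \<le> 1" by simp
    have Wi: "integrable (measure_pmf (Y \<rho>)) (\<lambda>y. WW \<rho> y * ?E \<rho> y)"
      using w_exp_bound(1)[OF \<theta> WW_nonneg[OF \<rho>]] WW_nonneg[OF \<rho>] by (intro integrable_bounded[of _ "1 / \<theta>"]) (simp add: abs_mult)
    have Zi: "integrable (measure_pmf (Y \<rho>)) (\<lambda>y. ZZ \<rho> j y * ?E \<rho> y)" if j: "j \<in> {1..N}" for j
    proof (rule integrable_bounded)
      fix y
      have "ZZ \<rho> j y * ?E \<rho> y \<le> WW \<rho> y / b j * ?E \<rho> y"
        using ZZ_bounds[OF \<rho> j, of y] by (intro mult_right_mono) auto
      also have "\<dots> = (WW \<rho> y * ?E \<rho> y) / b j" by simp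
      also have "\<dots> \<le> 1 / \<theta> / b j"
        using b_pos[OF j] w_exp_bound(1)[OF \<theta> WW_nonneg[OF \<rho>]] by (intro divide_right_mono) auto
      finally show "\<bar>ZZ \<rho> j y * ?E \<rho> y\<bar> \<le> 1 / \<theta> / b j" using ZZ_bounds(1)[OF \<rho> j, of y] by (simp add: abs_mult)
    qed
    have 1: "expect \<rho> (\<lambda>y. (\<Sum>j=1..N. vf \<theta> j * ZZ \<rho> j y) * ?E \<rho> y) = (\<Sum>j=1..N. vf \<theta> j * expect \<rho> (\<lambda>y. ZZ \<rho> j y * ?E \<rho> y))"
    proof -
      have "(\<Sum>j=1..N. vf \<theta> j * ZZ \<rho> j y) * ?E \<rho> y = (\<Sum>j=1..N. vf \<theta> j * (ZZ \<rho> j y * ?E \<rho> y))" for y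
        by (simp add: sum_distrib_right mult.assoc)
      then show ?thesis using Zi by (simp add: Bochner_Integration.integral_sum)
    qed
    have 2: "expect \<rho> (\<lambda>y. (ZZ \<rho> j y - cj j * WW \<rho> y) * ?E \<rho> y) = expect \<rho> (\<lambda>y. ZZ \<rho> j y * ?E \<rho> y) - cj j * mm \<rho> \<theta>"
      if j: "j \<in> {1..N}" for j
    proof -
      have "(\<lambda>y. (ZZ \<rho> j y - cj j * WW \<rho> y) * ?E \<rho> y) = (\<lambda>y. ZZ \<rho> j y * ?E \<rho> y - cj j * (WW \<rho> y * ?E \<rho> y))"
        by (simp add: fun_eq_iff algebra_simps)
      then show ?thesis using Zi[OF j] Wi by (simp add: mm_def)
    qed
    have 3: "(\<Sum>j=1..N. vf \<theta> j * cj j) = (\<theta> + \<theta>\<^sup>2 * c2 / 2) / dl"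
      unfolding Lf_vf[symmetric] Lf_def by (simp add: cj_def sum_divide_distrib mult.commute)
    have "(\<Sum>j=1..N. vf \<theta> j * expect \<rho> (\<lambda>y. (ZZ \<rho> j y - cj j * WW \<rho> y) * ?E \<rho> y))
       = (\<Sum>j=1..N. vf \<theta> j * expect \<rho> (\<lambda>y. ZZ \<rho> j y * ?E \<rho> y)) - (\<Sum>j=1..N. vf \<theta> j * cj j) * mm \<rho> \<theta>"
      using 2 by (simp add: right_diff_distrib sum_subtractf sum_distrib_right mult.assoc)
    then show ?case unfolding 1 3 by simp
  qed
  ultimately have "((\<lambda>\<rho>. (\<theta> + \<theta>\<^sup>2 * c2 / 2) / dl * mm \<rho> \<theta> - \<theta> * rr * chi \<rho> (\<lambda>j. \<theta> * b j)) \<longlongrightarrow> 0 - (\<Sum>j=1..N. vf \<theta> j * 0)) (at_left 1)"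
    by (rule Lim_transform_eventually)
  then have "((\<lambda>\<rho>. (\<theta> + \<theta>\<^sup>2 * c2 / 2) / dl * mm \<rho> \<theta> - \<theta> * rr * chi \<rho> (\<lambda>j. \<theta> * b j)) \<longlongrightarrow> 0) (at_left 1)"
    by simp
  then have "((\<lambda>\<rho>. dl / \<theta> * ((\<theta> + \<theta>\<^sup>2 * c2 / 2) / dl * mm \<rho> \<theta> - \<theta> * rr * chi \<rho> (\<lambda>j. \<theta> * b j))) \<longlongrightarrow> dl / \<theta> * 0) (at_left 1)"
    by (intro tendsto_intros)
  moreover have "dl / \<theta> * ((\<theta> + \<theta>\<^sup>2 * c2 / 2) / dl * mm \<rho> \<theta> - \<theta> * rr * chi \<rho> (\<lambda>j. \<theta> * b j))
     = mm \<rho> \<theta> * (1 + \<theta> * c2 / 2) - rr * dl * chi \<rho> (\<lambda>j. \<theta> * b j)" for \<rho>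
    using \<theta> dl_pos by (simp add: field_simps power2_eq_square)
  ultimately show ?thesis by simp
qed

end

section \<open>The limit of the transform\<close>

lemma at_left_1_Ioo: "at_left (1::real) = at 1 within {0<..<1}"
  by (rule at_within_nhd[of _ "{0<..}"]) auto

lemma has_field_derivative_quadratic_remainder:
  fixes F :: "real \<Rightarrow> real"
  assumes d: "0 < d" and rem: "\<And>h. \<bar>h\<bar> \<le> d \<Longrightarrow> \<bar>F (x + h) - F x - h * D\<bar> \<le> C * h\<^sup>2"
  shows "(F has_field_derivative D) (at x)"
proof -
  have "((\<lambda>h. (F (x + h) - F x) / h - D) \<longlongrightarrow> 0) (at 0)"
  proof (rule Lim_null_comparison)
    have "eventually (\<lambda>h::real. h \<noteq> 0 \<and> \<bar>h\<bar> < d) (at 0)"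
      unfolding eventually_at using d by (intro exI[of _ d]) (simp add: dist_real_def)
    then show "eventually (\<lambda>h. norm ((F (x + h) - F x) / h - D) \<le> C * \<bar>h\<bar>) (at 0)"
    proof eventually_elim
      case (elim h)
      then have h: "h \<noteq> 0" "\<bar>h\<bar> \<le> d" by auto
      have "(F (x + h) - F x) / h - D = (F (x + h) - F x - h * D) / h" using h by (simp add: field_simps)
      then have "norm ((F (x + h) - F x) / h - D) = \<bar>F (x + h) - F x - h * D\<bar> / \<bar>h\<bar>" by (simp only: real_norm_def abs_divide)
      also have "\<dots> \<le> C * h\<^sup>2 / \<bar>h\<bar>" by (intro divide_right_mono rem h) auto
      also have "\<dots> = C * \<bar>h\<bar>" using h by (simp add: power2_eq_square abs_if)
      finally show ?case .
    qed
    have "((\<lambda>h::real. C * \<bar>h\<bar>) \<longlongrightarrow> C * \<bar>0\<bar>) (at 0)" by (intro tendsto_intros)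
    then show "((\<lambda>h::real. C * \<bar>h\<bar>) \<longlongrightarrow> 0) (at 0)" by simp
  qed
  then have "((\<lambda>h. (F (x + h) - F x) / h) \<longlongrightarrow> D) (at 0)" by (rule LIM_zero_cancel)
  then show ?thesis by (simp only: DERIV_def)
qed

context heavy_traffic_steady
begin

definition vv :: real where "vv = c2 / 2"
definition al :: real where "al = rr * dl / vv"

lemma vv_pos: "0 < vv" using c2_pos by (simp add: vv_def)

lemma al_vv: "al * vv = rr * dl" using vv_pos by (simp add: al_def)

lemma chi_line: "chi \<rho> (\<lambda>j. \<theta> * b j) = expect \<rho> (\<lambda>y. exp (- \<theta> * WW \<rho> y))"
proof -
  have "(\<Sum>j=1..N. (\<theta> * b j) * ZZ \<rho> j y) = \<theta> * WW \<rho> y" for y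
    by (simp only: WW_sum sum_distrib_left mult.assoc)
  then show ?thesis by (simp only: chi_expect mult_minus_left)
qed

lemma integrable_W_exp:
  assumes "0 < \<theta>" "\<rho> \<le> 1"
  shows "integrable (measure_pmf (Y \<rho>)) (\<lambda>y. WW \<rho> y * exp (- \<theta> * WW \<rho> y))"
    "integrable (measure_pmf (Y \<rho>)) (\<lambda>y. (WW \<rho> y)\<^sup>2 * exp (- \<theta> * WW \<rho> y))"
    "expect \<rho> (\<lambda>y. (WW \<rho> y)\<^sup>2 * exp (- \<theta> * WW \<rho> y)) \<le> 2 / \<theta>\<^sup>2"
proof -
  note W = WW_nonneg[OF assms(2)]
  show "integrable (measure_pmf (Y \<rho>)) (\<lambda>y. WW \<rho> y * exp (- \<theta> * WW \<rho> y))"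
    using w_exp_bound(1)[OF assms(1) W] W by (intro integrable_bounded[of _ "1 / \<theta>"]) (simp add: abs_mult)
  have bd: "\<bar>(WW \<rho> y)\<^sup>2 * exp (- \<theta> * WW \<rho> y)\<bar> \<le> 2 / \<theta>\<^sup>2" for y
    using w_exp_bound(2)[OF assms(1) W[of y]] by (simp add: abs_mult)
  then show "integrable (measure_pmf (Y \<rho>)) (\<lambda>y. (WW \<rho> y)\<^sup>2 * exp (- \<theta> * WW \<rho> y))" by (rule integrable_bounded)
  show "expect \<rho> (\<lambda>y. (WW \<rho> y)\<^sup>2 * exp (- \<theta> * WW \<rho> y)) \<le> 2 / \<theta>\<^sup>2"
    using expect_abs_le[where f="\<lambda>y. (WW \<rho> y)\<^sup>2 * exp (- \<theta> * WW \<rho> y)", OF bd, of \<rho>] by linarith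
qed

text \<open>For \<open>\<bar>h\<bar> \<le> \<theta> / 2\<close> half of the weight absorbs
  \<open>exp (\<bar>h\<bar> * WW \<rho> y)\<close> and the other half bounds the square of the work,
  which gives a quadratic remainder.\<close>

lemma chi_line_derivative:
  assumes \<theta>: "0 < \<theta>" and \<rho>: "\<rho> \<le> 1"
  shows "((\<lambda>\<theta>. chi \<rho> (\<lambda>j. \<theta> * b j)) has_field_derivative - mm \<rho> \<theta>) (at \<theta>)"
proof (rule has_field_derivative_quadratic_remainder[where d="\<theta> / 2" and C="2 / (\<theta> / 2)\<^sup>2"])
  show "0 < \<theta> / 2" using \<theta> by simp
  fix h assume h: "\<bar>h\<bar> \<le> \<theta> / 2"
  note W = WW_nonneg[OF \<rho>]
  have th: "0 < \<theta> / 2" using \<theta> by simp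
  have ei: "integrable (measure_pmf (Y \<rho>)) (\<lambda>y. exp (- a * WW \<rho> y))" if "0 \<le> a" for a
    using that W by (intro integrable_bounded[of _ 1]) simp
  have h0: "0 \<le> \<theta> + h" using h by linarith
  have "chi \<rho> (\<lambda>j. (\<theta> + h) * b j) - chi \<rho> (\<lambda>j. \<theta> * b j) - h * - mm \<rho> \<theta>
      = expect \<rho> (\<lambda>y. exp (- (\<theta> + h) * WW \<rho> y) - exp (- \<theta> * WW \<rho> y) + h * (WW \<rho> y * exp (- \<theta> * WW \<rho> y)))"
    unfolding chi_line mm_def using ei[OF h0] ei[OF less_imp_le[OF \<theta>]] integrable_W_exp(1)[OF \<theta> \<rho>] by simp
  also have "\<bar>\<dots>\<bar> \<le> h\<^sup>2 * (2 / (\<theta> / 2)\<^sup>2)"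
  proof (rule expect_abs_le)
    fix y
    let ?W = "WW \<rho> y"
    have "exp (- (\<theta> + h) * ?W) - exp (- \<theta> * ?W) + h * (?W * exp (- \<theta> * ?W)) = exp (- \<theta> * ?W) * (exp (- (h * ?W)) - 1 - (- (h * ?W)))"
      by (simp add: algebra_simps mult_exp_exp)
    then have "\<bar>exp (- (\<theta> + h) * ?W) - exp (- \<theta> * ?W) + h * (?W * exp (- \<theta> * ?W))\<bar> = exp (- \<theta> * ?W) * \<bar>exp (- (h * ?W)) - 1 - (- (h * ?W))\<bar>"
      by (simp only: abs_mult abs_exp_cancel)
    also have "\<dots> \<le> exp (- \<theta> * ?W) * ((- (h * ?W))\<^sup>2 * exp \<bar>- (h * ?W)\<bar>)"
      by (intro mult_left_mono abs_exp_remainder) simp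
    also have "\<dots> \<le> exp (- \<theta> * ?W) * ((- (h * ?W))\<^sup>2 * exp (\<theta> / 2 * ?W))"
    proof (intro mult_left_mono)
      have "\<bar>- (h * ?W)\<bar> = \<bar>h\<bar> * ?W" using W[of y] by (simp add: abs_mult)
      also have "\<dots> \<le> \<theta> / 2 * ?W" by (intro mult_right_mono h W)
      finally show "exp \<bar>- (h * ?W)\<bar> \<le> exp (\<theta> / 2 * ?W)" by simp
    qed auto
    also have "\<dots> = h\<^sup>2 * (?W\<^sup>2 * exp (- (\<theta> / 2) * ?W))"
    proof -
      have "exp (- \<theta> * ?W) * exp (\<theta> / 2 * ?W) = exp (- (\<theta> / 2) * ?W)" by (simp add: mult_exp_exp algebra_simps)
      then show ?thesis by (simp add: power_mult_distrib)
    qed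
    also have "\<dots> \<le> h\<^sup>2 * (2 / (\<theta> / 2)\<^sup>2)"
      by (intro mult_left_mono w_exp_bound(2)[OF th W]) simp
    finally show "\<bar>exp (- (\<theta> + h) * ?W) - exp (- \<theta> * ?W) + h * (?W * exp (- \<theta> * ?W))\<bar> \<le> h\<^sup>2 * (2 / (\<theta> / 2)\<^sup>2)" .
  qed
  finally show "\<bar>chi \<rho> (\<lambda>j. (\<theta> + h) * b j) - chi \<rho> (\<lambda>j. \<theta> * b j) - h * - mm \<rho> \<theta>\<bar> \<le> 2 / (\<theta> / 2)\<^sup>2 * h\<^sup>2"
    by (simp only: mult.commute)
qed

lemma chi_line_continuous:
  assumes "0 < \<rho>" "\<rho> < 1" shows "continuous_on {0..T} (\<lambda>\<theta>. chi \<rho> (\<lambda>j. \<theta> * b j))"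
proof (rule lipschitz_on_continuous_on[where L="\<Sum>j=1..N. b j * (RR / (pm * b j))"], rule lipschitz_onI)
  fix x y :: real assume xy: "x \<in> {0..T}" "y \<in> {0..T}"
  have "\<bar>chi \<rho> (\<lambda>j. x * b j) - chi \<rho> (\<lambda>j. y * b j)\<bar> \<le> (\<Sum>j=1..N. \<bar>x * b j - y * b j\<bar> * (RR / (pm * b j)))"
    using assms xy by (intro chi_lipschitz mult_nonneg_nonneg b_nonneg) auto
  also have "\<dots> = (\<Sum>j=1..N. \<bar>x - y\<bar> * (b j * (RR / (pm * b j))))"
  proof (intro sum.cong refl)
    fix j assume "j \<in> {1..N}"
    then have "\<bar>x * b j - y * b j\<bar> = \<bar>x - y\<bar> * b j" using b_nonneg[of j] by (simp only: left_diff_distrib[symmetric] abs_mult abs_of_nonneg)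
    then show "\<bar>x * b j - y * b j\<bar> * (RR / (pm * b j)) = \<bar>x - y\<bar> * (b j * (RR / (pm * b j)))" by (simp only: mult.assoc)
  qed
  finally show "dist (chi \<rho> (\<lambda>j. x * b j)) (chi \<rho> (\<lambda>j. y * b j)) \<le> (\<Sum>j=1..N. b j * (RR / (pm * b j))) * dist x y"
    by (simp only: dist_real_def sum_distrib_left[symmetric] mult.commute)
next
  show "0 \<le> (\<Sum>j=1..N. b j * (RR / (pm * b j)))"
    using pm(1) RR_nonneg by (intro sum_nonneg mult_nonneg_nonneg divide_nonneg_nonneg) (auto intro: b_nonneg)
qed

lemma mm_bound:
  assumes "0 < \<rho>" "\<rho> < 1" "0 < \<theta>" shows "\<bar>mm \<rho> \<theta>\<bar> \<le> RR / pm"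
proof -
  have \<rho>: "\<rho> \<le> 1" using assms by simp
  note W = WW_nonneg[OF \<rho>]
  have Wi: "integrable (measure_pmf (Y \<rho>)) (WW \<rho>)"
    using work_mean(1)[OF assms(1,2)] by (simp add: WW_def[abs_def])
  have "0 \<le> mm \<rho> \<theta>" unfolding mm_def using W by (intro Bochner_Integration.integral_nonneg) simp
  moreover have "mm \<rho> \<theta> \<le> expect \<rho> (WW \<rho>)" unfolding mm_def
  proof (rule integral_mono[OF integrable_W_exp(1)[OF assms(3) \<rho>] Wi])
    fix y show "WW \<rho> y * exp (- \<theta> * WW \<rho> y) \<le> WW \<rho> y"
      using W[of y] assms(3) by (intro mult_left_le) auto
  qed
  moreover have "expect \<rho> (WW \<rho>) = (1 - \<rho>) * expect \<rho> work" by (simp add: WW_def[abs_def])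
  ultimately show ?thesis using work_mean(2)[OF assms(1,2)] by linarith
qed

lemma chi_abs_le: "\<rho> \<le> 1 \<Longrightarrow> 0 \<le> \<theta> \<Longrightarrow> \<bar>chi \<rho> (\<lambda>j. \<theta> * b j)\<bar> \<le> 1"
  unfolding chi_line using WW_nonneg[of \<rho>] by (intro expect_abs_le) simp

lemma chi_zero: "chi \<rho> (\<lambda>j. 0) = 1"
  by (simp add: chi_expect)

text \<open>
  Along the line \<open>\<theta> b\<close> the transform satisfies asymptotically
  \<open>-\<chi>'(\<theta>) (1 + \<theta> v) = \<alpha> v \<chi>(\<theta>)\<close>, whose solution with value 1 at 0 is \<open>(1 + \<theta> v) powr (-\<alpha>)\<close>.
\<close>

lemma chi_line_limit:
  assumes T: "0 < T"
  shows "((\<lambda>\<rho>. chi \<rho> (\<lambda>j. T * b j)) \<longlongrightarrow> (1 + T * vv) powr - al) (at_left 1)"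
  unfolding at_left_1_Ioo tendsto_at_iff_sequentially
proof (intro allI impI)
  fix R :: "nat \<Rightarrow> real" assume R: "\<forall>i. R i \<in> {0<..<1} - {1}" "R \<longlonglongrightarrow> 1"
  have R01: "0 < R k" "R k < 1" "R k \<le> 1" for k using R(1)[rule_format, of k] by auto
  have Rf: "filterlim R (at_left 1) sequentially"
    unfolding at_left_1_Ioo filterlim_at using R(2) R01(1,2) less_imp_neq[OF R01(2)] by simp
  define F where "F = (\<lambda>k x. chi (R k) (\<lambda>j. x * b j))"
  \<comment> \<open>Multiplication by the reciprocal of the expected solution: the derivative of
    \<open>q k\<close> is a power of \<open>1 + x * vv\<close> times the defect \<open>A k x\<close>
    in the differential equation.\<close>
  define q where "q = (\<lambda>k x. F k x * (1 + x * vv) powr al)"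
  define A where "A = (\<lambda>k x. mm (R k) x * (1 + x * vv) - rr * dl * F k x)"
  \<comment> \<open>The defect is controlled only for positive arguments, so the value at 0 is set
    to 0; a single point does not affect the integral.\<close>
  define q' where "q' = (\<lambda>k x. if x = 0 then 0 else - ((1 + x * vv) powr (al - 1)) * A k x)"
  define K where "K = RR / pm * (1 + T * vv) + \<bar>rr * dl\<bar>"
  have base: "0 < 1 + x * vv" if "0 \<le> x" for x
    using mult_nonneg_nonneg[OF that less_imp_le[OF vv_pos]] by linarith
  have "(q' k has_integral (q k T - q k 0)) {0..T}" for k
  proof (rule fundamental_theorem_of_calculus_interior)
    show "continuous_on {0..T} (q k)" unfolding q_def F_def
      using base by (intro continuous_intros chi_line_continuous R01) (auto simp: less_imp_neq[THEN not_sym])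
    fix x assume x: "x \<in> {0<..<T}"
    then have x0: "0 < x" by simp
    note bs = base[OF less_imp_le[OF x0]]
    have "(F k has_field_derivative - mm (R k) x) (at x)" unfolding F_def by (rule chi_line_derivative[OF x0 R01(3)])
    moreover have "((\<lambda>x. (1 + x * vv) powr al) has_field_derivative al * (1 + x * vv) powr (al - 1) * vv) (at x)"
      using bs by (auto intro!: derivative_eq_intros)
    ultimately have "(q k has_field_derivative - mm (R k) x * (1 + x * vv) powr al + al * (1 + x * vv) powr (al - 1) * vv * F k x) (at x)"
      unfolding q_def by (rule DERIV_mult)
    moreover have "- mm (R k) x * (1 + x * vv) powr al + al * (1 + x * vv) powr (al - 1) * vv * F k x = q' k x"
    proof -
      have "(1 + x * vv) powr al = (1 + x * vv) powr (al - 1) * (1 + x * vv)"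
        using powr_add[of "1 + x * vv" "al - 1" 1] bs by simp
      then have "- mm (R k) x * (1 + x * vv) powr al + al * (1 + x * vv) powr (al - 1) * vv * F k x
         = - ((1 + x * vv) powr (al - 1)) * (mm (R k) x * (1 + x * vv) - (al * vv) * F k x)" by (simp add: algebra_simps)
      then show ?thesis using x0 by (simp add: q'_def A_def al_vv)
    qed
    ultimately show "(q k has_vector_derivative q' k x) (at x)"
      by (simp only: has_real_derivative_iff_has_vector_derivative)
  qed (use T in simp)
  note ftc = this
  \<comment> \<open>The defects tend to 0 pointwise and are dominated by means of
    \<open>mm_bound\<close>, so integrating the derivative suffices and no convergence of the
    transforms has to be known beforehand.\<close>
  have "(\<lambda>k. integral {0..T} (q' k)) \<longlonglongrightarrow> integral {0..T} (\<lambda>_. 0)"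
  proof (rule dominated_convergence(2)[where h="\<lambda>x. (1 + x * vv) powr (al - 1) * K"])
    show "q' k integrable_on {0..T}" for k using ftc by (rule has_integral_integrable)
    show "(\<lambda>x. (1 + x * vv) powr (al - 1) * K) integrable_on {0..T}"
      using base by (intro integrable_continuous_interval continuous_intros) (auto simp: less_imp_neq[THEN not_sym])
    have K0: "0 \<le> K" unfolding K_def using RR_nonneg pm(1) less_imp_le[OF vv_pos] T by (intro add_nonneg_nonneg mult_nonneg_nonneg divide_nonneg_nonneg) auto
    fix k x assume x: "x \<in> {0..T}"
    show "norm (q' k x) \<le> (1 + x * vv) powr (al - 1) * K"
    proof (cases "x = 0")
      case True then show ?thesis using K0 by (simp add: q'_def)
    next
      case False
      then have x0: "0 < x" using x by simp
      have "\<bar>A k x\<bar> \<le> \<bar>mm (R k) x * (1 + x * vv)\<bar> + \<bar>rr * dl * F k x\<bar>" unfolding A_def by (rule abs_triangle_ineq4)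
      also have "\<bar>mm (R k) x * (1 + x * vv)\<bar> \<le> RR / pm * (1 + T * vv)"
      proof -
        have "1 + x * vv \<le> 1 + T * vv" using x vv_pos by simp
        then show ?thesis unfolding abs_mult
          using mm_bound[OF R01(1,2) x0, of k] base[of x] x RR_nonneg pm(1) by (intro mult_mono divide_nonneg_nonneg) auto
      qed
      also have "\<bar>rr * dl * F k x\<bar> \<le> \<bar>rr * dl\<bar>"
        unfolding abs_mult[of "rr * dl"] F_def using chi_abs_le[OF R01(3)[of k], of x] x by (intro mult_left_le) auto
      finally have "\<bar>A k x\<bar> \<le> K" by (simp add: K_def)
      then have "(1 + x * vv) powr (al - 1) * \<bar>A k x\<bar> \<le> (1 + x * vv) powr (al - 1) * K" by (intro mult_left_mono) auto
      then show ?thesis using False by (simp add: q'_def abs_mult)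
    qed
  next
    fix x assume x: "x \<in> {0..T}"
    show "(\<lambda>k. q' k x) \<longlonglongrightarrow> 0"
    proof (cases "x = 0")
      case False
      then have x0: "0 < x" using x by simp
      have "(\<lambda>k. A k x) \<longlonglongrightarrow> 0"
        using filterlim_compose[OF ode_limit[OF x0] Rf] by (simp add: A_def F_def vv_def)
      then have "(\<lambda>k. - ((1 + x * vv) powr (al - 1)) * A k x) \<longlonglongrightarrow> - ((1 + x * vv) powr (al - 1)) * 0"
        by (intro tendsto_intros)
      then show ?thesis using False by (simp add: q'_def)
    qed (simp add: q'_def)
  qed
  moreover have "integral {0..T} (q' k) = q k T - 1" for k
  proof -
    have "q k 0 = 1" by (simp add: q_def F_def chi_zero)
    then show ?thesis using integral_unique[OF ftc[of k]] by simp
  qed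
  ultimately have "(\<lambda>k. q k T - 1) \<longlonglongrightarrow> 0" by simp
  then have "(\<lambda>k. q k T) \<longlonglongrightarrow> 1" by (rule LIM_zero_cancel)
  then have "(\<lambda>k. q k T * (1 + T * vv) powr - al) \<longlonglongrightarrow> 1 * (1 + T * vv) powr - al" by (intro tendsto_intros)
  moreover have "q k T * (1 + T * vv) powr - al = F k T" for k
    using base[of T] T by (simp add: q_def mult.assoc powr_add[symmetric])
  ultimately show "((\<lambda>\<rho>. chi \<rho> (\<lambda>j. T * b j)) \<circ> R) \<longlonglongrightarrow> (1 + T * vv) powr - al"
    by (simp add: F_def comp_def)
qed

lemma theta_nonneg: "(\<And>j. j \<in> {1..N} \<Longrightarrow> 0 \<le> \<sigma> j) \<Longrightarrow> 0 \<le> theta \<sigma>"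
  unfolding theta_def Lf_def using dl_pos Uf_pos
  by (intro divide_nonneg_pos sum_nonneg mult_nonneg_nonneg) (auto intro: less_imp_le)

lemma chi_limit:
  assumes \<sigma>: "\<And>j. j \<in> {1..N} \<Longrightarrow> 0 \<le> \<sigma> j"
  shows "((\<lambda>\<rho>. chi \<rho> \<sigma>) \<longlongrightarrow> (1 + theta \<sigma> * vv) powr - al) (at_left 1)"
proof -
  have "((\<lambda>\<rho>. chi \<rho> (\<lambda>j. theta \<sigma> * b j)) \<longlongrightarrow> (1 + theta \<sigma> * vv) powr - al) (at_left 1)"
  proof (cases "theta \<sigma> = 0")
    case True then show ?thesis by (simp add: chi_zero)
  next
    case False
    then show ?thesis using theta_nonneg[of \<sigma>] \<sigma> by (intro chi_line_limit) auto
  qed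
  from tendsto_add[OF chi_collapse[of \<sigma>] this] \<sigma> show ?thesis by simp
qed

text \<open>
  The coordinates 0 and 1 of \<open>F\<close> belong to the queue and the orbit of station 1. Given the type-1
  population at the start of the glue period, each customer is in the queue with probability
  \<open>p 1\<close>, which is how \<open>F\<close> is expressed through \<open>Ut\<close>.
\<close>

lemma joint_limit:
  fixes F :: "real \<Rightarrow> (nat \<Rightarrow> real) \<Rightarrow> real"
  assumes split: "\<And>\<rho> w. 0 < \<rho> \<Longrightarrow> \<rho> < 1 \<Longrightarrow> w \<in> cube \<Longrightarrow> 0 \<le> w 0 \<Longrightarrow> w 0 \<le> 1 \<Longrightarrow>
      exp (LL \<rho> (w(1 := w 0)) * G 1) * F \<rho> w
      = exp (LL \<rho> (w(1 := p 1 * w 0 + (1 - p 1) * w 1)) * G 1) * Ut \<rho> (w(1 := p 1 * w 0 + (1 - p 1) * w 1))"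
    and k: "\<And>j. j \<le> N \<Longrightarrow> 0 \<le> k j"
  shows "((\<lambda>\<rho>. F \<rho> (\<lambda>j. exp (- (1 - \<rho>) * k j))) \<longlongrightarrow>
     (1 + theta (k(1 := p 1 * k 0 + (1 - p 1) * k 1)) * vv) powr - al) (at_left 1)"
proof -
  let ?w = "\<lambda>\<rho> j. exp (- (1 - \<rho>) * k j)"
  let ?k' = "k(1 := p 1 * k 0 + (1 - p 1) * k 1)"
  let ?wq = "\<lambda>\<rho>. (?w \<rho>)(1 := ?w \<rho> 0)"
  let ?w' = "\<lambda>\<rho>. (?w \<rho>)(1 := p 1 * ?w \<rho> 0 + (1 - p 1) * ?w \<rho> 1)"
  have pb: "0 \<le> p 1" "p 1 \<le> 1" using p_bounds[OF one_in] by auto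
  have fw: "first ?w k" using k by (intro first_exp) simp
  have k0: "((\<lambda>\<rho>. (1 - ?w \<rho> 0) / (1 - \<rho>)) \<longlongrightarrow> k 0) (at_left 1)"
    using firstD(2)[OF first_exp[of "\<lambda>_. k 0"] one_in] k[of 0] by simp
  have kn: "0 \<le> ?k' j" if "j \<in> {1..N}" for j using that k pb by (auto intro!: add_nonneg_nonneg mult_nonneg_nonneg)
  have w0: "eventually (\<lambda>\<rho>. 0 \<le> ?w \<rho> 0 \<and> ?w \<rho> 0 \<le> 1) (at_left 1)"
    using eventually_left_1 by eventually_elim (use k[of 0] in \<open>simp add: mult_nonpos_nonneg\<close>)
  have f0: "first ?wq (k(1 := k 0))"
  proof -
    have "first (\<lambda>\<rho> j. exp (- (1 - \<rho>) * (k(1 := k 0)) j)) (k(1 := k 0))" using k by (intro first_exp) auto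
    moreover have "(\<lambda>\<rho> j. exp (- (1 - \<rho>) * (k(1 := k 0)) j)) = ?wq" by (simp add: fun_eq_iff)
    ultimately show ?thesis by simp
  qed
  \<comment> \<open>A mixture of two exponentials is not an exponential, but it has the same
    first-order expansion as the one with the mixed exponent, and \<open>first_close\<close> needs
    no more.\<close>
  have f': "first ?w' ?k'" unfolding first_def
  proof (intro conjI ballI)
    show "eventually (\<lambda>\<rho>. ?w' \<rho> \<in> cube) (at_left 1)"
      using firstD(1)[OF fw] w0
    proof eventually_elim
      case (elim \<rho>)
      have w1: "0 \<le> ?w \<rho> 1" "?w \<rho> 1 \<le> 1" using elim(1) one_in by (auto simp: cube_def)
      have "0 \<le> p 1 * ?w \<rho> 0 + (1 - p 1) * ?w \<rho> 1" using pb w1 elim(2) by (intro add_nonneg_nonneg mult_nonneg_nonneg) auto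
      moreover have "p 1 * ?w \<rho> 0 + (1 - p 1) * ?w \<rho> 1 \<le> 1" using pb w1 elim(2) by (intro convex_bound_le) auto
      ultimately show ?case using elim(1) by (auto simp: cube_def)
    qed
    fix j assume j: "j \<in> {1..N}"
    show "((\<lambda>\<rho>. (1 - ?w' \<rho> j) / (1 - \<rho>)) \<longlongrightarrow> ?k' j) (at_left 1)"
    proof (cases "j = 1")
      case True
      have "((\<lambda>\<rho>. p 1 * ((1 - ?w \<rho> 0) / (1 - \<rho>)) + (1 - p 1) * ((1 - ?w \<rho> 1) / (1 - \<rho>))) \<longlongrightarrow> p 1 * k 0 + (1 - p 1) * k 1) (at_left 1)"
        by (intro tendsto_intros k0 firstD(2)[OF fw one_in])
      moreover have "p 1 * ((1 - ?w \<rho> 0) / (1 - \<rho>)) + (1 - p 1) * ((1 - ?w \<rho> 1) / (1 - \<rho>)) = (1 - ?w' \<rho> 1) / (1 - \<rho>)" for \<rho>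
        unfolding times_divide_eq_right add_divide_distrib[symmetric] by (simp add: algebra_simps)
      ultimately show ?thesis unfolding True by simp
    next
      case False then show ?thesis using firstD(2)[OF fw j] by simp
    qed
  qed
  have L: "((\<lambda>\<rho>. exp (LL \<rho> (z \<rho>) * G 1)) \<longlongrightarrow> 1) (at_left 1)" if "first z \<sigma>" for z \<sigma>
  proof -
    have "((\<lambda>\<rho>. LL \<rho> (z \<rho>)) \<longlongrightarrow> 0) (at_left 1)" by (rule small_of_quotient[OF first_LL[OF that] eps_tendsto eps_pos])
    then have "((\<lambda>\<rho>. exp (LL \<rho> (z \<rho>) * G 1)) \<longlongrightarrow> exp (0 * G 1)) (at_left 1)" by (intro tendsto_intros)
    then show ?thesis by simp
  qed
  have fk': "first (\<lambda>\<rho> j. exp (- (1 - \<rho>) * ?k' j)) ?k'" using kn by (rule first_exp)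
  have "((\<lambda>\<rho>. (Ut \<rho> (?w' \<rho>) - chi \<rho> ?k') + chi \<rho> ?k') \<longlongrightarrow> 0 + (1 + theta ?k' * vv) powr - al) (at_left 1)"
    unfolding chi_def by (intro tendsto_add first_close[OF f' fk'] chi_limit[unfolded chi_def] kn)
  then have "((\<lambda>\<rho>. exp (LL \<rho> (?w' \<rho>) * G 1) / exp (LL \<rho> (?wq \<rho>) * G 1) * Ut \<rho> (?w' \<rho>)) \<longlongrightarrow> 1 / 1 * (0 + (1 + theta ?k' * vv) powr - al)) (at_left 1)"
    by (intro tendsto_mult tendsto_divide L[OF f'] L[OF f0]) simp_all
  moreover have "eventually (\<lambda>\<rho>. exp (LL \<rho> (?w' \<rho>) * G 1) / exp (LL \<rho> (?wq \<rho>) * G 1) * Ut \<rho> (?w' \<rho>) = F \<rho> (?w \<rho>)) (at_left 1)"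
    using eventually_left_1 firstD(1)[OF fw] w0
  proof eventually_elim
    case (elim \<rho>)
    have "exp (LL \<rho> (?wq \<rho>) * G 1) * F \<rho> (?w \<rho>) = exp (LL \<rho> (?w' \<rho>) * G 1) * Ut \<rho> (?w' \<rho>)"
      by (rule split) (use elim in auto)
    then show ?case by (simp only: times_divide_eq_left nonzero_divide_eq_eq[OF exp_not_eq_zero]) (simp only: mult.commute)
  qed
  ultimately have "((\<lambda>\<rho>. F \<rho> (?w \<rho>)) \<longlongrightarrow> 1 / 1 * (0 + (1 + theta ?k' * vv) powr - al)) (at_left 1)"
    by (rule Lim_transform_eventually)
  then show ?thesis by simp
qed

end

section \<open>Continuity theorem for Laplace transforms\<close>

text \<open>The algebra for the Stone-Weierstrass theorem. After the substitution
  \<open>z j = exp (- x j)\<close> the expectation of a monomial is a Laplace transform at an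
  integer vector.\<close>

inductive monomial_sum :: "nat \<Rightarrow> ((nat \<Rightarrow> real) \<Rightarrow> real) \<Rightarrow> bool" for N where
  monomial: "monomial_sum N (\<lambda>z. c * (\<Prod>j\<le>N. z j ^ k j))"
| add: "monomial_sum N f \<Longrightarrow> monomial_sum N g \<Longrightarrow> monomial_sum N (\<lambda>z. f z + g z)"

lemma monomial_sum_const: "monomial_sum N (\<lambda>z. c)"
  using monomial[of N c "\<lambda>_. 0"] by simp

lemma monomial_sum_coordinate: "i \<le> N \<Longrightarrow> monomial_sum N (\<lambda>z. z i)"
proof -
  assume i: "i \<le> N"
  have "(\<Prod>j\<le>N. z j ^ (if j = i then 1 else 0)) = z i" for z :: "nat \<Rightarrow> real"
  proof -
    have "(\<Prod>j\<le>N. z j ^ (if j = i then 1 else 0)) = (\<Prod>j\<le>N. if j = i then z i else 1)" by (intro prod.cong) auto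
    then show ?thesis using i by simp
  qed
  then show ?thesis using monomial[of N 1 "\<lambda>j. if j = i then 1 else 0"] by simp
qed

lemma monomial_sum_mult:
  assumes "monomial_sum N f" "monomial_sum N g" shows "monomial_sum N (\<lambda>z. f z * g z)"
  using assms
proof (induction rule: monomial_sum.induct)
  case (monomial c k)
  from monomial.prems show ?case
  proof (induction rule: monomial_sum.induct)
    case (monomial c' k')
    have "c * (\<Prod>j\<le>N. z j ^ k j) * (c' * (\<Prod>j\<le>N. z j ^ k' j)) = (c * c') * (\<Prod>j\<le>N. z j ^ (k j + k' j))" for z :: "nat \<Rightarrow> real"
      by (simp add: power_add prod.distrib)
    then show ?case by (simp only: monomial_sum.monomial)
  next
    case (add f g)
    then show ?case using monomial_sum.add[OF add.IH] by (simp add: distrib_left)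
  qed
next
  case (add f f')
  then show ?case using monomial_sum.add[OF add.IH(1)[OF add.prems] add.IH(2)[OF add.prems]] by (simp add: distrib_right)
qed

lemma monomial_sum_continuous: "monomial_sum N f \<Longrightarrow> continuous_on S f"
  by (induction rule: monomial_sum.induct)
    (auto intro!: continuous_intros continuous_on_subset[OF continuous_on_product_coordinates])

definition zcube :: "nat \<Rightarrow> (nat \<Rightarrow> real) set" where
  "zcube N = {z. (\<forall>j\<le>N. 0 \<le> z j \<and> z j \<le> 1) \<and> (\<forall>j>N. z j = 0)}"

lemma compact_zcube: "compact (zcube N)"
proof -
  have "zcube N = (\<Pi>\<^sub>E j\<in>UNIV. if j \<le> N then {0..1} else {0})"
  proof (rule set_eqI)
    fix z :: "nat \<Rightarrow> real"
    have "z j \<in> (if j \<le> N then {0..1} else {0}) \<longleftrightarrow> (j \<le> N \<longrightarrow> 0 \<le> z j \<and> z j \<le> 1) \<and> (N < j \<longrightarrow> z j = 0)" for j by simp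
    then show "z \<in> zcube N \<longleftrightarrow> z \<in> (\<Pi>\<^sub>E j\<in>UNIV. if j \<le> N then {0..1} else {0})"
      unfolding zcube_def PiE_iff by (simp only: mem_Collect_eq UNIV_I extensional_UNIV ball_UNIV simp_thms) blast
  qed
  moreover have "compactin (product_topology (\<lambda>_. euclidean) UNIV) (\<Pi>\<^sub>E j\<in>UNIV. if j \<le> N then {0..1::real} else {0})"
    unfolding compactin_PiE by auto
  ultimately show ?thesis by (simp add: euclidean_product_topology)
qed

lemma monomial_sum_dense:
  assumes "continuous_on (zcube N) f" "0 < e"
  shows "\<exists>h. monomial_sum N h \<and> (\<forall>z\<in>zcube N. \<bar>f z - h z\<bar> < e)"
proof (rule Stone_Weierstrass_HOL[OF compact_zcube])
  fix x y assume "x \<in> zcube N \<and> y \<in> zcube N \<and> x \<noteq> y"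
  then obtain j where j: "x j \<noteq> y j" "x \<in> zcube N" "y \<in> zcube N" by (auto simp: fun_eq_iff)
  then have "j \<le> N" by (auto simp: zcube_def not_le[symmetric] intro: ccontr)
  then show "\<exists>f. monomial_sum N f \<and> f x \<noteq> f y"
    using monomial_sum_coordinate[of j N] j(1) by (intro exI[of _ "\<lambda>z. z j"]) simp
qed (use assms in \<open>auto intro: monomial_sum_const monomial_sum_continuous monomial_sum.add monomial_sum_mult\<close>)

text \<open>Truncation at 0 sends every vector into the compact cube while keeping the map
  continuous; laws on the orthant do not notice it.\<close>

definition zexp :: "nat \<Rightarrow> (nat \<Rightarrow> real) \<Rightarrow> nat \<Rightarrow> real" where
  "zexp N x j = (if j \<le> N then exp (- max 0 (x j)) else 0)"

lemma zexp_zcube: "zexp N x \<in> zcube N"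
  by (simp add: zexp_def zcube_def)

lemma continuous_zexp: "continuous_on UNIV (zexp N)"
proof (rule continuous_on_coordinatewise_then_product)
  fix i
  show "continuous_on UNIV (\<lambda>x. zexp N x i)"
    by (cases "i \<le> N") (auto simp: zexp_def intro!: continuous_intros)
qed

text \<open>The smoothed indicator of \<open>z j > 1 / R\<close>; it makes a bounded function of \<open>- ln z\<close> continuous on the cube.\<close>

definition cutoff :: "nat \<Rightarrow> real \<Rightarrow> (nat \<Rightarrow> real) \<Rightarrow> real" where
  "cutoff N R z = (\<Prod>j\<le>N. min 1 (max 0 (R * z j - 1)))"

lemma cutoff_bounds: "0 \<le> cutoff N R z" "cutoff N R z \<le> 1"
  unfolding cutoff_def by (auto intro!: prod_nonneg prod_le_1)

lemma continuous_cutoff: "continuous_on UNIV (cutoff N R)"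
  unfolding cutoff_def[abs_def] by (intro continuous_intros) simp_all

text \<open>Inverse of \<open>zexp\<close> on the orthant wherever \<open>cutoff\<close> is nonzero;
  the floor \<open>1 / R\<close> keeps the logarithm continuous on the whole space.\<close>

definition zlog :: "nat \<Rightarrow> real \<Rightarrow> (nat \<Rightarrow> real) \<Rightarrow> nat \<Rightarrow> real" where
  "zlog N R z j = (if j \<le> N then - ln (max (1 / R) (z j)) else 0)"

lemma continuous_zlog: "0 < R \<Longrightarrow> continuous_on UNIV (zlog N R)"
proof (rule continuous_on_coordinatewise_then_product)
  fix i assume R: "0 < R"
  have "max (1 / R) (z i) \<noteq> 0" for z :: "nat \<Rightarrow> real" using R less_max_iff_disj[of 0 "1 / R" "z i"] by simp
  then show "continuous_on UNIV (\<lambda>x. zlog N R x i)"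
    by (cases "i \<le> N") (auto simp: zlog_def intro!: continuous_intros)
qed

lemma zlog_zexp:
  assumes R: "0 < R" and x: "\<forall>j. 0 \<le> x j" "\<forall>j>N. x j = 0" and c: "cutoff N R (zexp N x) \<noteq> 0"
  shows "zlog N R (zexp N x) = x"
proof
  fix j
  show "zlog N R (zexp N x) j = x j"
  proof (cases "j \<le> N")
    case True
    then have "min 1 (max 0 (R * zexp N x j - 1)) \<noteq> 0" using c by (auto simp: cutoff_def)
    then have "1 / R \<le> zexp N x j" using R by (simp add: field_simps min_def max_def split: if_splits)
    then show ?thesis using True x(1) by (simp add: zlog_def zexp_def max_absorb2)
  next
    case False then show ?thesis using x(2) by (simp add: zlog_def)
  qed
qed

lemma cutoff_tendsto: "(\<lambda>n. cutoff N (real n) (zexp N x)) \<longlonglongrightarrow> 1"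
proof -
  have "(\<lambda>n. min 1 (max 0 (real n * zexp N x j - 1))) \<longlonglongrightarrow> 1" if "j \<le> N" for j
  proof (rule tendsto_eventually)
    have z: "0 < zexp N x j" using that by (simp add: zexp_def)
    obtain m where m: "2 / zexp N x j < real m" using reals_Archimedean2 by blast
    show "eventually (\<lambda>n. min 1 (max 0 (real n * zexp N x j - 1)) = 1) sequentially"
      unfolding eventually_sequentially
    proof (intro exI[of _ m] allI impI)
      fix n assume "m \<le> n"
      then have "2 / zexp N x j < real n" using m by linarith
      then have "2 < real n * zexp N x j" using z by (simp add: field_simps)
      then show "min 1 (max 0 (real n * zexp N x j - 1)) = 1" by simp
    qed
  qed
  then have "(\<lambda>n. \<Prod>j\<le>N. min 1 (max 0 (real n * zexp N x j - 1))) \<longlonglongrightarrow> (\<Prod>j\<le>N. 1)"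
    by (intro tendsto_prod) simp
  then show ?thesis by (simp add: cutoff_def)
qed

definition orthant_law :: "nat \<Rightarrow> (nat \<Rightarrow> real) measure \<Rightarrow> bool" where
  "orthant_law N P \<longleftrightarrow> prob_space P \<and> sets P = sets borel \<and> (AE v in P. (\<forall>j. 0 \<le> v j) \<and> (\<forall>j>N. v j = 0))"

lemma orthant_lawD:
  assumes "orthant_law N P"
  shows "prob_space P" "sets P = sets borel" "AE v in P. (\<forall>j. 0 \<le> v j) \<and> (\<forall>j>N. v j = 0)"
  using assms by (simp_all add: orthant_law_def)

lemma orthant_law_measurable:
  assumes "orthant_law N P" "continuous_on UNIV f" shows "(f :: _ \<Rightarrow> real) \<in> borel_measurable P"
  using borel_measurable_continuous_onI[OF assms(2)] orthant_lawD(2)[OF assms(1)]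
  by (simp cong: measurable_cong_sets)

lemma orthant_law_integrable:
  assumes P: "orthant_law N P" and f: "continuous_on UNIV f" "\<And>v. \<bar>f v :: real\<bar> \<le> C"
  shows "integrable P f"
proof -
  interpret prob_space P by (rule orthant_lawD(1)[OF P])
  show ?thesis using f(2) by (intro integrable_const_bound[of _ C] orthant_law_measurable[OF P f(1)]) simp
qed

lemma orthant_law_integral_diff:
  assumes P: "orthant_law N P" and f: "continuous_on UNIV f" "continuous_on UNIV g"
    and b: "\<And>v. \<bar>f v :: real\<bar> \<le> C" "\<And>v. \<bar>g v\<bar> \<le> C'" "\<And>v. \<bar>f v - g v\<bar> \<le> e"
  shows "\<bar>(\<integral>v. f v \<partial>P) - (\<integral>v. g v \<partial>P)\<bar> \<le> e"
proof -
  interpret prob_space P by (rule orthant_lawD(1)[OF P])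
  note i = orthant_law_integrable[OF P f(1) b(1)] orthant_law_integrable[OF P f(2) b(2)]
  have "\<bar>(\<integral>v. f v \<partial>P) - (\<integral>v. g v \<partial>P)\<bar> = \<bar>\<integral>v. f v - g v \<partial>P\<bar>" using i by simp
  also have "\<dots> \<le> (\<integral>v. \<bar>f v - g v\<bar> \<partial>P)" using integral_norm_bound[of P "\<lambda>v. f v - g v"] by simp
  also have "\<dots> \<le> (\<integral>v. e \<partial>P)" using i b(3) by (intro integral_mono) auto
  finally show ?thesis by (simp add: prob_space)
qed

context
  fixes N :: nat and P :: "'i \<Rightarrow> (nat \<Rightarrow> real) measure" and Q :: "(nat \<Rightarrow> real) measure" and F :: "'i filter"
  assumes P: "eventually (\<lambda>i. orthant_law N (P i)) F" and Q: "orthant_law N Q"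
    and lap: "\<And>k :: nat \<Rightarrow> nat. ((\<lambda>i. \<integral>v. exp (- (\<Sum>j\<le>N. real (k j) * v j)) \<partial>P i)
        \<longlongrightarrow> (\<integral>v. exp (- (\<Sum>j\<le>N. real (k j) * v j)) \<partial>Q)) F"
begin

lemma orthant_laplace_zexp:
  assumes R: "orthant_law N R"
  shows "(\<integral>v. (\<Prod>j\<le>N. zexp N v j ^ k j) \<partial>R) = (\<integral>v. exp (- (\<Sum>j\<le>N. real (k j) * v j)) \<partial>R)"
proof (rule integral_cong_AE)
  show "(\<lambda>v. \<Prod>j\<le>N. zexp N v j ^ k j) \<in> borel_measurable R"
    by (intro orthant_law_measurable[OF R] continuous_intros continuous_on_product_then_coordinatewise[OF continuous_zexp])
  show "(\<lambda>v. exp (- (\<Sum>j\<le>N. real (k j) * v j))) \<in> borel_measurable R"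
    by (intro orthant_law_measurable[OF R] continuous_intros) simp
  show "AE v in R. (\<Prod>j\<le>N. zexp N v j ^ k j) = exp (- (\<Sum>j\<le>N. real (k j) * v j))"
    using orthant_lawD(3)[OF R]
  proof eventually_elim
    case (elim v)
    have "(\<Prod>j\<le>N. zexp N v j ^ k j) = (\<Prod>j\<le>N. exp (- (real (k j) * v j)))"
      using elim by (intro prod.cong refl) (simp add: zexp_def exp_of_nat_mult[symmetric])
    then show ?case by (simp add: exp_sum[symmetric] sum_negf)
  qed
qed

lemma zexp_bounded:
  assumes "continuous_on UNIV f" obtains C where "0 \<le> C" "\<And>v. \<bar>f (zexp N v) :: real\<bar> \<le> C"
proof -
  have "compact (f ` zcube N)"
    by (intro compact_continuous_image compact_zcube continuous_on_subset[OF assms]) simp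
  then obtain C where "\<forall>y\<in>f ` zcube N. norm y \<le> C" using compact_imp_bounded bounded_iff by metis
  then have "\<bar>f (zexp N v)\<bar> \<le> C" for v using zexp_zcube[of N v] by auto
  moreover from this[of undefined] have "0 \<le> C" by linarith
  ultimately show thesis using that by blast
qed

lemma continuous_on_zexp: "continuous_on UNIV f \<Longrightarrow> continuous_on UNIV (\<lambda>v. f (zexp N v))"
  by (rule continuous_on_compose2[OF _ continuous_zexp]) auto

lemma monomial_sum_limit:
  "monomial_sum N h \<Longrightarrow> ((\<lambda>i. \<integral>v. h (zexp N v) \<partial>P i) \<longlongrightarrow> (\<integral>v. h (zexp N v) \<partial>Q)) F"
proof (induction rule: monomial_sum.induct)
  case (monomial c k)
  have "((\<lambda>i. c * (\<integral>v. exp (- (\<Sum>j\<le>N. real (k j) * v j)) \<partial>P i)) \<longlongrightarrow> c * (\<integral>v. exp (- (\<Sum>j\<le>N. real (k j) * v j)) \<partial>Q)) F"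
    by (intro tendsto_intros lap)
  moreover have "eventually (\<lambda>i. c * (\<integral>v. exp (- (\<Sum>j\<le>N. real (k j) * v j)) \<partial>P i) = (\<integral>v. c * (\<Prod>j\<le>N. zexp N v j ^ k j) \<partial>P i)) F"
    using P by eventually_elim (simp add: orthant_laplace_zexp)
  moreover have "c * (\<integral>v. exp (- (\<Sum>j\<le>N. real (k j) * v j)) \<partial>Q) = (\<integral>v. c * (\<Prod>j\<le>N. zexp N v j ^ k j) \<partial>Q)"
    by (simp add: orthant_laplace_zexp[OF Q])
  ultimately show ?case by (simp only: tendsto_cong)
next
  case (add f g)
  have cf: "continuous_on UNIV f" "continuous_on UNIV g" using add.hyps by (auto intro: monomial_sum_continuous)
  obtain C C' where C: "\<And>v. \<bar>f (zexp N v)\<bar> \<le> C" "\<And>v. \<bar>g (zexp N v)\<bar> \<le> C'"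
    using zexp_bounded[OF cf(1)] zexp_bounded[OF cf(2)] by metis
  have split: "(\<integral>v. f (zexp N v) \<partial>R) + (\<integral>v. g (zexp N v) \<partial>R) = (\<integral>v. f (zexp N v) + g (zexp N v) \<partial>R)" if "orthant_law N R" for R
    using orthant_law_integrable[OF that continuous_on_zexp[OF cf(1)] C(1)]
      orthant_law_integrable[OF that continuous_on_zexp[OF cf(2)] C(2)] by simp
  have "eventually (\<lambda>i. (\<integral>v. f (zexp N v) \<partial>P i) + (\<integral>v. g (zexp N v) \<partial>P i) = (\<integral>v. f (zexp N v) + g (zexp N v) \<partial>P i)) F"
    using P by eventually_elim (rule split)
  from Lim_transform_eventually[OF tendsto_add[OF add.IH] this] show ?case by (simp only: split[OF Q])
qed

lemma zexp_limit:
  fixes f :: "(nat \<Rightarrow> real) \<Rightarrow> real"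
  assumes f: "continuous_on UNIV f"
  shows "((\<lambda>i. \<integral>v. f (zexp N v) \<partial>P i) \<longlongrightarrow> (\<integral>v. f (zexp N v) \<partial>Q)) F"
proof (rule tendstoI)
  fix e :: real assume e: "0 < e"
  obtain h where h: "monomial_sum N h" "\<forall>z\<in>zcube N. \<bar>f z - h z\<bar> < e / 4"
    using monomial_sum_dense[of N f "e / 4"] continuous_on_subset[OF f] e by auto
  have ch: "continuous_on UNIV h" using h(1) by (rule monomial_sum_continuous)
  obtain C C' where C: "\<And>v. \<bar>f (zexp N v)\<bar> \<le> C" "\<And>v. \<bar>h (zexp N v)\<bar> \<le> C'"
    using zexp_bounded[OF f] zexp_bounded[OF ch] by metis
  have d: "\<bar>f (zexp N v) - h (zexp N v)\<bar> \<le> e / 4" for v using h(2) zexp_zcube[of N v] by (auto intro: less_imp_le)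
  have "eventually (\<lambda>i. dist (\<integral>v. h (zexp N v) \<partial>P i) (\<integral>v. h (zexp N v) \<partial>Q) < e / 4) F"
    using monomial_sum_limit[OF h(1)] e by (intro tendstoD) auto
  then show "eventually (\<lambda>i. dist (\<integral>v. f (zexp N v) \<partial>P i) (\<integral>v. f (zexp N v) \<partial>Q) < e) F"
    using P
  proof eventually_elim
    case (elim i)
    have "\<bar>(\<integral>v. f (zexp N v) \<partial>P i) - (\<integral>v. h (zexp N v) \<partial>P i)\<bar> \<le> e / 4"
      by (rule orthant_law_integral_diff[OF elim(2) continuous_on_zexp[OF f] continuous_on_zexp[OF ch] C d])
    moreover have "\<bar>(\<integral>v. f (zexp N v) \<partial>Q) - (\<integral>v. h (zexp N v) \<partial>Q)\<bar> \<le> e / 4"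
      by (rule orthant_law_integral_diff[OF Q continuous_on_zexp[OF f] continuous_on_zexp[OF ch] C d])
    ultimately show ?case using elim(1) e unfolding dist_real_def by linarith
  qed
qed

text \<open>Where the cutoff is nonzero, \<open>zlog\<close> undoes \<open>zexp\<close>; elsewhere
  the product vanishes. The error is thus at most \<open>C\<close> times the expected value of 1
  minus the cutoff.\<close>

lemma cutoff_error:
  assumes R: "0 < R" and L: "orthant_law N L" and f: "continuous_on UNIV f" "\<And>v. \<bar>f v :: real\<bar> \<le> C"
  shows "\<bar>(\<integral>v. f v \<partial>L) - (\<integral>v. f (zlog N R (zexp N v)) * cutoff N R (zexp N v) \<partial>L)\<bar> \<le> C * (1 - (\<integral>v. cutoff N R (zexp N v) \<partial>L))"
proof -
  interpret prob_space L by (rule orthant_lawD(1)[OF L])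
  let ?g = "\<lambda>v. f (zlog N R (zexp N v)) * cutoff N R (zexp N v)" and ?c = "\<lambda>v. cutoff N R (zexp N v)"
  have cb: "\<bar>?c v\<bar> \<le> 1" for v using cutoff_bounds[of N R] by (simp add: abs_of_nonneg)
  have cc: "continuous_on UNIV ?c" by (rule continuous_on_zexp[OF continuous_cutoff])
  have cg: "continuous_on UNIV ?g"
    by (intro continuous_on_mult cc continuous_on_zexp continuous_on_compose2[OF f(1) continuous_zlog[OF R]]) auto
  have C0: "0 \<le> C" using f(2)[of undefined] by linarith
  have gb: "\<bar>?g v\<bar> \<le> C" for v
    using mult_mono[OF f(2)[of "zlog N R (zexp N v)"] cb[of v]] C0 by (simp add: abs_mult)
  have ci: "integrable L ?c" by (rule orthant_law_integrable[OF L cc cb])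
  have fi: "integrable L f" by (rule orthant_law_integrable[OF L f])
  have gi: "integrable L ?g" by (rule orthant_law_integrable[OF L cg gb])
  have "\<bar>(\<integral>v. f v \<partial>L) - (\<integral>v. ?g v \<partial>L)\<bar> = \<bar>\<integral>v. f v - ?g v \<partial>L\<bar>" using fi gi by simp
  also have "\<dots> \<le> (\<integral>v. \<bar>f v - ?g v\<bar> \<partial>L)" using integral_norm_bound[of L "\<lambda>v. f v - ?g v"] by simp
  also have "\<dots> \<le> (\<integral>v. C * (1 - ?c v) \<partial>L)"
  proof (rule integral_mono_AE)
    show "AE v in L. \<bar>f v - ?g v\<bar> \<le> C * (1 - ?c v)"
      using orthant_lawD(3)[OF L]
    proof eventually_elim
      case (elim v)
      have "?g v = f v * ?c v"
      proof (cases "?c v = 0")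
        case False then show ?thesis using zlog_zexp[OF R _ _ False] elim by simp
      qed simp
      then have "f v - ?g v = f v * (1 - ?c v)" by (simp only: right_diff_distrib mult_1_right)
      then have "\<bar>f v - ?g v\<bar> = \<bar>f v\<bar> * (1 - ?c v)"
        using cutoff_bounds(2)[of N R "zexp N v"] by (simp only: abs_mult abs_of_nonneg diff_ge_0_iff_ge)
      also have "\<dots> \<le> C * (1 - ?c v)" using f(2) cutoff_bounds(2)[of N R "zexp N v"] by (intro mult_right_mono) auto
      finally show ?case .
    qed
  qed (use fi gi ci in auto)
  also have "\<dots> = C * (1 - (\<integral>v. ?c v \<partial>L))" using ci by (simp add: prob_space)
  finally show ?thesis .
qed

text \<open>Tightness comes for free: the cutoff is itself a continuous function of the exponential
  variables, so its integrals converge by \<open>zexp_limit\<close>, and mass escaping under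
  \<open>P i\<close> is controlled by that under \<open>Q\<close>.\<close>

lemma converges_in_distribution_of_laplace: "converges_in_distribution P Q F"
  unfolding converges_in_distribution_def
proof (intro allI impI, elim conjE)
  fix f :: "(nat \<Rightarrow> real) \<Rightarrow> real" assume f: "continuous_on UNIV f" and b: "bounded (range f)"
  obtain C where C0: "0 < C" and C: "\<And>v. \<bar>f v\<bar> \<le> C" using b unfolding bounded_pos by auto
  show "((\<lambda>i. \<integral>v. f v \<partial>P i) \<longlongrightarrow> (\<integral>v. f v \<partial>Q)) F"
  proof (rule tendstoI)
    fix e :: real assume e: "0 < e"
    interpret Q: prob_space Q by (rule orthant_lawD(1)[OF Q])
    have "(\<lambda>n. \<integral>v. cutoff N (real n) (zexp N v) \<partial>Q) \<longlonglongrightarrow> (\<integral>v. 1 \<partial>Q)"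
    proof (rule integral_dominated_convergence[where w="\<lambda>_. 1"])
      show "(\<lambda>v. cutoff N (real n) (zexp N v)) \<in> borel_measurable Q" for n
        by (rule orthant_law_measurable[OF Q continuous_on_zexp[OF continuous_cutoff]])
      show "AE v in Q. (\<lambda>n. cutoff N (real n) (zexp N v)) \<longlonglongrightarrow> 1" by (simp only: cutoff_tendsto) simp
      show "AE v in Q. norm (cutoff N (real n) (zexp N v)) \<le> 1" for n
        by (simp only: real_norm_def abs_of_nonneg[OF cutoff_bounds(1)] cutoff_bounds(2)) simp
    qed simp_all
    then have "eventually (\<lambda>n. 1 - e / (5 * C) < (\<integral>v. cutoff N (real n) (zexp N v) \<partial>Q)) sequentially"
      using e C0 by (intro order_tendstoD(1)) (auto simp: Q.prob_space)
    then have "eventually (\<lambda>n. 0 < n \<and> 1 - e / (5 * C) < (\<integral>v. cutoff N (real n) (zexp N v) \<partial>Q)) sequentially"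
      by (intro eventually_conj eventually_gt_at_top)
    then obtain n where n: "0 < n" "1 - e / (5 * C) < (\<integral>v. cutoff N (real n) (zexp N v) \<partial>Q)"
      using eventually_happens'[OF sequentially_bot] by blast
    define R where "R = real n"
    have R: "0 < R" using n by (simp add: R_def)
    let ?g = "\<lambda>v. f (zlog N R (zexp N v)) * cutoff N R (zexp N v)" and ?c = "\<lambda>v. cutoff N R (zexp N v)"
    have "((\<lambda>i. \<integral>v. ?c v \<partial>P i) \<longlongrightarrow> (\<integral>v. ?c v \<partial>Q)) F" by (rule zexp_limit[OF continuous_cutoff])
    then have 1: "eventually (\<lambda>i. 1 - e / (5 * C) < (\<integral>v. ?c v \<partial>P i)) F"
      using n(2) unfolding R_def by (rule order_tendstoD(1))
    have "((\<lambda>i. \<integral>v. ?g v \<partial>P i) \<longlongrightarrow> (\<integral>v. ?g v \<partial>Q)) F"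
      by (rule zexp_limit[where f="\<lambda>z. f (zlog N R z) * cutoff N R z"])
        (intro continuous_on_mult continuous_cutoff continuous_on_compose2[OF f continuous_zlog[OF R]], auto)
    then have 2: "eventually (\<lambda>i. dist (\<integral>v. ?g v \<partial>P i) (\<integral>v. ?g v \<partial>Q) < e / 5) F"
      using e by (intro tendstoD) auto
    have small: "C * (1 - x) \<le> e / 5" if "1 - e / (5 * C) < x" for x
      using that C0 by (simp add: field_simps)
    show "eventually (\<lambda>i. dist (\<integral>v. f v \<partial>P i) (\<integral>v. f v \<partial>Q) < e) F"
      using P 1 2
    proof eventually_elim
      case (elim i)
      have "\<bar>(\<integral>v. f v \<partial>P i) - (\<integral>v. ?g v \<partial>P i)\<bar> \<le> e / 5"
        using cutoff_error[OF R elim(1) f C] small[OF elim(2)] by linarith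
      moreover have "\<bar>(\<integral>v. f v \<partial>Q) - (\<integral>v. ?g v \<partial>Q)\<bar> \<le> e / 5"
        using cutoff_error[OF R Q f C] small[OF n(2)] unfolding R_def by linarith
      ultimately show ?case using elim(3) e unfolding dist_real_def by linarith
    qed
  qed
qed

end

section \<open>Laplace transform of the gamma law\<close>

lemma gamma_law_nn_laplace:
  assumes a: "0 < a" and t: "0 \<le> t"
  shows "(\<integral>\<^sup>+x. ennreal (exp (- (t * x))) \<partial>gamma_law a 1) = ennreal ((1 + t) powr - a)"
proof -
  let ?d = "\<lambda>x::real. if 0 < x then 1 powr a / Gamma a * x powr (a - 1) * exp (- 1 * x) else 0"
  let ?h = "\<lambda>x::real. ennreal (indicator {0..} x * x powr (a - 1) / exp x)"
  have G: "0 < Gamma a" using a by (rule Gamma_real_pos)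
  have t1: "0 < 1 + t" using t by simp
  have "(\<integral>\<^sup>+x. ennreal (exp (- (t * x))) \<partial>gamma_law a 1) = (\<integral>\<^sup>+x. ennreal (?d x) * ennreal (exp (- (t * x))) \<partial>lborel)"
    unfolding gamma_law_def by (subst nn_integral_density) auto
  also have "\<dots> = (\<integral>\<^sup>+x. ennreal ((1 + t) powr (1 - a) / Gamma a) * ?h (0 + (1 + t) * x) \<partial>lborel)"
  proof (rule nn_integral_cong)
    fix x :: real
    show "ennreal (?d x) * ennreal (exp (- (t * x))) = ennreal ((1 + t) powr (1 - a) / Gamma a) * ?h (0 + (1 + t) * x)"
    proof (cases "0 < x")
      case True
      have "((1 + t) * x) powr (a - 1) = (1 + t) powr (a - 1) * x powr (a - 1)" using True t1 by (intro powr_mult)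
      moreover have "(1 + t) powr (1 - a) * (1 + t) powr (a - 1) = 1" using t1 by (simp add: powr_add[symmetric])
      ultimately have "(1 + t) powr (1 - a) * ((1 + t) * x) powr (a - 1) = x powr (a - 1)" by (simp add: mult.assoc[symmetric])
      moreover have "exp (- x) * exp (- (t * x)) = 1 / exp ((1 + t) * x)" by (simp add: mult_exp_exp exp_minus[symmetric] divide_inverse algebra_simps)
      ultimately have "?d x * exp (- (t * x)) = (1 + t) powr (1 - a) / Gamma a * (indicator {0..} ((1 + t) * x) * ((1 + t) * x) powr (a - 1) / exp ((1 + t) * x))"
        using True t1 by (simp add: mult.assoc)
      then show ?thesis using True G t1 by (simp add: ennreal_mult'[symmetric] flip: ennreal_mult'')
    next
      case False
      then have "x = 0 \<or> (1 + t) * x < 0" using t1 by (auto simp: mult_less_0_iff)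
      then have "indicator {0..} ((1 + t) * x) * ((1 + t) * x) powr (a - 1) = (0 :: real)" by auto
      then show ?thesis using False by simp
    qed
  qed
  also have "\<dots> = ennreal ((1 + t) powr (1 - a) / Gamma a) * (\<integral>\<^sup>+x. ?h (0 + (1 + t) * x) \<partial>lborel)"
    by (rule nn_integral_cmult) simp
  also have "(\<integral>\<^sup>+x. ?h (0 + (1 + t) * x) \<partial>lborel) = ennreal (Gamma a / (1 + t))"
  proof -
    have "ennreal (Gamma a) = (\<integral>\<^sup>+x. ?h x \<partial>lborel)" by (rule Gamma_conv_nn_integral_real[OF a])
    also have "\<dots> = ennreal \<bar>1 + t\<bar> * (\<integral>\<^sup>+x. ?h (0 + (1 + t) * x) \<partial>lborel)"
      using t1 by (intro nn_integral_real_affine) auto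
    finally have e: "ennreal (Gamma a) = ennreal (1 + t) * (\<integral>\<^sup>+x. ?h (0 + (1 + t) * x) \<partial>lborel)" using t1 by simp
    have "ennreal (1 / (1 + t)) * ennreal (Gamma a) = (ennreal (1 / (1 + t)) * ennreal (1 + t)) * (\<integral>\<^sup>+x. ?h (0 + (1 + t) * x) \<partial>lborel)"
      by (simp only: e mult.assoc)
    then show ?thesis using t1 G by (simp add: ennreal_mult'[symmetric])
  qed
  also have "ennreal ((1 + t) powr (1 - a) / Gamma a) * ennreal (Gamma a / (1 + t)) = ennreal ((1 + t) powr - a)"
  proof -
    have "(1 + t) powr (1 - a) / (1 + t) = (1 + t) powr - a" using t1 powr_diff[of "1 + t" "1 - a" 1] by simp
    then show ?thesis using G t1 by (simp add: ennreal_mult'[symmetric])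
  qed
  finally show ?thesis .
qed

lemma gamma_law_prob_space: "0 < a \<Longrightarrow> prob_space (gamma_law a 1)"
proof
  assume a: "0 < a"
  have "emeasure (gamma_law a 1) (space (gamma_law a 1)) = (\<integral>\<^sup>+x. ennreal (exp (- (0 * x))) \<partial>gamma_law a 1)" by simp
  then show "emeasure (gamma_law a 1) (space (gamma_law a 1)) = 1" unfolding gamma_law_nn_laplace[OF a order_refl] by simp
qed

lemma gamma_law_laplace:
  assumes "0 < a" "0 \<le> t" shows "(\<integral>x. exp (- (t * x)) \<partial>gamma_law a 1) = (1 + t) powr - a"
proof -
  have "(\<integral>x. exp (- (t * x)) \<partial>gamma_law a 1) = enn2real (\<integral>\<^sup>+x. ennreal (exp (- (t * x))) \<partial>gamma_law a 1)"
    by (rule integral_eq_nn_integral) (auto simp: gamma_law_def)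
  then show ?thesis unfolding gamma_law_nn_laplace[OF assms] by simp
qed

lemma sets_gamma_law [simp, measurable_cong]: "sets (gamma_law a m) = sets borel"
  by (simp add: gamma_law_def)

lemma gamma_law_pos: "AE x in gamma_law a m. 0 < x"
  unfolding gamma_law_def by (subst AE_density) (auto simp: ennreal_eq_0_iff)

section \<open>The limit law\<close>

lemma orthant_law_distr:
  assumes "prob_space M" and T: "T \<in> borel_measurable M"
    and o: "AE x in M. (\<forall>j. 0 \<le> T x j) \<and> (\<forall>j>N. T x j = 0)"
  shows "orthant_law N (distr M borel T)"
  unfolding orthant_law_def
proof (intro conjI)
  show "prob_space (distr M borel T)" using assms(1) T by (rule prob_space.prob_space_distr)
  have "{v :: nat \<Rightarrow> real. (\<forall>j. 0 \<le> v j) \<and> (\<forall>j>N. v j = 0)} = (\<Inter>j. {v. 0 \<le> v j}) \<inter> (\<Inter>j\<in>{N<..}. {v. v j = 0})" by auto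
  moreover have "closed ((\<Inter>j. {v :: nat \<Rightarrow> real. 0 \<le> v j}) \<inter> (\<Inter>j\<in>{N<..}. {v. v j = 0}))"
    by (intro closed_Int closed_INT ballI closed_Collect_le closed_Collect_eq continuous_on_const continuous_on_product_coordinates)
  ultimately have "{v :: nat \<Rightarrow> real. (\<forall>j. 0 \<le> v j) \<and> (\<forall>j>N. v j = 0)} \<in> sets borel" by simp
  then show "AE v in distr M borel T. (\<forall>j. 0 \<le> v j) \<and> (\<forall>j>N. v j = 0)"
    using o by (subst AE_distr_iff[OF T]) simp_all
qed simp

lemma atMost_insert_0: "{..N} = insert 0 {1..N::nat}"
  by auto

context heavy_traffic
begin

lemma polling_model: "0 < \<rho> \<Longrightarrow> polling_model N (\<lambda>i. \<rho> * lamh i) nu G B S"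
proof
  show "N \<ge> 1" by (rule N)
  fix i assume "0 < \<rho>" and i: "i \<in> {1..N}"
  then show "0 < \<rho> * lamh i" using lamh_pos by simp
  show "0 < nu i" "0 < G i" using i by (rule nu_pos, rule G_pos)
  show "prob_space (B i) \<and> sets (B i) = sets borel \<and> (AE x in B i. 0 \<le> x)"
    using B[OF i] by (simp add: nonneg_law_def nonneg_law_axioms_def)
  show "prob_space (S i) \<and> sets (S i) = sets borel \<and> (AE x in S i. 0 \<le> x)"
    using S[OF i] by (simp add: nonneg_law_def nonneg_law_axioms_def)
qed

text \<open>Giving queue and orbit of station 1 the same mark merges coordinates 0 and 1 of the
  state into \<open>tot y 1\<close>. The remaining work is to identify the maps of the model at
  rates \<open>\<rho> * lamh i\<close> with the parametrised ones.\<close>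

lemma steady_equations:
  assumes \<rho>: "0 < \<rho>" and pr: "polling_primitives M X N (\<lambda>i. \<rho> * lamh i) nu B S" and st: "steady_state_counts M X N G Q"
  defines "F \<equiv> \<lambda>w. \<integral>y. (\<Prod>j\<le>N. w j ^ y j) \<partial>measure_pmf Q"
    and "U \<equiv> \<lambda>z. \<integral>y. (\<Prod>j=1..N. z j ^ tot y j) \<partial>measure_pmf Q"
  shows "z \<in> cube \<Longrightarrow> exp (LL \<rho> z * G 1) * U z = GG \<rho> N z * (exp (LL \<rho> (CC \<rho> N z) * G 1) * U (CC \<rho> N z))"
    and "w \<in> cube \<Longrightarrow> 0 \<le> w 0 \<Longrightarrow> w 0 \<le> 1 \<Longrightarrow>
      exp (LL \<rho> (w(1 := w 0)) * G 1) * F w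
      = exp (LL \<rho> (w(1 := p 1 * w 0 + (1 - p 1) * w 1)) * G 1) * U (w(1 := p 1 * w 0 + (1 - p 1) * w 1))"
    and "v \<in> set_pmf Q \<Longrightarrow> N < j \<Longrightarrow> v j = 0"
proof -
  interpret PM: polling_model N "\<lambda>i. \<rho> * lamh i" nu G B S by (rule polling_model[OF \<rho>])
  have L: "PM.Lam = LL \<rho>" by (simp add: fun_eq_iff PM.Lam_def LL_def)
  have T: "PM.Tst i = TT \<rho> i" for i by (simp add: fun_eq_iff PM.Tst_def TT_def L p_def)
  have g: "PM.gst i = gt \<rho> i" for i by (simp add: fun_eq_iff PM.gst_def gt_def L)
  have C: "PM.cyc k z = CC \<rho> k z" for k z by (induction k arbitrary: z) (simp_all add: T)
  have GG: "PM.gg k z = GG \<rho> k z" for k z by (induction k arbitrary: z) (simp_all add: T g)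
  have c: "PM.unit_cube = cube" by (simp add: PM.unit_cube_def cube_def)
  have U: "PM.genfun Q (z(0 := z 1)) = U z" for z
  proof -
    have "(\<Prod>j\<le>N. (z(0 := z 1)) j ^ y j) = (\<Prod>j=1..N. z j ^ tot y j)" for y
    proof -
      have "z j ^ tot y j = (z(0 := z 1)) j ^ y j * (if j = 1 then z 1 ^ y 0 else 1)" if "j \<in> {1..N}" for j
        using that by (auto simp: tot_def power_add)
      then have "(\<Prod>j=1..N. z j ^ tot y j) = (\<Prod>j=1..N. (z(0 := z 1)) j ^ y j * (if j = 1 then z 1 ^ y 0 else 1))"
        by (rule prod.cong[OF refl])
      also have "\<dots> = (\<Prod>j=1..N. (z(0 := z 1)) j ^ y j) * z 1 ^ y 0"
        using N by (simp add: prod.distrib)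
      finally show ?thesis unfolding atMost_insert_0 by simp
    qed
    then show ?thesis by (simp add: PM.genfun_def U_def)
  qed
  have F: "PM.genfun Q w = F w" for w by (simp add: PM.genfun_def F_def)
  note eqs = PM.genfun_equations[OF pr st]
  show "z \<in> cube \<Longrightarrow> exp (LL \<rho> z * G 1) * U z = GG \<rho> N z * (exp (LL \<rho> (CC \<rho> N z) * G 1) * U (CC \<rho> N z))"
    using eqs(1)[of z] by (simp only: c L U C GG)
  have p1: "1 - exp (- nu 1 * G 1) = p 1" "exp (- nu 1 * G 1) = 1 - p 1" by (simp_all add: p_def)
  show "w \<in> cube \<Longrightarrow> 0 \<le> w 0 \<Longrightarrow> w 0 \<le> 1 \<Longrightarrow>
      exp (LL \<rho> (w(1 := w 0)) * G 1) * F w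
      = exp (LL \<rho> (w(1 := p 1 * w 0 + (1 - p 1) * w 1)) * G 1) * U (w(1 := p 1 * w 0 + (1 - p 1) * w 1))"
    using eqs(2)[of w, OF _ _ _ refl, unfolded c L U, unfolded F p1(1), unfolded p1(2)] by blast
  show "v \<in> set_pmf Q \<Longrightarrow> N < j \<Longrightarrow> v j = 0" by (rule PM.steady_state_limit(1)[OF pr st])
qed

lemma limit_constants:
  shows "j \<noteq> 0 \<Longrightarrow> u_coeff N lamh nu G B j = Uf 0 j"
    and "delta_coeff N lamh nu G B = dl" (is ?d)
    and "b_moment N lamh B 2 / (2 * b_moment N lamh B 1) = c2 / 2" (is ?b)
    and "alpha_coeff N lamh nu G B S = (\<Sum>i=1..N. s i + G i) * dl / (c2 / 2)" (is ?a)
proof -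
  show u: "u_coeff N lamh nu G B j = Uf 0 j" if "j \<noteq> 0" for j
    using that by (simp add: u_coeff_def Uf_def p_def b_def)
  show ?d unfolding delta_coeff_def dl_def Lf_def by (intro sum.cong refl) (simp add: u b_def)
  have L: "0 < (\<Sum>i=1..N. lamh i)" using N lamh_pos by (intro sum_pos) auto
  have b1: "b_moment N lamh B 1 = 1 / (\<Sum>i=1..N. lamh i)" unfolding b_moment_def load' by (rule refl)
  have b2: "b_moment N lamh B 2 = c2 / (\<Sum>i=1..N. lamh i)" by (simp add: b_moment_def c2_def b2_def)
  show ?b unfolding b1 b2 using L by (simp add: field_simps)
  show ?a unfolding alpha_coeff_def b1 b2 using L c2_pos \<open>?d\<close> by (simp add: r_total_def s_def field_simps)
qed

text \<open>Splitting the coefficient of type 1 in the proportion \<open>p 1\<close> to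
  \<open>1 - p 1\<close> is dual to mixing the exponents of queue and orbit in that
  proportion.\<close>

lemma limit_direction_sum:
  "(\<Sum>j\<le>N. k j * limit_direction N lamh nu G B j) = Lf 0 (k(1 := p 1 * k 0 + (1 - p 1) * k 1))"
proof -
  let ?k = "k(1 := p 1 * k 0 + (1 - p 1) * k 1)"
  have "Uf 0 j * ?k j = k j * limit_direction N lamh nu G B j + (if j = 1 then k 0 * (p 1 * Uf 0 1) else 0)" if "j \<in> {1..N}" for j
    using that by (auto simp: limit_direction_def limit_constants(1) p_def algebra_simps)
  then have "Lf 0 ?k = (\<Sum>j=1..N. k j * limit_direction N lamh nu G B j + (if j = 1 then k 0 * (p 1 * Uf 0 1) else 0))"
    unfolding Lf_def by (rule sum.cong[OF refl])
  also have "\<dots> = (\<Sum>j=1..N. k j * limit_direction N lamh nu G B j) + k 0 * (p 1 * Uf 0 1)"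
    using N by (simp add: sum.distrib)
  also have "k 0 * (p 1 * Uf 0 1) = k 0 * limit_direction N lamh nu G B 0"
    by (simp add: limit_direction_def limit_constants(1) p_def)
  finally show ?thesis unfolding atMost_insert_0 by (subst sum.insert) (simp_all only: add.commute, auto)
qed

lemma limit_direction_nonneg: "0 \<le> limit_direction N lamh nu G B j"
  using Uf_pos[OF one_in] Uf_pos[of j] p_bounds[OF one_in]
  by (auto simp: limit_direction_def limit_constants(1) p_def less_imp_le)

end

theorem theorem3:
  fixes N :: nat
    and lamh nu G :: "nat \<Rightarrow> real"
    and B S :: "nat \<Rightarrow> real measure"
    and M :: "real \<Rightarrow> 'a measure"
    and X :: "real \<Rightarrow> primitive \<Rightarrow> 'a \<Rightarrow> real"
    and Y :: "real \<Rightarrow> (nat \<Rightarrow> nat) pmf"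
  assumes "N \<ge> 1"
    and "\<And>i. i \<in> {1..N} \<Longrightarrow> lamh i > 0"
    and "\<And>i. i \<in> {1..N} \<Longrightarrow> nu i > 0"
    and "\<And>i. i \<in> {1..N} \<Longrightarrow> G i > 0"
    and "\<And>i. i \<in> {1..N} \<Longrightarrow> prob_space (B i) \<and> sets (B i) = sets borel \<and> (AE x in B i. 0 \<le> x)"
    and "\<And>i. i \<in> {1..N} \<Longrightarrow> integrable (B i) (\<lambda>x. x) \<and> integrable (B i) (\<lambda>x. x ^ 2)"
    and "\<And>i. i \<in> {1..N} \<Longrightarrow> moment 1 (B i) > 0"
    and "\<And>i. i \<in> {1..N} \<Longrightarrow> prob_space (S i) \<and> sets (S i) = sets borel \<and> (AE x in S i. 0 \<le> x)"
    and "\<And>i. i \<in> {1..N} \<Longrightarrow> integrable (S i) (\<lambda>x. x)"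
    and "(\<Sum>i=1..N. lamh i * moment 1 (B i)) = 1"
    and "\<And>\<rho>. 0 < \<rho> \<Longrightarrow> \<rho> < 1 \<Longrightarrow>
           polling_primitives (M \<rho>) (X \<rho>) N (\<lambda>i. \<rho> * lamh i) nu B S"
    and "\<And>\<rho>. 0 < \<rho> \<Longrightarrow> \<rho> < 1 \<Longrightarrow> steady_state_counts (M \<rho>) (X \<rho>) N G (Y \<rho>)"
  shows "converges_in_distribution
           (\<lambda>\<rho>. distr (measure_pmf (Y \<rho>)) borel (\<lambda>y j. (1 - \<rho>) * real (y j)))
           (distr (gamma_law (alpha_coeff N lamh nu G B S) 1) borel
             (\<lambda>x j. b_moment N lamh B 2 / (2 * b_moment N lamh B 1)
                     * (1 / delta_coeff N lamh nu G B) * limit_direction N lamh nu G B j * x))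
           (at_left 1)"
proof -
  have nonneg_law: "nonneg_law P" if "prob_space P \<and> sets P = sets borel \<and> (AE x in P. 0 \<le> x)" "integrable P (\<lambda>x. x)" for P
    using that by (simp add: nonneg_law_def nonneg_law_axioms_def)
  interpret heavy_traffic N lamh nu G B S
    by (intro heavy_traffic.intro nonneg_law assms(1-5,7-10) assms(6)[THEN conjunct1] assms(6)[THEN conjunct2])
  interpret heavy_traffic_steady N lamh nu G B S Y "\<lambda>\<rho> z. \<integral>y. (\<Prod>j=1..N. z j ^ tot y j) \<partial>measure_pmf (Y \<rho>)"
  proof unfold_locales
    fix \<rho> :: real and z assume \<rho>: "0 < \<rho>" "\<rho> < 1" and z: "z \<in> cube"
    show "exp (LL \<rho> z * G 1) * (\<integral>y. (\<Prod>j=1..N. z j ^ tot y j) \<partial>measure_pmf (Y \<rho>))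
      = GG \<rho> N z * (exp (LL \<rho> (CC \<rho> N z) * G 1) * (\<integral>y. (\<Prod>j=1..N. CC \<rho> N z j ^ tot y j) \<partial>measure_pmf (Y \<rho>)))"
      by (rule steady_equations(1)[OF \<rho>(1) assms(11)[OF \<rho>] assms(12)[OF \<rho>] z])
  qed
  let ?d = "limit_direction N lamh nu G B"
  let ?x = "\<lambda>\<rho> y j. (1 - \<rho>) * real (y j)"
  let ?l = "\<lambda>x j. b_moment N lamh B 2 / (2 * b_moment N lamh B 1) * (1 / delta_coeff N lamh nu G B) * ?d j * x"
  have alpha: "alpha_coeff N lamh nu G B S = al" by (simp add: limit_constants(4) al_def vv_def rr_def)
  have al_pos: "0 < al"
  proof -
    have "0 < (\<Sum>i=1..N. s i + G i)"
    proof (intro sum_pos add_nonneg_pos)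
      fix i assume i: "i \<in> {1..N}"
      have "AE x in S i. 0 \<le> x" using assms(8)[OF i] by blast
      then show "0 \<le> s i" unfolding s_def moment_def by (intro integral_nonneg_AE) (auto elim: eventually_mono)
      show "0 < G i" by (rule assms(4)[OF i])
    qed (use assms(1) in auto)
    then show ?thesis using dl_pos vv_pos by (simp add: al_def rr_def)
  qed
  have l: "?l = (\<lambda>x j. vv / dl * ?d j * x)"
    by (simp only: limit_constants(2,3) vv_def) simp
  show ?thesis unfolding alpha l
  proof (rule converges_in_distribution_of_laplace)
    show "eventually (\<lambda>\<rho>. orthant_law N (distr (measure_pmf (Y \<rho>)) borel (?x \<rho>))) (at_left 1)"
      using eventually_left_1
    proof eventually_elim
      case (elim \<rho>)
      show ?case
      proof (rule orthant_law_distr[OF measure_pmf.prob_space_axioms])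
        show "AE y in measure_pmf (Y \<rho>). (\<forall>j. 0 \<le> ?x \<rho> y j) \<and> (\<forall>j>N. ?x \<rho> y j = 0)"
          using steady_equations(3)[OF _ assms(11) assms(12)] elim by (auto simp: AE_measure_pmf_iff)
      qed simp
    qed
    have lm: "(\<lambda>x j. vv / dl * ?d j * x) \<in> borel_measurable (gamma_law al 1)"
      unfolding measurable_cong_sets[OF sets_gamma_law refl]
      by (intro borel_measurable_continuous_onI continuous_on_coordinatewise_then_product continuous_intros)
    show "orthant_law N (distr (gamma_law al 1) borel (\<lambda>x j. vv / dl * ?d j * x))"
    proof (rule orthant_law_distr[OF gamma_law_prob_space[OF al_pos] lm])
      show "AE x in gamma_law al 1. (\<forall>j. 0 \<le> vv / dl * ?d j * x) \<and> (\<forall>j>N. vv / dl * ?d j * x = 0)"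
        using gamma_law_pos
      proof eventually_elim
        case (elim x)
        have "0 \<le> vv / dl * ?d j * x" for j
          using elim vv_pos dl_pos limit_direction_nonneg[of j] by simp
        then show ?case using assms(1) by (simp add: limit_direction_def)
      qed
    qed
    fix k :: "nat \<Rightarrow> nat"
    let ?k = "\<lambda>j. real (k j)"
    let ?e = "\<lambda>v :: nat \<Rightarrow> real. exp (- (\<Sum>j\<le>N. ?k j * v j))"
    have em: "?e \<in> borel_measurable borel" by (intro borel_measurable_continuous_onI continuous_intros) simp
    \<comment> \<open>The Laplace transform of the scaled vector at the integer point
      \<open>k\<close> is the generating function at \<open>exp (- (1 - \<rho>) * ?k j)\<close>, to
      which \<open>joint_limit\<close> applies.\<close>
    have "((\<lambda>\<rho>. \<integral>y. (\<Prod>j\<le>N. exp (- (1 - \<rho>) * ?k j) ^ y j) \<partial>measure_pmf (Y \<rho>)) \<longlongrightarrow>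
       (1 + theta (?k(1 := p 1 * ?k 0 + (1 - p 1) * ?k 1)) * vv) powr - al) (at_left 1)"
    proof (rule joint_limit[where F="\<lambda>\<rho> w. \<integral>y. (\<Prod>j\<le>N. w j ^ y j) \<partial>measure_pmf (Y \<rho>)"])
      fix \<rho> :: real and w assume \<rho>: "0 < \<rho>" "\<rho> < 1" and w: "w \<in> cube" "0 \<le> w 0" "w 0 \<le> (1 :: real)"
      show "exp (LL \<rho> (w(1 := w 0)) * G 1) * (\<integral>y. (\<Prod>j\<le>N. w j ^ y j) \<partial>measure_pmf (Y \<rho>))
        = exp (LL \<rho> (w(1 := p 1 * w 0 + (1 - p 1) * w 1)) * G 1) *
          (\<integral>y. (\<Prod>j=1..N. (w(1 := p 1 * w 0 + (1 - p 1) * w 1)) j ^ tot y j) \<partial>measure_pmf (Y \<rho>))"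
        by (rule steady_equations(2)[OF \<rho>(1) assms(11)[OF \<rho>] assms(12)[OF \<rho>] w])
    qed simp
    moreover have "(\<integral>y. (\<Prod>j\<le>N. exp (- (1 - \<rho>) * ?k j) ^ y j) \<partial>measure_pmf (Y \<rho>)) = (\<integral>v. ?e v \<partial>distr (measure_pmf (Y \<rho>)) borel (?x \<rho>))" for \<rho>
    proof -
      have "(\<Prod>j\<le>N. exp (- (1 - \<rho>) * ?k j) ^ y j) = ?e (?x \<rho> y)" for y :: "nat \<Rightarrow> nat"
      proof -
        have "(\<Prod>j\<le>N. exp (- (1 - \<rho>) * ?k j) ^ y j) = (\<Prod>j\<le>N. exp (- (?k j * ?x \<rho> y j)))"
          by (intro prod.cong refl) (simp only: exp_of_nat_mult[symmetric], simp add: algebra_simps)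
        then show ?thesis by (simp only: exp_sum[OF finite_atMost] sum_negf[symmetric])
      qed
      then show ?thesis by (simp add: integral_distr[OF _ em])
    qed
    moreover have "(1 + theta (?k(1 := p 1 * ?k 0 + (1 - p 1) * ?k 1)) * vv) powr - al
      = (\<integral>v. ?e v \<partial>distr (gamma_law al 1) borel (\<lambda>x j. vv / dl * ?d j * x))"
    proof -
      let ?t = "theta (?k(1 := p 1 * ?k 0 + (1 - p 1) * ?k 1)) * vv"
      have t: "?t = (\<Sum>j\<le>N. ?k j * ?d j) * vv / dl"
        by (simp only: theta_def limit_direction_sum times_divide_eq_left)
      have "?e (\<lambda>j. vv / dl * ?d j * x) = exp (- (?t * x))" for x
      proof -
        have "(\<Sum>j\<le>N. ?k j * (vv / dl * ?d j * x)) = (\<Sum>j\<le>N. ?k j * ?d j * (vv / dl * x))"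
          by (intro sum.cong refl) (simp add: ac_simps)
        then show ?thesis unfolding t sum_distrib_right[symmetric] by simp
      qed
      then have "(\<integral>v. ?e v \<partial>distr (gamma_law al 1) borel (\<lambda>x j. vv / dl * ?d j * x)) = (\<integral>x. exp (- (?t * x)) \<partial>gamma_law al 1)"
        by (simp only: integral_distr[OF lm em])
      also have "\<dots> = (1 + ?t) powr - al"
        unfolding t using al_pos vv_pos dl_pos limit_direction_nonneg
        by (intro gamma_law_laplace divide_nonneg_pos mult_nonneg_nonneg sum_nonneg) auto
      finally show ?thesis by simp
    qed
    ultimately show "((\<lambda>\<rho>. \<integral>v. ?e v \<partial>distr (measure_pmf (Y \<rho>)) borel (?x \<rho>)) \<longlongrightarrow>
       (\<integral>v. ?e v \<partial>distr (gamma_law al 1) borel (\<lambda>x j. vv / dl * ?d j * x))) (at_left 1)"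
      by (simp only:)
  qed
qed


end
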